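(* Let $K$ be an algebraically closed field of positive characteristic, let $G$ be an arbitrary (abstract) group, and let $\rho: G \to \mathrm{GL}(V)$ be a finite-dimensional representation of $G$ over $K$. Let $H$ be the set of unipotent elements of the Zariski closure of $\rho(G)$ in $\mathrm{GL}(V)$. Then $d(G,V)=\dim V$ if and only if the determinant map takes only finitely many values on $\rho(G)$ and $H=\{e\}$.
   Context: For a finite-dimensional representation $W$ of $G$ over $K$, $\mathrm{TS}_G(W)$ denotes the number of trivial summands (summands isomorphic to the one-dimensional trivial representation), counted with multiplicity, when $W$ is written as a direct sum of indecomposable representations of $G$. Define $d(G,V)=\limsup_{n\to\infty}\mathrm{TS}_G(V^{\otimes n})^{1/n}$. Closed subvarieties of $\mathrm{GL}(V)$ are identified with their sets of $K$-points; the Zariski closure of a subset is the smallest closed subvariety containing it. $e$ is the identity element. *)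

theory Defs
  imports
    "HOL-Computational_Algebra.Polynomial"
    "HOL-Algebra.Group"
    "HOL-Library.Function_Algebras"
    "HOL-Library.Extended_Real"
    "HOL-Library.Liminf_Limsup"
    "Jordan_Normal_Form.Determinant"
begin

section \<open>The general linear group of an abstract vector space\<close>

definition GL :: "('k::field \<Rightarrow> 'v::ab_group_add \<Rightarrow> 'v) \<Rightarrow> ('v \<Rightarrow> 'v) monoid" where
  "GL scale = \<lparr>carrier = {f. Vector_Spaces.linear scale scale f \<and> bij f},
               monoid.mult = (\<circ>), one = id\<rparr>"

definition basis_list :: "('k::field \<Rightarrow> 'v::ab_group_add \<Rightarrow> 'v) \<Rightarrow> 'v list \<Rightarrow> bool" where
  "basis_list scale bs \<longleftrightarrow> distinct bs \<and> \<not> Modules.module.dependent scale (set bs) \<and>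
     Modules.module.span scale (set bs) = UNIV"

definition endo_matrix ::
  "('k::field \<Rightarrow> 'v::ab_group_add \<Rightarrow> 'v) \<Rightarrow> 'v list \<Rightarrow> ('v \<Rightarrow> 'v) \<Rightarrow> 'k mat" where
  "endo_matrix scale bs f = mat (length bs) (length bs)
     (\<lambda>(i, j). Modules.module.representation scale (set bs) (f (bs ! j)) (bs ! i))"

text \<open>The determinant of an endomorphism of a finite-dimensional space; the chosen ordered
  basis is irrelevant, since a change of basis conjugates the matrix.\<close>

definition lin_det :: "('k::field \<Rightarrow> 'v::ab_group_add \<Rightarrow> 'v) \<Rightarrow> ('v \<Rightarrow> 'v) \<Rightarrow> 'k" where
  "lin_det scale f = det (endo_matrix scale (SOME bs. basis_list scale bs) f)"

definition unipotent :: "('v::ab_group_add \<Rightarrow> 'v) \<Rightarrow> bool" where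
  "unipotent f \<longleftrightarrow> (\<exists>n. \<forall>v. ((\<lambda>w. f w - w) ^^ n) v = 0)"

text \<open>The coordinate ring of \<open>GL(V)\<close>, as functions on endomorphisms: it is generated over the
  constants by the matrix coefficients and the inverse of the determinant. Only the values on
  the carrier of \<open>GL scale\<close> matter.\<close>

inductive_set regular_functions ::
    "('k::field \<Rightarrow> 'v::ab_group_add \<Rightarrow> 'v) \<Rightarrow> (('v \<Rightarrow> 'v) \<Rightarrow> 'k) set"
  for scale :: "'k::field \<Rightarrow> 'v::ab_group_add \<Rightarrow> 'v" where
  const: "(\<lambda>_. c) \<in> regular_functions scale"
| coeff: "Vector_Spaces.linear scale (*) \<phi> \<Longrightarrow> (\<lambda>f. \<phi> (f v)) \<in> regular_functions scale"
| inv_det: "(\<lambda>f. inverse (lin_det scale f)) \<in> regular_functions scale"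
| add: "p \<in> regular_functions scale \<Longrightarrow> q \<in> regular_functions scale \<Longrightarrow>
    (\<lambda>f. p f + q f) \<in> regular_functions scale"
| mult: "p \<in> regular_functions scale \<Longrightarrow> q \<in> regular_functions scale \<Longrightarrow>
    (\<lambda>f. p f * q f) \<in> regular_functions scale"

definition zariski_closed ::
  "('k::field \<Rightarrow> 'v::ab_group_add \<Rightarrow> 'v) \<Rightarrow> ('v \<Rightarrow> 'v) set \<Rightarrow> bool" where
  "zariski_closed scale Z \<longleftrightarrow>
     (\<exists>P \<subseteq> regular_functions scale. Z = {f \<in> carrier (GL scale). \<forall>p \<in> P. p f = 0})"

definition zariski_closure ::
  "('k::field \<Rightarrow> 'v::ab_group_add \<Rightarrow> 'v) \<Rightarrow> ('v \<Rightarrow> 'v) set \<Rightarrow> ('v \<Rightarrow> 'v) set" where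
  "zariski_closure scale S = \<Inter> {Z. zariski_closed scale Z \<and> S \<subseteq> Z}"


section \<open>Decompositions into indecomposables\<close>

text \<open>A representation of \<open>G\<close> is given by a subspace \<open>W\<close> of an ambient vector space
  together with maps \<open>act g\<close> of the ambient space that restrict to linear maps of \<open>W\<close>.\<close>

definition subrep :: "('g, 'm) monoid_scheme \<Rightarrow> ('k::field \<Rightarrow> 'w::ab_group_add \<Rightarrow> 'w) \<Rightarrow>
    ('g \<Rightarrow> 'w \<Rightarrow> 'w) \<Rightarrow> 'w set \<Rightarrow> bool" where
  "subrep G scale act U \<longleftrightarrow>
     Modules.module.subspace scale U \<and> (\<forall>g \<in> carrier G. \<forall>u \<in> U. act g u \<in> U)"

definition indecomposable :: "('g, 'm) monoid_scheme \<Rightarrow> ('k::field \<Rightarrow> 'w::ab_group_add \<Rightarrow> 'w) \<Rightarrow>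
    ('g \<Rightarrow> 'w \<Rightarrow> 'w) \<Rightarrow> 'w set \<Rightarrow> bool" where
  "indecomposable G scale act U \<longleftrightarrow> subrep G scale act U \<and> U \<noteq> {0} \<and>
     \<not> (\<exists>A B. subrep G scale act A \<and> subrep G scale act B \<and> A \<noteq> {0} \<and> B \<noteq> {0} \<and>
             A \<inter> B = {0} \<and> U = {a + b | a b. a \<in> A \<and> b \<in> B})"

text \<open>Internal direct sums. A set (not a family) of summands loses no multiplicities, because
  the nonzero summands of a direct sum are pairwise distinct as subspaces.\<close>

definition internal_direct_sum :: "'w::ab_group_add set set \<Rightarrow> 'w set \<Rightarrow> bool" where
  "internal_direct_sum D W \<longleftrightarrow> finite D \<and>
     W = {\<Sum>U\<in>D. x U | x. \<forall>U\<in>D. x U \<in> U} \<and>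
     (\<forall>x. (\<forall>U\<in>D. x U \<in> U) \<and> (\<Sum>U\<in>D. x U) = 0 \<longrightarrow> (\<forall>U\<in>D. x U = 0))"

definition indecomposable_decomposition ::
  "('g, 'm) monoid_scheme \<Rightarrow> ('k::field \<Rightarrow> 'w::ab_group_add \<Rightarrow> 'w) \<Rightarrow>
    ('g \<Rightarrow> 'w \<Rightarrow> 'w) \<Rightarrow> 'w set \<Rightarrow> 'w set set \<Rightarrow> bool" where
  "indecomposable_decomposition G scale act W D \<longleftrightarrow>
     internal_direct_sum D W \<and> (\<forall>U\<in>D. indecomposable G scale act U)"

text \<open>Being isomorphic to the trivial representation on the field itself.\<close>

definition trivial_rep :: "('g, 'm) monoid_scheme \<Rightarrow> ('k::field \<Rightarrow> 'w::ab_group_add \<Rightarrow> 'w) \<Rightarrow>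
    ('g \<Rightarrow> 'w \<Rightarrow> 'w) \<Rightarrow> 'w set \<Rightarrow> bool" where
  "trivial_rep G scale act U \<longleftrightarrow> (\<exists>\<phi>. bij_betw \<phi> U (UNIV :: 'k set) \<and>
     (\<forall>u\<in>U. \<forall>v\<in>U. \<phi> (u + v) = \<phi> u + \<phi> v) \<and> (\<forall>c. \<forall>u\<in>U. \<phi> (scale c u) = c * \<phi> u) \<and>
     (\<forall>g\<in>carrier G. \<forall>u\<in>U. \<phi> (act g u) = \<phi> u))"

text \<open>For a finite-dimensional representation a decomposition exists, and by the Krull--Schmidt
  theorem the count does not depend on the one that is chosen.\<close>

definition TS :: "('g, 'm) monoid_scheme \<Rightarrow> ('k::field \<Rightarrow> 'w::ab_group_add \<Rightarrow> 'w) \<Rightarrow>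
    ('g \<Rightarrow> 'w \<Rightarrow> 'w) \<Rightarrow> 'w set \<Rightarrow> nat" where
  "TS G scale act W =
     card {U \<in> (SOME D. indecomposable_decomposition G scale act W D). trivial_rep G scale act U}"


section \<open>Tensor powers\<close>

text \<open>Over a field, \<open>V\<^sup>\<otimes>\<^sup>n\<close> embeds into the functions of \<open>n\<close> linear functionals by
  sending \<open>v\<^sub>1 \<otimes> \<dots> \<otimes> v\<^sub>n\<close> to \<open>(\<phi>\<^sub>1, \<dots>, \<phi>\<^sub>n) \<mapsto> \<phi>\<^sub>1 v\<^sub>1 \<cdots> \<phi>\<^sub>n v\<^sub>n\<close>, and is realised here as the span
  of these pure tensors. Outside the lists of \<open>n\<close> linear functionals every tensor is set to \<open>0\<close>.\<close>

definition pure_tensor :: "('k::field \<Rightarrow> 'v::ab_group_add \<Rightarrow> 'v) \<Rightarrow> 'v list \<Rightarrow>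
    ('v \<Rightarrow> 'k) list \<Rightarrow> 'k" where
  "pure_tensor scale vs = (\<lambda>\<phi>s.
     if length \<phi>s = length vs \<and> (\<forall>\<phi> \<in> set \<phi>s. Vector_Spaces.linear scale (*) \<phi>)
     then \<Prod>i<length vs. (\<phi>s ! i) (vs ! i) else 0)"

definition fun_scale :: "'k::field \<Rightarrow> ('x \<Rightarrow> 'k) \<Rightarrow> 'x \<Rightarrow> 'k" where
  "fun_scale c t = (\<lambda>x. c * t x)"

definition tensor_power :: "('k::field \<Rightarrow> 'v::ab_group_add \<Rightarrow> 'v) \<Rightarrow> nat \<Rightarrow>
    (('v \<Rightarrow> 'k) list \<Rightarrow> 'k) set" where
  "tensor_power scale n = Modules.module.span fun_scale {pure_tensor scale vs | vs. length vs = n}"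

text \<open>The diagonal action, cf. \<open>tensor_act_pure\<close> below.\<close>

definition tensor_act :: "('g \<Rightarrow> 'v \<Rightarrow> 'v) \<Rightarrow> 'g \<Rightarrow>
    (('v \<Rightarrow> 'k) list \<Rightarrow> 'k) \<Rightarrow> ('v \<Rightarrow> 'k) list \<Rightarrow> 'k" where
  "tensor_act \<rho> g t = (\<lambda>\<phi>s. t (map (\<lambda>\<phi>. \<phi> \<circ> \<rho> g) \<phi>s))"

lemma fun_scale_vector_space: "vector_space fun_scale"
  by unfold_locales (auto simp: fun_scale_def algebra_simps fun_eq_iff)

lemma linear_comp_GL_iff:
  assumes "f \<in> carrier (GL scale)"
  shows "Vector_Spaces.linear scale (*) (\<phi> \<circ> f) \<longleftrightarrow> Vector_Spaces.linear scale (*) \<phi>"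
proof
  have f: "Vector_Spaces.linear scale scale f" "bij f"
    using assms by (auto simp: GL_def)
  then interpret f: Vector_Spaces.linear scale scale f by blast
  {
    assume "Vector_Spaces.linear scale (*) \<phi>"
    then show "Vector_Spaces.linear scale (*) (\<phi> \<circ> f)"
      using f(1) by (intro Vector_Spaces.linear_compose)
  next
    assume l: "Vector_Spaces.linear scale (*) (\<phi> \<circ> f)"
    then interpret l: Vector_Spaces.linear scale "(*)" "\<phi> \<circ> f" .
    show "Vector_Spaces.linear scale (*) \<phi>"
    proof unfold_locales
      fix b1 b2 r
      obtain a1 a2 where "b1 = f a1" "b2 = f a2"
        using f(2) by (meson bij_pointE)
      then show "\<phi> (b1 + b2) = \<phi> b1 + \<phi> b2" "\<phi> (scale r b1) = r * \<phi> b1"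
        using l.add[of a1 a2] l.scale[of r a1] by (simp_all add: f.add f.scale)
    qed
  }
qed

lemma tensor_act_pure:
  assumes "\<rho> g \<in> carrier (GL scale)"
  shows "tensor_act \<rho> g (pure_tensor scale vs) = pure_tensor scale (map (\<rho> g) vs)"
  using linear_comp_GL_iff[OF assms]
  by (auto simp: tensor_act_def pure_tensor_def fun_eq_iff)


section \<open>The growth rate of the number of trivial summands\<close>

definition trivial_growth :: "('g, 'm) monoid_scheme \<Rightarrow>
    ('k::field \<Rightarrow> 'v::ab_group_add \<Rightarrow> 'v) \<Rightarrow> ('g \<Rightarrow> 'v \<Rightarrow> 'v) \<Rightarrow> ereal" where
  "trivial_growth G scale \<rho> =
     limsup (\<lambda>n. ereal (root n (real (TS G fun_scale (tensor_act \<rho>) (tensor_power scale n)))))"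

end

theory Submission
  imports
    Defs
    "HOL-Library.List_Lexorder"
    "HOL-Algebra.Sylow"
    "HOL-Algebra.Generated_Groups"
    "HOL-Algebra.Multiplicative_Group"
    "Jordan_Normal_Form.Char_Poly"
begin

hide_const (open) up_ring.coeff up_ring.monom

text \<open>The number of trivial summands of \<open>V\<^sup>\<otimes>\<^sup>n\<close> is the rank of the pairing between its invariant
  vectors and its invariant linear forms.

  Suppose first that this number grows like \<open>d\<^sup>n\<close>, where \<open>d = dim V\<close>. If the determinant takes infinitely
  many values, then in triangular bases only the words \<open>x\<close> whose eigenvalues multiply to \<open>1\<close> contribute
  to the pairing; an additive character of the group of eigenvalue relations that does not kill the
  determinant shows, by a Chernoff bound, that these words are exponentially rare. If the Zariski closure
  contains a nontrivial unipotent element, it contains one of order \<open>p\<close>, and on \<open>p - 1\<close> tensor factors one basis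
  tensor is a trace from the cyclic group that it generates. Traces pair to zero with invariants because
  \<open>p = 0\<close>, so each block of \<open>p - 1\<close> factors loses at least one dimension.

  Conversely, let the closure contain no nontrivial unipotent element. An invariant vector \<open>z\<close> that is
  killed by all invariant forms is a finite sum of vectors \<open>g t - t\<close>. This certificate survives a
  specialisation of the finitely generated coefficient ring to a finite field, where it forces \<open>p\<close> to
  divide the order of the image of the group, so that some \<open>g\<close> is specialised to an element of order \<open>p\<close>.
  Taking more and more coefficients into the ring, the specialisations along an ultrafilter yield a point
  of order \<open>p\<close> of the closure, which is unipotent. Hence all invariants are detected and
  it suffices to find many of them. If all determinants are \<open>N\<close>-th roots of unity, every rectangular ballot
  word with \<open>m\<close> letters of each kind, \<open>N dvd m\<close>, gives an invariant product of \<open>m\<close> determinants; these are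
  linearly independent because their supports are lexicographically triangular, and the number of such
  words grows like \<open>d\<^sup>n\<close>.\<close>

section \<open>Trivial summands and invariant functionals\<close>

text \<open>An indecomposable summand is trivial as soon as it holds an invariant vector
  \<open>u\<close> and an invariant form \<open>f\<close> with \<open>f u\<close> nonzero, because
  the line of \<open>u\<close> splits off; hence the count is a rank, and both bounds need vectors
  and forms together. The group is abstract, so a point of the closure is no limit of group elements
  and is reached only through functions: polynomial identities on the group pass to the closure, and
  conversely a point arises as a homomorphism from a ring of functions. That ring consists of
  families indexed by the finite subsets of the field, taken modulo an ultrafilter. It is huge, but
  the matrix entries generate a finitely generated algebra over a copy of the field inside it, and a
  Nullstellensatz for such algebras yields a point over the field that keeps one chosen element
  nonzero. The same extension result over the algebraic closure of the prime field gives the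
  specialisations to finite fields. The block length \<open>p - 1\<close> comes from power sums over
  the residues modulo \<open>p\<close>: they vanish for exponents below \<open>p - 1\<close> and
  equal \<open>-1\<close> at \<open>p - 1\<close>.\<close>

lemma vector_space_mult: "vector_space ((*) :: 'k::field \<Rightarrow> 'k \<Rightarrow> 'k)"
  by unfold_locales (auto simp: algebra_simps)

definition sum_of :: "'b::ab_group_add set set \<Rightarrow> 'b set" where
  "sum_of E = {\<Sum>U\<in>E. x U | x. \<forall>U\<in>E. x U \<in> U}"

text \<open>Linearity is asked on the whole ambient space and invariance only on \<open>W\<close>: a
  linear form on \<open>W\<close> always extends linearly, but the extension need not be invariant
  elsewhere.\<close>

definition inv_functional :: "('g, 'm) monoid_scheme \<Rightarrow> ('k::field \<Rightarrow> 'w::ab_group_add \<Rightarrow> 'w) \<Rightarrow>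
    ('g \<Rightarrow> 'w \<Rightarrow> 'w) \<Rightarrow> 'w set \<Rightarrow> ('w \<Rightarrow> 'k) \<Rightarrow> bool" where
  "inv_functional G scale act W f \<longleftrightarrow>
     Vector_Spaces.linear scale (*) f \<and> (\<forall>g\<in>carrier G. \<forall>w\<in>W. f (act g w) = f w)"

context vector_space
begin

lemma linearI':
  assumes "\<And>x y. f (x + y) = f x + f y" "\<And>c x. f (scale c x) = c * f x"
  shows "Vector_Spaces.linear scale (*) f"
  using assms vector_space_mult vector_space_axioms
  by (auto simp: Vector_Spaces.linear_def module_hom_def module_hom_axioms_def module_iff_vector_space)

text \<open>A basis of \<open>S\<close> stays independent when \<open>w\<close> is added, so the
  values zero on \<open>S\<close> and one at \<open>w\<close> can be prescribed.\<close>

lemma separating_functional: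
  assumes S: "subspace S" and w: "w \<notin> S"
  shows "\<exists>f. Vector_Spaces.linear scale (*) f \<and> (\<forall>s\<in>S. f s = 0) \<and> f w = 1"
proof -
  interpret vector_space_pair scale "(*)"
    using vector_space_axioms vector_space_mult by (simp add: vector_space_pair_def)
  obtain B where B: "B \<subseteq> S" "independent B" "S \<subseteq> span B" using maximal_independent_subset by blast
  then have "span B \<subseteq> S" using S by (simp add: span_minimal)
  then have "w \<notin> span B" using w by blast
  then have "independent (insert w B)" using B by (simp add: independent_insert)
  from linear_independent_extend[OF this, of "\<lambda>x. if x = w then 1 else 0"]
  obtain f where f: "Vector_Spaces.linear scale (*) f" "\<And>x. x \<in> insert w B \<Longrightarrow> f x = (if x = w then 1 else 0)"
    by blast
  have "f b = 0" if "b \<in> B" for b using f(2)[of b] that B(1) w by auto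
  then have "f s = 0" if "s \<in> S" for s
    using linear_eq_0_on_span[OF f(1), of B s] that B by blast
  then show ?thesis using f by auto
qed

lemma subspace_sum_of: "(\<And>U. U \<in> E \<Longrightarrow> subspace U) \<Longrightarrow> subspace (sum_of E)"
proof (rule subspaceI)
  assume E: "\<And>U. U \<in> E \<Longrightarrow> subspace U"
  show "0 \<in> sum_of E" unfolding sum_of_def using E subspace_0 by (intro CollectI exI[of _ "\<lambda>_. 0"]) auto
  show "a + b \<in> sum_of E" if ab: "a \<in> sum_of E" "b \<in> sum_of E" for a b
  proof -
    from ab obtain x y where "a = (\<Sum>U\<in>E. x U)" "\<forall>U\<in>E. x U \<in> U" "b = (\<Sum>U\<in>E. y U)" "\<forall>U\<in>E. y U \<in> U"
      by (auto simp: sum_of_def)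
    then show ?thesis unfolding sum_of_def using E subspace_add
      by (intro CollectI exI[of _ "\<lambda>U. x U + y U"]) (auto simp: sum.distrib)
  qed
  show "scale c a \<in> sum_of E" if a: "a \<in> sum_of E" for a c
  proof -
    from a obtain x where "a = (\<Sum>U\<in>E. x U)" "\<forall>U\<in>E. x U \<in> U" by (auto simp: sum_of_def)
    then show ?thesis unfolding sum_of_def using E subspace_scale
      by (intro CollectI exI[of _ "\<lambda>U. scale c (x U)"]) (auto simp: scale_sum_right)
  qed
qed

lemma internal_direct_sum_alt:
  "internal_direct_sum D W \<longleftrightarrow> finite D \<and> W = sum_of D \<and>
     (\<forall>x. (\<forall>U\<in>D. x U \<in> U) \<and> (\<Sum>U\<in>D. x U) = 0 \<longrightarrow> (\<forall>U\<in>D. x U = 0))"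
  unfolding internal_direct_sum_def sum_of_def ..

text \<open>Summands form a set, so the two families must be disjoint: a common member would lie in
  the zero intersection of \<open>A\<close> and \<open>B\<close>, yet summands are nonzero.\<close>

lemma internal_direct_sum_Un:
  assumes DA: "internal_direct_sum D\<^sub>A A" and DB: "internal_direct_sum D\<^sub>B B"
    and sub: "\<And>U. U \<in> D\<^sub>A \<union> D\<^sub>B \<Longrightarrow> subspace U \<and> U \<noteq> {0}"
    and AB: "A \<inter> B = {0}"
  shows "internal_direct_sum (D\<^sub>A \<union> D\<^sub>B) {a + b | a b. a \<in> A \<and> b \<in> B}"
proof -
  have fin: "finite D\<^sub>A" "finite D\<^sub>B" and A: "A = sum_of D\<^sub>A" and B: "B = sum_of D\<^sub>B"
    using DA DB by (auto simp: internal_direct_sum_alt)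
  have sA: "subspace A" and sB: "subspace B" using subspace_sum_of sub A B by auto
  have UA: "U \<subseteq> sum_of D" if "U \<in> D" "finite D" "D \<subseteq> D\<^sub>A \<union> D\<^sub>B" for D U
  proof
    fix u assume "u \<in> U"
    have "0 \<in> U'" if "U' \<in> D" for U' using sub that \<open>D \<subseteq> _\<close> subspace_0 by auto
    then show "u \<in> sum_of D" unfolding sum_of_def using that \<open>u \<in> U\<close>
      by (intro CollectI exI[of _ "\<lambda>U'. if U' = U then u else 0"]) (auto simp: sum.delta)
  qed
  have disj: "D\<^sub>A \<inter> D\<^sub>B = {}"
  proof (rule ccontr)
    assume "D\<^sub>A \<inter> D\<^sub>B \<noteq> {}"
    then obtain U where U: "U \<in> D\<^sub>A" "U \<in> D\<^sub>B" by blast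
    then have "U \<subseteq> A \<inter> B" using UA[of U D\<^sub>A] UA[of U D\<^sub>B] fin A B by auto
    moreover have "0 \<in> U" "U \<noteq> {0}" using sub[of U] U subspace_0 by auto
    ultimately show False using AB by auto
  qed
  have split: "(\<Sum>U\<in>D\<^sub>A \<union> D\<^sub>B. x U) = (\<Sum>U\<in>D\<^sub>A. x U) + (\<Sum>U\<in>D\<^sub>B. x U)" for x :: "'b set \<Rightarrow> 'b"
    by (rule sum.union_disjoint[OF fin disj])
  have "{a + b | a b. a \<in> A \<and> b \<in> B} = sum_of (D\<^sub>A \<union> D\<^sub>B)"
  proof (intro equalityI subsetI)
    fix v assume "v \<in> {a + b | a b. a \<in> A \<and> b \<in> B}"
    then obtain x y where xy: "\<forall>U\<in>D\<^sub>A. x U \<in> U" "\<forall>U\<in>D\<^sub>B. y U \<in> U" "v = (\<Sum>U\<in>D\<^sub>A. x U) + (\<Sum>U\<in>D\<^sub>B. y U)"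
      unfolding A B sum_of_def by auto
    have "(\<Sum>U\<in>D\<^sub>A \<union> D\<^sub>B. if U \<in> D\<^sub>A then x U else y U) = v"
      unfolding split xy(3) using disj by (intro arg_cong2[of _ _ _ _ "(+)"] sum.cong) auto
    then show "v \<in> sum_of (D\<^sub>A \<union> D\<^sub>B)" unfolding sum_of_def using xy
      by (intro CollectI exI[of _ "\<lambda>U. if U \<in> D\<^sub>A then x U else y U"]) auto
  next
    fix v assume "v \<in> sum_of (D\<^sub>A \<union> D\<^sub>B)"
    then obtain x where "v = (\<Sum>U\<in>D\<^sub>A \<union> D\<^sub>B. x U)" "\<forall>U\<in>D\<^sub>A \<union> D\<^sub>B. x U \<in> U" by (auto simp: sum_of_def)
    then show "v \<in> {a + b | a b. a \<in> A \<and> b \<in> B}" unfolding A B sum_of_def split by blast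
  qed
  moreover have "\<forall>U\<in>D\<^sub>A \<union> D\<^sub>B. x U = 0" if x: "\<forall>U\<in>D\<^sub>A \<union> D\<^sub>B. x U \<in> U" "(\<Sum>U\<in>D\<^sub>A \<union> D\<^sub>B. x U) = 0" for x
  proof -
    have a: "(\<Sum>U\<in>D\<^sub>A. x U) \<in> A" and b: "(\<Sum>U\<in>D\<^sub>B. x U) \<in> B" using x(1) unfolding A B sum_of_def by blast+
    have "(\<Sum>U\<in>D\<^sub>A. x U) = - (\<Sum>U\<in>D\<^sub>B. x U)" using x(2) unfolding split by (simp add: eq_neg_iff_add_eq_0)
    then have "(\<Sum>U\<in>D\<^sub>A. x U) \<in> A \<inter> B" using a b subspace_neg[OF sB] by auto
    then have "(\<Sum>U\<in>D\<^sub>A. x U) = 0" "(\<Sum>U\<in>D\<^sub>B. x U) = 0" using AB x(2) split by auto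
    then show ?thesis using x(1) DA DB unfolding internal_direct_sum_alt by blast
  qed
  ultimately show ?thesis unfolding internal_direct_sum_alt using fin by auto
qed

text \<open>Induction on the size of a basis. A decomposable space is a sum of two parts, each of
  which misses a nonzero vector of the other; adding that vector to a basis of a part keeps it
  independent, so the part has a smaller basis.\<close>

lemma decomposition_exists:
  assumes "finite B" "independent B" "subrep G scale act (span B)"
  shows "\<exists>D. indecomposable_decomposition G scale act (span B) D"
  using assms
proof (induction "card B" arbitrary: B rule: less_induct)
  case less
  define W where "W = span B"
  consider "W = {0}" | "indecomposable G scale act W" | "W \<noteq> {0}" "\<not> indecomposable G scale act W" by blast
  then show ?case
  proof cases
    case 1
    then show ?thesis unfolding W_def[symmetric]
      by (intro exI[of _ "{}"]) (auto simp: indecomposable_decomposition_def internal_direct_sum_def)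
  next
    case 2
    have "w \<in> {\<Sum>U\<in>{W}. x U | x. \<forall>U\<in>{W}. x U \<in> U}" if "w \<in> W" for w
      by (rule CollectI, rule exI[of _ "\<lambda>_. w"]) (simp add: that)
    then have "W = {\<Sum>U\<in>{W}. x U | x. \<forall>U\<in>{W}. x U \<in> U}" by auto
    then have "internal_direct_sum {W} W" unfolding internal_direct_sum_def by simp
    then show ?thesis using 2 unfolding W_def[symmetric]
      by (intro exI[of _ "{W}"]) (auto simp: indecomposable_decomposition_def)
  next
    case 3
    then obtain X Y where XY: "subrep G scale act X" "subrep G scale act Y" "X \<noteq> {0}" "Y \<noteq> {0}" "X \<inter> Y = {0}"
      "W = {a + b | a b. a \<in> X \<and> b \<in> Y}"
      using less.prems(3) unfolding indecomposable_def W_def by blast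
    have sub: "subspace X" "subspace Y" using XY by (auto simp: subrep_def)
    have smaller: "\<exists>C. finite C \<and> independent C \<and> span C = X \<and> card C < card B"
      if "subspace X" "X \<subseteq> W" "v \<in> W" "v \<notin> X" for X v
    proof -
      obtain C where C: "C \<subseteq> X" "independent C" "X \<subseteq> span C" using maximal_independent_subset by blast
      then have sC: "span C = X" using that(1) span_minimal by blast
      then have "independent (insert v C)" "v \<notin> C" using C that(4) span_superset by (auto simp: independent_insert)
      moreover have "insert v C \<subseteq> span B"
        using subset_trans[OF C(1) that(2)] that(3) unfolding W_def by (simp only: insert_subset simp_thms)
      ultimately have "finite (insert v C) \<and> card (insert v C) \<le> card B"
        by (intro independent_span_bound[OF less.prems(1)])
      then have "finite C \<and> card C < card B" using \<open>v \<notin> C\<close> card_insert_disjoint[of C v] by auto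
      then show ?thesis using C(2) sC by blast
    qed
    have "X \<subseteq> W" "Y \<subseteq> W"
    proof -
      show "X \<subseteq> W"
      proof
        fix x assume "x \<in> X"
        then have "x = x + 0 \<and> x \<in> X \<and> 0 \<in> Y" using subspace_0[OF sub(2)] by simp
        then show "x \<in> W" unfolding XY(6) by blast
      qed
      show "Y \<subseteq> W"
      proof
        fix x assume "x \<in> Y"
        then have "x = 0 + x \<and> 0 \<in> X \<and> x \<in> Y" using subspace_0[OF sub(1)] by simp
        then show "x \<in> W" unfolding XY(6) by blast
      qed
    qed
    obtain x y where "x \<in> X" "x \<noteq> 0" "y \<in> Y" "y \<noteq> 0" using XY(3,4) subspace_0[OF sub(1)] subspace_0[OF sub(2)] by blast
    then have "x \<notin> Y" "y \<notin> X" using XY(5) by auto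
    obtain CX where CX: "finite CX" "independent CX" "span CX = X" "card CX < card B"
      using smaller[OF sub(1) \<open>X \<subseteq> W\<close> _ \<open>y \<notin> X\<close>] \<open>Y \<subseteq> W\<close> \<open>y \<in> Y\<close> by blast
    obtain CY where CY: "finite CY" "independent CY" "span CY = Y" "card CY < card B"
      using smaller[OF sub(2) \<open>Y \<subseteq> W\<close> _ \<open>x \<notin> Y\<close>] \<open>X \<subseteq> W\<close> \<open>x \<in> X\<close> by blast
    obtain DX DY where D: "indecomposable_decomposition G scale act X DX" "indecomposable_decomposition G scale act Y DY"
      using less.hyps[OF CX(4,1,2)] less.hyps[OF CY(4,1,2)] CX(3) CY(3) XY by auto
    then have "internal_direct_sum (DX \<union> DY) W"
      unfolding XY(6) by (intro internal_direct_sum_Un XY)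
        (auto simp: indecomposable_decomposition_def indecomposable_def subrep_def)
    then show ?thesis using D unfolding W_def[symmetric]
      by (intro exI[of _ "DX \<union> DY"]) (auto simp: indecomposable_decomposition_def)
  qed
qed

text \<open>The line of \<open>u\<close> and the kernel of \<open>f\<close> on \<open>U\<close> are
  complementary subrepresentations. The line is nonzero, so the kernel is zero and \<open>f\<close>
  itself is the isomorphism to the field.\<close>

lemma indecomposable_trivial:
  assumes U: "indecomposable G scale act U" and u: "u \<in> U" "\<And>g. g \<in> carrier G \<Longrightarrow> act g u = u"
    and lin: "\<And>g. g \<in> carrier G \<Longrightarrow> Vector_Spaces.linear scale scale (act g)"
    and f: "Vector_Spaces.linear scale (*) f" "\<And>g w. g \<in> carrier G \<Longrightarrow> w \<in> U \<Longrightarrow> f (act g w) = f w"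
    and fu: "f u \<noteq> 0"
  shows "trivial_rep G scale act U"
proof -
  interpret f: Vector_Spaces.linear scale "(*)" f by (rule f)
  have sU: "subspace U" and aU: "\<And>g w. g \<in> carrier G \<Longrightarrow> w \<in> U \<Longrightarrow> act g w \<in> U"
    using U by (auto simp: indecomposable_def subrep_def)
  define A where "A = range (\<lambda>c. scale c u)"
  define B where "B = {w \<in> U. f w = 0}"
  have "subspace A" unfolding A_def
    by (rule subspaceI) (auto simp: image_iff scale_left_distrib[symmetric] intro: exI[of _ 0])
  moreover have "act g (scale c u) = scale c u" if "g \<in> carrier G" for g c
  proof -
    interpret g: Vector_Spaces.linear scale scale "act g" by (rule lin[OF that])
    show ?thesis using u(2)[OF that] by (simp add: g.scale)
  qed
  ultimately have "subrep G scale act A" unfolding subrep_def A_def by auto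
  moreover have "subrep G scale act B" unfolding subrep_def B_def
    using sU aU f(2) by (auto intro!: subspaceI simp: subspace_0 subspace_add subspace_scale f.add f.scale f.zero)
  moreover have "A \<noteq> {0}"
  proof -
    have "u \<in> A" unfolding A_def by (rule image_eqI[of _ _ 1]) auto
    moreover have "u \<noteq> 0" using fu f.zero by auto
    ultimately show ?thesis by blast
  qed
  moreover have "A \<inter> B = {0}"
    unfolding A_def B_def using fu f.zero subspace_0[OF sU] by (auto simp: f.scale image_iff intro: exI[of _ 0])
  moreover have dec: "w = scale (f w / f u) u + (w - scale (f w / f u) u) \<and> w - scale (f w / f u) u \<in> B" if "w \<in> U" for w
    using that u fu sU by (auto simp: B_def f.diff f.scale subspace_diff subspace_scale)
  moreover have "U = {a + b | a b. a \<in> A \<and> b \<in> B}"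
  proof (intro equalityI subsetI)
    fix w assume "w \<in> U"
    then show "w \<in> {a + b | a b. a \<in> A \<and> b \<in> B}" using dec[of w] unfolding A_def by blast
  qed (use sU u in \<open>auto simp: A_def B_def subspace_add subspace_scale\<close>)
  ultimately have "B = {0}" using U unfolding indecomposable_def by blast
  then have w: "w = scale (f w / f u) u" if "w \<in> U" for w using dec[OF that] by simp
  have "bij_betw f U UNIV"
  proof (rule bij_betwI')
    fix x y assume "x \<in> U" "y \<in> U"
    then show "f x = f y \<longleftrightarrow> x = y" using w by metis
  next
    fix c :: 'a
    have "scale (c / f u) u \<in> U" "f (scale (c / f u) u) = c" using sU u fu by (auto simp: subspace_scale f.scale)
    then show "\<exists>x\<in>U. c = f x" by metis
  qed auto
  then show ?thesis unfolding trivial_rep_def using f by (intro exI[of _ f]) (auto simp: f.add f.scale)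
qed

lemma trivial_repD:
  assumes "trivial_rep G scale act U" "subrep G scale act U"
  shows "\<exists>z\<in>U. z \<noteq> 0 \<and> (\<forall>g\<in>carrier G. act g z = z) \<and> U \<subseteq> span {z}"
proof -
  obtain \<phi> where bij: "bij_betw \<phi> U (UNIV :: 'a set)" and
     \<phi>: "\<forall>u\<in>U. \<forall>v\<in>U. \<phi> (u + v) = \<phi> u + \<phi> v" "\<forall>c. \<forall>u\<in>U. \<phi> (scale c u) = c * \<phi> u"
     "\<forall>g\<in>carrier G. \<forall>u\<in>U. \<phi> (act g u) = \<phi> u"
    using assms(1) by (auto simp: trivial_rep_def)
  have sU: "subspace U" and aU: "\<And>g w. g \<in> carrier G \<Longrightarrow> w \<in> U \<Longrightarrow> act g w \<in> U"
    using assms(2) by (auto simp: subrep_def)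
  have inj: "x = y" if "\<phi> x = \<phi> y" "x \<in> U" "y \<in> U" for x y using that bij by (auto simp: bij_betw_def inj_on_def)
  obtain z where z: "z \<in> U" "\<phi> z = 1" using bij unfolding bij_betw_def by (metis UNIV_I imageE)
  have "z \<noteq> 0" using z \<phi>(2) subspace_0[OF sU] by (metis mult_zero_left scale_zero_left zero_neq_one)
  moreover have "act g z = z" if "g \<in> carrier G" for g using inj \<phi>(3) aU z that by auto
  moreover have "w \<in> span {z}" if "w \<in> U" for w
  proof -
    have "w = scale (\<phi> w) z" using inj[of w "scale (\<phi> w) z"] \<phi>(2) z that sU by (auto simp: subspace_scale)
    then show ?thesis by (metis span_base insertI1 span_scale)
  qed
  ultimately show ?thesis using z by blast
qed

text \<open>Turns the count into a biorthogonal system of invariant vectors and invariant forms, one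
  pair for each trivial summand. The last clause serves the lower bound: if every nonzero invariant
  vector is seen by an invariant form, the chosen vectors span all invariants.\<close>

lemma TS_decomposition:
  assumes lin: "\<And>g. g \<in> carrier G \<Longrightarrow> Vector_Spaces.linear scale scale (act g)"
    and W: "subrep G scale act W" "finite B" "W \<subseteq> span B"
  obtains T :: "'b set set" and z f where "finite T" "card T = TS G scale act W"
    "\<And>U. U \<in> T \<Longrightarrow> z U \<in> W \<and> (\<forall>g\<in>carrier G. act g (z U) = z U) \<and> inv_functional G scale act W (f U)"
    "\<And>U U'. U \<in> T \<Longrightarrow> U' \<in> T \<Longrightarrow> f U (z U') = (if U = U' then 1 else 0)"
    "\<And>w. w \<in> W \<Longrightarrow> (\<And>g. g \<in> carrier G \<Longrightarrow> act g w = w) \<Longrightarrow>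
       (\<And>w. w \<in> W \<Longrightarrow> w \<noteq> 0 \<Longrightarrow> (\<forall>g\<in>carrier G. act g w = w) \<Longrightarrow> \<exists>f. inv_functional G scale act W f \<and> f w \<noteq> 0) \<Longrightarrow>
       w \<in> span (z ` T)"
proof -
  have sW: "subspace W" using W by (auto simp: subrep_def)
  obtain C where C: "C \<subseteq> W" "independent C" "W \<subseteq> span C" using maximal_independent_subset by blast
  then have "span C = W" using sW span_minimal by blast
  moreover have "finite C" using independent_span_bound[OF W(2) C(2)] C W by blast
  ultimately have "\<exists>D. indecomposable_decomposition G scale act W D" using decomposition_exists C W by metis
  define D where "D = (SOME D. indecomposable_decomposition G scale act W D)"
  have D: "indecomposable_decomposition G scale act W D"
    unfolding D_def using someI_ex[OF \<open>\<exists>D. _ D\<close>] .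
  then have fin: "finite D" and Wsum: "W = sum_of D" and ind: "\<And>U. U \<in> D \<Longrightarrow> indecomposable G scale act U" and
    dir: "\<And>x. (\<forall>U\<in>D. x U \<in> U) \<Longrightarrow> (\<Sum>U\<in>D. x U) = 0 \<Longrightarrow> (\<forall>U\<in>D. x U = 0)"
    by (auto simp: indecomposable_decomposition_def internal_direct_sum_alt)
  have sub: "subrep G scale act U" "subspace U" "U \<noteq> {0}" if "U \<in> D" for U
    using ind[OF that] by (auto simp: indecomposable_def subrep_def)
  have UW: "U \<subseteq> W" if "U \<in> D" for U
  proof
    fix u assume "u \<in> U"
    then show "u \<in> W" unfolding Wsum sum_of_def using that fin sub subspace_0
      by (intro CollectI exI[of _ "\<lambda>U'. if U' = U then u else 0"]) (auto simp: sum.delta)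
  qed
  define T where "T = {U \<in> D. trivial_rep G scale act U}"
  have "\<forall>U\<in>T. \<exists>z\<in>U. z \<noteq> 0 \<and> (\<forall>g\<in>carrier G. act g z = z) \<and> U \<subseteq> span {z}"
    unfolding T_def using trivial_repD sub by blast
  then obtain z where z: "\<And>U. U \<in> T \<Longrightarrow> z U \<in> U" "\<And>U. U \<in> T \<Longrightarrow> z U \<noteq> 0"
    "\<And>U g. U \<in> T \<Longrightarrow> g \<in> carrier G \<Longrightarrow> act g (z U) = z U" "\<And>U. U \<in> T \<Longrightarrow> U \<subseteq> span {z U}"
    by metis
  \<comment> \<open>An invariant form on one summand extends by zero on the others to an invariant
    form on all of \<open>W\<close>.\<close>
  have comp_fun: "\<exists>f. inv_functional G scale act W f \<and> f u = 1 \<and> (\<forall>U'\<in>D - {U}. \<forall>w\<in>U'. f w = 0)"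
    if U: "U \<in> D" and u: "u \<in> U" "u \<noteq> 0" and h: "h u = 1" "Vector_Spaces.linear scale (*) h"
       "\<And>g w. g \<in> carrier G \<Longrightarrow> w \<in> U \<Longrightarrow> h (act g w) = h w" for U u h
  proof -
    interpret h: Vector_Spaces.linear scale "(*)" h by (rule h)
    \<comment> \<open>The kernel of \<open>h\<close> on \<open>U\<close> together with all other
      summands: a form that vanishes here and is one at \<open>u\<close> must agree with
      \<open>h\<close> on \<open>U\<close>.\<close>
    define S where "S = {a + b | a b. a \<in> U \<and> h a = 0 \<and> b \<in> sum_of (D - {U})}"
    have sD: "subspace (sum_of (D - {U}))" by (rule subspace_sum_of) (use sub(2) in blast)
    have U0: "U \<inter> sum_of (D - {U}) = {0}"
    proof (intro equalityI subsetI)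
      fix a assume "a \<in> U \<inter> sum_of (D - {U})"
      then obtain x where a: "a \<in> U" "a = (\<Sum>U'\<in>D - {U}. x U')" "\<forall>U'\<in>D - {U}. x U' \<in> U'" by (auto simp: sum_of_def)
      \<comment> \<open>Moving \<open>a\<close> to the other side gives a vanishing sum over all of
        \<open>D\<close>, to which directness applies.\<close>
      define y where "y U' = (if U' = U then - a else x U')" for U'
      have "(\<Sum>U'\<in>D. y U') = - a + (\<Sum>U'\<in>D - {U}. y U')" using U fin by (simp add: sum.remove y_def)
      also have "(\<Sum>U'\<in>D - {U}. y U') = a" unfolding a(2) by (rule sum.cong) (auto simp: y_def)
      finally have "(\<Sum>U'\<in>D. y U') = 0" by simp
      moreover have "\<forall>U'\<in>D. y U' \<in> U'" using a sub U by (auto simp: y_def subspace_neg)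
      ultimately have "y U = 0" using dir U by blast
      then show "a \<in> {0}" by (simp add: y_def)
    qed (use U sub sD subspace_0 in auto)
    have sS: "subspace S"
    proof (rule subspaceI)
      show "0 \<in> S" unfolding S_def using subspace_0[OF sD] subspace_0[OF sub(2)[OF U]] h.zero by force
      show "x + y \<in> S" if xy: "x \<in> S" "y \<in> S" for x y
      proof -
        obtain a b a' b' where *: "x = a + b" "y = a' + b'" "a \<in> U" "h a = 0" "b \<in> sum_of (D - {U})"
           "a' \<in> U" "h a' = 0" "b' \<in> sum_of (D - {U})" using xy by (auto simp: S_def)
        then have "x + y = (a + a') + (b + b')" "a + a' \<in> U" "h (a + a') = 0" "b + b' \<in> sum_of (D - {U})"
          using subspace_add[OF sD] subspace_add[OF sub(2)[OF U]] by (auto simp: h.add)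
        then show ?thesis unfolding S_def by blast
      qed
      show "scale c x \<in> S" if x: "x \<in> S" for c x
      proof -
        obtain a b where *: "x = a + b" "a \<in> U" "h a = 0" "b \<in> sum_of (D - {U})" using x by (auto simp: S_def)
        then have "scale c x = scale c a + scale c b" "scale c a \<in> U" "h (scale c a) = 0" "scale c b \<in> sum_of (D - {U})"
          using subspace_scale[OF sD] subspace_scale[OF sub(2)[OF U]] by (auto simp: h.scale scale_right_distrib)
        then show ?thesis unfolding S_def by blast
      qed
    qed
    have "u \<notin> S"
    proof
      assume "u \<in> S"
      then obtain a b where *: "u = a + b" "a \<in> U" "h a = 0" "b \<in> sum_of (D - {U})" by (auto simp: S_def)
      then have "b = u - a" by simp
      then have "b \<in> U" using subspace_diff[OF sub(2)[OF U]] u *(2) by auto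
      then have "b = 0" using U0 * by auto
      then show False using * h by auto
    qed
    from separating_functional[OF sS this] obtain f where
      f: "Vector_Spaces.linear scale (*) f" "\<And>s. s \<in> S \<Longrightarrow> f s = 0" "f u = 1" by blast
    interpret f: Vector_Spaces.linear scale "(*)" f by (rule f)
    have fh: "f w = h a" if "w = a + b" "a \<in> U" "b \<in> sum_of (D - {U})" for w a b
    proof -
      have "a - scale (h a) u \<in> U" using that u subspace_diff[OF sub(2)[OF U]] subspace_scale[OF sub(2)[OF U]] by auto
      moreover have "h (a - scale (h a) u) = 0" using h(1) by (simp add: h.diff h.scale)
      moreover have "w - scale (h a) u = (a - scale (h a) u) + b" using that by simp
      ultimately have "w - scale (h a) u \<in> S" using that unfolding S_def by blast
      then show ?thesis using f(2)[of "w - scale (h a) u"] f(3) by (simp add: f.diff f.scale)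
    qed
    have Wdec: "\<exists>a b. w = a + b \<and> a \<in> U \<and> b \<in> sum_of (D - {U})" if w: "w \<in> W" for w
    proof -
      obtain x where "w = (\<Sum>U\<in>D. x U)" "\<forall>U\<in>D. x U \<in> U" using w unfolding Wsum sum_of_def by auto
      then have "w = x U + (\<Sum>U'\<in>D - {U}. x U')" "x U \<in> U" "(\<Sum>U'\<in>D - {U}. x U') \<in> sum_of (D - {U})"
        using U fin by (auto simp: sum.remove sum_of_def)
      then show ?thesis by blast
    qed
    have stable: "act g b \<in> sum_of (D - {U})" if gb: "g \<in> carrier G" "b \<in> sum_of (D - {U})" for g b
    proof -
      interpret g: Vector_Spaces.linear scale scale "act g" by (rule lin[OF gb(1)])
      obtain x where "b = (\<Sum>U'\<in>D - {U}. x U')" "\<forall>U'\<in>D - {U}. x U' \<in> U'" using gb by (auto simp: sum_of_def)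
      then have "act g b = (\<Sum>U'\<in>D - {U}. act g (x U'))" "\<forall>U'\<in>D - {U}. act g (x U') \<in> U'"
        using sub(1) gb(1) by (auto simp: g.sum subrep_def)
      then show ?thesis unfolding sum_of_def by blast
    qed
    have "f (act g w) = f w" if g: "g \<in> carrier G" and w: "w \<in> W" for g w
    proof -
      obtain a b where ab: "w = a + b" "a \<in> U" "b \<in> sum_of (D - {U})" using Wdec w by blast
      interpret g: Vector_Spaces.linear scale scale "act g" by (rule lin[OF g])
      have "act g w = act g a + act g b" using ab by (simp add: g.add)
      moreover have "act g a \<in> U" using sub(1)[OF U] ab g by (auto simp: subrep_def)
      ultimately have "f (act g w) = h (act g a)" using fh stable g ab by blast
      then show ?thesis using h(3) g ab fh by auto
    qed
    moreover have "f w = 0" if "U' \<in> D - {U}" "w \<in> U'" for U' w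
    proof -
      have "w \<in> sum_of (D - {U})" unfolding sum_of_def using that fin sub subspace_0
        by (intro CollectI exI[of _ "\<lambda>V. if V = U' then w else 0"]) (auto simp: sum.delta)
      then have "w \<in> S" unfolding S_def using subspace_0[OF sub(2)[OF U]] h.zero by force
      then show ?thesis by (rule f(2))
    qed
    ultimately show ?thesis unfolding inv_functional_def using f by blast
  qed
  have "\<exists>f. inv_functional G scale act W f \<and> f (z U) = 1 \<and> (\<forall>U'\<in>D - {U}. \<forall>w\<in>U'. f w = 0)" if U: "U \<in> T" for U
  proof -
    obtain h where h: "Vector_Spaces.linear scale (*) h" "h (z U) = 1"
      using separating_functional[of "{0}" "z U"] z(2)[OF U] by (auto simp: subspace_single_0)
    interpret h: Vector_Spaces.linear scale "(*)" h by (rule h)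
    have UD: "U \<in> D" using U by (auto simp: T_def)
    have "act g w = w" if gw: "g \<in> carrier G" "w \<in> U" for g w
    proof -
      obtain c where "w = scale c (z U)" using z(4)[OF U] gw(2) by (auto simp: span_singleton)
      interpret g: Vector_Spaces.linear scale scale "act g" by (rule lin[OF that(1)])
      show ?thesis using z(3)[OF U that(1)] \<open>w = _\<close> by (simp add: g.scale)
    qed
    then show ?thesis using h z U by (intro comp_fun[OF UD]) auto
  qed
  then obtain f where f: "\<And>U. U \<in> T \<Longrightarrow> inv_functional G scale act W (f U) \<and> f U (z U) = 1 \<and> (\<forall>U'\<in>D - {U}. \<forall>w\<in>U'. f U w = 0)"
    by metis
  show thesis
  proof (rule that[of T z f])
    show "finite T" using fin by (simp add: T_def)
    show "card T = TS G scale act W" unfolding T_def TS_def D_def ..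
    show "z U \<in> W \<and> (\<forall>g\<in>carrier G. act g (z U) = z U) \<and> inv_functional G scale act W (f U)" if "U \<in> T" for U
    proof (intro conjI ballI)
      have "U \<in> D" using that by (simp add: T_def)
      then show "z U \<in> W" using UW z(1)[OF that] by blast
      show "act g (z U) = z U" if "g \<in> carrier G" for g by (rule z(3)[OF \<open>U \<in> T\<close> that])
      show "inv_functional G scale act W (f U)" using f[OF that] by (rule conjunct1)
    qed
    show "f U (z U') = (if U = U' then 1 else 0)" if "U \<in> T" "U' \<in> T" for U U'
    proof (cases "U = U'")
      case True
      then show ?thesis using f[OF that(1)] by simp
    next
      case False
      have "U' \<in> D" using that(2) by (simp add: T_def)
      then have "f U (z U') = 0" using f[OF that(1)] z(1)[OF that(2)] False by blast
      then show ?thesis using False by simp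
    qed
    fix w assume w: "w \<in> W" "\<And>g. g \<in> carrier G \<Longrightarrow> act g w = w"
      and det: "\<And>w. w \<in> W \<Longrightarrow> w \<noteq> 0 \<Longrightarrow> (\<forall>g\<in>carrier G. act g w = w) \<Longrightarrow> \<exists>f. inv_functional G scale act W f \<and> f w \<noteq> 0"
    obtain x where x: "w = (\<Sum>U\<in>D. x U)" "\<And>U. U \<in> D \<Longrightarrow> x U \<in> U" using w(1) unfolding Wsum sum_of_def by auto
    \<comment> \<open>Uniqueness of components makes every component of an invariant vector
      invariant.\<close>
    have inv: "act g (x U) = x U" if "U \<in> D" "g \<in> carrier G" for U g
    proof -
      interpret g: Vector_Spaces.linear scale scale "act g" by (rule lin[OF that(2)])
      have "(\<Sum>U\<in>D. act g (x U) - x U) = 0" using w(2)[OF that(2)] by (simp add: x(1) g.sum sum_subtractf)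
      moreover have "\<forall>U\<in>D. act g (x U) - x U \<in> U" using x(2) sub that by (auto simp: subrep_def subspace_diff)
      ultimately have "act g (x U) - x U = 0" using dir[of "\<lambda>U. act g (x U) - x U"] that(1) by blast
      then show ?thesis by (rule eq_iff_diff_eq_0[THEN iffD2])
    qed
    have "x U \<in> span (z ` T)" if U: "U \<in> D" for U
    proof (cases "U \<in> T")
      case True
      then have "x U \<in> span {z U}" using z(4) x(2) U by auto
      then show ?thesis using span_mono[of "{z U}" "z ` T"] True by auto
    next
      case False
      \<comment> \<open>A nonzero component would be an invariant vector of \<open>U\<close> seen by
        an invariant form, which makes the indecomposable \<open>U\<close> trivial.\<close>
      have "x U = 0"
      proof (rule ccontr)
        assume "x U \<noteq> 0"
        moreover have "x U \<in> W" using UW[OF U] x(2)[OF U] by blast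
        ultimately have "\<exists>h. inv_functional G scale act W h \<and> h (x U) \<noteq> 0"
          using inv[OF U] by (intro det) blast+
        then obtain h where h: "inv_functional G scale act W h" "h (x U) \<noteq> 0" by blast
        have "Vector_Spaces.linear scale (*) h" "\<And>g w. g \<in> carrier G \<Longrightarrow> w \<in> U \<Longrightarrow> h (act g w) = h w"
          using UW[OF U] h(1) by (auto simp: inv_functional_def)
        from indecomposable_trivial[OF ind[OF U] x(2)[OF U] inv[OF U] lin this h(2)]
        have "trivial_rep G scale act U" .
        then show False using False U by (auto simp: T_def)
      qed
      then show ?thesis by (simp add: span_zero)
    qed
    then show "w \<in> span (z ` T)" unfolding x(1) by (rule span_sum)
  qed
qed

end

section \<open>Coordinates on tensor powers\<close>

text \<open>Letters are indices into a basis of size \<open>d\<close>, so these words label the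
  basis tensors of the \<open>n\<close>-th tensor power.\<close>

definition words :: "nat \<Rightarrow> nat \<Rightarrow> nat list set" where
  "words d n = {x. set x \<subseteq> {..<d} \<and> length x = n}"

lemma finite_words [simp]: "finite (words d n)"
  unfolding words_def by (rule finite_lists_length_eq) simp

lemma card_words: "card (words d n) = d ^ n"
  unfolding words_def by (subst card_lists_length_eq) simp_all

lemma words_nth: "x \<in> words d n \<Longrightarrow> j < n \<Longrightarrow> x ! j < d"
  unfolding words_def by (auto dest: nth_mem)

lemma words_length: "x \<in> words d n \<Longrightarrow> length x = n"
  unfolding words_def by simp

lemma words_0: "words d 0 = {[]}"
  unfolding words_def by auto

lemma words_Suc: "words d (Suc n) = (\<lambda>(i, x). i # x) ` ({..<d} \<times> words d n)"
proof (intro equalityI subsetI)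
  fix x assume "x \<in> words d (Suc n)"
  then obtain i y where "x = i # y" "i < d" "y \<in> words d n"
    unfolding words_def by (cases x) auto
  then show "x \<in> (\<lambda>(i, x). i # x) ` ({..<d} \<times> words d n)" by force
qed (auto simp: words_def)

lemma sum_words_Suc:
  fixes F :: "nat list \<Rightarrow> 'k::comm_monoid_add"
  shows "(\<Sum>x\<in>words d (Suc n). F x) = (\<Sum>i<d. \<Sum>x\<in>words d n. F (i # x))"
proof -
  have "(\<Sum>x\<in>words d (Suc n). F x) = (\<Sum>(i, x)\<in>{..<d} \<times> words d n. F (i # x))"
    unfolding words_Suc by (subst sum.reindex) (auto simp: inj_on_def case_prod_beta)
  also have "\<dots> = (\<Sum>i<d. \<Sum>x\<in>words d n. F (i # x))" by (rule sum.cartesian_product[symmetric])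
  finally show ?thesis .
qed

text \<open>Expanding a product of \<open>n\<close> sums selects one summand from each factor, and
  the selections are the words.\<close>

lemma sum_words_prod:
  fixes F :: "nat \<Rightarrow> nat \<Rightarrow> 'k::comm_semiring_1"
  shows "(\<Sum>x\<in>words d n. \<Prod>j<n. F j (x ! j)) = (\<Prod>j<n. \<Sum>i<d. F j i)"
proof (induction n arbitrary: F)
  case 0
  then show ?case by (simp add: words_0)
next
  case (Suc n)
  have "(\<Sum>x\<in>words d (Suc n). \<Prod>j<Suc n. F j (x ! j)) = (\<Sum>i<d. \<Sum>x\<in>words d n. F 0 i * (\<Prod>j<n. F (Suc j) (x ! j)))"
    unfolding sum_words_Suc prod.lessThan_Suc_shift by simp
  also have "\<dots> = (\<Sum>i<d. F 0 i) * (\<Prod>j<n. \<Sum>i<d. F (Suc j) i)"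
    unfolding Suc[of "\<lambda>j. F (Suc j)", symmetric] by (rule sum_product[symmetric])
  finally show ?case unfolding prod.lessThan_Suc_shift .
qed

lemma sum_mult_delta:
  fixes f :: "'i \<Rightarrow> 'k::comm_semiring_1"
  assumes "finite S"
  shows "(\<Sum>i\<in>S. f i * (if x = i then 1 else 0)) = (if x \<in> S then f x else 0)"
    "(\<Sum>i\<in>S. f i * (if i = x then 1 else 0)) = (if x \<in> S then f x else 0)"
  using assms by (simp_all add: if_distrib[of "(*) _"] cong: if_cong)

text \<open>The entry in row \<open>x\<close> and column \<open>y\<close> of the tensor power of the
  matrix \<open>A\<close>.\<close>

definition kron :: "(nat \<Rightarrow> nat \<Rightarrow> 'k::comm_semiring_1) \<Rightarrow> nat list \<Rightarrow> nat list \<Rightarrow> 'k" where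
  "kron A x y = (\<Prod>j<length x. A (x ! j) (y ! j))"

lemma kron_mult:
  assumes x: "x \<in> words d n" and z: "z \<in> words d n" and "\<And>i j. i < d \<Longrightarrow> j < d \<Longrightarrow> (\<Sum>k<d. A i k * B k j) = C i j"
  shows "(\<Sum>y\<in>words d n. kron A x y * kron B y z) = kron C x z"
proof -
  have "(\<Sum>y\<in>words d n. kron A x y * kron B y z) = (\<Sum>y\<in>words d n. \<Prod>j<n. A (x ! j) (y ! j) * B (y ! j) (z ! j))"
    by (intro sum.cong refl) (simp add: kron_def words_length[OF x] words_length prod.distrib)
  also have "\<dots> = (\<Prod>j<n. \<Sum>k<d. A (x ! j) k * B k (z ! j))"
    by (rule sum_words_prod)
  also have "\<dots> = (\<Prod>j<n. C (x ! j) (z ! j))"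
    by (intro prod.cong) (auto simp: assms(3) words_nth[OF x] words_nth[OF z])
  finally show ?thesis by (simp add: kron_def words_length[OF x])
qed

lemma kron_id:
  assumes x: "x \<in> words d n" and y: "y \<in> words d n" and A: "\<And>i j. i < d \<Longrightarrow> j < d \<Longrightarrow> A i j = (if i = j then 1 else 0)"
  shows "kron A x y = (if x = y then 1 else 0)"
proof (cases "x = y")
  case True
  have "(\<Prod>j<n. A (x ! j) (x ! j)) = 1" by (rule prod.neutral) (auto simp: A words_nth[OF x])
  then show ?thesis by (simp add: True[symmetric] kron_def words_length[OF x])
next
  case False
  then obtain j where j: "j < n" "x ! j \<noteq> y ! j" using words_length[OF x] words_length[OF y] by (metis nth_equalityI)
  have "(\<Prod>j<n. A (x ! j) (y ! j)) = 0"
    by (rule prod_zero) (use j A[OF words_nth[OF x j(1)] words_nth[OF y j(1)]] in auto)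
  then show ?thesis using False by (simp add: kron_def words_length[OF x])
qed

text \<open>Functions cut down to \<open>S\<close> lie in the span of the \<open>card S\<close>
  point functions, and \<open>ind\<close> says that cutting down keeps them independent.\<close>

lemma indep_bound:
  fixes Z :: "nat \<Rightarrow> 'x \<Rightarrow> 'k::field"
  assumes S: "finite S" and ind: "\<And>c k. (\<And>x. x \<in> S \<Longrightarrow> (\<Sum>k<N. c k * Z k x) = 0) \<Longrightarrow> k < N \<Longrightarrow> c k = 0"
  shows "N \<le> card S"
proof -
  interpret vector_space "fun_scale :: 'k \<Rightarrow> ('x \<Rightarrow> 'k) \<Rightarrow> _" by (rule fun_scale_vector_space)
  define v where "v k = (\<lambda>x. if x \<in> S then Z k x else 0)" for k
  define e where "e = (\<lambda>x y :: 'x. if y = x then 1 else 0 :: 'k)"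
  have sum_app: "(\<Sum>i\<in>I. fun_scale (c i) (h i)) x = (\<Sum>i\<in>I. c i * h i x)" for I :: "'i set" and c and h :: "'i \<Rightarrow> 'x \<Rightarrow> 'k" and x
    by (induction I rule: infinite_finite_induct) (auto simp: fun_scale_def)
  have v0: "c k = 0" if "(\<Sum>k<N. fun_scale (c k) (v k)) = 0" "k < N" for c k
  proof (rule ind[OF _ that(2)])
    fix x assume "x \<in> S"
    have "(\<Sum>k<N. fun_scale (c k) (v k)) x = 0" unfolding that(1) by simp
    then show "(\<Sum>k<N. c k * Z k x) = 0" unfolding sum_app v_def using \<open>x \<in> S\<close> by simp
  qed
  have inj: "inj_on v {..<N}"
  proof (rule inj_onI, rule ccontr)
    fix k l assume kl: "k \<in> {..<N}" "l \<in> {..<N}" "v k = v l" "k \<noteq> l"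
    \<comment> \<open>Two equal members would satisfy the relation with coefficients 1 and
      -1.\<close>
    define c where "c i = (if i = k then 1 else if i = l then - 1 else 0 :: 'k)" for i
    have "(\<Sum>i<N. fun_scale (c i) (v i)) = (\<Sum>i\<in>{k, l}. fun_scale (c i) (v i))"
      using kl by (intro sum.mono_neutral_right) (auto simp: c_def)
    also have "\<dots> = 0" using kl by (auto simp: c_def)
    finally have "c k = 0" using v0 kl by auto
    then show False by (simp add: c_def)
  qed
  have "independent (v ` {..<N})"
  proof
    assume "dependent (v ` {..<N})"
    then obtain u w where u: "w \<in> v ` {..<N}" "u w \<noteq> 0" "(\<Sum>w\<in>v ` {..<N}. fun_scale (u w) w) = 0"
      by (auto simp: dependent_finite)
    then have "(\<Sum>k<N. fun_scale (u (v k)) (v k)) = 0" using inj by (simp add: sum.reindex)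
    then show False using v0[of "\<lambda>k. u (v k)"] u by auto
  qed
  moreover have "v k \<in> span (e ` S)" for k
  proof -
    have "v k = (\<Sum>x\<in>S. fun_scale (Z k x) (e x))"
      by (rule ext) (simp add: sum_app v_def e_def sum_mult_delta[OF S])
    also have "\<dots> \<in> span (e ` S)" by (intro span_sum span_scale span_base) auto
    finally show ?thesis .
  qed
  then have "v ` {..<N} \<subseteq> span (e ` S)" by blast
  ultimately have "card (v ` {..<N}) \<le> card (e ` S)"
    using independent_span_bound[of "e ` S" "v ` {..<N}"] S by auto
  also have "card (v ` {..<N}) = N" using inj by (simp add: card_image)
  also have "card (e ` S) \<le> card S" using S by (rule card_image_le)
  finally show ?thesis .
qed

text \<open>The common form of all upper bounds: it suffices that a combination of the
  \<open>Z l\<close> vanishing on a small set \<open>S\<close> pairs to zero with every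
  \<open>F k\<close>, since that pairing returns the coefficient \<open>c k\<close>.\<close>

lemma biorthogonal_bound:
  fixes Z F :: "nat \<Rightarrow> 'x \<Rightarrow> 'k::field"
  assumes S: "finite S" "finite X"
    and bi: "\<And>k l. k < N \<Longrightarrow> l < N \<Longrightarrow> (\<Sum>x\<in>X. F k x * Z l x) = (if k = l then 1 else 0)"
    and dep: "\<And>c k. (\<And>x. x \<in> S \<Longrightarrow> (\<Sum>l<N. c l * Z l x) = 0) \<Longrightarrow> k < N \<Longrightarrow>
       (\<Sum>x\<in>X. F k x * (\<Sum>l<N. c l * Z l x)) = 0"
  shows "N \<le> card S"
proof (rule indep_bound[where Z = Z, OF S(1)])
  fix c k assume 0: "\<And>x. x \<in> S \<Longrightarrow> (\<Sum>k<N. c k * Z k x) = 0" and k: "k < N"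
  have "(\<Sum>x\<in>X. F k x * (\<Sum>l<N. c l * Z l x)) = (\<Sum>l<N. c l * (\<Sum>x\<in>X. F k x * Z l x))"
    unfolding sum_distrib_left by (subst sum.swap) (simp add: mult_ac)
  also have "\<dots> = (\<Sum>l<N. c l * (if k = l then 1 else 0))" using bi k by (intro sum.cong) auto
  also have "\<dots> = c k" using k by (simp add: sum_mult_delta)
  finally show "c k = 0" using dep[of c k] 0 k by simp
qed

text \<open>The ordered basis is a parameter because triangular and Jordan bases of the same space
  are used beside the given one.\<close>

locale based_space = vector_space scale for scale :: "'k::field \<Rightarrow> 'v::ab_group_add \<Rightarrow> 'v" +
  fixes bs :: "'v list"
  assumes basis: "basis_list scale bs"
begin

lemma distinct_bs: "distinct bs" and independent_bs: "independent (set bs)" and span_bs: "span (set bs) = UNIV"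
  using basis by (auto simp: basis_list_def)

definition "co i v = representation (set bs) v (bs ! i)"

lemma co_add: "co i (v + w) = co i v + co i w"
  unfolding co_def using representation_add[OF independent_bs, of w v] span_bs by simp

lemma co_scale: "co i (scale c v) = c * co i v"
  unfolding co_def using representation_scale[OF independent_bs, of v c] span_bs by simp

lemma linear_co: "Vector_Spaces.linear scale (*) (co i)"
  by (rule linearI') (auto simp: co_add co_scale)

lemma co_bs: "i < length bs \<Longrightarrow> j < length bs \<Longrightarrow> co i (bs ! j) = (if i = j then 1 else 0)"
  unfolding co_def using representation_basis[OF independent_bs, of "bs ! j"] distinct_bs
  by (simp add: nth_eq_iff_index_eq)

lemma co_expand: "v = (\<Sum>i<length bs. scale (co i v) (bs ! i))"
proof -
  have "v = (\<Sum>b\<in>set bs. scale (representation (set bs) v b) b)"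
    using sum_representation_eq[OF independent_bs, of v "set bs"] span_bs by simp
  also have "\<dots> = (\<Sum>b\<leftarrow>bs. scale (representation (set bs) v b) b)"
    using distinct_bs by (simp add: sum_list_distinct_conv_sum_set)
  also have "\<dots> = (\<Sum>i<length bs. scale (co i v) (bs ! i))"
    by (simp add: sum_list_sum_nth atLeast0LessThan co_def)
  finally show ?thesis .
qed

lemma functional_expand:
  assumes "Vector_Spaces.linear scale (*) \<phi>"
  shows "\<phi> v = (\<Sum>i<length bs. co i v * \<phi> (bs ! i))"
proof -
  interpret Vector_Spaces.linear scale "(*)" \<phi> by (rule assms)
  show ?thesis by (subst co_expand[of v]) (simp only: sum scale)
qed

lemma linear_eqI_bs:
  assumes "Vector_Spaces.linear scale scale f" "Vector_Spaces.linear scale scale g"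
    and "\<And>i j. i < length bs \<Longrightarrow> j < length bs \<Longrightarrow> co i (f (bs ! j)) = co i (g (bs ! j))"
  shows "f = g"
proof
  interpret f: Vector_Spaces.linear scale scale f by (rule assms)
  interpret g: Vector_Spaces.linear scale scale g by (rule assms)
  have "f (bs ! j) = g (bs ! j)" if "j < length bs" for j
    using assms(3)[OF _ that] by (subst (1 2) co_expand) (auto intro!: sum.cong)
  then show "f v = g v" for v
    by (subst (1 2) co_expand[of v]) (auto simp only: f.sum g.sum f.scale g.scale lessThan_iff intro!: sum.cong)
qed

abbreviation "W n \<equiv> words (length bs) n"

text \<open>A tensor is a function of linear forms, so its coordinates are its values on the dual
  basis.\<close>

definition "tco t x = t (map co x)"
definition "bt x = pure_tensor scale (map ((!) bs) x)"

sublocale tens: vector_space "fun_scale :: 'k \<Rightarrow> (('v \<Rightarrow> 'k) list \<Rightarrow> 'k) \<Rightarrow> _"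
  by (rule fun_scale_vector_space)

lemma sum_fun_scale_apply:
  "(\<Sum>i\<in>I. fun_scale (c i) (h i)) x = (\<Sum>i\<in>I. c i * h i x)" for h :: "'i \<Rightarrow> 'x \<Rightarrow> 'k"
  by (induction I rule: infinite_finite_induct) (auto simp: fun_scale_def)

lemma bt_mem: "x \<in> W n \<Longrightarrow> bt x \<in> tensor_power scale n"
  unfolding tensor_power_def bt_def by (rule tens.span_base) (auto simp: words_length)

lemma tco_pure: "length vs = length x \<Longrightarrow> tco (pure_tensor scale vs) x = (\<Prod>j<length x. co (x ! j) (vs ! j))"
  unfolding tco_def pure_tensor_def by (auto simp: linear_co)

lemma tco_bt: "x \<in> W n \<Longrightarrow> y \<in> W n \<Longrightarrow> tco (bt y) x = (if x = y then 1 else 0)"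
proof -
  assume x: "x \<in> W n" and y: "y \<in> W n"
  have "tco (bt y) x = kron (\<lambda>i j. co i (bs ! j)) x y"
    unfolding bt_def using x y by (subst tco_pure) (auto simp: words_length kron_def)
  then show ?thesis using kron_id[OF x y, of "\<lambda>i j. co i (bs ! j)"] co_bs by simp
qed

text \<open>Multilinearity: each factor is expanded in the basis and \<open>sum_words_prod\<close>
  collects the terms. On lists that are not \<open>n\<close> linear forms both sides are zero by
  definition of pure tensors.\<close>

lemma pure_expand:
  assumes "length vs = n"
  shows "pure_tensor scale vs = (\<Sum>x\<in>W n. fun_scale (\<Prod>j<n. co (x ! j) (vs ! j)) (bt x))"
proof
  fix \<phi>s :: "('v \<Rightarrow> 'k) list"
  show "pure_tensor scale vs \<phi>s = (\<Sum>x\<in>W n. fun_scale (\<Prod>j<n. co (x ! j) (vs ! j)) (bt x)) \<phi>s"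
  proof (cases "length \<phi>s = n \<and> (\<forall>\<phi>\<in>set \<phi>s. Vector_Spaces.linear scale (*) \<phi>)")
    case True
    have "pure_tensor scale vs \<phi>s = (\<Prod>j<n. (\<phi>s ! j) (vs ! j))"
      using True assms by (simp add: pure_tensor_def)
    also have "\<dots> = (\<Prod>j<n. \<Sum>i<length bs. co i (vs ! j) * (\<phi>s ! j) (bs ! i))"
      using True by (intro prod.cong refl functional_expand) auto
    also have "\<dots> = (\<Sum>x\<in>W n. \<Prod>j<n. co (x ! j) (vs ! j) * (\<phi>s ! j) (bs ! (x ! j)))"
      by (rule sum_words_prod[symmetric])
    also have "\<dots> = (\<Sum>x\<in>W n. (\<Prod>j<n. co (x ! j) (vs ! j)) * bt x \<phi>s)"
      using True by (intro sum.cong refl) (auto simp: bt_def pure_tensor_def words_length prod.distrib)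
    finally show ?thesis by (simp add: sum_fun_scale_apply)
  next
    case False
    then have "pure_tensor scale vs \<phi>s = 0" "x \<in> W n \<Longrightarrow> bt x \<phi>s = 0" for x
      using assms by (auto simp: pure_tensor_def bt_def words_length)
    then show ?thesis by (simp add: sum_fun_scale_apply)
  qed
qed

lemma tensor_expand:
  assumes "t \<in> tensor_power scale n"
  shows "t = (\<Sum>x\<in>W n. fun_scale (tco t x) (bt x))"
proof -
  show "t = (\<Sum>x\<in>W n. fun_scale (tco t x) (bt x))"
    using assms unfolding tensor_power_def
  proof (rule tens.span_induct)
    show "tens.subspace {t. t = (\<Sum>x\<in>W n. fun_scale (tco t x) (bt x))}"
    proof (rule tens.subspaceI)
      show "0 \<in> {t. t = (\<Sum>x\<in>W n. fun_scale (tco t x) (bt x))}" by (simp add: tco_def)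
    next
      fix s t :: "('v \<Rightarrow> 'k) list \<Rightarrow> 'k"
      assume "s \<in> {t. t = (\<Sum>x\<in>W n. fun_scale (tco t x) (bt x))}" "t \<in> {t. t = (\<Sum>x\<in>W n. fun_scale (tco t x) (bt x))}"
      then have s: "s = (\<Sum>x\<in>W n. fun_scale (tco s x) (bt x))" and t: "t = (\<Sum>x\<in>W n. fun_scale (tco t x) (bt x))" by auto
      have "s + t = (\<Sum>x\<in>W n. fun_scale (tco s x) (bt x)) + (\<Sum>x\<in>W n. fun_scale (tco t x) (bt x))"
        using s t by (rule arg_cong2)
      also have "\<dots> = (\<Sum>x\<in>W n. fun_scale (tco (s + t) x) (bt x))"
        by (simp add: tco_def tens.scale_left_distrib sum.distrib)
      finally show "s + t \<in> {t. t = (\<Sum>x\<in>W n. fun_scale (tco t x) (bt x))}" by simp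
    next
      fix c and t :: "('v \<Rightarrow> 'k) list \<Rightarrow> 'k"
      assume "t \<in> {t. t = (\<Sum>x\<in>W n. fun_scale (tco t x) (bt x))}"
      then have "fun_scale c t = fun_scale c (\<Sum>x\<in>W n. fun_scale (tco t x) (bt x))" by (auto intro: arg_cong)
      also have "\<dots> = (\<Sum>x\<in>W n. fun_scale (tco (fun_scale c t) x) (bt x))"
        unfolding tens.scale_sum_right tens.scale_scale
        by (intro sum.cong refl) (simp add: tco_def fun_scale_def)
      finally show "fun_scale c t \<in> {t. t = (\<Sum>x\<in>W n. fun_scale (tco t x) (bt x))}" by simp
    qed
  next
    fix t assume "t \<in> {pure_tensor scale vs |vs. length vs = n}"
    then obtain vs where vs: "t = pure_tensor scale vs" "length vs = n" by auto
    have "t = (\<Sum>x\<in>W n. fun_scale (\<Prod>j<n. co (x ! j) (vs ! j)) (bt x))" unfolding vs(1) by (rule pure_expand[OF vs(2)])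
    also have "\<dots> = (\<Sum>x\<in>W n. fun_scale (tco t x) (bt x))"
      unfolding vs(1) by (intro sum.cong refl) (simp add: tco_pure vs words_length)
    finally show "t = (\<Sum>x\<in>W n. fun_scale (tco t x) (bt x))" .
  qed
qed

definition "from_co n z = (\<Sum>x\<in>W n. fun_scale (z x) (bt x))"

lemma from_co_mem: "from_co n z \<in> tensor_power scale n"
  unfolding from_co_def
proof (rule tens.subspace_sum)
  show sub: "tens.subspace (tensor_power scale n)" unfolding tensor_power_def by (rule tens.subspace_span)
  show "fun_scale (z x) (bt x) \<in> tensor_power scale n" if "x \<in> W n" for x
    by (rule tens.subspace_scale[OF sub bt_mem[OF that]])
qed

lemma tco_from_co: "x \<in> W n \<Longrightarrow> tco (from_co n z) x = z x"
proof -
  assume x: "x \<in> W n"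
  have "tco (from_co n z) x = (\<Sum>y\<in>W n. z y * tco (bt y) x)" by (simp add: tco_def from_co_def sum_fun_scale_apply)
  also have "\<dots> = (\<Sum>y\<in>W n. z y * (if x = y then 1 else 0))"
    by (intro sum.cong refl) (simp add: tco_bt[OF x])
  also have "\<dots> = z x" using x by (simp add: sum_mult_delta)
  finally show ?thesis .
qed

lemma tensor_eqI:
  assumes "s \<in> tensor_power scale n" "t \<in> tensor_power scale n" "\<And>x. x \<in> W n \<Longrightarrow> tco s x = tco t x"
  shows "s = t"
proof -
  have "s = (\<Sum>x\<in>W n. fun_scale (tco s x) (bt x))" by (rule tensor_expand[OF assms(1)])
  also have "\<dots> = (\<Sum>x\<in>W n. fun_scale (tco t x) (bt x))" using assms(3) by (intro sum.cong) auto
  also have "\<dots> = t" by (rule tensor_expand[OF assms(2), symmetric])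
  finally show ?thesis .
qed

definition "mco f i j = co i (f (bs ! j))"

lemma linear_tensor_act: "Vector_Spaces.linear fun_scale fun_scale (tensor_act \<rho> g)"
  using fun_scale_vector_space
  by (auto simp: Vector_Spaces.linear_def module_hom_def module_hom_axioms_def module_iff_vector_space tensor_act_def fun_scale_def)

lemma tensor_act_mem:
  assumes "\<rho> g \<in> carrier (GL scale)" "t \<in> tensor_power scale n"
  shows "tensor_act \<rho> g t \<in> tensor_power scale n"
proof -
  interpret A: Vector_Spaces.linear fun_scale fun_scale "tensor_act \<rho> g" by (rule linear_tensor_act)
  have "tensor_act \<rho> g (bt x) \<in> tensor_power scale n" if "x \<in> W n" for x
    unfolding bt_def tensor_act_pure[where \<rho> = \<rho> and g = g, OF assms(1)] tensor_power_def
    by (rule tens.span_base) (use that in \<open>auto simp: words_length\<close>)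
  then show ?thesis
    by (subst tensor_expand[OF assms(2)]) (auto simp: A.sum A.scale tensor_power_def intro!: tens.span_sum tens.span_scale)
qed

lemma tco_tensor_act:
  assumes "Vector_Spaces.linear scale scale (\<rho> g)" "t \<in> tensor_power scale n" "x \<in> W n"
  shows "tco (tensor_act \<rho> g t) x = (\<Sum>y\<in>W n. kron (mco (\<rho> g)) x y * tco t y)"
proof -
  have lin: "Vector_Spaces.linear scale (*) (co i \<circ> \<rho> g)" for i
    using Vector_Spaces.linear_compose[OF assms(1) linear_co[of i]] .
  have len: "length x = n" using words_length assms(3) .
  have "tco (tensor_act \<rho> g t) x = t (map (\<lambda>i. co i \<circ> \<rho> g) x)" by (simp add: tco_def tensor_act_def comp_def)
  also have "\<dots> = (\<Sum>y\<in>W n. tco t y * bt y (map (\<lambda>i. co i \<circ> \<rho> g) x))"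
    by (subst tensor_expand[OF assms(2)]) (rule sum_fun_scale_apply)
  also have "\<dots> = (\<Sum>y\<in>W n. kron (mco (\<rho> g)) x y * tco t y)"
    using lin by (intro sum.cong refl) (auto simp: bt_def pure_tensor_def len words_length kron_def mco_def mult.commute)
  finally show ?thesis .
qed

text \<open>Invariance under one endomorphism in coordinates. It involves \<open>f\<close> only
  through polynomials in its matrix entries, which is what lets it pass to the Zariski
  closure.\<close>

definition fixed_vec :: "nat \<Rightarrow> ('v \<Rightarrow> 'v) \<Rightarrow> (nat list \<Rightarrow> 'k) \<Rightarrow> bool" where
  "fixed_vec n f z \<longleftrightarrow> (\<forall>x\<in>W n. (\<Sum>y\<in>W n. kron (mco f) x y * z y) = z x)"

definition fixed_form :: "nat \<Rightarrow> ('v \<Rightarrow> 'v) \<Rightarrow> (nat list \<Rightarrow> 'k) \<Rightarrow> bool" where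
  "fixed_form n f h \<longleftrightarrow> (\<forall>y\<in>W n. (\<Sum>x\<in>W n. h x * kron (mco f) x y) = h y)"

lemma subrep_tensor:
  assumes \<rho>: "\<And>g. g \<in> carrier G \<Longrightarrow> \<rho> g \<in> carrier (GL scale)"
  shows "subrep G fun_scale (tensor_act \<rho>) (tensor_power scale n)"
  unfolding subrep_def using tensor_act_mem[where \<rho> = \<rho>, OF \<rho>] by (simp add: tensor_power_def)

lemma tensor_span_bt: "tensor_power scale n \<subseteq> tens.span (bt ` W n)"
proof
  fix t assume t: "t \<in> tensor_power scale n"
  show "t \<in> tens.span (bt ` W n)"
    by (subst tensor_expand[OF t]) (intro tens.span_sum tens.span_scale tens.span_base imageI)
qed

lemma fixed_vec_tco:
  assumes "\<rho> g \<in> carrier (GL scale)" "t \<in> tensor_power scale n"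
  shows "fixed_vec n (\<rho> g) (tco t) \<longleftrightarrow> tensor_act \<rho> g t = t"
proof -
  have lin: "Vector_Spaces.linear scale scale (\<rho> g)" using assms(1) by (simp add: GL_def)
  have "tensor_act \<rho> g t = t \<longleftrightarrow> (\<forall>x\<in>W n. tco (tensor_act \<rho> g t) x = tco t x)"
    using tensor_eqI[OF tensor_act_mem[where \<rho> = \<rho> and g = g, OF assms] assms(2)] by auto
  then show ?thesis unfolding fixed_vec_def
    using tco_tensor_act[where \<rho> = \<rho> and g = g, OF lin assms(2)] by simp
qed

lemma form_apply:
  assumes "Vector_Spaces.linear fun_scale (*) h" "t \<in> tensor_power scale n"
  shows "h t = (\<Sum>x\<in>W n. h (bt x) * tco t x)"
proof -
  interpret h: Vector_Spaces.linear fun_scale "(*)" h by (rule assms(1))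
  show ?thesis by (subst tensor_expand[OF assms(2)]) (simp add: h.sum h.scale mult.commute)
qed

lemma fixed_form_bt:
  assumes \<rho>: "\<And>g. g \<in> carrier G \<Longrightarrow> \<rho> g \<in> carrier (GL scale)"
    and h: "inv_functional G fun_scale (tensor_act \<rho>) (tensor_power scale n) h" and g: "g \<in> carrier G"
  shows "fixed_form n (\<rho> g) (\<lambda>x. h (bt x))"
  unfolding fixed_form_def
proof
  fix y assume y: "y \<in> W n"
  have lin: "Vector_Spaces.linear scale scale (\<rho> g)" using \<rho>[OF g] by (simp add: GL_def)
  have "h (bt y) = h (tensor_act \<rho> g (bt y))" using h g bt_mem[OF y] by (auto simp: inv_functional_def)
  also have "\<dots> = (\<Sum>x\<in>W n. h (bt x) * tco (tensor_act \<rho> g (bt y)) x)"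
    using h by (intro form_apply tensor_act_mem \<rho> g bt_mem y) (auto simp: inv_functional_def)
  also have "\<dots> = (\<Sum>x\<in>W n. h (bt x) * kron (mco (\<rho> g)) x y)"
  proof (intro sum.cong refl arg_cong2[of _ _ _ _ "(*)"])
    fix x assume x: "x \<in> W n"
    have "tco (tensor_act \<rho> g (bt y)) x = (\<Sum>z\<in>W n. kron (mco (\<rho> g)) x z * (if z = y then 1 else 0))"
      unfolding tco_tensor_act[where \<rho> = \<rho> and g = g, OF lin bt_mem[OF y] x] by (intro sum.cong refl) (simp add: tco_bt[OF _ y])
    also have "\<dots> = kron (mco (\<rho> g)) x y" using y by (simp add: sum_mult_delta)
    finally show "tco (tensor_act \<rho> g (bt y)) x = kron (mco (\<rho> g)) x y" .
  qed
  finally show "(\<Sum>x\<in>W n. h (bt x) * kron (mco (\<rho> g)) x y) = h (bt y)" by simp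
qed

text \<open>The coordinate form of \<open>TS_decomposition\<close>, numbered by natural numbers so
  that \<open>biorthogonal_bound\<close> applies.\<close>

lemma TS_upper:
  assumes \<rho>: "\<And>g. g \<in> carrier G \<Longrightarrow> \<rho> g \<in> carrier (GL scale)"
  obtains Z F :: "nat \<Rightarrow> nat list \<Rightarrow> 'k" where
    "\<And>k g. k < TS G fun_scale (tensor_act \<rho>) (tensor_power scale n) \<Longrightarrow> g \<in> carrier G \<Longrightarrow> fixed_vec n (\<rho> g) (Z k)"
    "\<And>k g. k < TS G fun_scale (tensor_act \<rho>) (tensor_power scale n) \<Longrightarrow> g \<in> carrier G \<Longrightarrow> fixed_form n (\<rho> g) (F k)"
    "\<And>k l. k < TS G fun_scale (tensor_act \<rho>) (tensor_power scale n) \<Longrightarrow>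
       l < TS G fun_scale (tensor_act \<rho>) (tensor_power scale n) \<Longrightarrow>
       (\<Sum>x\<in>W n. F k x * Z l x) = (if k = l then 1 else 0)"
proof -
  obtain T :: "(('v \<Rightarrow> 'k) list \<Rightarrow> 'k) set set" and z f where T: "finite T"
    "card T = TS G fun_scale (tensor_act \<rho>) (tensor_power scale n)"
    "\<And>U. U \<in> T \<Longrightarrow> z U \<in> tensor_power scale n \<and> (\<forall>g\<in>carrier G. tensor_act \<rho> g (z U) = z U) \<and>
       inv_functional G fun_scale (tensor_act \<rho>) (tensor_power scale n) (f U)"
    "\<And>U U'. U \<in> T \<Longrightarrow> U' \<in> T \<Longrightarrow> f U (z U') = (if U = U' then 1 else 0)"
    by (rule tens.TS_decomposition[of G "tensor_act \<rho>" "tensor_power scale n" "bt ` W n",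
       OF linear_tensor_act subrep_tensor[OF \<rho>] finite_imageI[OF finite_words] tensor_span_bt]) blast+
  obtain b where b: "bij_betw b {..<card T} T" using ex_bij_betw_nat_finite[OF T(1)] by (auto simp: atLeast0LessThan)
  have bT: "b k \<in> T" if "k < card T" for k using b that by (auto simp: bij_betw_def)
  have beq: "b k = b l \<longleftrightarrow> k = l" if "k < card T" "l < card T" for k l
    using b that by (auto simp: bij_betw_def inj_on_def)
  show ?thesis
  proof (rule that[of "\<lambda>k. tco (z (b k))" "\<lambda>k x. f (b k) (bt x)"]; unfold T(2)[symmetric])
    fix k g assume "k < card T" "g \<in> carrier G"
    then show "fixed_vec n (\<rho> g) (tco (z (b k)))" using T(3)[OF bT] \<rho> by (subst fixed_vec_tco) auto
    show "fixed_form n (\<rho> g) (\<lambda>x. f (b k) (bt x))"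
      using T(3)[OF bT] \<rho> \<open>k < card T\<close> \<open>g \<in> carrier G\<close> by (intro fixed_form_bt[where G = G]) auto
  next
    fix k l assume kl: "k < card T" "l < card T"
    have "(\<Sum>x\<in>W n. f (b k) (bt x) * tco (z (b l)) x) = f (b k) (z (b l))"
      using T(3)[OF bT] kl by (intro form_apply[symmetric]) (auto simp: inv_functional_def)
    then show "(\<Sum>x\<in>W n. f (b k) (bt x) * tco (z (b l)) x) = (if k = l then 1 else 0)"
      using T(4)[OF bT bT] kl beq by simp
  qed
qed

text \<open>With detection, the vectors chosen from the trivial summands span all invariants, so an
  independent family of invariants is no larger than their number.\<close>

lemma TS_lower:
  assumes \<rho>: "\<And>g. g \<in> carrier G \<Longrightarrow> \<rho> g \<in> carrier (GL scale)"
    and det: "\<And>z x. x \<in> W n \<Longrightarrow> z x \<noteq> 0 \<Longrightarrow> (\<And>g. g \<in> carrier G \<Longrightarrow> fixed_vec n (\<rho> g) z) \<Longrightarrow>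
       \<exists>h. (\<forall>g\<in>carrier G. fixed_form n (\<rho> g) h) \<and> (\<Sum>x\<in>W n. h x * z x) \<noteq> 0"
    and S: "finite S" "\<And>s g. s \<in> S \<Longrightarrow> g \<in> carrier G \<Longrightarrow> fixed_vec n (\<rho> g) (w s)"
    and ind: "\<And>c s. (\<And>x. x \<in> W n \<Longrightarrow> (\<Sum>s\<in>S. c s * w s x) = 0) \<Longrightarrow> s \<in> S \<Longrightarrow> c s = 0"
  shows "card S \<le> TS G fun_scale (tensor_act \<rho>) (tensor_power scale n)"
proof -
  let ?V = "tensor_power scale n"
  obtain T :: "(('v \<Rightarrow> 'k) list \<Rightarrow> 'k) set set" and z where T: "finite T" "card T = TS G fun_scale (tensor_act \<rho>) ?V"
    "\<And>w. w \<in> ?V \<Longrightarrow> (\<And>g. g \<in> carrier G \<Longrightarrow> tensor_act \<rho> g w = w) \<Longrightarrow>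
       (\<And>w. w \<in> ?V \<Longrightarrow> w \<noteq> 0 \<Longrightarrow> (\<forall>g\<in>carrier G. tensor_act \<rho> g w = w) \<Longrightarrow>
       \<exists>f. inv_functional G fun_scale (tensor_act \<rho>) ?V f \<and> f w \<noteq> 0) \<Longrightarrow>
       w \<in> tens.span (z ` T)"
    by (rule tens.TS_decomposition[of G "tensor_act \<rho>" ?V "bt ` W n",
       OF linear_tensor_act subrep_tensor[OF \<rho>] finite_imageI[OF finite_words] tensor_span_bt]) blast+
  have detect: "\<exists>f. inv_functional G fun_scale (tensor_act \<rho>) ?V f \<and> f t \<noteq> 0"
    if t: "t \<in> ?V" "t \<noteq> 0" "\<forall>g\<in>carrier G. tensor_act \<rho> g t = t" for t
  proof -
    have "0 \<in> ?V" unfolding tensor_power_def by (rule tens.span_zero)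
    then obtain x where x: "x \<in> W n" "tco t x \<noteq> 0"
      using tensor_eqI[OF t(1), of 0] t(2) by (auto simp: tco_def)
    have "fixed_vec n (\<rho> g) (tco t)" if "g \<in> carrier G" for g
      using fixed_vec_tco[where \<rho> = \<rho> and g = g, OF \<rho>[OF that] t(1)] t(3) that by simp
    from det[OF x this] obtain h where h: "\<And>g. g \<in> carrier G \<Longrightarrow> fixed_form n (\<rho> g) h" "(\<Sum>x\<in>W n. h x * tco t x) \<noteq> 0"
      by blast
    define f where "f s = (\<Sum>x\<in>W n. h x * tco s x)" for s
    have "f (tensor_act \<rho> g s) = f s" if g: "g \<in> carrier G" and s: "s \<in> ?V" for g s
    proof -
      have lin: "Vector_Spaces.linear scale scale (\<rho> g)" using \<rho>[OF g] by (simp add: GL_def)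
      have "f (tensor_act \<rho> g s) = (\<Sum>x\<in>W n. h x * (\<Sum>y\<in>W n. kron (mco (\<rho> g)) x y * tco s y))"
        unfolding f_def using tco_tensor_act[where \<rho> = \<rho> and g = g, OF lin s] by simp
      also have "\<dots> = (\<Sum>y\<in>W n. (\<Sum>x\<in>W n. h x * kron (mco (\<rho> g)) x y) * tco s y)"
        unfolding sum_distrib_left sum_distrib_right by (subst sum.swap) (simp add: mult_ac)
      also have "\<dots> = f s" unfolding f_def using h(1)[OF g] by (intro sum.cong) (auto simp: fixed_form_def)
      finally show ?thesis .
    qed
    moreover have "Vector_Spaces.linear fun_scale (*) f"
      by (rule tens.linearI') (simp_all add: f_def tco_def algebra_simps sum.distrib fun_scale_def sum_distrib_left)
    ultimately show ?thesis using h(2) by (intro exI[of _ f]) (auto simp: inv_functional_def f_def)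
  qed
  define v where "v s = from_co n (w s)" for s
  have v0: "c s = 0" if 0: "(\<Sum>s\<in>S. fun_scale (c s) (v s)) = 0" and s: "s \<in> S" for c s
  proof (rule ind[OF _ s])
    fix x assume x: "x \<in> W n"
    have "(\<Sum>s\<in>S. fun_scale (c s) (v s)) (map co x) = 0" unfolding 0 by simp
    then show "(\<Sum>s\<in>S. c s * w s x) = 0"
      unfolding sum_fun_scale_apply v_def using tco_from_co[OF x] unfolding tco_def by simp
  qed
  have inj: "inj_on v S"
  proof (rule inj_onI, rule ccontr)
    fix k l assume kl: "k \<in> S" "l \<in> S" "v k = v l" "k \<noteq> l"
    define c where "c i = (if i = k then 1 else if i = l then - 1 else 0 :: 'k)" for i
    have "(\<Sum>i\<in>S. fun_scale (c i) (v i)) = (\<Sum>i\<in>{k, l}. fun_scale (c i) (v i))"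
      using kl S(1) by (intro sum.mono_neutral_right) (auto simp: c_def)
    also have "\<dots> = 0" using kl by (auto simp: c_def)
    finally have "c k = 0" using v0 kl by auto
    then show False by (simp add: c_def)
  qed
  have "tens.independent (v ` S)"
  proof
    assume "tens.dependent (v ` S)"
    then obtain u s where u: "s \<in> v ` S" "u s \<noteq> 0" "(\<Sum>s\<in>v ` S. fun_scale (u s) s) = 0"
      using S(1) by (auto simp: tens.dependent_finite)
    then have "(\<Sum>k\<in>S. fun_scale (u (v k)) (v k)) = 0" using inj by (simp add: sum.reindex)
    then show False using v0[of "\<lambda>k. u (v k)"] u by auto
  qed
  moreover have "v s \<in> tens.span (z ` T)" if "s \<in> S" for s
  proof (rule T(3)[OF _ _ detect])
    show mem: "v s \<in> ?V" unfolding v_def by (rule from_co_mem)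
    fix g assume g: "g \<in> carrier G"
    have "fixed_vec n (\<rho> g) (tco (v s))"
      using S(2)[OF \<open>s \<in> S\<close> g] unfolding fixed_vec_def v_def by (simp add: tco_from_co)
    then show "tensor_act \<rho> g (v s) = v s"
      using fixed_vec_tco[where \<rho> = \<rho> and g = g, OF \<rho>[OF g] mem] by simp
  qed
  then have "v ` S \<subseteq> tens.span (z ` T)" by blast
  ultimately have "card (v ` S) \<le> card (z ` T)"
    using tens.independent_span_bound[of "z ` T" "v ` S"] T(1) by auto
  also have "card (v ` S) = card S" using inj by (rule card_image)
  also have "card (z ` T) \<le> card T" using T(1) by (rule card_image_le)
  finally show ?thesis unfolding T(2) .
qed

end

section \<open>Determinants and triangular bases\<close>

context based_space
begin

lemma dim_UNIV: "dim UNIV = length bs"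
  using dim_eq_card[of "set bs" UNIV] span_bs independent_bs distinct_bs by (simp add: distinct_card)

lemma mco_comp:
  assumes "Vector_Spaces.linear scale scale f"
  shows "mco (f \<circ> g) i j = (\<Sum>k<length bs. mco f i k * mco g k j)"
  unfolding mco_def comp_def
  using functional_expand[OF Vector_Spaces.linear_compose[OF assms linear_co[of i]], of "g (bs ! j)"]
  by (simp add: mult.commute comp_def)

lemma mco_id: "i < length bs \<Longrightarrow> j < length bs \<Longrightarrow> mco id i j = (if i = j then 1 else 0)"
  unfolding mco_def by (simp add: co_bs)

lemma endo_matrix_mco: "endo_matrix scale bs f = mat (length bs) (length bs) (\<lambda>(i, j). mco f i j)"
  unfolding endo_matrix_def mco_def co_def ..

lemma endo_matrix_carrier [simp]: "endo_matrix scale bs f \<in> carrier_mat (length bs) (length bs)"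
  unfolding endo_matrix_mco by simp

lemma endo_matrix_comp:
  assumes "Vector_Spaces.linear scale scale f"
  shows "endo_matrix scale bs (f \<circ> g) = endo_matrix scale bs f * endo_matrix scale bs g"
  unfolding endo_matrix_mco
  by (rule eq_matI) (auto simp: mco_comp[OF assms] scalar_prod_def atLeast0LessThan)

lemma endo_matrix_id: "endo_matrix scale bs id = 1\<^sub>m (length bs)"
  unfolding endo_matrix_mco by (rule eq_matI) (auto simp: mco_id)

text \<open>A change of basis conjugates the matrix.\<close>

lemma det_endo_matrix_basis_indep:
  assumes bs': "basis_list scale bs'" and f: "Vector_Spaces.linear scale scale f"
  shows "det (endo_matrix scale bs' f) = det (endo_matrix scale bs f)"
proof -
  interpret B': based_space scale bs' by unfold_locales (rule bs')
  have len: "length bs' = length bs" using dim_UNIV B'.dim_UNIV by simp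
  define n where "n = length bs"
  define P where "P = mat n n (\<lambda>(i, j). co i (bs' ! j))"
  define Q where "Q = mat n n (\<lambda>(i, j). B'.co i (bs ! j))"
  have P: "P \<in> carrier_mat n n" and Q: "Q \<in> carrier_mat n n" by (auto simp: P_def Q_def)
  have A: "endo_matrix scale bs f \<in> carrier_mat n n" and A': "endo_matrix scale bs' f \<in> carrier_mat n n"
    using endo_matrix_carrier[of f] B'.endo_matrix_carrier[of f] by (simp_all add: n_def len)
  have "co i (bs ! j) = (\<Sum>k<n. B'.co k (bs ! j) * co i (bs' ! k))" for i j
    using B'.functional_expand[OF linear_co[of i], of "bs ! j"] by (simp add: n_def len)
  \<comment> \<open>This single product already makes \<open>det P\<close> nonzero, and that is
    enough to cancel it from the conjugation identity below.\<close>
  then have "P * Q = 1\<^sub>m n"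
    by (intro eq_matI) (auto simp: P_def Q_def scalar_prod_def atLeast0LessThan mult.commute co_bs[symmetric] n_def)
  then have "det P * det Q = 1" using det_mult[OF P Q] by simp
  then have dP: "det P \<noteq> 0" by auto
  have lin: "Vector_Spaces.linear scale (*) (co i \<circ> f)" for i
    by (rule Vector_Spaces.linear_compose[OF f linear_co])
  have a1: "co i (f v) = (\<Sum>k<n. co k v * co i (f (bs ! k)))" for i v
    using functional_expand[OF lin[of i], of v] by (simp add: n_def)
  have a2: "co i (f v) = (\<Sum>k<n. B'.co k (f v) * co i (bs' ! k))" for i v
    using B'.functional_expand[OF linear_co[of i], of "f v"] by (simp add: n_def len)
  have "(\<Sum>k<n. co i (f (bs ! k)) * co k v) = (\<Sum>k<n. co i (bs' ! k) * B'.co k (f v))" for i v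
    using trans[OF a1[symmetric] a2] unfolding mult.commute[of "co i (f (bs ! _))"] mult.commute[of "co i (bs' ! _)"] .
  then have "endo_matrix scale bs f * P = P * endo_matrix scale bs' f"
    unfolding endo_matrix_mco B'.endo_matrix_mco P_def n_def[symmetric] len
    by (intro eq_matI) (auto simp: scalar_prod_def atLeast0LessThan mco_def B'.mco_def)
  then have "det (endo_matrix scale bs f) * det P = det P * det (endo_matrix scale bs' f)"
    using det_mult[OF A P] det_mult[OF P A'] arg_cong[of _ _ det] by metis
  then show ?thesis using dP by (simp add: mult.commute)
qed

lemma lin_det_eq:
  assumes "Vector_Spaces.linear scale scale f"
  shows "lin_det scale f = det (endo_matrix scale bs f)"
  unfolding lin_det_def using someI[of "basis_list scale", OF basis]
  by (intro det_endo_matrix_basis_indep assms)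

lemma lin_det_comp:
  assumes "Vector_Spaces.linear scale scale f" "Vector_Spaces.linear scale scale g"
  shows "lin_det scale (f \<circ> g) = lin_det scale f * lin_det scale g"
  unfolding lin_det_eq[OF assms(1)] lin_det_eq[OF assms(2)] lin_det_eq[OF Vector_Spaces.linear_compose[OF assms(2,1)]]
    endo_matrix_comp[OF assms(1)]
  by (rule det_mult[OF endo_matrix_carrier endo_matrix_carrier])

lemma linear_id': "Vector_Spaces.linear scale scale id"
  using vector_space_axioms by (auto simp: Vector_Spaces.linear_def module_hom_def module_hom_axioms_def module_iff_vector_space)

lemma lin_det_id: "lin_det scale id = 1"
  unfolding lin_det_eq[OF linear_id'] endo_matrix_id by simp

lemma linear_funpow: "Vector_Spaces.linear scale scale f \<Longrightarrow> Vector_Spaces.linear scale scale (f ^^ n)"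
proof (induction n)
  case 0
  then show ?case using linear_id' by (simp add: id_def)
next
  case (Suc n)
  then show ?case unfolding funpow.simps by (intro Vector_Spaces.linear_compose)
qed

lemma lin_det_funpow:
  assumes "Vector_Spaces.linear scale scale f"
  shows "lin_det scale (f ^^ n) = lin_det scale f ^ n"
proof (induction n)
  case 0
  then show ?case using lin_det_id by (simp add: id_def)
next
  case (Suc n)
  then show ?case unfolding funpow.simps lin_det_comp[OF assms linear_funpow[OF assms]] by simp
qed

section \<open>Polynomials in an endomorphism and triangular bases\<close>

definition pact :: "('v \<Rightarrow> 'v) \<Rightarrow> 'k poly \<Rightarrow> 'v \<Rightarrow> 'v" where
  "pact f p v = (\<Sum>i\<le>degree p. scale (coeff p i) ((f ^^ i) v))"

lemma pact_bound: "degree p \<le> n \<Longrightarrow> pact f p v = (\<Sum>i\<le>n. scale (coeff p i) ((f ^^ i) v))"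
  unfolding pact_def by (rule sum.mono_neutral_left) (auto simp: coeff_eq_0)

lemma pact_mult_linear:
  assumes f: "Vector_Spaces.linear scale scale f"
  shows "pact f (q * [:- a, 1:]) v = f (pact f q v) - scale a (pact f q v)"
proof -
  interpret f: Vector_Spaces.linear scale scale f by (rule f)
  define n where "n = degree q"
  have "degree (q * [:- a, 1:]) \<le> Suc n"
    using degree_mult_le[of q "[:- a, 1:]"] by (simp add: n_def)
  then have "pact f (q * [:- a, 1:]) v = (\<Sum>i\<le>Suc n. scale (coeff (q * [:- a, 1:]) i) ((f ^^ i) v))"
    by (rule pact_bound)
  also have "\<dots> = (\<Sum>i\<le>Suc n. scale (coeff (pCons 0 q) i) ((f ^^ i) v)) - (\<Sum>i\<le>Suc n. scale (a * coeff q i) ((f ^^ i) v))"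
    unfolding sum_subtractf[symmetric] by (intro sum.cong refl) (simp add: mult_pCons_right scale_left_diff_distrib)
  also have "(\<Sum>i\<le>Suc n. scale (coeff (pCons 0 q) i) ((f ^^ i) v)) = f (\<Sum>i\<le>n. scale (coeff q i) ((f ^^ i) v))"
    unfolding sum.atMost_Suc_shift by (simp add: f.sum f.scale)
  also have "(\<Sum>i\<le>Suc n. scale (a * coeff q i) ((f ^^ i) v)) = scale a (\<Sum>i\<le>n. scale (coeff q i) ((f ^^ i) v))"
    by (simp add: scale_sum_right n_def coeff_eq_0)
  finally show ?thesis by (simp add: pact_def n_def)
qed

text \<open>One more iterate of \<open>v\<close> than there are coordinates must be linearly
  dependent; the dependence is the polynomial.\<close>

lemma annihilating_poly: "\<exists>p. p \<noteq> 0 \<and> pact f p v = 0"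
proof -
  let ?d = "length bs"
  define Z where "Z k i = co i ((f ^^ k) v)" for k i
  have "\<not> (\<forall>c k. (\<forall>i\<in>{..<?d}. (\<Sum>k<Suc ?d. c k * Z k i) = 0) \<longrightarrow> k < Suc ?d \<longrightarrow> c k = 0)"
    using indep_bound[where S = "{..<?d}" and N = "Suc ?d" and Z = Z] by (auto simp del: sum.lessThan_Suc)
  then obtain c k where c: "\<And>i. i < ?d \<Longrightarrow> (\<Sum>k<Suc ?d. c k * Z k i) = 0" "k < Suc ?d" "c k \<noteq> 0" by blast
  define p where "p = (\<Sum>k<Suc ?d. monom (c k) k)"
  have cp: "coeff p i = (if i < Suc ?d then c i else 0)" for i by (simp add: p_def coeff_sum)
  have "p \<noteq> 0" using c(2,3) cp[of k] by auto
  moreover have "degree p \<le> ?d" by (rule degree_le) (simp add: cp)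
  then have pv: "pact f p v = (\<Sum>k<Suc ?d. scale (c k) ((f ^^ k) v))"
    unfolding pact_bound[OF \<open>degree p \<le> ?d\<close>] by (intro sum.cong) (auto simp: cp)
  have "co i (pact f p v) = 0" if "i < ?d" for i
  proof -
    interpret c: Vector_Spaces.linear scale "(*)" "co i" by (rule linear_co)
    show ?thesis unfolding pv c.sum c.scale using c(1)[OF that] unfolding Z_def .
  qed
  then have "pact f p v = 0" by (subst co_expand) simp
  ultimately show ?thesis by blast
qed

end

text \<open>Take a nonzero polynomial of least degree that carries some \<open>x\<close> outside
  \<open>U\<close> into \<open>U\<close>, and strip off a factor belonging to a root
  \<open>a\<close>. The remaining quotient leaves \<open>x\<close> outside \<open>U\<close>, and
  \<open>f - a\<close> carries the result into \<open>U\<close>: an eigenvector modulo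
  \<open>U\<close>.\<close>

lemma (in based_space) triangular_extend:
  fixes f :: "'v \<Rightarrow> 'v"
  assumes ac: "\<And>p :: 'k poly. degree p > 0 \<Longrightarrow> \<exists>x. poly p x = 0"
    and f: "Vector_Spaces.linear scale scale f" and U: "subspace U" "U \<noteq> UNIV"
  shows "\<exists>v a. v \<notin> U \<and> f v - scale a v \<in> U"
proof -
  obtain x where x: "x \<notin> U" using U(2) by auto
  have "\<exists>p. p \<noteq> 0 \<and> pact f p x \<in> U" using annihilating_poly[of f x] subspace_0[OF U(1)] by metis
  then obtain p where p: "p \<noteq> 0" "pact f p x \<in> U" and min: "\<And>q. q \<noteq> 0 \<Longrightarrow> pact f q x \<in> U \<Longrightarrow> degree p \<le> degree q"
    using ex_has_least_nat[of "\<lambda>p. p \<noteq> 0 \<and> pact f p x \<in> U" _ degree] by metis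
  have "degree p > 0"
  proof (rule ccontr)
    assume "\<not> degree p > 0"
    then obtain c where c: "p = [:c:]" by (metis degree_eq_zeroE neq0_conv)
    then have "c \<noteq> 0" "scale c x \<in> U" using p by (auto simp: pact_def)
    then have "scale (inverse c) (scale c x) \<in> U" using subspace_scale[OF U(1)] by blast
    then show False using x \<open>c \<noteq> 0\<close> by simp
  qed
  then obtain a where "poly p a = 0" using ac by blast
  then obtain q where q: "p = q * [:- a, 1:]" by (metis poly_eq_0_iff_dvd dvdE mult.commute)
  then have "q \<noteq> 0" using p(1) by auto
  then have "degree q < degree p" unfolding q by (subst degree_mult_eq) auto
  then have "pact f q x \<notin> U" using min[OF \<open>q \<noteq> 0\<close>] by auto
  then show ?thesis using p(2) unfolding q pact_mult_linear[OF f] by blast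
qed

lemma (in based_space) triangular_basis:
  fixes f :: "'v \<Rightarrow> 'v"
  assumes ac: "\<And>p :: 'k poly. degree p > 0 \<Longrightarrow> \<exists>x. poly p x = 0"
    and f: "Vector_Spaces.linear scale scale f"
  shows "\<exists>bs'. basis_list scale bs' \<and> (\<forall>j<length bs'. f (bs' ! j) \<in> span (set (take (Suc j) bs')))"
proof -
  have "\<exists>cs. length cs = k \<and> distinct cs \<and> independent (set cs) \<and> (\<forall>j<k. f (cs ! j) \<in> span (set (take (Suc j) cs)))"
    if "k \<le> length bs" for k
    using that
  proof (induction k)
    case (Suc k)
    then obtain cs where cs: "length cs = k" "distinct cs" "independent (set cs)"
      "\<And>j. j < k \<Longrightarrow> f (cs ! j) \<in> span (set (take (Suc j) cs))" by auto
    have nU: "span (set cs) \<noteq> UNIV"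
    proof
      assume "span (set cs) = UNIV"
      then have "dim UNIV = card (set cs)" using cs(3) dim_eq_card[of "set cs" UNIV] by simp
      then show False using Suc.prems cs(1,2) dim_UNIV by (simp add: distinct_card)
    qed
    then obtain v a where v: "v \<notin> span (set cs)" "f v - scale a v \<in> span (set cs)"
      using triangular_extend[OF ac f subspace_span nU] by blast
    have "v \<notin> set cs" using v(1) span_base by blast
    then have ind: "independent (insert v (set cs))" using v(1) cs(3) by (simp add: independent_insert)
    have fv: "f v \<in> span (set (cs @ [v]))"
    proof -
      have "f v - scale a v \<in> span (set (cs @ [v]))" using v(2) span_mono[of "set cs" "set (cs @ [v])"] by auto
      moreover have "scale a v \<in> span (set (cs @ [v]))" by (intro span_scale span_base) simp
      ultimately have "(f v - scale a v) + scale a v \<in> span (set (cs @ [v]))" by (rule span_add)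
      then show ?thesis by simp
    qed
    have tr: "f ((cs @ [v]) ! j) \<in> span (set (take (Suc j) (cs @ [v])))" if j: "j < Suc k" for j
    proof (cases "j = k")
      case True
      then show ?thesis using fv cs(1) by (simp add: nth_append)
    next
      case False
      then have "j < k" using j by simp
      from cs(4)[OF this] show ?thesis using cs(1) \<open>j < k\<close> by (simp add: nth_append)
    qed
    show ?case
    proof (intro exI[of _ "cs @ [v]"] conjI allI impI)
      show "length (cs @ [v]) = Suc k" "distinct (cs @ [v])" "independent (set (cs @ [v]))"
        using cs(1,2) ind \<open>v \<notin> set cs\<close> by simp_all
    qed (rule tr)
  qed (simp add: independent_empty)
  then obtain cs where cs: "length cs = length bs" "distinct cs" "independent (set cs)"
      "\<And>j. j < length bs \<Longrightarrow> f (cs ! j) \<in> span (set (take (Suc j) cs))" by blast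
  have "span (set cs) = UNIV"
  proof (rule ccontr)
    assume "span (set cs) \<noteq> UNIV"
    then obtain v where v: "v \<notin> span (set cs)" by auto
    then have "independent (insert v (set cs))" "v \<notin> set cs" using cs(3) span_superset by (auto simp: independent_insert)
    then have "card (insert v (set cs)) \<le> card (set bs)"
      using independent_span_bound[of "set bs" "insert v (set cs)"] span_bs by auto
    then show False using \<open>v \<notin> set cs\<close> cs(1,2) distinct_bs by (simp add: distinct_card)
  qed
  then show ?thesis using cs unfolding basis_list_def by (intro exI[of _ cs]) auto
qed

section \<open>Trivial summands against words with eigenvalue one\<close>

context based_space
begin

lemma co_span_take:
  assumes "v \<in> span (set (take k bs))" "k \<le> i" "i < length bs"
  shows "co i v = 0"
  using assms(1)
proof (rule span_induct)
  have "co i 0 = 0" by (simp add: co_def representation_zero)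
  then show "subspace {v. co i v = 0}" by (intro subspaceI) (auto simp: co_add co_scale)
  fix b assume "b \<in> set (take k bs)"
  then obtain j where "j < k" "j < length bs" "b = bs ! j" by (auto simp: in_set_conv_nth)
  then show "co i b = 0" using co_bs[OF assms(3), of j] assms(2) by auto
qed

text \<open>A nonzero entry needs \<open>x ! j \<le> y ! j\<close> at every position, so off the
  diagonal the letter sum strictly increases.\<close>

lemma kron_triangular:
  assumes A: "\<And>i j. j < i \<Longrightarrow> i < d \<Longrightarrow> A i j = 0" and x: "x \<in> words d n" and y: "y \<in> words d n"
    and nz: "kron A x y \<noteq> 0" and "sum_list y \<le> sum_list x"
  shows "y = x"
proof -
  have le: "x ! j \<le> y ! j" if "j < n" for j
  proof (rule ccontr)
    assume "\<not> x ! j \<le> y ! j"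
    then have "A (x ! j) (y ! j) = 0" using A words_nth[OF x that] by simp
    then have "kron A x y = 0" unfolding kron_def using that words_length[OF x] by (intro prod_zero) auto
    then show False using nz by simp
  qed
  have s: "sum_list x = (\<Sum>j<n. x ! j)" "sum_list y = (\<Sum>j<n. y ! j)"
    using words_length x y by (auto simp: sum_list_sum_nth atLeast0LessThan)
  have "x ! j = y ! j" if "j < n" for j
  proof (rule ccontr)
    assume "x ! j \<noteq> y ! j"
    then have "x ! j < y ! j" using le[OF that] by simp
    then have "(\<Sum>j<n. x ! j) < (\<Sum>j<n. y ! j)" using le that by (intro sum_strict_mono_ex1) auto
    then show False using assms(5) s by simp
  qed
  then show ?thesis using words_length x y by (intro nth_equalityI) auto
qed

text \<open>A fixed vector that vanishes on all words with eigenvalue product one is zero: at a word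
  of largest letter sum in its support only the diagonal term of the fixed point equation survives,
  so the diagonal entry there is one.\<close>

lemma TS_triangular_bound:
  assumes \<rho>: "\<And>g. g \<in> carrier G \<Longrightarrow> \<rho> g \<in> carrier (GL scale)" and g: "g \<in> carrier G"
    and tri: "\<And>j. j < length bs \<Longrightarrow> \<rho> g (bs ! j) \<in> span (set (take (Suc j) bs))"
  shows "TS G fun_scale (tensor_act \<rho>) (tensor_power scale n) \<le>
    card {x \<in> W n. (\<Prod>j<n. mco (\<rho> g) (x ! j) (x ! j)) = 1}" (is "?N \<le> card ?S")
proof -
  obtain Z F where ZF: "\<And>k. k < ?N \<Longrightarrow> fixed_vec n (\<rho> g) (Z k)"
    "\<And>k l. k < ?N \<Longrightarrow> l < ?N \<Longrightarrow> (\<Sum>x\<in>W n. F k x * Z l x) = (if k = l then 1 else 0)"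
  proof (rule TS_upper[where \<rho> = \<rho> and G = G and n = n, OF \<rho>], assumption)
    fix Z F assume "\<And>k g. k < ?N \<Longrightarrow> g \<in> carrier G \<Longrightarrow> fixed_vec n (\<rho> g) (Z k)"
      and "\<And>k l. k < ?N \<Longrightarrow> l < ?N \<Longrightarrow> (\<Sum>x\<in>W n. F k x * Z l x) = (if k = l then 1 else 0)"
    then show thesis using g by (intro that)
  qed
  define A where "A = mco (\<rho> g)"
  have A: "A i j = 0" if "j < i" "i < length bs" for i j
    unfolding A_def mco_def by (rule co_span_take[OF tri]) (use that in auto)
  show ?thesis
  proof (rule biorthogonal_bound[where X = "W n" and Z = Z and F = F, OF _ _ ZF(2)])
    show "finite ?S" "finite (W n)" by auto
    fix c k assume 0: "\<And>x. x \<in> ?S \<Longrightarrow> (\<Sum>l<?N. c l * Z l x) = 0"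
    define z where "z x = (\<Sum>l<?N. c l * Z l x)" for x
    have fx: "(\<Sum>y\<in>W n. kron A x y * z y) = z x" if "x \<in> W n" for x
    proof -
      have "(\<Sum>y\<in>W n. kron A x y * z y) = (\<Sum>l<?N. c l * (\<Sum>y\<in>W n. kron A x y * Z l y))"
        unfolding z_def sum_distrib_left by (subst sum.swap) (simp add: mult_ac)
      also have "\<dots> = z x" unfolding z_def using ZF(1) that by (intro sum.cong refl) (simp add: fixed_vec_def A_def)
      finally show ?thesis .
    qed
    have z0: "z x = 0" if "x \<in> W n" for x
    proof (rule ccontr)
      assume "z x \<noteq> 0"
      \<comment> \<open>The support of \<open>z\<close>; the contradiction comes from a word in it
        with the largest letter sum.\<close>
      define M where "M = {x \<in> W n. z x \<noteq> 0}"
      have "finite M" "M \<noteq> {}" using that \<open>z x \<noteq> 0\<close> by (auto simp: M_def)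
      then have "Max (sum_list ` M) \<in> sum_list ` M" by (intro Max_in) auto
      then obtain y where y: "y \<in> M" "sum_list y = Max (sum_list ` M)" by auto
      have ymax: "sum_list y' \<le> sum_list y" if "y' \<in> M" for y'
        unfolding y(2) using that \<open>finite M\<close> by (intro Max_ge) auto
      have "(\<Sum>y'\<in>W n. kron A y y' * z y') = (\<Sum>y'\<in>{y}. kron A y y' * z y')"
      proof (intro sum.mono_neutral_right ballI)
        fix y' assume y': "y' \<in> W n - {y}"
        show "kron A y y' * z y' = 0"
        proof (rule ccontr)
          assume "kron A y y' * z y' \<noteq> 0"
          then have "kron A y y' \<noteq> 0" "y' \<in> M" using y' by (auto simp: M_def)
          then show False using kron_triangular[of "length bs" A y n y', OF A] ymax y(1) y' by (simp add: M_def)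
        qed
      qed (use y M_def in auto)
      then have "kron A y y * z y = z y" using fx[of y] y(1) by (simp add: M_def)
      then have "kron A y y = 1" using y(1) by (simp add: M_def)
      then have "y \<in> ?S" using y(1) words_length[of y "length bs" n] by (simp add: M_def kron_def A_def)
      then show False using 0 y(1) by (simp add: M_def z_def)
    qed
    show "(\<Sum>x\<in>W n. F k x * (\<Sum>l<?N. c l * Z l x)) = 0"
      using z0 unfolding z_def by simp
  qed
qed

lemma lin_det_triangular:
  assumes "Vector_Spaces.linear scale scale f" "\<And>j. j < length bs \<Longrightarrow> f (bs ! j) \<in> span (set (take (Suc j) bs))"
  shows "lin_det scale f = (\<Prod>i<length bs. mco f i i)"
proof -
  have "det (endo_matrix scale bs f) = prod_list (diag_mat (endo_matrix scale bs f))"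
  proof (rule det_upper_triangular[OF _ endo_matrix_carrier])
    show "upper_triangular (endo_matrix scale bs f)"
    proof (rule upper_triangularI)
      fix i j assume "j < i" "i < dim_row (endo_matrix scale bs f)"
      then show "endo_matrix scale bs f $$ (i, j) = 0"
        unfolding endo_matrix_mco mco_def using co_span_take[OF assms(2), of j i] by simp
    qed
  qed
  also have "\<dots> = (\<Prod>i<length bs. mco f i i)"
    unfolding prod_list_diag_prod endo_matrix_mco by (simp add: atLeast0LessThan)
  finally show ?thesis using lin_det_eq[OF assms(1)] by simp
qed

end

section \<open>Extension of ring homomorphisms\<close>

text \<open>Subrings are sets inside one type, so that repeated adjunctions never change the
  type.\<close>

definition is_subring :: "'b::comm_ring_1 set \<Rightarrow> bool" where
  "is_subring A \<longleftrightarrow> 0 \<in> A \<and> 1 \<in> A \<and> (\<forall>x\<in>A. \<forall>y\<in>A. x + y \<in> A \<and> x - y \<in> A \<and> x * y \<in> A)"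

text \<open>A total function of which only the values on \<open>A\<close> are constrained; nothing
  is assumed about it outside.\<close>

definition hom_on :: "'b::comm_ring_1 set \<Rightarrow> ('b \<Rightarrow> 'c::comm_ring_1) \<Rightarrow> bool" where
  "hom_on A \<phi> \<longleftrightarrow> \<phi> 1 = 1 \<and> (\<forall>x\<in>A. \<forall>y\<in>A. \<phi> (x + y) = \<phi> x + \<phi> y \<and> \<phi> (x * y) = \<phi> x * \<phi> y)"

lemma is_subringD:
  assumes "is_subring A"
  shows "0 \<in> A" "1 \<in> A" "x \<in> A \<Longrightarrow> y \<in> A \<Longrightarrow> x + y \<in> A" "x \<in> A \<Longrightarrow> y \<in> A \<Longrightarrow> x - y \<in> A"
    "x \<in> A \<Longrightarrow> y \<in> A \<Longrightarrow> x * y \<in> A"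
  using assms by (auto simp: is_subring_def)

lemma is_subring_uminus: "is_subring A \<Longrightarrow> x \<in> A \<Longrightarrow> - x \<in> A"
  using is_subringD(1)[of A] is_subringD(4)[of A 0 x] by simp

lemma is_subring_power: "is_subring A \<Longrightarrow> x \<in> A \<Longrightarrow> x ^ n \<in> A"
  by (induction n) (auto simp: is_subringD)

lemma is_subring_sum: "is_subring A \<Longrightarrow> (\<And>i. i \<in> I \<Longrightarrow> f i \<in> A) \<Longrightarrow> sum f I \<in> A"
  by (induction I rule: infinite_finite_induct) (auto simp: is_subringD)

lemma is_subring_prod: "is_subring A \<Longrightarrow> (\<And>i. i \<in> I \<Longrightarrow> f i \<in> A) \<Longrightarrow> prod f I \<in> A"
  by (induction I rule: infinite_finite_induct) (auto simp: is_subringD)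

lemma hom_onD:
  assumes "hom_on A \<phi>"
  shows "\<phi> 1 = 1" "x \<in> A \<Longrightarrow> y \<in> A \<Longrightarrow> \<phi> (x + y) = \<phi> x + \<phi> y"
    "x \<in> A \<Longrightarrow> y \<in> A \<Longrightarrow> \<phi> (x * y) = \<phi> x * \<phi> y"
  using assms by (auto simp: hom_on_def)

lemma hom_on_0: "is_subring A \<Longrightarrow> hom_on A \<phi> \<Longrightarrow> \<phi> 0 = 0"
  using hom_onD(2)[of A \<phi> 0 0] is_subringD(1)[of A] by simp

lemma hom_on_uminus: "is_subring A \<Longrightarrow> hom_on A \<phi> \<Longrightarrow> x \<in> A \<Longrightarrow> \<phi> (- x) = - \<phi> x"
  using hom_onD(2)[of A \<phi> x "- x"] is_subring_uminus[of A x] hom_on_0[of A \<phi>]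
  by (simp add: eq_neg_iff_add_eq_0 add.commute)

lemma hom_on_diff:
  "is_subring A \<Longrightarrow> hom_on A \<phi> \<Longrightarrow> x \<in> A \<Longrightarrow> y \<in> A \<Longrightarrow> \<phi> (x - y) = \<phi> x - \<phi> y"
  using hom_onD(2)[of A \<phi> x "- y"] is_subring_uminus[of A y] hom_on_uminus[of A \<phi> y] by simp

lemma hom_on_power: "is_subring A \<Longrightarrow> hom_on A \<phi> \<Longrightarrow> x \<in> A \<Longrightarrow> \<phi> (x ^ n) = \<phi> x ^ n"
  by (induction n) (auto simp: hom_onD is_subring_power)

lemma hom_on_sum:
  "is_subring A \<Longrightarrow> hom_on A \<phi> \<Longrightarrow> (\<And>i. i \<in> I \<Longrightarrow> f i \<in> A) \<Longrightarrow> \<phi> (sum f I) = (\<Sum>i\<in>I. \<phi> (f i))"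
  by (induction I rule: infinite_finite_induct) (auto simp: hom_on_0 hom_onD(2) is_subring_sum)

lemma hom_on_prod:
  "is_subring A \<Longrightarrow> hom_on A \<phi> \<Longrightarrow> (\<And>i. i \<in> I \<Longrightarrow> f i \<in> A) \<Longrightarrow> \<phi> (prod f I) = (\<Prod>i\<in>I. \<phi> (f i))"
  by (induction I rule: infinite_finite_induct) (auto simp: hom_onD is_subring_prod)

section \<open>Polynomials with coefficients in a subring\<close>

definition polys_over :: "'b::comm_ring_1 set \<Rightarrow> 'b poly set" where
  "polys_over A = {p. \<forall>i. coeff p i \<in> A}"

lemma is_subring_polys_over:
  assumes "is_subring A"
  shows "is_subring (polys_over A)"
  unfolding is_subring_def[of "polys_over A"]
  by (auto simp: polys_over_def is_subringD[OF assms] coeff_mult coeff_1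
      intro!: is_subring_sum[OF assms])

lemma polys_over_smult: "is_subring A \<Longrightarrow> c \<in> A \<Longrightarrow> p \<in> polys_over A \<Longrightarrow> smult c p \<in> polys_over A"
  by (auto simp: polys_over_def is_subringD)

lemma polys_over_pCons: "is_subring A \<Longrightarrow> c \<in> A \<Longrightarrow> p \<in> polys_over A \<Longrightarrow> pCons c p \<in> polys_over A"
  by (auto simp: polys_over_def coeff_pCons split: nat.split)

lemma map_poly_const: "f 0 = 0 \<Longrightarrow> map_poly f [:a:] = [:f a:]"
  by (intro poly_eqI) (auto simp: coeff_map_poly coeff_pCons split: nat.split)

lemma hom_on_map_poly:
  assumes A: "is_subring A" and \<phi>: "hom_on A \<phi>"
  shows "hom_on (polys_over A) (map_poly \<phi>)"
  unfolding hom_on_def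
proof (intro conjI ballI)
  have [simp]: "\<phi> 0 = 0" "\<phi> 1 = 1" using hom_on_0[OF A \<phi>] hom_onD[OF \<phi>] by auto
  show "map_poly \<phi> 1 = 1" by simp
  fix p q assume pq: "p \<in> polys_over A" "q \<in> polys_over A"
  then show "map_poly \<phi> (p + q) = map_poly \<phi> p + map_poly \<phi> q"
    using hom_onD[OF \<phi>] by (intro poly_eqI) (simp add: coeff_map_poly polys_over_def)
  show "map_poly \<phi> (p * q) = map_poly \<phi> p * map_poly \<phi> q"
    using pq hom_onD[OF \<phi>]
    by (intro poly_eqI)
      (simp add: coeff_map_poly polys_over_def coeff_mult hom_on_sum[OF A \<phi>] is_subringD[OF A])
qed

text \<open>The leading coefficient of \<open>g\<close> need not be invertible, which is why powers of it appear.\<close>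

lemma pseudo_division_over:
  assumes A: "is_subring A" and g: "g \<in> polys_over A" and m: "degree g > 0"
    and f: "f \<in> polys_over A"
  shows "\<exists>N q r. q \<in> polys_over A \<and> r \<in> polys_over A \<and> degree r < degree g \<and>
           smult (lead_coeff g ^ N) f = q * g + r"
  using f
proof (induction "degree f" arbitrary: f rule: less_induct)
  case less
  note PA = is_subringD[OF is_subring_polys_over[OF A]]
  show ?case
  proof (cases "degree f < degree g")
    case True
    then show ?thesis using less.prems PA(1) by (intro exI[of _ 0] exI[of _ f]) auto
  next
    case False
    define c where "c = lead_coeff g"
    define h where "h = monom (lead_coeff f) (degree f - degree g)"
    define f' where "f' = smult c f - h * g"
    have c: "c \<in> A" and h: "h \<in> polys_over A"
      using g less.prems by (auto simp: c_def polys_over_def h_def is_subringD[OF A])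
    then have f'A: "f' \<in> polys_over A"
      unfolding f'_def using less.prems g by (intro PA polys_over_smult[OF A])
    have "degree (h * g) \<le> degree f"
      using degree_mult_le[of h g] degree_monom_le[of "lead_coeff f" "degree f - degree g"] False
      unfolding h_def[symmetric] by linarith
    then have "degree f' \<le> degree f"
      unfolding f'_def by (intro degree_diff_le) (auto intro: order.trans[OF degree_smult_le])
    moreover have "coeff f' (degree f) = 0"
      using False by (simp add: f'_def h_def coeff_monom_mult c_def)
    ultimately have "degree f' < degree f"
      using False m by (metis leading_coeff_0_iff le_neq_implies_less degree_0 not_less)
    from less.hyps[OF this f'A] obtain N q r where
      IH: "q \<in> polys_over A" "r \<in> polys_over A" "degree r < degree g" "smult (c ^ N) f' = q * g + r"
      unfolding c_def by blast
    have "smult (c ^ Suc N) f = smult (c ^ N) f' + smult (c ^ N) h * g"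
      unfolding f'_def by (simp add: algebra_simps smult_diff_right)
    also have "\<dots> = (q + smult (c ^ N) h) * g + r" unfolding IH by (simp add: algebra_simps)
    finally have "smult (c ^ Suc N) f = (q + smult (c ^ N) h) * g + r" .
    moreover have "q + smult (c ^ N) h \<in> polys_over A"
      by (intro PA(3) IH polys_over_smult[OF A] is_subring_power[OF A] c h)
    ultimately show ?thesis using IH unfolding c_def by blast
  qed
qed

section \<open>Adjoining one element\<close>

definition adjoin :: "'b::comm_ring_1 set \<Rightarrow> 'b \<Rightarrow> 'b set" where
  "adjoin A x = (\<lambda>p. poly p x) ` polys_over A"

lemma is_subring_adjoin:
  assumes "is_subring A"
  shows "is_subring (adjoin A x)"
proof -
  note PA = is_subringD[OF is_subring_polys_over[OF assms]]
  have "poly 0 x \<in> adjoin A x" "poly 1 x \<in> adjoin A x"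
    unfolding adjoin_def using PA by blast+
  moreover have "poly p x + poly q x \<in> adjoin A x" "poly p x - poly q x \<in> adjoin A x"
      "poly p x * poly q x \<in> adjoin A x"
    if "p \<in> polys_over A" "q \<in> polys_over A" for p q
    unfolding poly_add[symmetric] poly_diff[symmetric] poly_mult[symmetric] adjoin_def
    using PA that by blast+
  ultimately show ?thesis unfolding is_subring_def by (auto simp: adjoin_def)
qed

lemma adjoin_superset: "is_subring A \<Longrightarrow> A \<subseteq> adjoin A x"
proof
  fix a assume "is_subring A" "a \<in> A"
  then have "[:a:] \<in> polys_over A" by (intro polys_over_pCons) (auto simp: is_subringD is_subring_polys_over)
  then show "a \<in> adjoin A x" unfolding adjoin_def by (force intro!: image_eqI[of _ _ "[:a:]"])
qed

lemma adjoin_self: "is_subring A \<Longrightarrow> x \<in> adjoin A x"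
  unfolding adjoin_def
  by (rule image_eqI[of _ _ "[:0, 1:]"]) (auto intro!: polys_over_pCons simp: is_subringD is_subring_polys_over)

text \<open>A prime ideal of the whole ring. The quotient domain is never formed; statements hold
  modulo \<open>P\<close> and homomorphisms are required to kill \<open>P\<close>.\<close>

locale prime_set =
  fixes P :: "'b::comm_ring_1 set"
  assumes zero_mem: "0 \<in> P" and add_mem: "x \<in> P \<Longrightarrow> y \<in> P \<Longrightarrow> x + y \<in> P"
    and absorb: "y \<in> P \<Longrightarrow> x * y \<in> P" and one_notin: "1 \<notin> P"
    and prime: "x * y \<in> P \<Longrightarrow> x \<in> P \<or> y \<in> P"
begin

lemma uminus_mem: "x \<in> P \<Longrightarrow> - x \<in> P"
  using absorb[of x "-1"] by simp

lemma diff_mem: "x \<in> P \<Longrightarrow> y \<in> P \<Longrightarrow> x - y \<in> P"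
  using add_mem[of x "- y"] uminus_mem[of y] by simp

lemma sum_mem: "(\<And>i. i \<in> I \<Longrightarrow> f i \<in> P) \<Longrightarrow> sum f I \<in> P"
  by (induction I rule: infinite_finite_induct) (auto simp: zero_mem add_mem)

lemma power_notin: "x \<notin> P \<Longrightarrow> x ^ n \<notin> P"
  by (induction n) (auto simp: one_notin dest: prime)

lemma mult_notin: "x \<notin> P \<Longrightarrow> y \<notin> P \<Longrightarrow> x * y \<notin> P"
  using prime by blast

text \<open>The condition that \<open>\<phi>\<close> extends a given homomorphism \<open>\<phi>\<^sub>0\<close> is what makes the
  homomorphisms constructed below algebra homomorphisms.\<close>

definition extends_to :: "('b \<Rightarrow> 'c::field) \<Rightarrow> 'b set \<Rightarrow> 'c set \<Rightarrow> 'b set \<Rightarrow> bool" where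
  "extends_to \<phi>\<^sub>0 A\<^sub>0 \<Omega> A \<longleftrightarrow> is_subring A \<and> A\<^sub>0 \<subseteq> A \<and> (\<forall>b\<in>A - P. \<exists>\<phi>. hom_on A \<phi> \<and> \<phi> ` A \<subseteq> \<Omega> \<and>
     (\<forall>a\<in>A\<^sub>0. \<phi> a = \<phi>\<^sub>0 a) \<and> (\<forall>a\<in>A \<inter> P. \<phi> a = 0) \<and> \<phi> b \<noteq> 0)"

text \<open>Everything is read modulo \<open>P\<close>. If \<open>x\<close> is transcendental over
  \<open>A\<close>, it can be sent to any non-root of the polynomial representing \<open>b\<close>.
  If it is algebraic, it is sent to a root of the specialised minimal polynomial, and an element of
  \<open>A\<close> that is a multiple of \<open>b\<close> guards \<open>b\<close> against vanishing.
  Denominators are avoided: they turn into elements outside \<open>P\<close> which the homomorphism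
  on \<open>A\<close> must not kill.\<close>

lemma extends_to_adjoin:
  fixes \<phi>\<^sub>0 :: "'b \<Rightarrow> 'c::field"
  assumes ext: "extends_to \<phi>\<^sub>0 A\<^sub>0 \<Omega> A" and \<Omega>: "is_subring \<Omega>" "infinite \<Omega>"
    and closed: "\<And>p. p \<in> polys_over \<Omega> \<Longrightarrow> degree p > 0 \<Longrightarrow> \<exists>\<xi>\<in>\<Omega>. poly p \<xi> = 0"
  shows "extends_to \<phi>\<^sub>0 A\<^sub>0 \<Omega> (adjoin A x)"
proof -
  have A: "is_subring A" and A0: "A\<^sub>0 \<subseteq> A" using ext by (auto simp: extends_to_def)
  have Ax: "is_subring (adjoin A x)" by (rule is_subring_adjoin[OF A])
  have PAsub: "is_subring (polys_over A)" by (rule is_subring_polys_over[OF A])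
  note PA = is_subringD[OF PAsub]
  \<comment> \<open>The relations satisfied by \<open>x\<close> modulo \<open>P\<close>;
    \<open>triv\<close> below describes those that hold because all coefficients are zero modulo
    \<open>P\<close>.\<close>
  define I where "I = {p \<in> polys_over A. poly p x \<in> P}"
  define triv where "triv p \<longleftrightarrow> (\<forall>i. coeff p i \<in> P)" for p
  have triv_poly: "poly p x \<in> P" if "triv p" for p
    using that unfolding triv_def poly_altdef by (intro sum_mem) (metis absorb mult.commute)
  \<comment> \<open>Any \<open>\<xi>\<close> that satisfies the images of all relations in
    \<open>I\<close> makes the assignment of \<open>poly (map_poly \<phi> p) \<xi>\<close> to
    \<open>poly p x\<close> well defined.\<close>
  have specialise: "\<exists>\<Phi>. hom_on (adjoin A x) \<Phi> \<and> \<Phi> ` (adjoin A x) \<subseteq> \<Omega> \<and>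
      (\<forall>a\<in>A\<^sub>0. \<Phi> a = \<phi>\<^sub>0 a) \<and> (\<forall>a\<in>adjoin A x \<inter> P. \<Phi> a = 0) \<and> \<Phi> b \<noteq> 0"
    if \<phi>: "hom_on A \<phi>" "\<phi> ` A \<subseteq> \<Omega>" "\<forall>a\<in>A\<^sub>0. \<phi> a = \<phi>\<^sub>0 a" and \<xi>: "\<xi> \<in> \<Omega>"
      and I0: "\<And>p. p \<in> I \<Longrightarrow> poly (map_poly \<phi> p) \<xi> = 0"
      and B: "B \<in> polys_over A" "b = poly B x" "poly (map_poly \<phi> B) \<xi> \<noteq> 0" for \<phi> \<xi> B b
  proof -
    note H = hom_onD[OF hom_on_map_poly[OF A \<phi>(1)]]
    define \<Phi> where "\<Phi> y = poly (map_poly \<phi> (SOME p. p \<in> polys_over A \<and> poly p x = y)) \<xi>" for y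
    have \<Phi>: "\<Phi> y = poly (map_poly \<phi> p) \<xi>" if p: "p \<in> polys_over A" "poly p x - y \<in> P" "y \<in> adjoin A x" for p y
    proof -
      define q where "q = (SOME p. p \<in> polys_over A \<and> poly p x = y)"
      have "\<exists>q. q \<in> polys_over A \<and> poly q x = y" using p by (auto simp: adjoin_def)
      then have q: "q \<in> polys_over A" "poly q x = y"
        unfolding q_def by (metis (mono_tags, lifting) someI_ex)+
      then have "p - q \<in> I" using p PA(4) by (auto simp: I_def)
      then have "poly (map_poly \<phi> (p - q)) \<xi> = 0" by (rule I0)
      then show ?thesis unfolding \<Phi>_def q_def[symmetric]
        using hom_on_diff[OF PAsub hom_on_map_poly[OF A \<phi>(1)] p(1) q(1)] by simp
    qed
    have \<Phi>p: "\<Phi> (poly p x) = poly (map_poly \<phi> p) \<xi>" if "p \<in> polys_over A" for p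
      using that by (intro \<Phi>) (auto simp: zero_mem adjoin_def)
    have "\<Phi> a = \<phi>\<^sub>0 a" if "a \<in> A\<^sub>0" for a
    proof -
      have "a \<in> A" using that A0 by auto
      then have "[:a:] \<in> polys_over A" using A PA by (intro polys_over_pCons) auto
      from \<Phi>p[OF this] show ?thesis using \<phi>(3) that by (simp add: map_poly_const hom_on_0[OF A \<phi>(1)])
    qed
    moreover have "hom_on (adjoin A x) \<Phi>"
      unfolding hom_on_def
    proof (intro conjI ballI)
      show "\<Phi> 1 = 1" using \<Phi>p[OF PA(2)] H(1) by simp
      fix y z assume "y \<in> adjoin A x" "z \<in> adjoin A x"
      then obtain p q where pq: "p \<in> polys_over A" "q \<in> polys_over A" "y = poly p x" "z = poly q x"
        by (auto simp: adjoin_def)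
      show "\<Phi> (y + z) = \<Phi> y + \<Phi> z"
        using \<Phi>p[OF PA(3)[OF pq(1,2)]] \<Phi>p[OF pq(1)] \<Phi>p[OF pq(2)] pq H(2)[OF pq(1,2)] by simp
      show "\<Phi> (y * z) = \<Phi> y * \<Phi> z"
        using \<Phi>p[OF PA(5)[OF pq(1,2)]] \<Phi>p[OF pq(1)] \<Phi>p[OF pq(2)] pq H(3)[OF pq(1,2)] by simp
    qed
    moreover have "\<Phi> y \<in> \<Omega>" if "y \<in> adjoin A x" for y
    proof -
      obtain p where p: "p \<in> polys_over A" "y = poly p x" using \<open>y \<in> adjoin A x\<close> unfolding adjoin_def by blast
      have "coeff (map_poly \<phi> p) i \<in> \<Omega>" for i
        using p(1) \<phi>(2) hom_on_0[OF A \<phi>(1)] by (auto simp: coeff_map_poly polys_over_def)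
      then have "poly (map_poly \<phi> p) \<xi> \<in> \<Omega>" unfolding poly_altdef[of "map_poly \<phi> p"]
        using \<xi> \<Omega>(1) by (intro is_subring_sum is_subringD(5) is_subring_power) auto
      then show ?thesis unfolding p(2) \<Phi>p[OF p(1)] .
    qed
    moreover have "\<Phi> y = 0" if "y \<in> adjoin A x" "y \<in> P" for y
      using \<Phi>[of 0 y] PA(1) that uminus_mem by simp
    moreover have "\<Phi> b \<noteq> 0" using B \<Phi>p[OF B(1)] by simp
    ultimately show ?thesis by blast
  qed
  have map0: "map_poly \<phi> p = 0"
    if "hom_on A \<phi>" "\<forall>a\<in>A \<inter> P. \<phi> a = 0" "triv p" "p \<in> polys_over A" for \<phi> :: "'b \<Rightarrow> 'c" and p
    using that hom_on_0[OF A that(1)] by (intro poly_eqI) (auto simp: coeff_map_poly triv_def polys_over_def)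
  have "\<exists>\<Phi>. hom_on (adjoin A x) \<Phi> \<and> \<Phi> ` (adjoin A x) \<subseteq> \<Omega> \<and>
      (\<forall>a\<in>A\<^sub>0. \<Phi> a = \<phi>\<^sub>0 a) \<and> (\<forall>a\<in>adjoin A x \<inter> P. \<Phi> a = 0) \<and> \<Phi> b \<noteq> 0"
    if b: "b \<in> adjoin A x" "b \<notin> P" for b
  proof -
    obtain B where B: "B \<in> polys_over A" "b = poly B x" using b by (auto simp: adjoin_def)
    have Bn: "\<not> triv B" using b B triv_poly by blast
    show ?thesis
    proof (cases "\<forall>p\<in>I. triv p")
      case True
      \<comment> \<open>Transcendental case: once one coefficient of \<open>B\<close> survives, only
        finitely many \<open>\<xi>\<close> have to be avoided.\<close>
      obtain k where k: "coeff B k \<notin> P" using Bn by (auto simp: triv_def)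
      moreover have "coeff B k \<in> A" using B by (auto simp: polys_over_def)
      ultimately obtain \<phi> where \<phi>: "hom_on A \<phi>" "\<phi> ` A \<subseteq> \<Omega>" "\<forall>a\<in>A\<^sub>0. \<phi> a = \<phi>\<^sub>0 a"
        "\<forall>a\<in>A \<inter> P. \<phi> a = 0" "\<phi> (coeff B k) \<noteq> 0"
        using ext unfolding extends_to_def by (metis DiffI)
      have "map_poly \<phi> B \<noteq> 0" using \<phi>(5) hom_on_0[OF A \<phi>(1)] by (metis coeff_0 coeff_map_poly)
      then have "finite {\<xi>. poly (map_poly \<phi> B) \<xi> = 0}" by (rule poly_roots_finite)
      then obtain \<xi> where \<xi>: "\<xi> \<in> \<Omega>" "poly (map_poly \<phi> B) \<xi> \<noteq> 0"
        using \<Omega>(2) by (metis (mono_tags, lifting) finite_subset mem_Collect_eq subsetI)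
      show ?thesis
        by (rule specialise[OF \<phi>(1,2,3) \<xi>(1) _ B \<xi>(2)]) (use True map0[OF \<phi>(1,4)] I_def in auto)
    next
      case False
      \<comment> \<open>Top coefficients may lie in \<open>P\<close>. Cutting them off changes
        nothing modulo \<open>P\<close> and leaves a leading coefficient outside \<open>P\<close>,
        as pseudo-division requires.\<close>
      have trunc: "\<exists>q. q \<in> polys_over A \<and> lead_coeff q \<notin> P \<and> triv (p - q) \<and> degree q \<le> degree p"
        if "p \<in> polys_over A" "\<not> triv p" for p
      proof -
        define S where "S = {i. coeff p i \<notin> P}"
        have "S \<subseteq> {..degree p}" unfolding S_def using zero_mem le_degree by (metis (mono_tags, lifting) atMost_iff mem_Collect_eq subsetI)
        then have fin: "finite S" and "S \<noteq> {}" using that finite_subset by (auto simp: S_def triv_def)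
        define n where "n = Max S"
        have n: "n \<in> S" "\<And>i. i \<in> S \<Longrightarrow> i \<le> n" unfolding n_def using fin \<open>S \<noteq> {}\<close> by auto
        define q where "q = (\<Sum>i\<le>n. monom (coeff p i) i)"
        have cq: "coeff q i = (if i \<le> n then coeff p i else 0)" for i
          by (auto simp: q_def coeff_sum)
        have "coeff q n \<noteq> 0" using n(1) zero_mem by (auto simp: cq S_def)
        then have "degree q = n" by (intro antisym degree_le le_degree) (auto simp: cq)
        moreover have "n \<le> degree p" using n(1) \<open>S \<subseteq> {..degree p}\<close> by auto
        ultimately show ?thesis using n that(1) A zero_mem
          by (intro exI[of _ q]) (force simp: cq S_def polys_over_def is_subringD triv_def not_le)
      qed
      have triv_I: "p \<in> polys_over A \<Longrightarrow> triv p \<Longrightarrow> p \<in> I" for p using triv_poly by (auto simp: I_def)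
      obtain g0 where g0: "g0 \<in> I" "\<not> triv g0" "\<And>p. p \<in> I \<Longrightarrow> \<not> triv p \<Longrightarrow> degree g0 \<le> degree p"
        using False ex_has_least_nat[of "\<lambda>p. p \<in> I \<and> \<not> triv p" _ degree] by blast
      \<comment> \<open>This \<open>g\<close> plays the minimal polynomial of \<open>x\<close>
        modulo \<open>P\<close>, with leading coefficient \<open>c\<close> outside
        \<open>P\<close>.\<close>
      obtain g where g: "g \<in> polys_over A" "lead_coeff g \<notin> P" "triv (g0 - g)" "degree g \<le> degree g0"
        using trunc g0 I_def by blast
      define c where "c = lead_coeff g"
      have "poly (g0 - g) x \<in> P" "poly g0 x \<in> P" using triv_poly[OF g(3)] g0(1) unfolding I_def by blast+
      then have "poly g x \<in> P" using diff_mem[of "poly g0 x" "poly (g0 - g) x"] by simp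
      then have gI: "g \<in> I" using g by (auto simp: I_def)
      have gmin: "triv p" if "p \<in> I" "degree p < degree g" for p using that g0(3) g(4) by force
      have gtriv: "\<not> triv g" using g(2) by (auto simp: triv_def)
      have gpos: "degree g > 0"
      proof (rule ccontr)
        assume "\<not> degree g > 0"
        then obtain a where a: "g = [:a:]" by (metis degree_eq_zeroE neq0_conv)
        then show False using g(2) \<open>poly g x \<in> P\<close> by simp
      qed
      have cA: "c \<in> A" using g by (auto simp: c_def polys_over_def)
      \<comment> \<open>Polynomials whose value at \<open>x\<close> is a multiple of
        \<open>b\<close> modulo \<open>P\<close>. A constant \<open>e\<close> in \<open>J\<close>
        outside \<open>P\<close> is what is wanted: if \<open>e\<close> survives a specialisation,
        so does \<open>b\<close>.\<close>
      define J where "J = {p \<in> polys_over A. \<exists>s\<in>polys_over A. poly p x - poly s x * b \<in> P}"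
      have IJ: "I \<subseteq> J" unfolding I_def J_def using PA(1) by (force intro!: bexI[of _ 0])
      have "B \<in> J" unfolding J_def using B PA(2) zero_mem by (auto intro!: bexI[of _ 1])
      have Jdiff: "p - q * r \<in> J" if "p \<in> J" "r \<in> J" "q \<in> polys_over A" for p q r
      proof -
        obtain s t where st: "s \<in> polys_over A" "t \<in> polys_over A"
            "poly p x - poly s x * b \<in> P" "poly r x - poly t x * b \<in> P"
          using \<open>p \<in> J\<close> \<open>r \<in> J\<close> by (auto simp: J_def)
        have "poly (p - q * r) x - poly (s - q * t) x * b
            = (poly p x - poly s x * b) - poly q x * (poly r x - poly t x * b)"
          by (simp add: algebra_simps)
        also have "\<dots> \<in> P" by (intro diff_mem absorb st)
        finally show ?thesis unfolding J_def using PA that st by (auto simp: J_def intro!: bexI[of _ "s - q * t"])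
      qed
      have Jsmult: "smult a p \<in> J" if "p \<in> J" "a \<in> A" for p a
      proof -
        have "[:a:] \<in> polys_over A" using that A PA by (intro polys_over_pCons) auto
        then have "- [:a:] \<in> polys_over A" by (rule is_subring_uminus[OF PAsub])
        moreover have "0 \<in> J" using IJ PA(1) zero_mem by (auto simp: I_def)
        ultimately show ?thesis using Jdiff[of 0 p "- [:a:]"] that by simp
      qed
      obtain f0 where f0: "f0 \<in> J" "\<not> triv f0" "\<And>p. p \<in> J \<Longrightarrow> \<not> triv p \<Longrightarrow> degree f0 \<le> degree p"
        using \<open>B \<in> J\<close> Bn ex_has_least_nat[of "\<lambda>p. p \<in> J \<and> \<not> triv p" _ degree] by blast
      obtain f where f: "f \<in> polys_over A" "lead_coeff f \<notin> P" "triv (f0 - f)" "degree f \<le> degree f0"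
        using trunc f0 J_def by blast
      have "f0 - f \<in> polys_over A" using f(1) f0(1) PA(4)[of f0 f] unfolding J_def by blast
      then have "f0 - 1 * (f0 - f) \<in> J"
        using f0(1) PA(2) triv_I f(3) IJ by (intro Jdiff) auto
      then have fJ: "f \<in> J" by simp
      have fmin: "triv p" if "p \<in> J" "degree p < degree f" for p using that f0(3) f(4) by force
      \<comment> \<open>Otherwise \<open>f\<close>, of least degree in \<open>J\<close>, divides a
        multiple of \<open>g\<close> modulo \<open>P\<close>, so one of the two cofactors kills
        \<open>x\<close>. If \<open>f\<close> does, dividing \<open>B\<close> by \<open>f\<close>
        puts a multiple of \<open>b\<close> by a power of \<open>e\<close> into \<open>P\<close>; if
        the quotient \<open>q\<close> does, it is a shorter relation than \<open>g\<close>.\<close>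
      have "degree f = 0"
      proof (rule ccontr)
        assume "degree f \<noteq> 0"
        then have fpos: "degree f > 0" by simp
        define e where "e = lead_coeff f"
        have eA: "e \<in> A" using f by (auto simp: e_def polys_over_def)
        have rem: "triv r \<and> r \<in> I" if "p \<in> J" "q \<in> polys_over A" "r \<in> polys_over A" "degree r < degree f"
            "smult (e ^ N) p = q * f + r" for p q r N
        proof -
          have "r = smult (e ^ N) p - q * f" using that by simp
          also have "\<dots> \<in> J" by (intro Jdiff Jsmult is_subring_power A eA fJ that)
          finally have "triv r" using fmin that by auto
          then show ?thesis using triv_I that by auto
        qed
        obtain N q r where qr: "q \<in> polys_over A" "r \<in> polys_over A" "degree r < degree f"
            "smult (e ^ N) g = q * f + r"
          using pseudo_division_over[OF A f(1) fpos g(1)] unfolding e_def by blast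
        have r: "triv r" "r \<in> I" using rem[OF _ qr] gI IJ by auto
        have "poly (q * f) x = e ^ N * poly g x - poly r x"
          using arg_cong[OF qr(4), of "\<lambda>p. poly p x"] by (simp add: algebra_simps)
        also have "\<dots> \<in> P" using r(2) \<open>poly g x \<in> P\<close> by (intro diff_mem absorb) (auto simp: I_def)
        finally have "poly q x \<in> P \<or> poly f x \<in> P" using prime by simp
        then show False
        proof
          assume fx: "poly f x \<in> P"
          obtain N q r where qr: "q \<in> polys_over A" "r \<in> polys_over A" "degree r < degree f"
            "smult (e ^ N) B = q * f + r"
            using pseudo_division_over[OF A f(1) fpos B(1)] unfolding e_def by blast
          have "r \<in> I" using rem[OF _ qr] \<open>B \<in> J\<close> by auto
          moreover have "e ^ N * b = poly q x * poly f x + poly r x"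
            using arg_cong[OF qr(4), of "\<lambda>p. poly p x"] B by simp
          ultimately have "e ^ N * b \<in> P" using fx by (auto simp: I_def intro!: add_mem absorb)
          then show False using b(2) power_notin[OF f(2)] mult_notin e_def by auto
        next
          assume "poly q x \<in> P"
          then have qI: "q \<in> I" using qr by (auto simp: I_def)
          \<comment> \<open>Otherwise the top coefficient of \<open>smult (e ^ N) g\<close> would
            lie in \<open>P\<close>, although both its factors avoid \<open>P\<close>.\<close>
          have "\<not> triv q"
          proof
            assume "triv q"
            then have "coeff (q * f) i \<in> P" for i
              unfolding coeff_mult triv_def by (intro sum_mem) (metis absorb mult.commute)
            then have "coeff (q * f + r) (degree g) \<in> P" using r(1) by (auto simp: triv_def intro!: add_mem)
            then show False unfolding qr(4)[symmetric]
              using g(2) power_notin[OF f(2)] mult_notin by (auto simp: e_def)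
          qed
          then obtain q' where q': "q' \<in> polys_over A" "lead_coeff q' \<notin> P" "triv (q - q')"
            using trunc qr(1) by blast
          have "q' \<in> I"
          proof -
            have "poly q x - poly (q - q') x \<in> P" using qI triv_poly[OF q'(3)] unfolding I_def by (intro diff_mem) auto
            then show ?thesis using q' by (auto simp: I_def)
          qed
          moreover have "\<not> triv q'" using q' by (auto simp: triv_def)
          \<comment> \<open>As a nontrivial relation \<open>q'\<close> is at least as long as
            \<open>g\<close>. Then \<open>q' * f\<close> has a coefficient outside \<open>P\<close>
            in a degree above that of \<open>g\<close>, where \<open>q * f\<close> has none.\<close>
          ultimately have "degree g \<le> degree q'" using gmin by force
          have "coeff (q' * f) (degree q' + degree f) \<notin> P"
            using q'(2) f(2) mult_notin by (simp add: coeff_mult_degree_sum)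
          moreover have "coeff ((q - q') * f) i \<in> P" for i
            using q'(3) unfolding coeff_mult triv_def by (intro sum_mem) (metis absorb mult.commute)
          moreover have "coeff (q * f) (degree q' + degree f) = 0"
          proof -
            have "coeff (smult (e ^ N) g - r) (degree q' + degree f) = 0"
              using \<open>degree g \<le> degree q'\<close> fpos qr(3) by (simp add: coeff_eq_0)
            then show ?thesis unfolding qr(4) by simp
          qed
          moreover have "coeff (q' * f) i = coeff (q * f) i - coeff ((q - q') * f) i" for i
            by (simp add: algebra_simps)
          ultimately show False using uminus_mem by (metis diff_0)
        qed
      qed
      then obtain e where e: "f = [:e:]" by (metis degree_eq_zeroE)
      have eA: "e \<in> A" "e \<notin> P" using f unfolding e polys_over_def by (auto, metis coeff_pCons_0)
      obtain s where s: "s \<in> polys_over A" "e - poly s x * b \<in> P" using fJ unfolding e J_def by auto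
      \<comment> \<open>Both factors must survive: \<open>c\<close> keeps the specialised
        \<open>g\<close> nonconstant and pseudo-division by it valid, \<open>e\<close> keeps
        \<open>b\<close> nonzero.\<close>
      have "c * e \<in> A - P" using eA cA A mult_notin g(2) by (auto simp: is_subringD c_def)
      then obtain \<phi> where \<phi>: "hom_on A \<phi>" "\<phi> ` A \<subseteq> \<Omega>" "\<forall>a\<in>A\<^sub>0. \<phi> a = \<phi>\<^sub>0 a"
        "\<forall>a\<in>A \<inter> P. \<phi> a = 0" "\<phi> (c * e) \<noteq> 0"
        using ext unfolding extends_to_def by (metis (no_types, lifting))
      have ce: "\<phi> c \<noteq> 0" "\<phi> e \<noteq> 0" using \<phi>(5) hom_onD(3)[OF \<phi>(1) cA eA(1)] by auto
      note H = hom_onD[OF hom_on_map_poly[OF A \<phi>(1)]]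
      have [simp]: "\<phi> 0 = 0" using hom_on_0[OF A \<phi>(1)] .
      have "coeff (map_poly \<phi> g) (degree g) \<noteq> 0" using ce by (simp add: coeff_map_poly c_def)
      then have "degree (map_poly \<phi> g) > 0" using gpos le_degree by fastforce
      moreover have "map_poly \<phi> g \<in> polys_over \<Omega>"
        using g(1) \<phi>(2) by (auto simp: polys_over_def coeff_map_poly)
      ultimately obtain \<xi> where \<xi>: "\<xi> \<in> \<Omega>" "poly (map_poly \<phi> g) \<xi> = 0" using closed by blast
      have smult_map: "map_poly \<phi> (smult a p) = smult (\<phi> a) (map_poly \<phi> p)"
        if "a \<in> A" "p \<in> polys_over A" for a p
        using that hom_onD[OF \<phi>(1)] by (intro poly_eqI) (auto simp: coeff_map_poly polys_over_def)
      \<comment> \<open>Pseudo-division of a relation by \<open>g\<close> leaves a remainder that is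
        again a relation, of smaller degree, hence trivial; so every relation vanishes at a root of
        the specialised \<open>g\<close>.\<close>
      have I0: "poly (map_poly \<phi> p) \<xi> = 0" if p: "p \<in> I" for p
      proof -
        have pA: "p \<in> polys_over A" using p by (auto simp: I_def)
        obtain N q r where qr: "q \<in> polys_over A" "r \<in> polys_over A" "degree r < degree g"
            "smult (c ^ N) p = q * g + r"
          using pseudo_division_over[OF A g(1) gpos pA] unfolding c_def by blast
        have "poly r x = c ^ N * poly p x - poly q x * poly g x"
          using arg_cong[OF qr(4), of "\<lambda>p. poly p x"] by (simp add: algebra_simps)
        also have "\<dots> \<in> P" using gI p by (intro diff_mem absorb) (auto simp: I_def)
        finally have "triv r" using gmin qr by (auto simp: I_def)
        then have "map_poly \<phi> r = 0" using map0[OF \<phi>(1,4)] qr by auto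
        have "map_poly \<phi> (smult (c ^ N) p) = map_poly \<phi> q * map_poly \<phi> g"
          unfolding qr(4) using H qr g PA(5) \<open>map_poly \<phi> r = 0\<close> by simp
        then have "\<phi> (c ^ N) * poly (map_poly \<phi> p) \<xi> = 0"
          unfolding smult_map[OF is_subring_power[OF A cA] pA] using \<xi>(2)
          by (metis poly_smult poly_mult mult_zero_right)
        then show ?thesis using ce hom_on_power[OF A \<phi>(1) cA] by simp
      qed
      have "poly (map_poly \<phi> B) \<xi> \<noteq> 0"
      proof
        assume B0: "poly (map_poly \<phi> B) \<xi> = 0"
        have eP: "[:e:] \<in> polys_over A" using e f by simp
        have "[:e:] - s * B \<in> I" using s B eP PA by (auto simp: I_def)
        from I0[OF this] have "poly (map_poly \<phi> [:e:] - map_poly \<phi> (s * B)) \<xi> = 0"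
          using hom_on_diff[OF PAsub hom_on_map_poly[OF A \<phi>(1)] eP PA(5)[OF s(1) B(1)]] by simp
        then show False using H(3)[OF s(1) B(1)] B0 ce(2) by (simp add: map_poly_const)
      qed
      then show ?thesis by (intro specialise[OF \<phi>(1,2,3) \<xi>(1) I0 B])
    qed
  qed
  then show ?thesis unfolding extends_to_def using Ax A0 adjoin_superset[OF A, of x] by blast
qed

end

section \<open>Specialisation to finite fields\<close>

text \<open>The start of the tower: if the kernel of the given homomorphism is exactly what
  \<open>P\<close> cuts out, it already keeps every element outside \<open>P\<close>
  nonzero.\<close>

lemma (in prime_set) extends_to_base:
  assumes "is_subring A\<^sub>0" "hom_on A\<^sub>0 \<phi>\<^sub>0" "\<phi>\<^sub>0 ` A\<^sub>0 \<subseteq> \<Omega>" "\<And>a. a \<in> A\<^sub>0 \<Longrightarrow> \<phi>\<^sub>0 a = 0 \<longleftrightarrow> a \<in> P"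
  shows "extends_to \<phi>\<^sub>0 A\<^sub>0 \<Omega> A\<^sub>0"
  using assms unfolding extends_to_def by (auto intro!: exI[of _ \<phi>\<^sub>0])

lemma (in prime_set) extends_to_finite:
  assumes "extends_to \<phi>\<^sub>0 A\<^sub>0 \<Omega> A\<^sub>0" "finite S" "is_subring \<Omega>" "infinite \<Omega>"
    and "\<And>p. p \<in> polys_over \<Omega> \<Longrightarrow> degree p > 0 \<Longrightarrow> \<exists>\<xi>\<in>\<Omega>. poly p \<xi> = 0"
  shows "\<exists>A. extends_to \<phi>\<^sub>0 A\<^sub>0 \<Omega> A \<and> S \<subseteq> A"
  using assms(2)
proof (induction S rule: finite_induct)
  case empty
  then show ?case using assms(1) by blast
next
  case (insert x S)
  then obtain A where A: "extends_to \<phi>\<^sub>0 A\<^sub>0 \<Omega> A" "S \<subseteq> A" by blast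
  have "extends_to \<phi>\<^sub>0 A\<^sub>0 \<Omega> (adjoin A x)" by (rule extends_to_adjoin[OF A(1) assms(3-5)])
  moreover have "insert x S \<subseteq> adjoin A x"
    using A adjoin_superset[of A x] adjoin_self[of A x] by (auto simp: extends_to_def)
  ultimately show ?case by blast
qed

definition gen_ring :: "'b::comm_ring_1 set \<Rightarrow> 'b set" where
  "gen_ring S = \<Inter> {A. is_subring A \<and> S \<subseteq> A}"

lemma is_subring_gen_ring: "is_subring (gen_ring S)"
  unfolding gen_ring_def is_subring_def by blast

lemma gen_ring_superset: "S \<subseteq> gen_ring S"
  unfolding gen_ring_def by blast

lemma gen_ring_least: "is_subring A \<Longrightarrow> S \<subseteq> A \<Longrightarrow> gen_ring S \<subseteq> A"
  unfolding gen_ring_def by blast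

lemma is_subring_vimage:
  assumes "is_subring A" "hom_on A \<phi>" "is_subring B"
  shows "is_subring {x \<in> A. \<phi> x \<in> B}"
  using assms unfolding is_subring_def[of "{x \<in> A. \<phi> x \<in> B}"]
  by (auto simp: is_subringD hom_onD hom_on_0 hom_on_diff)

section \<open>Finite fields as fixed points of Frobenius powers\<close>

lemma frob_add:
  fixes x y :: "'k::field" assumes "CHAR('k) > 0" shows "(x + y) ^ (CHAR('k) ^ n) = x ^ (CHAR('k) ^ n) + y ^ (CHAR('k) ^ n)"
  using freshmans_dream'[OF prime_CHAR_semidom[OF assms] refl] .

lemma frob_diff:
  fixes x y :: "'k::field" assumes "CHAR('k) > 0" shows "(x - y) ^ (CHAR('k) ^ n) = x ^ (CHAR('k) ^ n) - y ^ (CHAR('k) ^ n)"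
  using frob_add[OF assms, of "x - y" y n] by simp

lemma frob_inj:
  fixes x y :: "'k::field" assumes "CHAR('k) > 0" "x ^ (CHAR('k) ^ n) = y ^ (CHAR('k) ^ n)" shows "x = y"
proof -
  have "(x - y) ^ (CHAR('k) ^ n) = 0" unfolding frob_diff[OF assms(1)] assms(2) by (rule diff_self)
  then have "x - y = 0" by (rule power_eq_0_iff[THEN iffD1, THEN conjunct1])
  then show ?thesis by (rule eq_iff_diff_eq_0[THEN iffD2])
qed

text \<open>For \<open>n > 0\<close> the roots of \<open>X ^ q - X\<close> with
  \<open>q = CHAR('k) ^ n\<close>, hence a finite subfield.\<close>

definition frob_fixed :: "nat \<Rightarrow> 'k::field set" where
  "frob_fixed n = {x. x ^ (CHAR('k) ^ n) = x}"

lemma is_subring_frob_fixed: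
  assumes "CHAR('k::field) > 0"
  shows "is_subring (frob_fixed n :: 'k set)"
  using assms by (auto simp: is_subring_def frob_fixed_def frob_add frob_diff power_mult_distrib)

lemma finite_frob_fixed:
  assumes "CHAR('k::field) > 0" "n > 0"
  shows "finite (frob_fixed n :: 'k set)"
proof -
  define q where "q = CHAR('k) ^ n"
  have "CHAR('k) > 1" using prime_CHAR_semidom[OF assms(1)] prime_gt_1_nat by blast
  then have "q > 1" unfolding q_def using assms(2) by (rule one_less_power)
  define f :: "'k poly" where "f = monom 1 q - monom 1 1"
  have "coeff f q = 1" using \<open>q > 1\<close> by (simp add: f_def)
  then have "f \<noteq> 0" by force
  then have "finite {x. poly f x = 0}" by (rule poly_roots_finite)
  then show ?thesis by (simp add: f_def frob_fixed_def poly_monom q_def)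
qed

lemma frob_fixed_mono: "n dvd m \<Longrightarrow> frob_fixed n \<subseteq> (frob_fixed m :: 'k::field set)"
proof
  fix x :: 'k assume "n dvd m" and x: "x \<in> frob_fixed n"
  then obtain k where k: "m = n * k" by blast
  have "x ^ (CHAR('k) ^ (n * k)) = x"
    by (induction k) (use x in \<open>simp_all add: frob_fixed_def power_add power_mult\<close>)
  then show "x \<in> frob_fixed m" by (simp add: frob_fixed_def k)
qed

text \<open>This is the algebraic closure of the prime field inside \<open>'k\<close>.\<close>

definition frob_periodic :: "'k::field set" where
  "frob_periodic = (\<Union>n\<in>{0<..}. frob_fixed n)"

lemma frob_periodic_finite:
  assumes "finite S" "S \<subseteq> (frob_periodic :: 'k::field set)"
  shows "\<exists>n>0. S \<subseteq> frob_fixed n"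
  using assms
proof (induction S rule: finite_induct)
  case empty
  then show ?case by (intro exI[of _ 1]) simp
next
  case (insert x S)
  then obtain n m where "n > 0" "m > 0" "S \<subseteq> frob_fixed n" "x \<in> frob_fixed m" by (auto simp: frob_periodic_def)
  then show ?case using frob_fixed_mono[of n "n * m"] frob_fixed_mono[of m "n * m"]
    by (intro exI[of _ "n * m"]) auto
qed

lemma is_subring_frob_periodic:
  assumes "CHAR('k::field) > 0"
  shows "is_subring (frob_periodic :: 'k set)"
proof -
  have "x + y \<in> frob_periodic \<and> x - y \<in> frob_periodic \<and> x * y \<in> frob_periodic"
    if xy: "x \<in> frob_periodic" "y \<in> frob_periodic" for x y :: 'k
  proof -
    obtain n where "n > 0" "{x, y} \<subseteq> frob_fixed n" using frob_periodic_finite[of "{x, y}"] xy by auto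
    then have "x + y \<in> frob_fixed n" "x - y \<in> frob_fixed n" "x * y \<in> frob_fixed n"
      using is_subringD[OF is_subring_frob_fixed[OF assms]] by auto
    then show ?thesis using \<open>n > 0\<close> unfolding frob_periodic_def by blast
  qed
  then show ?thesis unfolding is_subring_def
    using assms by (auto simp: frob_periodic_def frob_fixed_def)
qed

text \<open>If the coefficients are fixed by the \<open>p ^ N\<close>-th power map, that map sends
  roots of \<open>f\<close> to roots. The forward orbit of a root is therefore finite, and
  injectivity of the Frobenius makes the root itself periodic.\<close>

lemma frob_periodic_closed:
  fixes f :: "'k::alg_closed_field poly"
  assumes p: "CHAR('k) > 0" and f: "f \<in> polys_over frob_periodic" "degree f > 0"
  shows "\<exists>\<xi>\<in>frob_periodic. poly f \<xi> = 0"
proof -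
  define p where "p = CHAR('k)"
  obtain \<xi> where \<xi>: "poly f \<xi> = 0" using alg_closed_imp_poly_has_root[OF f(2)] ..
  have "coeff f ` {..degree f} \<subseteq> frob_periodic" using f by (auto simp: polys_over_def)
  then obtain N where N: "N > 0" "coeff f ` {..degree f} \<subseteq> frob_fixed N"
    using frob_periodic_finite[of "coeff f ` {..degree f}"] by auto
  have root: "poly f (\<xi> ^ (p ^ (N * j))) = 0" for j
  proof (induction j)
    case (Suc j)
    define y where "y = \<xi> ^ (p ^ (N * j))"
    have "p ^ N > 0" using p unfolding p_def by (rule zero_less_power)
    moreover have "poly f y = 0" using Suc unfolding y_def .
    ultimately have "0 = poly f y ^ (p ^ N)" by (simp only: zero_power)
    also have "\<dots> = (\<Sum>i\<le>degree f. (coeff f i * y ^ i) ^ (p ^ N))"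
      unfolding p_def poly_altdef
      by (rule freshmans_dream_sum'[OF prime_CHAR_semidom[OF p] refl])
    also have "\<dots> = (\<Sum>i\<le>degree f. coeff f i * (y ^ (p ^ N)) ^ i)"
    proof (rule sum.cong)
      fix i assume "i \<in> {..degree f}"
      then have "coeff f i ^ (p ^ N) = coeff f i" using N(2) by (auto simp: frob_fixed_def p_def)
      moreover have "(y ^ i) ^ (p ^ N) = (y ^ (p ^ N)) ^ i" by (metis power_mult mult.commute)
      ultimately show "(coeff f i * y ^ i) ^ (p ^ N) = coeff f i * (y ^ (p ^ N)) ^ i"
        by (simp add: power_mult_distrib)
    qed simp
    finally have "poly f (y ^ (p ^ N)) = 0" by (simp add: poly_altdef)
    moreover have "y ^ (p ^ N) = \<xi> ^ (p ^ (N * Suc j))"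
      unfolding y_def power_mult[symmetric] mult_Suc_right power_add by (rule arg_cong[OF mult.commute])
    ultimately show ?case by simp
  qed (use \<xi> in simp)
  have "f \<noteq> 0" using f(2) by auto
  have "finite (range (\<lambda>j. \<xi> ^ (p ^ (N * j))))"
    by (rule finite_subset[OF _ poly_roots_finite[OF \<open>f \<noteq> 0\<close>]]) (use root in auto)
  then have "\<not> inj (\<lambda>j. \<xi> ^ (p ^ (N * j)))" using finite_imageD[of "\<lambda>j. \<xi> ^ (p ^ (N * j))" UNIV] by auto
  then obtain i' j' where ij': "\<xi> ^ (p ^ (N * i')) = \<xi> ^ (p ^ (N * j'))" "i' \<noteq> j'" by (auto simp: inj_def)
  obtain i j where ij: "i < j" "\<xi> ^ (p ^ (N * i)) = \<xi> ^ (p ^ (N * j))"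
      proof (cases "i' < j'")
    case True
    show ?thesis by (rule that[OF True ij'(1)])
  next
    case False
    then have "j' < i'" using ij'(2) by linarith
    then show ?thesis by (rule that[OF _ ij'(1)[symmetric]])
  qed
  \<comment> \<open>Two equal members of the orbit: the common power \<open>p ^ (N * i)\<close> is
    cancelled, which leaves \<open>\<xi>\<close> fixed by the power map for
    \<open>N * (j - i)\<close>.\<close>
  have "N * j = N * (j - i) + N * i" unfolding distrib_left[symmetric] using ij(1) by simp
  then have eq: "\<xi> ^ (p ^ (N * j)) = (\<xi> ^ (p ^ (N * (j - i)))) ^ (p ^ (N * i))"
    by (simp only: power_add power_mult)
  have "\<xi> ^ (p ^ (N * (j - i))) = \<xi>"
    by (rule frob_inj[OF p, folded p_def, OF trans[OF eq[symmetric] ij(2)[symmetric]]])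
  then have "\<xi> \<in> frob_fixed (N * (j - i))" unfolding frob_fixed_def p_def by (rule CollectI)
  moreover have "N * (j - i) \<in> {0<..}" using N(1) ij(1) by simp
  ultimately have "\<xi> \<in> frob_periodic" unfolding frob_periodic_def by (rule UN_I[rotated])
  with \<xi> show ?thesis ..
qed

text \<open>As in Euclid's argument, one plus the product of all \<open>X - a\<close> has no root in
  a finite ring.\<close>

lemma infinite_if_closed:
  fixes \<Omega> :: "'k::field set"
  assumes "is_subring \<Omega>" and "\<And>p. p \<in> polys_over \<Omega> \<Longrightarrow> degree p > 0 \<Longrightarrow> \<exists>\<xi>\<in>\<Omega>. poly p \<xi> = 0"
  shows "infinite \<Omega>"
proof
  assume fin: "finite \<Omega>"
  define g where "g = (\<Prod>a\<in>\<Omega>. [:- a, 1:])"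
  have sub: "is_subring (polys_over \<Omega>)" by (rule is_subring_polys_over[OF assms(1)])
  have "g \<in> polys_over \<Omega>" unfolding g_def
    by (intro is_subring_prod sub polys_over_pCons assms is_subring_uminus is_subringD(1)[OF sub])
      (auto simp: assms(1) is_subringD)
  then have "g + 1 \<in> polys_over \<Omega>" using is_subringD[OF sub] by auto
  moreover have "degree g = card \<Omega>" unfolding g_def by (subst degree_prod_eq_sum_degree) auto
  then have "degree g > 0" using fin is_subringD(1)[OF assms(1)] by (auto simp: card_gt_0_iff)
  then have "degree (g + 1) > 0" by (simp add: degree_add_eq_left)
  ultimately obtain \<xi> where "\<xi> \<in> \<Omega>" "poly (g + 1) \<xi> = 0" using assms(2) by blast
  moreover have "poly g \<xi> = 0" if "\<xi> \<in> \<Omega>" for \<xi>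
    unfolding g_def poly_prod using that fin by (intro prod_zero) auto
  ultimately show False by simp
qed

text \<open>Applied with the zero ideal over the algebraic closure of the prime field: the finitely
  many generators go to algebraic elements, which lie in a common finite field.\<close>

lemma finite_specialisation:
  fixes S :: "'k::alg_closed_field set"
  assumes p: "CHAR('k) > 0" and S: "finite S" "b \<in> gen_ring S" "b \<noteq> 0"
  shows "\<exists>\<phi> :: 'k \<Rightarrow> 'k. hom_on (gen_ring S) \<phi> \<and> finite (\<phi> ` gen_ring S) \<and> \<phi> b \<noteq> 0"
proof -
  interpret prime_set "{0 :: 'k}" by unfold_locales auto
  note closed = frob_periodic_closed[OF p]
  note sub = is_subring_frob_periodic[OF p]
  have inf: "infinite (frob_periodic :: 'k set)"
    by (rule infinite_if_closed[OF sub]) (rule closed)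
  have base: "extends_to id frob_periodic (frob_periodic :: 'k set) frob_periodic"
    by (rule extends_to_base) (auto simp: sub hom_on_def)
  have "\<exists>A. extends_to id frob_periodic (frob_periodic :: 'k set) A \<and> S \<subseteq> A"
    by (rule extends_to_finite[OF base S(1) sub inf]) (rule closed)
  then obtain A where A: "extends_to id frob_periodic (frob_periodic :: 'k set) A" "S \<subseteq> A" by blast
  then have Asub: "is_subring A" by (auto simp: extends_to_def)
  have SA: "gen_ring S \<subseteq> A" using gen_ring_least[OF Asub A(2)] .
  then obtain \<phi> :: "'k \<Rightarrow> 'k" where \<phi>: "hom_on A \<phi>" "\<phi> ` A \<subseteq> frob_periodic" "\<phi> b \<noteq> 0"
    using A(1)[unfolded extends_to_def, THEN conjunct2, THEN conjunct2, THEN bspec, of b] subsetD[OF SA S(2)] S(3) by auto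
  obtain n where n: "n > 0" "\<phi> ` S \<subseteq> frob_fixed n"
    using frob_periodic_finite[of "\<phi> ` S"] S(1) A(2) \<phi>(2) by blast
  \<comment> \<open>The elements with value in the finite field form a subring containing the
    generators, so they are everything.\<close>
  have "gen_ring S \<subseteq> {x \<in> A. \<phi> x \<in> frob_fixed n}"
    by (rule gen_ring_least[OF is_subring_vimage[OF Asub \<phi>(1) is_subring_frob_fixed[OF p]]]) (use n(2) A(2) in auto)
  then have "finite (\<phi> ` gen_ring S)" by (intro finite_subset[OF _ finite_frob_fixed[OF p n(1)]]) auto
  moreover have "hom_on (gen_ring S) \<phi>" using \<phi>(1) SA by (auto simp: hom_on_def)
  ultimately show ?thesis using \<phi>(3) by blast
qed

text \<open>Zorn's lemma for proper filters below \<open>F\<close>, finer ones counting as larger.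
  Adding a set that is not negligible to a maximal filter keeps it proper, so the set already
  belonged to it.\<close>

lemma ultrafilter_exists:
  fixes F :: "'a filter"
  assumes "F \<noteq> bot"
  shows "\<exists>U\<le>F. U \<noteq> bot \<and> (\<forall>Q. eventually Q U \<or> eventually (\<lambda>x. \<not> Q x) U)"
proof -
  let ?A = "{G. G \<noteq> bot \<and> G \<le> F}"
  have "\<exists>m\<in>?A. \<forall>a\<in>?A. a \<le> m \<longrightarrow> a = m"
  proof (rule predicate_Zorn[of ?A "\<lambda>a b. b \<le> a"])
    show "partial_order_on ?A (relation_of (\<lambda>a b. b \<le> a) ?A)"
      by (rule partial_order_on_relation_ofI) auto
    fix C assume C: "C \<in> Chains (relation_of (\<lambda>a b. b \<le> a) ?A)"
    have CA: "C \<subseteq> ?A" using C by (auto simp: Chains_def relation_of_def)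
    have ch: "a \<le> b \<or> b \<le> a" if "a \<in> C" "b \<in> C" for a b
      using C that by (auto simp: Chains_def relation_of_def)
    show "\<exists>u\<in>?A. \<forall>a\<in>C. u \<le> a"
    proof (cases "C = {}")
      case True
      then show ?thesis using assms by auto
    next
      case False
      \<comment> \<open>A chain is directed, so its infimum has no large sets beyond those of its
        members and stays proper.\<close>
      have "eventually Q (Inf C) \<longleftrightarrow> (\<exists>b\<in>C. eventually Q b)" for Q
        using False
      proof (intro eventually_Inf_base)
        fix a b assume "a \<in> C" "b \<in> C"
        then show "\<exists>x\<in>C. x \<le> inf a b"
          using ch[OF \<open>a \<in> C\<close> \<open>b \<in> C\<close>] \<open>a \<in> C\<close> \<open>b \<in> C\<close> by (elim disjE) (rule bexI[of _ a] bexI[of _ b], simp_all)+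
      qed
      then have "Inf C \<noteq> bot" using CA by (auto simp: trivial_limit_def)
      moreover have "Inf C \<le> F" using False CA by (auto intro: Inf_lower2)
      ultimately show ?thesis by (intro bexI[of _ "Inf C"]) (auto intro: Inf_lower)
    qed
  qed
  then obtain U where UA: "U \<in> ?A" "\<forall>a\<in>?A. a \<le> U \<longrightarrow> a = U" by blast
  have U: "U \<noteq> bot" "U \<le> F" using UA(1) by auto
  have max: "G = U" if "G \<noteq> bot" "G \<le> U" for G using UA(2) that U(2) by (auto intro: order_trans)
  have "eventually Q U" if "\<not> eventually (\<lambda>x. \<not> Q x) U" for Q
  proof -
    have "inf U (principal {x. Q x}) \<noteq> bot"
      using that by (simp add: trivial_limit_def eventually_inf_principal)
    then have "inf U (principal {x. Q x}) = U" by (intro max) auto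
    moreover have "eventually Q (inf U (principal {x. Q x}))" by (simp add: eventually_inf_principal)
    ultimately show ?thesis by simp
  qed
  then show ?thesis using U by blast
qed

section \<open>Determinants with infinitely many values\<close>

text \<open>At zero the sum equals \<open>d\<close> and has derivative one, so it drops below
  \<open>d\<close> for small negative \<open>s\<close>.\<close>

lemma exp_sum_less:
  fixes \<chi> :: "nat \<Rightarrow> real"
  assumes "(\<Sum>i<d. \<chi> i) = 1"
  shows "\<exists>s. (\<Sum>i<d. exp (s * \<chi> i)) < real d"
proof -
  define h where "h s = (\<Sum>i<d. exp (s * \<chi> i))" for s
  have "(h has_real_derivative (\<Sum>i<d. exp (0 * \<chi> i) * (1 * \<chi> i))) (at 0)"
    unfolding h_def by (intro derivative_eq_intros DERIV_sum) (auto intro!: sum.cong derivative_eq_intros)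
  then have "DERIV h 0 :> 1" using assms by simp
  from DERIV_pos_inc_left[OF this] obtain \<delta> where "\<delta> > 0" "\<And>t. 0 < t \<Longrightarrow> t < \<delta> \<Longrightarrow> h (0 - t) < h 0" by auto
  then have "h (0 - \<delta> / 2) < h 0" by simp
  also have "h 0 = real d" by (simp add: h_def)
  finally show ?thesis unfolding h_def by blast
qed

text \<open>Exponential Markov inequality: each counted word has weight exactly one, and the total
  weight of all words factors over the letters.\<close>

lemma card_words_sum_zero:
  fixes \<chi> :: "nat \<Rightarrow> real"
  shows "real (card {x \<in> words d n. (\<Sum>j<n. \<chi> (x ! j)) = 0}) \<le> (\<Sum>i<d. exp (s * \<chi> i)) ^ n"
proof -
  let ?S = "{x \<in> words d n. (\<Sum>j<n. \<chi> (x ! j)) = 0}"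
  have "real (card ?S) = (\<Sum>x\<in>?S. exp (s * (\<Sum>j<n. \<chi> (x ! j))))" by simp
  also have "\<dots> \<le> (\<Sum>x\<in>words d n. exp (s * (\<Sum>j<n. \<chi> (x ! j))))" by (rule sum_mono2) auto
  also have "\<dots> = (\<Sum>x\<in>words d n. \<Prod>j<n. exp (s * \<chi> (x ! j)))" by (simp add: sum_distrib_left exp_sum)
  also have "\<dots> = (\<Sum>i<d. exp (s * \<chi> i)) ^ n" by (subst sum_words_prod) simp
  finally show ?thesis .
qed

lemma prod_words_count:
  fixes l :: "nat \<Rightarrow> 'k::comm_monoid_mult"
  assumes "x \<in> words d n"
  shows "(\<Prod>j<n. l (x ! j)) = (\<Prod>i<d. l i ^ count_list x i)"
  using assms
proof (induction n arbitrary: x)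
  case (Suc n)
  then obtain a y where x: "x = a # y" "a < d" "y \<in> words d n" unfolding words_Suc by auto
  have "(\<Prod>j<Suc n. l (x ! j)) = l a * (\<Prod>i<d. l i ^ count_list y i)"
    unfolding prod.lessThan_Suc_shift x(1) using Suc.IH[OF x(3)] by simp
  also have "l a = (\<Prod>i<d. if i = a then l i else 1)" using x(2) by (simp add: prod.delta)
  also have "\<dots> * (\<Prod>i<d. l i ^ count_list y i) = (\<Prod>i<d. l i ^ count_list x i)"
    unfolding prod.distrib[symmetric] x(1) by (intro prod.cong) (auto simp: mult.commute)
  finally show ?case .
qed (simp add: words_0)

lemma sum_words_count:
  fixes l :: "nat \<Rightarrow> real"
  assumes "x \<in> words d n"
  shows "(\<Sum>j<n. l (x ! j)) = (\<Sum>i<d. real (count_list x i) * l i)"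
  using assms
proof (induction n arbitrary: x)
  case (Suc n)
  then obtain a y where x: "x = a # y" "a < d" "y \<in> words d n" unfolding words_Suc by auto
  have "(\<Sum>j<Suc n. l (x ! j)) = l a + (\<Sum>i<d. real (count_list y i) * l i)"
    unfolding sum.lessThan_Suc_shift x(1) using Suc.IH[OF x(3)] by simp
  also have "l a = (\<Sum>i<d. if i = a then l i else 0)" using x(2) by (simp add: sum.delta)
  also have "\<dots> + (\<Sum>i<d. real (count_list y i) * l i) = (\<Sum>i<d. real (count_list x i) * l i)"
    unfolding sum.distrib[symmetric] x(1) by (intro sum.cong) (auto simp: algebra_simps)
  finally show ?case .
qed (simp add: words_0)

text \<open>A character \<open>\<chi>\<close> of the multiplicative relations that hold along an ultrafilter exists because
  no power of the product is eventually trivial; it turns the relations into a drift condition.\<close>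

lemma multiplicative_relations_bound:
  fixes \<mu> :: "nat \<Rightarrow> nat \<Rightarrow> 'k::field"
  assumes nz: "\<And>k i. i < d \<Longrightarrow> \<mu> k i \<noteq> 0"
    and ord: "\<And>k j. 1 \<le> j \<Longrightarrow> j \<le> k \<Longrightarrow> (\<Prod>i<d. \<mu> k i) ^ j \<noteq> 1"
  shows "\<exists>c<real d. c \<ge> 0 \<and> (\<forall>n. \<exists>k. real (card {x \<in> words d n. (\<Prod>j<n. \<mu> k (x ! j)) = 1}) \<le> c ^ n)"
proof -
  obtain U :: "nat filter" where U: "U \<le> sequentially" "U \<noteq> bot"
    and ultra: "\<And>Q. eventually Q U \<or> eventually (\<lambda>x. \<not> Q x) U"
    using ultrafilter_exists[of sequentially] by auto
  \<comment> \<open>Exponent vectors of the multiplicative relations that hold for almost all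
    \<open>k\<close>.\<close>
  define L where "L = {a :: nat \<Rightarrow> int. eventually (\<lambda>k. (\<Prod>i<d. \<mu> k i powi a i) = 1) U}"
  have Ladd: "(\<lambda>i. a i + b i) \<in> L" if "a \<in> L" "b \<in> L" for a b
    unfolding L_def
  proof (rule CollectI, rule eventually_mono[OF eventually_conj])
    show "eventually (\<lambda>k. (\<Prod>i<d. \<mu> k i powi a i) = 1) U" "eventually (\<lambda>k. (\<Prod>i<d. \<mu> k i powi b i) = 1) U"
      using that by (auto simp: L_def)
    fix k assume k: "(\<Prod>i<d. \<mu> k i powi a i) = 1 \<and> (\<Prod>i<d. \<mu> k i powi b i) = 1"
    have "(\<Prod>i<d. \<mu> k i powi (a i + b i)) = (\<Prod>i<d. \<mu> k i powi a i * \<mu> k i powi b i)"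
      by (intro prod.cong refl) (simp add: power_int_add nz)
    also have "\<dots> = 1" using k by (simp add: prod.distrib)
    finally show "(\<Prod>i<d. \<mu> k i powi (a i + b i)) = 1" .
  qed
  have Lscale: "(\<lambda>i. r * a i) \<in> L" if "a \<in> L" for a r
    unfolding L_def
  proof (rule CollectI, rule eventually_mono)
    show "eventually (\<lambda>k. (\<Prod>i<d. \<mu> k i powi a i) = 1) U" using that by (auto simp: L_def)
    fix k assume k: "(\<Prod>i<d. \<mu> k i powi a i) = 1"
    have prod_pow: "(\<Prod>i\<in>I. f i powi r) = (\<Prod>i\<in>I. f i) powi r" for I :: "nat set" and f :: "nat \<Rightarrow> 'k"
      by (induction I rule: infinite_finite_induct) (auto simp: power_int_mult_distrib)
    have "(\<Prod>i<d. \<mu> k i powi (r * a i)) = (\<Prod>i<d. (\<mu> k i powi a i) powi r)"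
      by (intro prod.cong refl) (simp add: power_int_mult[symmetric] mult.commute)
    also have "\<dots> = 1" unfolding prod_pow k by simp
    finally show "(\<Prod>i<d. \<mu> k i powi (r * a i)) = 1" .
  qed
  interpret Q: vector_space "fun_scale :: rat \<Rightarrow> (nat \<Rightarrow> rat) \<Rightarrow> _" by (rule fun_scale_vector_space)
  \<comment> \<open>The rational span of \<open>L\<close> with coordinates from \<open>d\<close> on
    ignored, so that linear algebra supplies the character.\<close>
  define M where "M = {v :: nat \<Rightarrow> rat. \<exists>r>0. \<exists>a\<in>L. \<forall>i<d. of_int r * v i = of_int (a i)}"
  have "0 \<in> L" by (simp add: L_def zero_fun_def)
  have "Q.subspace M"
  proof (rule Q.subspaceI)
    show "0 \<in> M" unfolding M_def using \<open>0 \<in> L\<close> by (intro CollectI exI[of _ 1] conjI bexI[of _ 0]) auto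
    fix v w assume "v \<in> M" "w \<in> M"
    then obtain r a s b where *: "r > 0" "a \<in> L" "\<And>i. i < d \<Longrightarrow> of_int r * v i = of_int (a i)"
       "s > 0" "b \<in> L" "\<And>i. i < d \<Longrightarrow> of_int s * w i = of_int (b i)"
      unfolding M_def by blast
    have "of_int (r * s) * (v + w) i = of_int (s * a i + r * b i)" if "i < d" for i
      using *(3,6)[OF that] by (simp add: algebra_simps)
    moreover have "(\<lambda>i. s * a i + r * b i) \<in> L" by (intro Ladd Lscale *)
    moreover have "r * s > 0" using * by simp
    ultimately show "v + w \<in> M" unfolding M_def
      by (intro CollectI exI[of _ "r * s"] conjI bexI[of _ "\<lambda>i. s * a i + r * b i"] allI impI)
  next
    fix c :: rat and v assume "v \<in> M"
    then obtain r a where *: "r > 0" "a \<in> L" "\<And>i. i < d \<Longrightarrow> of_int r * v i = of_int (a i)"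
      unfolding M_def by blast
    obtain p q where "c = Rat.Fract p q" "q > 0" by (cases c)
    then have c: "c = of_int p / of_int q" "q > 0" by (auto simp: Fract_of_int_quotient)
    have "of_int (q * r) * fun_scale c v i = of_int (p * a i)" if "i < d" for i
    proof -
      have "of_int (q * r) * fun_scale c v i = (of_int q * c) * (of_int r * v i)" by (simp add: fun_scale_def)
      also have "of_int q * c = of_int p" using c by simp
      finally show ?thesis using *(3)[OF that] by simp
    qed
    moreover have "(\<lambda>i. p * a i) \<in> L" by (intro Lscale *)
    moreover have "q * r > 0" using * c by simp
    ultimately show "fun_scale c v \<in> M" unfolding M_def
      by (intro CollectI exI[of _ "q * r"] conjI bexI[of _ "\<lambda>i. p * a i"] allI impI)
  qed
  moreover define one where "one i = (if i < d then 1 else 0 :: rat)" for i :: nat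
  \<comment> \<open>A multiple of the all-one vector in \<open>L\<close> would make a fixed positive
    power of the product trivial for almost all \<open>k\<close>, against \<open>ord\<close> once
    \<open>k\<close> is large.\<close>
  have "one \<notin> M"
  proof
    assume "one \<in> M"
    then obtain r a where *: "r > 0" "a \<in> L" "\<And>i. i < d \<Longrightarrow> of_int r * one i = of_int (a i)"
      unfolding M_def by blast
    have a: "a i = r" if "i < d" for i using *(3)[OF that] that by (simp add: one_def)
    define m where "m = nat r"
    have m: "m \<ge> 1" "r = int m" using *(1) by (auto simp: m_def)
    have "eventually (\<lambda>k. (\<Prod>i<d. \<mu> k i powi a i) = 1) U" using *(2) by (simp add: L_def)
    moreover have "(\<Prod>i<d. \<mu> k i powi a i) = (\<Prod>i<d. \<mu> k i) ^ m" for k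
      by (simp add: a m(2) prod_power_distrib)
    moreover have "eventually (\<lambda>k. k \<ge> m) U" using U(1) eventually_ge_at_top le_filter_def by blast
    ultimately have "eventually (\<lambda>k. (\<Prod>i<d. \<mu> k i) ^ m = 1 \<and> k \<ge> m) U" by (simp add: eventually_conj_iff)
    then have "eventually (\<lambda>k. False) U" by (rule eventually_mono) (use ord m in auto)
    then show False using U(2) by (simp add: trivial_limit_def)
  qed
  ultimately obtain f where f: "Vector_Spaces.linear fun_scale (*) f" "\<And>v. v \<in> M \<Longrightarrow> f v = 0" "f one = 1"
    using Q.separating_functional by blast
  interpret f: Vector_Spaces.linear fun_scale "(*)" f by (rule f(1))
  define e where "e i = (\<lambda>j. if j = i then 1 else 0 :: rat)" for i :: nat
  define \<chi> where "\<chi> i = (of_rat (f (e i)) :: real)" for i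
  have f_expand: "f (\<lambda>i. if i < d then v i else 0) = (\<Sum>i<d. v i * f (e i))" for v
  proof -
    have app: "(\<Sum>i\<in>I. fun_scale (v i) (e i)) j = (\<Sum>i\<in>I. v i * e i j)" for I :: "nat set" and j
      by (induction I rule: infinite_finite_induct) (auto simp: fun_scale_def)
    have "(\<lambda>i. if i < d then v i else 0) = (\<Sum>i<d. fun_scale (v i) (e i))"
      unfolding app fun_eq_iff by (simp add: e_def sum_mult_delta)
    then show ?thesis by (simp add: f.sum f.scale)
  qed
  have "(\<Sum>i<d. f (e i)) = 1" using f_expand[of "\<lambda>_. 1"] f(3) unfolding one_def[abs_def] by simp
  then have "(\<Sum>i<d. \<chi> i) = 1" unfolding \<chi>_def of_rat_sum[symmetric] by simp
  then obtain s where s: "(\<Sum>i<d. exp (s * \<chi> i)) < real d" using exp_sum_less by blast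
  have "\<exists>k. real (card {x \<in> words d n. (\<Prod>j<n. \<mu> k (x ! j)) = 1}) \<le> (\<Sum>i<d. exp (s * \<chi> i)) ^ n" for n
  proof -
    let ?S = "{x \<in> words d n. (\<Sum>j<n. \<chi> (x ! j)) = 0}"
    \<comment> \<open>If the product along \<open>x\<close> were one for almost all
      \<open>k\<close>, the letter counts of \<open>x\<close> would be a relation and
      \<open>\<chi>\<close> would vanish on them. There are finitely many words, so one
      \<open>k\<close> excludes all words outside \<open>?S\<close> at once; it depends on
      \<open>n\<close>, the rate does not.\<close>
    have "eventually (\<lambda>k. (\<Prod>j<n. \<mu> k (x ! j)) \<noteq> 1) U" if x: "x \<in> words d n - ?S" for x
    proof (rule ccontr)
      assume "\<not> ?thesis"
      then have "eventually (\<lambda>k. (\<Prod>j<n. \<mu> k (x ! j)) = 1) U" using ultra by blast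
      moreover have "(\<Prod>j<n. \<mu> k (x ! j)) = (\<Prod>i<d. \<mu> k i ^ count_list x i)" for k
        using x by (intro prod_words_count) simp
      ultimately have "(\<lambda>i. int (count_list x i)) \<in> L" unfolding L_def by simp
      then have "(\<lambda>i. if i < d then of_nat (count_list x i) else 0) \<in> M"
        unfolding M_def by (intro CollectI exI[of _ 1] conjI bexI[of _ "\<lambda>i. int (count_list x i)"]) auto
      then have "(\<Sum>i<d. of_nat (count_list x i) * f (e i)) = 0" using f(2) f_expand by metis
      then have "of_rat (\<Sum>i<d. of_nat (count_list x i) * f (e i)) = (0 :: real)" by simp
      then have "(\<Sum>i<d. real (count_list x i) * \<chi> i) = 0"
        unfolding \<chi>_def of_rat_sum of_rat_mult by simp
      then show False using x sum_words_count[of x d n \<chi>] by auto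
    qed
    then have "eventually (\<lambda>k. \<forall>x\<in>words d n - ?S. (\<Prod>j<n. \<mu> k (x ! j)) \<noteq> 1) U"
      by (intro eventually_ball_finite) auto
    then obtain k where k: "\<forall>x\<in>words d n - ?S. (\<Prod>j<n. \<mu> k (x ! j)) \<noteq> 1"
      using U(2) eventually_happens' by blast
    have "card {x \<in> words d n. (\<Prod>j<n. \<mu> k (x ! j)) = 1} \<le> card ?S"
      by (rule card_mono) (use k in auto)
    also have "real (card ?S) \<le> (\<Sum>i<d. exp (s * \<chi> i)) ^ n" by (rule card_words_sum_zero)
    finally show ?thesis by auto
  qed
  moreover have "(\<Sum>i<d. exp (s * \<chi> i)) \<ge> 0" by (intro sum_nonneg) auto
  ultimately show ?thesis using s by blast
qed

text \<open>For each \<open>k\<close> some group element has a determinant with no trivial power up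
  to \<open>k\<close>, since only finitely many roots of unity have such small orders. Each element
  is made triangular in a basis of its own; only its eigenvalues enter the bound.\<close>

lemma (in based_space) TS_bound_infinite_det:
  assumes ac: "\<And>p :: 'k poly. degree p > 0 \<Longrightarrow> \<exists>x. poly p x = 0"
    and \<rho>: "\<And>g. g \<in> carrier G \<Longrightarrow> \<rho> g \<in> carrier (GL scale)"
    and inf: "infinite (lin_det scale ` \<rho> ` carrier G)"
  shows "\<exists>c<real (length bs). c \<ge> 0 \<and> (\<forall>n. real (TS G fun_scale (tensor_act \<rho>) (tensor_power scale n)) \<le> c ^ n)"
proof -
  let ?d = "length bs"
  have "\<exists>g. g \<in> carrier G \<and> (\<forall>j\<in>{1..k}. lin_det scale (\<rho> g) ^ j \<noteq> 1)" for k
  proof (rule ccontr)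
    assume "\<not> ?thesis"
    then have "lin_det scale ` \<rho> ` carrier G \<subseteq> (\<Union>j\<in>{1..k}. {x. x ^ j = 1})" by auto
    moreover have "finite {x :: 'k. x ^ j = 1}" if "j \<in> {1..k}" for j
    proof -
      define q :: "'k poly" where "q = monom 1 j - 1"
      have "coeff q j = 1" using that by (simp add: q_def)
      then have "q \<noteq> 0" by force
      then have "finite {x. poly q x = 0}" by (rule poly_roots_finite)
      then show ?thesis by (simp add: q_def poly_monom)
    qed
    ultimately have "finite (lin_det scale ` \<rho> ` carrier G)" by (rule finite_subset[OF _ finite_UN_I[OF finite_atLeastAtMost]])
    then show False using inf by simp
  qed
  then have "\<forall>k. \<exists>g. g \<in> carrier G \<and> (\<forall>j\<in>{1..k}. lin_det scale (\<rho> g) ^ j \<noteq> 1)" by blast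
  from choice[OF this] obtain g where g': "\<And>k. g k \<in> carrier G \<and> (\<forall>j\<in>{1..k}. lin_det scale (\<rho> (g k)) ^ j \<noteq> 1)" by blast
  have g: "g k \<in> carrier G" "1 \<le> j \<Longrightarrow> j \<le> k \<Longrightarrow> lin_det scale (\<rho> (g k)) ^ j \<noteq> 1" for k j
    using g'[of k] by auto
  have lin: "Vector_Spaces.linear scale scale (\<rho> (g k))" and bij: "bij (\<rho> (g k))" for k
    using \<rho>[OF g(1)] by (auto simp: GL_def)
  have "\<exists>bs'. basis_list scale bs' \<and> (\<forall>j<length bs'. \<rho> (g k) (bs' ! j) \<in> span (set (take (Suc j) bs')))" for k
    by (rule triangular_basis[OF ac lin])
  then obtain B where B: "\<And>k. basis_list scale (B k)"
    "\<And>k j. j < length (B k) \<Longrightarrow> \<rho> (g k) (B k ! j) \<in> span (set (take (Suc j) (B k)))" by metis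
  define \<mu> where "\<mu> k i = based_space.mco scale (B k) (\<rho> (g k)) i i" for k i
  have bsp: "based_space scale (B k)" for k by unfold_locales (rule B(1))
  have len: "length (B k) = ?d" for k
    using based_space.dim_UNIV[OF bsp] dim_UNIV by simp
  have det: "lin_det scale (\<rho> (g k)) = (\<Prod>i<?d. \<mu> k i)" for k
    unfolding \<mu>_def using based_space.lin_det_triangular[OF bsp lin B(2)] by (simp add: len)
  have "lin_det scale (\<rho> (g k)) \<noteq> 0" for k
  proof -
    interpret r: vector_space_pair scale scale using vector_space_axioms by (simp add: vector_space_pair_def)
    obtain h where h: "Vector_Spaces.linear scale scale h" "\<rho> (g k) \<circ> h = id"
      using r.linear_surjective_right_inverse[OF lin bij_is_surj[OF bij]] by blast
    have "lin_det scale (\<rho> (g k)) * lin_det scale h = 1"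
      unfolding lin_det_comp[OF lin h(1), symmetric] h(2) by (rule lin_det_id)
    then show ?thesis by auto
  qed
  then have nz: "\<mu> k i \<noteq> 0" if "i < ?d" for k i using that unfolding det by auto
  have ord: "(\<Prod>i<?d. \<mu> k i) ^ j \<noteq> 1" if "1 \<le> j" "j \<le> k" for k j using g(2)[OF that] unfolding det .
  have TS: "TS G fun_scale (tensor_act \<rho>) (tensor_power scale n) \<le> card {x \<in> words ?d n. (\<Prod>j<n. \<mu> k (x ! j)) = 1}" for n k
    using based_space.TS_triangular_bound[OF bsp, of G \<rho> "g k" k n, OF \<rho> g(1) B(2)] unfolding \<mu>_def len by simp
  obtain c where c: "c < real ?d" "c \<ge> 0" "\<And>n. \<exists>k. real (card {x \<in> words ?d n. (\<Prod>j<n. \<mu> k (x ! j)) = 1}) \<le> c ^ n"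
    using multiplicative_relations_bound[of ?d \<mu>] nz ord by blast
  have "real (TS G fun_scale (tensor_act \<rho>) (tensor_power scale n)) \<le> c ^ n" for n
  proof -
    obtain k where "real (card {x \<in> words ?d n. (\<Prod>j<n. \<mu> k (x ! j)) = 1}) \<le> c ^ n" using c(3) by blast
    moreover have "real (TS G fun_scale (tensor_act \<rho>) (tensor_power scale n)) \<le>
       real (card {x \<in> words ?d n. (\<Prod>j<n. \<mu> k (x ! j)) = 1})" using TS by (rule of_nat_mono)
    ultimately show ?thesis by linarith
  qed
  then show ?thesis using c by blast
qed

text \<open>The constant \<open>C\<close> disappears because its \<open>n\<close>-th root tends to
  one.\<close>

lemma trivial_growth_less:
  assumes TS: "\<And>n. real (TS G fun_scale (tensor_act \<rho>) (tensor_power scale n)) \<le> C * c ^ n"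
    and "C > 0" "c \<ge> 0" "c < d"
  shows "trivial_growth G scale \<rho> < ereal d"
proof -
  have "(\<lambda>n. root n C) \<longlonglongrightarrow> 1" using \<open>C > 0\<close> by (rule LIMSEQ_root_const)
  then have "(\<lambda>n. root n C * c) \<longlonglongrightarrow> 1 * c" by (intro tendsto_intros)
  then have lim: "(\<lambda>n. ereal (root n C * c)) \<longlonglongrightarrow> ereal c" by simp
  have "trivial_growth G scale \<rho> \<le> limsup (\<lambda>n. ereal (root n C * c))"
    unfolding trivial_growth_def
  proof (rule Limsup_mono, rule eventually_mono[OF eventually_gt_at_top[of 0]])
    \<comment> \<open>The index zero is excluded because the zeroth root is a conventional
      value.\<close>
    fix n :: nat assume n: "n > 0"
    have "root n (real (TS G fun_scale (tensor_act \<rho>) (tensor_power scale n))) \<le> root n (C * c ^ n)"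
      using n TS by (intro real_root_le_mono)
    also have "\<dots> = root n C * c" using n \<open>c \<ge> 0\<close> by (simp add: real_root_mult real_root_power_cancel)
    finally show "ereal (root n (real (TS G fun_scale (tensor_act \<rho>) (tensor_power scale n)))) \<le> ereal (root n C * c)"
      by simp
  qed
  also have "\<dots> = ereal c" using lim_imp_Limsup[OF sequentially_bot lim] .
  also have "\<dots> < ereal d" using \<open>c < d\<close> by simp
  finally show ?thesis .
qed

section \<open>Unipotent elements in the Zariski closure\<close>

text \<open>For small exponents, telescoping the differences of the \<open>Suc k\<close>-th powers
  and induction leave only \<open>Suc k\<close> times the sum, and \<open>Suc k\<close> is
  invertible. For the exponent \<open>p - 1\<close> every nonzero residue contributes one by Fermat,
  which gives \<open>p - 1 = -1\<close>.\<close>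

lemma sum_powers_char:
  assumes p: "CHAR('k::field) = p" "prime p" and k: "k \<le> p - 1"
  shows "(\<Sum>t<p. of_nat t ^ k) = (if k = p - 1 then - 1 else 0 :: 'k)"
proof -
  have p1: "p > 1" using p(2) prime_gt_1_nat by blast
  have of_p: "of_nat p = (0 :: 'k)" using p(1) of_nat_CHAR[where 'a = 'k] by simp
  have low: "(\<Sum>t<p. of_nat t ^ k) = (0 :: 'k)" if "k < p - 1" for k
    using that
  proof (induction k rule: less_induct)
    case (less k)
    \<comment> \<open>The telescoped value is \<open>p ^ Suc k\<close>, which is zero in the
      field.\<close>
    have "0 = (\<Sum>t<p. of_nat (Suc t) ^ Suc k - of_nat t ^ Suc k :: 'k)"
      unfolding sum_lessThan_telescope[of "\<lambda>t. of_nat t ^ Suc k :: 'k" p] of_p by simp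
    also have "\<dots> = (\<Sum>t<p. \<Sum>j\<le>k. of_nat (Suc k choose j) * of_nat t ^ j)"
    proof (intro sum.cong refl)
      fix t
      have "(of_nat (Suc t) :: 'k) ^ Suc k = (of_nat t + 1) ^ Suc k" by (simp add: add.commute)
      also have "\<dots> = (\<Sum>j\<le>Suc k. of_nat (Suc k choose j) * of_nat t ^ j * 1 ^ (Suc k - j))" by (rule binomial_ring)
      finally show "of_nat (Suc t) ^ Suc k - of_nat t ^ Suc k = (\<Sum>j\<le>k. of_nat (Suc k choose j) * (of_nat t :: 'k) ^ j)"
        by simp
    qed
    also have "\<dots> = (\<Sum>j\<le>k. of_nat (Suc k choose j) * (\<Sum>t<p. of_nat t ^ j))"
      unfolding sum_distrib_left by (rule sum.swap)
    also have "\<dots> = (\<Sum>j\<in>{k}. of_nat (Suc k choose j) * (\<Sum>t<p. of_nat t ^ j))"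
      using less by (intro sum.mono_neutral_right) auto
    finally have "of_nat (Suc k) * (\<Sum>t<p. of_nat t ^ k) = (0 :: 'k)" by simp
    moreover have "\<not> p dvd Suc k" using less.prems by (auto dest: dvd_imp_le)
    then have "of_nat (Suc k) \<noteq> (0 :: 'k)" unfolding of_nat_eq_0_iff_char_dvd p(1) .
    ultimately show ?case by (metis mult_eq_0_iff)
  qed
  show ?thesis
  proof (cases "k = p - 1")
    case False
    then show ?thesis using low[of k] k by simp
  next
    case True
    have frob: "(of_nat t :: 'k) ^ p = of_nat t" for t
    proof (induction t)
      case (Suc t)
      have "(of_nat t + 1 :: 'k) ^ p = of_nat t ^ p + 1 ^ p"
        by (rule freshmans_dream) (use p in auto)
      then show ?case using Suc by (simp add: add.commute)
    qed (use p1 in \<open>simp add: power_0_left\<close>)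
    have one: "(of_nat t :: 'k) ^ (p - 1) = 1" if "t \<in> {1..<p}" for t
    proof -
      have "\<not> p dvd t" using that by (auto dest: dvd_imp_le)
      then have "of_nat t \<noteq> (0 :: 'k)" unfolding of_nat_eq_0_iff_char_dvd p(1) .
      moreover have "of_nat t * (of_nat t :: 'k) ^ (p - 1) = of_nat t * 1"
        using frob[of t] p1 by (simp flip: power_Suc)
      ultimately show ?thesis by (metis mult_left_cancel)
    qed
    have "(\<Sum>t<p. of_nat t ^ k :: 'k) = (\<Sum>t\<in>{1..<p}. of_nat t ^ k)"
      using True p1 by (intro sum.mono_neutral_right) (auto simp: power_0_left not_le)
    also have "\<dots> = (\<Sum>t\<in>{1..<p}. 1)" unfolding True using one by (rule sum.cong[OF refl])
    also have "\<dots> = - 1" using p1 of_p by (simp add: of_nat_diff)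
    finally show ?thesis using True by simp
  qed
qed

lemma sum_mod_shift:
  fixes h :: "nat \<Rightarrow> 'b::comm_monoid_add"
  assumes p: "p > 0" and h: "\<And>t. h (t + p) = h t"
  shows "(\<Sum>t<p. h (s + t)) = (\<Sum>t<p. h t)"
proof (induction s)
  case (Suc s)
  have "(\<Sum>t<p. h (Suc s + t)) = (\<Sum>t<p. h (s + Suc t))" by simp
  also have "\<dots> = (\<Sum>t<p. h (s + t))"
  proof -
    have "(\<Sum>t<Suc p. h (s + t)) = h s + (\<Sum>t<p. h (s + Suc t))"
      unfolding sum.lessThan_Suc_shift by simp
    moreover have "(\<Sum>t<Suc p. h (s + t)) = h s + (\<Sum>t<p. h (s + t))" using h[of s] by (simp add: add.commute)
    moreover have "(\<Sum>t<Suc p. h (s + t)) = (\<Sum>t<p. h (s + t)) + h (s + p)" by simp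
    ultimately show ?thesis
    proof -
      obtain q where q: "p = Suc q" using p by (cases p) auto
      have "(\<Sum>t<p. h (s + Suc t)) = (\<Sum>t<q. h (s + Suc t)) + h (s + p)" unfolding q by simp
      also have "\<dots> = h (s + 0) + (\<Sum>t<q. h (s + Suc t))" using h[of s] by (simp add: add.commute)
      also have "\<dots> = (\<Sum>t<p. h (s + t))" unfolding q by (simp only: sum.lessThan_Suc_shift)
      finally show ?thesis .
    qed
  qed
  finally show ?case using Suc by simp
qed simp

text \<open>Kernels on words are composed by summation over the middle index; \<open>ten n\<close> is the tensor product,
  which splits words after the first \<open>n\<close> letters.\<close>

definition kmul :: "nat \<Rightarrow> nat \<Rightarrow> (nat list \<Rightarrow> nat list \<Rightarrow> 'k::comm_ring_1) \<Rightarrow> _ \<Rightarrow> nat list \<Rightarrow> nat list \<Rightarrow> 'k" where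
  "kmul d n A B = (\<lambda>x y. \<Sum>z\<in>words d n. A x z * B z y)"

definition kid :: "nat \<Rightarrow> nat \<Rightarrow> nat list \<Rightarrow> nat list \<Rightarrow> 'k::comm_ring_1" where
  "kid d n = (\<lambda>x y. if x \<in> words d n \<and> x = y then 1 else 0)"

text \<open>Kernels are functions on all lists; the unit laws for \<open>kid\<close> and the passage
  to longer words hold for those supported on words of the right length.\<close>

definition ksupp :: "nat \<Rightarrow> nat \<Rightarrow> (nat list \<Rightarrow> nat list \<Rightarrow> 'k::comm_ring_1) \<Rightarrow> bool" where
  "ksupp d n A \<longleftrightarrow> (\<forall>x y. A x y \<noteq> 0 \<longrightarrow> x \<in> words d n \<and> y \<in> words d n)"

definition ten :: "nat \<Rightarrow> (nat list \<Rightarrow> nat list \<Rightarrow> 'k::comm_ring_1) \<Rightarrow> _ \<Rightarrow> nat list \<Rightarrow> nat list \<Rightarrow> 'k" where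
  "ten n A B = (\<lambda>x y. A (take n x) (take n y) * B (drop n x) (drop n y))"

section \<open>Algebra of kernels\<close>

lemma kmul_assoc: "kmul d n (kmul d n A B) C = kmul d n A (kmul d n B C)"
  unfolding kmul_def
proof (intro ext)
  fix x y
  have "(\<Sum>z\<in>words d n. (\<Sum>w\<in>words d n. A x w * B w z) * C z y) = (\<Sum>z\<in>words d n. \<Sum>w\<in>words d n. A x w * (B w z * C z y))"
    by (simp add: sum_distrib_right mult.assoc)
  also have "\<dots> = (\<Sum>w\<in>words d n. \<Sum>z\<in>words d n. A x w * (B w z * C z y))" by (rule sum.swap)
  finally show "(\<Sum>z\<in>words d n. (\<Sum>w\<in>words d n. A x w * B w z) * C z y) = (\<Sum>w\<in>words d n. A x w * (\<Sum>z\<in>words d n. B w z * C z y))"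
    by (simp add: sum_distrib_left)
qed

lemma kmul_id:
  assumes "ksupp d n A"
  shows "kmul d n A (kid d n) = A" "kmul d n (kid d n) A = A"
proof -
  have "(\<Sum>z\<in>words d n. A x z * kid d n z y) = A x y" for x y
  proof -
    have "(\<Sum>z\<in>words d n. A x z * kid d n z y) = (\<Sum>z\<in>words d n. A x z * (if z = y then 1 else 0))"
      by (intro sum.cong) (auto simp: kid_def)
    then show ?thesis using assms by (auto simp: sum_mult_delta ksupp_def)
  qed
  then show "kmul d n A (kid d n) = A" by (simp add: kmul_def)
  have "(\<Sum>z\<in>words d n. kid d n x z * A z y) = A x y" for x y
  proof -
    have "(\<Sum>z\<in>words d n. kid d n x z * A z y) = (\<Sum>z\<in>words d n. A z y * (if x = z then 1 else 0))"
      by (intro sum.cong) (auto simp: kid_def)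
    then show ?thesis using assms by (auto simp: sum_mult_delta ksupp_def)
  qed
  then show "kmul d n (kid d n) A = A" by (simp add: kmul_def)
qed

lemma kmul_sum_left: "kmul d n (\<Sum>t\<in>I. A t) B = (\<Sum>t\<in>I. kmul d n (A t) B)"
  by (induction I rule: infinite_finite_induct) (auto simp: kmul_def fun_eq_iff algebra_simps sum.distrib)

lemma kmul_sum_right: "kmul d n B (\<Sum>t\<in>I. A t) = (\<Sum>t\<in>I. kmul d n B (A t))"
  by (induction I rule: infinite_finite_induct) (auto simp: kmul_def fun_eq_iff algebra_simps sum.distrib)

lemma kmul_diff_left: "kmul d n (A - A') B = kmul d n A B - kmul d n A' B"
  by (auto simp: kmul_def fun_eq_iff algebra_simps sum_subtractf)

lemma kmul_diff_right: "kmul d n B (A - A') = kmul d n B A - kmul d n B A'"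
  by (auto simp: kmul_def fun_eq_iff algebra_simps sum_subtractf)

lemma ten_sum_left: "ten n (\<Sum>t\<in>I. A t) B = (\<Sum>t\<in>I. ten n (A t) B)"
  by (induction I rule: infinite_finite_induct) (auto simp: ten_def fun_eq_iff algebra_simps)

lemma ten_sum_right: "ten n B (\<Sum>t\<in>I. A t) = (\<Sum>t\<in>I. ten n B (A t))"
  by (induction I rule: infinite_finite_induct) (auto simp: ten_def fun_eq_iff algebra_simps)

lemma ten_diff_left: "ten n (A - A') B = ten n A B - ten n A' B"
  by (auto simp: ten_def fun_eq_iff algebra_simps)

lemma ten_diff_right: "ten n B (A - A') = ten n B A - ten n B A'"
  by (auto simp: ten_def fun_eq_iff algebra_simps)

lemma words_add_iff: "x \<in> words d (n + m) \<longleftrightarrow> take n x \<in> words d n \<and> drop n x \<in> words d m \<and> length x = n + m"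
proof
  assume x: "x \<in> words d (n + m)"
  then show "take n x \<in> words d n \<and> drop n x \<in> words d m \<and> length x = n + m"
    unfolding words_def using set_take_subset[of n x] set_drop_subset[of n x] by auto
next
  assume "take n x \<in> words d n \<and> drop n x \<in> words d m \<and> length x = n + m"
  then have "set (take n x @ drop n x) \<subseteq> {..<d}" "length x = n + m" unfolding words_def set_append by auto
  then show "x \<in> words d (n + m)" by (simp add: words_def)
qed

lemma words_add_image: "words d (n + m) = (\<lambda>(x, y). x @ y) ` (words d n \<times> words d m)"
proof (intro equalityI subsetI)
  fix x assume "x \<in> words d (n + m)"
  then have "take n x \<in> words d n" "drop n x \<in> words d m" by (auto simp: words_add_iff)
  then show "x \<in> (\<lambda>(x, y). x @ y) ` (words d n \<times> words d m)"
    by (intro image_eqI[of _ _ "(take n x, drop n x)"]) auto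
qed (auto simp: words_def)

lemma sum_words_add: "(\<Sum>z\<in>words d (n + m). h z) = (\<Sum>a\<in>words d n. \<Sum>b\<in>words d m. h (a @ b))"
proof -
  have inj: "inj_on (\<lambda>(x, y). x @ y) (words d n \<times> words d m)" by (auto simp: inj_on_def words_length)
  have "(\<Sum>z\<in>words d (n + m). h z) = (\<Sum>(a, b)\<in>words d n \<times> words d m. h (a @ b))"
    unfolding words_add_image sum.reindex[OF inj] by (intro sum.cong) auto
  then show ?thesis by (simp add: sum.cartesian_product)
qed

lemma kmul_ten: "kmul d (n + m) (ten n A B) (ten n A' B') = ten n (kmul d n A A') (kmul d m B B')"
proof (intro ext)
  fix x y
  have "(\<Sum>z\<in>words d (n + m). ten n A B x z * ten n A' B' z y)
    = (\<Sum>a\<in>words d n. \<Sum>b\<in>words d m. (A (take n x) a * A' a (take n y)) * (B (drop n x) b * B' b (drop n y)))"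
    unfolding sum_words_add by (intro sum.cong refl) (simp add: ten_def words_length mult_ac)
  also have "\<dots> = ten n (kmul d n A A') (kmul d m B B') x y"
    unfolding ten_def kmul_def by (rule sum_product[symmetric])
  finally show "kmul d (n + m) (ten n A B) (ten n A' B') x y = ten n (kmul d n A A') (kmul d m B B') x y"
    by (simp add: kmul_def)
qed

lemma ten_length:
  assumes "ksupp d n A" "ksupp d m B" "ten n A B x y \<noteq> 0"
  shows "x \<in> words d (n + m)" "y \<in> words d (n + m)"
proof -
  have "A (take n x) (take n y) \<noteq> 0" "B (drop n x) (drop n y) \<noteq> 0" using assms(3) by (auto simp: ten_def)
  then have *: "take n x \<in> words d n" "take n y \<in> words d n" "drop n x \<in> words d m" "drop n y \<in> words d m"
    using assms(1,2) unfolding ksupp_def by blast+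
  then have "set (take n x @ drop n x) \<subseteq> {..<d}" "length (take n x @ drop n x) = n + m"
     "set (take n y @ drop n y) \<subseteq> {..<d}" "length (take n y @ drop n y) = n + m"
    unfolding words_def set_append length_append by auto
  then show "x \<in> words d (n + m)" "y \<in> words d (n + m)" by (simp_all add: words_def)
qed

lemma ksupp_ten': "ksupp d n A \<Longrightarrow> ksupp d m B \<Longrightarrow> ksupp d (n + m) (ten n A B)"
  using ten_length unfolding ksupp_def[of d "n + m"] by blast

lemma ten_kid: "ten n (kid d n) (kid d m) = (kid d (n + m) :: nat list \<Rightarrow> nat list \<Rightarrow> 'k::comm_ring_1)"
proof (intro ext)
  fix x y :: "nat list"
  have "ksupp d n (kid d n :: _ \<Rightarrow> _ \<Rightarrow> 'k)" "ksupp d m (kid d m :: _ \<Rightarrow> _ \<Rightarrow> 'k)" by (auto simp: ksupp_def kid_def)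
  note len = ten_length(1)[OF this, of x y]
  show "ten n (kid d n) (kid d m) x y = (kid d (n + m) x y :: 'k)"
  proof (cases "x \<in> words d (n + m)")
    case True
    then have *: "take n x \<in> words d n" "drop n x \<in> words d m" unfolding words_add_iff by blast+
    have **: "x = y \<longleftrightarrow> take n x = take n y \<and> drop n x = drop n y"
      using append_take_drop_id[of n x] append_take_drop_id[of n y] by metis
    show ?thesis unfolding ten_def kid_def ** using * True by simp
  next
    case False
    then have "ten n (kid d n) (kid d m) x y = (0 :: 'k)" using len by blast
    then show ?thesis using False by (simp add: kid_def)
  qed
qed

lemma ksupp_kmul: "ksupp d n A \<Longrightarrow> ksupp d n B \<Longrightarrow> ksupp d n (kmul d n A B)"
proof -
  assume A: "ksupp d n A" and B: "ksupp d n B"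
  show ?thesis unfolding ksupp_def
  proof (intro allI impI)
    fix x y assume "kmul d n A B x y \<noteq> 0"
    then obtain z where "A x z * B z y \<noteq> 0" unfolding kmul_def by (rule sum.not_neutral_contains_not_neutral)
    then have "A x z \<noteq> 0" "B z y \<noteq> 0" by auto
    then show "x \<in> words d n \<and> y \<in> words d n" using A B unfolding ksupp_def by blast
  qed
qed

lemma ksupp_add: "ksupp d n A \<Longrightarrow> ksupp d n B \<Longrightarrow> ksupp d n (A + B)"
proof -
  assume A: "ksupp d n A" and B: "ksupp d n B"
  show ?thesis unfolding ksupp_def
  proof (intro allI impI)
    fix x y assume "(A + B) x y \<noteq> 0"
    then have "A x y \<noteq> 0 \<or> B x y \<noteq> 0" by auto
    then show "x \<in> words d n \<and> y \<in> words d n" using A B unfolding ksupp_def by blast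
  qed
qed

lemma ksupp_diff: "ksupp d n A \<Longrightarrow> ksupp d n B \<Longrightarrow> ksupp d n (A - B)"
proof -
  assume A: "ksupp d n A" and B: "ksupp d n B"
  show ?thesis unfolding ksupp_def
  proof (intro allI impI)
    fix x y assume "(A - B) x y \<noteq> 0"
    then have "A x y \<noteq> 0 \<or> B x y \<noteq> 0" by auto
    then show "x \<in> words d n \<and> y \<in> words d n" using A B unfolding ksupp_def by blast
  qed
qed

lemma ksupp_sum: "(\<And>t. t \<in> I \<Longrightarrow> ksupp d n (A t)) \<Longrightarrow> ksupp d n (\<Sum>t\<in>I. A t)"
proof (induction I rule: infinite_finite_induct)
  case (insert t I)
  then show ?case unfolding sum.insert[OF insert(1,2)] by (intro ksupp_add) blast+
qed (simp_all add: ksupp_def)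

text \<open>\<open>C t\<close> stands for the \<open>t\<close>-th power of a matrix whose
  \<open>p\<close>-th power is the identity. Exponents are natural numbers, so the inverse of the
  \<open>t\<close>-th power is written with exponent \<open>t * (p - 1)\<close>.\<close>

locale cyclic_action =
  fixes d p :: nat and C :: "nat \<Rightarrow> nat \<Rightarrow> nat \<Rightarrow> 'k::field"
  assumes p: "CHAR('k) = p" "prime p"
    and C_add: "\<And>s t i j. i < d \<Longrightarrow> j < d \<Longrightarrow> C (s + t) i j = (\<Sum>k<d. C s i k * C t k j)"
    and C_0: "\<And>i j. i < d \<Longrightarrow> j < d \<Longrightarrow> C 0 i j = (if i = j then 1 else 0)"
    and C_p: "\<And>i j. i < d \<Longrightarrow> j < d \<Longrightarrow> C p i j = C 0 i j"
begin

definition K :: "nat \<Rightarrow> nat \<Rightarrow> nat list \<Rightarrow> nat list \<Rightarrow> 'k" where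
  "K n t = (\<lambda>x y. if x \<in> words d n \<and> y \<in> words d n then kron (C t) x y else 0)"

lemma ksupp_K: "ksupp d n (K n t)"
  by (simp add: ksupp_def K_def)

lemma K_add: "kmul d n (K n s) (K n t) = K n (s + t)"
proof (intro ext)
  fix x y
  show "kmul d n (K n s) (K n t) x y = K n (s + t) x y"
  proof (cases "x \<in> words d n \<and> y \<in> words d n")
    case True
    then have "kmul d n (K n s) (K n t) x y = (\<Sum>z\<in>words d n. kron (C s) x z * kron (C t) z y)"
      unfolding kmul_def by (intro sum.cong) (auto simp: K_def)
    also have "\<dots> = kron (C (s + t)) x y" using True by (intro kron_mult) (auto simp: C_add)
    finally show ?thesis using True by (simp add: K_def)
  next
    case False
    then show ?thesis by (auto simp: kmul_def K_def)
  qed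
qed

lemma K_0: "K n 0 = kid d n"
  by (intro ext) (auto simp: K_def kid_def kron_id[where A = "C 0", OF _ _ C_0])

lemma K_p: "K n (t + p) = K n t"
proof -
  have "K n p = K n 0"
  proof (intro ext)
    fix x y
    have "kron (C p) x y = kron (C 0) x y" if "x \<in> words d n" "y \<in> words d n"
      unfolding kron_def using that words_nth[OF that(1)] words_nth[OF that(2)]
      by (intro prod.cong refl C_p) (auto simp: words_length)
    then show "K n p x y = K n 0 x y" by (simp add: K_def)
  qed
  then show ?thesis unfolding K_add[symmetric] using K_0[of n] kmul_id(1)[OF ksupp_K] by metis
qed

lemma K_ten: "ten n (K n t) (K m t) = K (n + m) t"
proof (intro ext)
  fix x y
  show "ten n (K n t) (K m t) x y = K (n + m) t x y"
  proof (cases "x \<in> words d (n + m) \<and> y \<in> words d (n + m)")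
    case True
    have "kron (C t) x y = kron (C t) (take n x) (take n y) * kron (C t) (drop n x) (drop n y)"
    proof -
      have l: "length x = n + m" "length y = n + m" using True words_length by auto
      have "kron (C t) x y = (\<Prod>j<n + m. C t (x ! j) (y ! j))" by (simp add: kron_def l)
      also have "\<dots> = (\<Prod>j<n. C t (x ! j) (y ! j)) * (\<Prod>j<m. C t (x ! (n + j)) (y ! (n + j)))"
        by (induction m) (simp_all add: mult.assoc)
      finally show ?thesis by (simp add: kron_def l)
    qed
    then show ?thesis using True by (auto simp: ten_def K_def words_add_iff)
  next
    case False
    then show ?thesis using ten_length[OF ksupp_K ksupp_K, of n t m t x y] by (auto simp: K_def)
  qed
qed

lemma p_pos: "p > 0" using p(2) prime_gt_0_nat by blast

text \<open>The trace of a kernel over the cyclic group: the sum of its conjugates, with inverses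
  written as above.\<close>

definition Tr :: "nat \<Rightarrow> (nat list \<Rightarrow> nat list \<Rightarrow> 'k) \<Rightarrow> nat list \<Rightarrow> nat list \<Rightarrow> 'k" where
  "Tr n \<theta> = (\<Sum>t<p. kmul d n (K n t) (kmul d n \<theta> (K n (t * (p - 1)))))"

lemma K_inv: "kmul d n (K n t) (K n (t * (p - 1))) = kid d n"
proof -
  have "t + t * (p - 1) = 0 + t * p" using p_pos by (cases p) auto
  moreover have "K n (0 + t * p) = K n 0" by (induction t) (simp_all add: K_p add.commute[of p])
  ultimately show ?thesis unfolding K_add using K_0 by metis
qed

text \<open>Conjugation by the \<open>s\<close>-th power shifts the summation index, and the summand
  has period \<open>p\<close>.\<close>

lemma Tr_invariant: "kmul d n (K n s) (kmul d n (Tr n \<theta>) (K n (s * (p - 1)))) = Tr n \<theta>"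
proof -
  define r where "r = p - 1"
  define h where "h t = kmul d n (K n t) (kmul d n \<theta> (K n (t * r)))" for t
  have "h (t + p) = h t" for t
  proof -
    have "K n ((t + p) * r) = K n (t * r + r * p)" by (simp add: algebra_simps)
    moreover have "K n (a + b * p) = K n a" for a b by (induction b) (simp_all add: K_p add.assoc[symmetric] add.commute[of p])
    ultimately show ?thesis by (simp add: h_def K_p)
  qed
  from sum_mod_shift[of p h, OF p_pos this] have sh: "(\<Sum>t<p. h (s + t)) = (\<Sum>t<p. h t)" .
  have "kmul d n (K n s) (kmul d n (h t) (K n (s * r))) = h (s + t)" for t
  proof -
    have "kmul d n (K n s) (kmul d n (h t) (K n (s * r))) =
        kmul d n (kmul d n (K n s) (K n t)) (kmul d n \<theta> (kmul d n (K n (t * r)) (K n (s * r))))"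
      unfolding h_def kmul_assoc ..
    also have "\<dots> = h (s + t)" unfolding K_add h_def add_mult_distrib add.commute[of "t * r"] ..
    finally show ?thesis .
  qed
  then show ?thesis unfolding Tr_def r_def[symmetric] h_def[symmetric] kmul_sum_left kmul_sum_right using sh by simp
qed

text \<open>Relative to invariant vectors and forms, \<open>T\<close> is the identity: it differs from it by a trace.\<close>

definition reducible :: "nat \<Rightarrow> nat list set \<Rightarrow> bool" where
  "reducible n S \<longleftrightarrow> S \<subseteq> words d n \<and> (\<exists>\<theta>. ksupp d n \<theta> \<and> (\<forall>x y. y \<notin> S \<longrightarrow> (kid d n - Tr n \<theta>) x y = 0))"

lemma reducible_all: "reducible n (words d n)"
proof -
  have "Tr n (\<lambda>_ _. 0) = 0" by (simp add: Tr_def kmul_def fun_eq_iff)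
  then show ?thesis unfolding reducible_def by (intro conjI exI[of _ "\<lambda>_ _. 0"]) (auto simp: ksupp_def kid_def)
qed

lemma ksupp_Tr: "ksupp d n \<theta> \<Longrightarrow> ksupp d n (Tr n \<theta>)"
proof -
  assume \<theta>: "ksupp d n \<theta>"
  show ?thesis unfolding Tr_def by (intro ksupp_sum ksupp_kmul ksupp_K \<theta>)
qed

lemma ten_Tr_left: "ten n (Tr n \<theta>) (kid d m) = Tr (n + m) (ten n \<theta> (kid d m))"
proof -
  have kk: "ksupp d m (kid d m :: _ \<Rightarrow> _ \<Rightarrow> 'k)" by (auto simp: ksupp_def kid_def)
  have "ten n (kmul d n (K n t) (kmul d n \<theta> (K n (t * (p - 1))))) (kid d m) =
     kmul d (n + m) (K (n + m) t) (kmul d (n + m) (ten n \<theta> (kid d m)) (K (n + m) (t * (p - 1))))" for t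
    unfolding K_ten[symmetric] kmul_ten kmul_id(2)[OF ksupp_K] K_inv ..
  then show ?thesis unfolding Tr_def ten_sum_left by simp
qed

text \<open>An invariant kernel \<open>T\<close> may be moved inside the conjugation, so its tensor
  product with a trace is again a trace.\<close>

lemma ten_Tr_right:
  assumes T: "\<And>s. kmul d n (K n s) (kmul d n T (K n (s * (p - 1)))) = T"
  shows "ten n T (Tr m \<theta>) = Tr (n + m) (ten n T \<theta>)"
proof -
  have "ten n T (kmul d m (K m t) (kmul d m \<theta> (K m (t * (p - 1))))) =
     kmul d (n + m) (K (n + m) t) (kmul d (n + m) (ten n T \<theta>) (K (n + m) (t * (p - 1))))" for t
    unfolding K_ten[symmetric] kmul_ten T ..
  then show ?thesis unfolding Tr_def ten_sum_right by simp
qed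

lemma Tr_add: "Tr n (\<theta> + \<theta>') = Tr n \<theta> + Tr n \<theta>'"
  unfolding Tr_def sum.distrib[symmetric] by (intro sum.cong refl) (auto simp: kmul_def fun_eq_iff algebra_simps sum.distrib)

text \<open>With \<open>T\<close> and \<open>T'\<close> the two differences from the identity,
  \<open>1 - T T' = (1 - T) 1 + T (1 - T')\<close> as tensor products. Both terms are traces because
  \<open>T\<close> is invariant, and the columns of the tensor product \<open>T T'\<close> are
  supported on concatenations.\<close>

lemma reducible_append:
  assumes "reducible n S" "reducible m S'"
  shows "reducible (n + m) ((\<lambda>(x, y). x @ y) ` (S \<times> S'))"
proof -
  obtain \<theta> \<theta>' where \<theta>: "ksupp d n \<theta>" "\<And>x y. y \<notin> S \<Longrightarrow> (kid d n - Tr n \<theta>) x y = 0"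
    and \<theta>': "ksupp d m \<theta>'" "\<And>x y. y \<notin> S' \<Longrightarrow> (kid d m - Tr m \<theta>') x y = 0"
    and S: "S \<subseteq> words d n" "S' \<subseteq> words d m" using assms by (auto simp: reducible_def)
  define T where "T = kid d n - Tr n \<theta>"
  define T' where "T' = kid d m - Tr m \<theta>'"
  have kid: "ksupp d k (kid d k :: _ \<Rightarrow> _ \<Rightarrow> 'k)" for k by (auto simp: ksupp_def kid_def)
  have sT: "ksupp d n T" "ksupp d m T'"
    unfolding T_def T'_def by (intro ksupp_diff kid ksupp_Tr \<theta> \<theta>')+
  have inv: "kmul d n (K n s) (kmul d n T (K n (s * (p - 1)))) = T" for s
    unfolding T_def kmul_diff_left kmul_diff_right Tr_invariant kmul_id(2)[OF ksupp_K] K_inv ..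
  have "kid d (n + m) - ten n T T' = ten n (kid d n - T) (kid d m) + ten n T (kid d m - T')"
    unfolding ten_kid[symmetric] ten_diff_left ten_diff_right by simp
  also have "kid d n - T = Tr n \<theta>" by (simp add: T_def)
  also have "kid d m - T' = Tr m \<theta>'" by (simp add: T'_def)
  finally have e: "kid d (n + m) - ten n T T' = Tr (n + m) (ten n \<theta> (kid d m) + ten n T \<theta>')"
    unfolding ten_Tr_left ten_Tr_right[OF inv] Tr_add .
  have eq: "kid d (n + m) - Tr (n + m) (ten n \<theta> (kid d m) + ten n T \<theta>') = ten n T T'"
    unfolding e[symmetric] by simp
  have z: "ten n T T' x y = 0" if "y \<notin> (\<lambda>(x, y). x @ y) ` (S \<times> S')" for x y
  proof -
    have "y \<in> (\<lambda>(x, y). x @ y) ` (S \<times> S')" if "take n y \<in> S" "drop n y \<in> S'"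
      by (rule image_eqI[of _ _ "(take n y, drop n y)"]) (simp_all add: that)
    then have "take n y \<notin> S \<or> drop n y \<notin> S'" using that by blast
    then have "T (take n x) (take n y) = 0 \<or> T' (drop n x) (drop n y) = 0"
      unfolding T_def T'_def using \<theta>(2) \<theta>'(2) by blast
    then show ?thesis unfolding ten_def by auto
  qed
  have ks: "ksupp d (n + m) (ten n \<theta> (kid d m) + ten n T \<theta>')"
    by (intro ksupp_add ksupp_ten' \<theta> \<theta>' sT kid)
  have "(\<lambda>(x, y). x @ y) ` (S \<times> S') \<subseteq> words d (n + m)"
    unfolding words_add_image using S by blast
  then show ?thesis unfolding reducible_def
    by (intro conjI exI[of _ "ten n \<theta> (kid d m) + ten n T \<theta>'"] allI impI ks) (simp_all only: eq z not_False_eq_True)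
qed

text \<open>All \<open>p\<close> conjugates of a kernel pair alike with an invariant vector and an
  invariant form, so a trace pairs to a multiple of \<open>p\<close>, which is zero. The plain
  pairing therefore equals the one through the kernel that reads \<open>z\<close> only on
  \<open>S\<close>.\<close>

lemma reducible_pairing:
  assumes red: "reducible n S"
    and z: "\<And>t x. x \<in> words d n \<Longrightarrow> (\<Sum>y\<in>words d n. kron (C t) x y * z y) = z x"
    and h: "\<And>t y. y \<in> words d n \<Longrightarrow> (\<Sum>x\<in>words d n. h x * kron (C t) x y) = h y"
    and zS: "\<And>x. x \<in> S \<Longrightarrow> z x = 0"
  shows "(\<Sum>x\<in>words d n. h x * z x) = 0"
proof -
  obtain \<theta> where \<theta>: "ksupp d n \<theta>" "\<And>x y. y \<notin> S \<Longrightarrow> (kid d n - Tr n \<theta>) x y = 0"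
    using red by (auto simp: reducible_def)
  define pair where "pair A = (\<Sum>x\<in>words d n. \<Sum>y\<in>words d n. h x * A x y * z y)" for A
  have pair_sum: "pair (\<Sum>t\<in>I. A t) = (\<Sum>t\<in>I. pair (A t))" for A :: "nat \<Rightarrow> nat list \<Rightarrow> nat list \<Rightarrow> 'k" and I
    by (induction I rule: infinite_finite_induct) (auto simp: pair_def algebra_simps sum.distrib)
  have left: "pair (kmul d n (K n t) A) = pair A" for t A
  proof -
    have "pair (kmul d n (K n t) A) = (\<Sum>x\<in>words d n. \<Sum>y\<in>words d n. \<Sum>w\<in>words d n. h x * K n t x w * (A w y * z y))"
      unfolding pair_def kmul_def sum_distrib_left sum_distrib_right by (simp add: mult.assoc)
    also have "\<dots> = (\<Sum>y\<in>words d n. \<Sum>w\<in>words d n. \<Sum>x\<in>words d n. h x * K n t x w * (A w y * z y))"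
      by (subst sum.swap, intro sum.cong refl sum.swap)
    also have "\<dots> = (\<Sum>y\<in>words d n. \<Sum>w\<in>words d n. h w * (A w y * z y))"
      unfolding sum_distrib_right[symmetric] by (intro sum.cong refl) (simp add: K_def h)
    also have "\<dots> = pair A" unfolding pair_def by (subst sum.swap) (simp add: mult.assoc)
    finally show ?thesis .
  qed
  have right: "pair (kmul d n A (K n t)) = pair A" for t A
  proof -
    have "pair (kmul d n A (K n t)) = (\<Sum>x\<in>words d n. \<Sum>y\<in>words d n. \<Sum>w\<in>words d n. h x * A x w * (K n t w y * z y))"
      unfolding pair_def kmul_def sum_distrib_left sum_distrib_right by (simp add: mult.assoc)
    also have "\<dots> = (\<Sum>x\<in>words d n. \<Sum>w\<in>words d n. \<Sum>y\<in>words d n. h x * A x w * (K n t w y * z y))"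
      by (intro sum.cong refl sum.swap)
    also have "\<dots> = pair A" unfolding pair_def sum_distrib_left[symmetric]
      by (intro sum.cong refl) (simp add: K_def z)
    finally show ?thesis .
  qed
  have "pair (Tr n \<theta>) = (\<Sum>t<p. pair \<theta>)" unfolding Tr_def pair_sum left right ..
  also have "\<dots> = 0" using p(1) of_nat_CHAR[where 'a = 'k] by simp
  finally have "pair (Tr n \<theta>) = 0" .
  moreover have "pair (kid d n - Tr n \<theta>) = 0"
    unfolding pair_def
  proof (intro sum.neutral ballI)
    fix x y
    show "h x * (kid d n - Tr n \<theta>) x y * z y = 0" using \<theta>(2) zS by (cases "y \<in> S") auto
  qed
  moreover have "pair (kid d n - Tr n \<theta>) = pair (kid d n) - pair (Tr n \<theta>)"
    by (simp add: pair_def algebra_simps sum_subtractf)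
  ultimately have "pair (kid d n) = 0" by simp
  moreover have "pair (kid d n) = (\<Sum>x\<in>words d n. h x * z x)"
  proof -
    have "(\<Sum>y\<in>words d n. h x * kid d n x y * z y) = h x * z x" if "x \<in> words d n" for x
    proof -
      have "(\<Sum>y\<in>words d n. h x * kid d n x y * z y) = (\<Sum>y\<in>words d n. (h x * z y) * (if x = y then 1 else 0))"
        using that by (intro sum.cong) (auto simp: kid_def)
      also have "\<dots> = h x * z x" using that by (simp add: sum_mult_delta)
      finally show ?thesis .
    qed
    then show ?thesis unfolding pair_def by simp
  qed
  ultimately show ?thesis by simp
qed

end

text \<open>The first basis vector is fixed and the second gains \<open>t\<close> times the first:
  the powers of a unipotent map with a Jordan pair in front.\<close>

locale jordan_action = cyclic_action d p C for d p and C :: "nat \<Rightarrow> nat \<Rightarrow> nat \<Rightarrow> 'k::field" +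
  assumes d2: "d \<ge> 2" and C_col0: "\<And>t i. i < d \<Longrightarrow> C t i 0 = (if i = 0 then 1 else 0)"
    and C_col1: "\<And>t i. i < d \<Longrightarrow> C t i 1 = (if i = 0 then of_nat t else if i = 1 then 1 else 0)"
begin

text \<open>At a word in the letters 0 and 1 with \<open>k\<close> zeros, the image of the constant
  word 1 under the \<open>t\<close>-th power has coefficient \<open>t ^ k\<close>. Summation over
  \<open>t\<close> keeps only \<open>k = p - 1\<close>, so the trace of a rank one kernel is the
  identity on the column of the constant word 0, and that word may be dropped.\<close>

lemma reducible_block: "reducible (p - 1) (words d (p - 1) - {replicate (p - 1) 0})"
proof -
  define m where "m = p - 1"
  define x0 where "x0 = replicate m (0 :: nat)"
  define x1 where "x1 = replicate m (1 :: nat)"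
  have w: "x0 \<in> words d m" "x1 \<in> words d m" using d2 by (auto simp: words_def x0_def x1_def)
  \<comment> \<open>The sign compensates the value -1 of the power sum.\<close>
  define \<theta> where "\<theta> x y = (if x = x1 \<and> y = x0 then - 1 else 0 :: 'k)" for x y
  have sum_power: "(\<Sum>t<p. K m t x x1) = - kid d m x x0" for x
  proof (cases "x \<in> words d m")
    case True
    have K: "K m t x x1 = (\<Prod>j<m. C t (x ! j) 1)" for t
      using True w by (simp add: K_def kron_def words_length[OF True]) (simp add: x1_def)
    show ?thesis
    proof (cases "\<forall>j<m. x ! j = 0 \<or> x ! j = 1")
      case bin: True
      define k where "k = card {j. j < m \<and> x ! j = 0}"
      have "K m t x x1 = of_nat t ^ k" for t
      proof -
        have "K m t x x1 = (\<Prod>j<m. if x ! j = 0 then of_nat t else 1)"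
          unfolding K using bin words_nth[OF True] d2 by (intro prod.cong refl) (auto simp: C_col1[unfolded One_nat_def])
        also have "\<dots> = of_nat t ^ k" unfolding k_def by (simp add: prod.If_cases Int_def)
        finally show ?thesis .
      qed
      moreover have "k \<le> m" unfolding k_def using card_mono[of "{..<m}" "{j. j < m \<and> x ! j = 0}"] by auto
      ultimately have "(\<Sum>t<p. K m t x x1) = (if k = m then - 1 else 0)"
        using sum_powers_char[OF p(1,2), of k] by (simp add: m_def)
      moreover have "k = m \<longleftrightarrow> x = x0"
      proof
        assume "k = m"
        then have "{j. j < m \<and> x ! j = 0} = {..<m}" unfolding k_def by (intro card_subset_eq) auto
        then show "x = x0" using words_length[OF True] by (intro nth_equalityI) (auto simp: x0_def)
      next
        assume "x = x0"
        then have "{j. j < m \<and> x ! j = 0} = {..<m}" by (auto simp: x0_def)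
        then show "k = m" by (simp add: k_def)
      qed
      ultimately show ?thesis using True by (simp add: kid_def)
    next
      case False
      then obtain j where j: "j < m" "x ! j \<noteq> 0" "x ! j \<noteq> 1" by blast
      have "K m t x x1 = 0" for t
        unfolding K using j words_nth[OF True j(1)] by (intro prod_zero bexI[of _ j]) (auto simp: C_col1[unfolded One_nat_def])
      moreover have "x \<noteq> x0" using j by (auto simp: x0_def)
      ultimately show ?thesis by (simp add: kid_def)
    qed
  qed (simp add: K_def kid_def)
  have K00: "K m t x0 x0 = 1" for t
    unfolding K_def kron_def using w words_length[OF w(1)] C_col0[of 0 t] d2 by (simp add: x0_def)
  have "Tr m \<theta> x x0 = kid d m x x0" for x
  proof -
    have kk: "kmul d m (K m t) (kmul d m \<theta> (K m s)) x x0 = - K m t x x1" for t s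
    proof -
      have inner: "kmul d m \<theta> (K m s) y x0 = - (if y = x1 then 1 else 0)" for y
      proof -
        have "kmul d m \<theta> (K m s) y x0 = (\<Sum>z\<in>words d m. - (if y = x1 then K m s z x0 else 0) * (if z = x0 then 1 else 0))"
          unfolding kmul_def \<theta>_def by (intro sum.cong refl) auto
        also have "\<dots> = - (if y = x1 then 1 else 0)"
          unfolding sum_mult_delta(2)[OF finite_words] using w K00 by simp
        finally show ?thesis .
      qed
      have "kmul d m (K m t) (kmul d m \<theta> (K m s)) x x0 = (\<Sum>y\<in>words d m. - K m t x y * (if y = x1 then 1 else 0))"
        unfolding kmul_def[of d m "K m t"] inner by (intro sum.cong refl) simp
      also have "\<dots> = - K m t x x1" unfolding sum_mult_delta(2)[OF finite_words] using w by simp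
      finally show ?thesis .
    qed
    have "Tr m \<theta> x x0 = (\<Sum>t<p. - K m t x x1)"
    proof -
      have app: "(\<Sum>t\<in>I. A t) x y = (\<Sum>t\<in>I. A t x y)" for A :: "nat \<Rightarrow> nat list \<Rightarrow> nat list \<Rightarrow> 'k" and I x y
        by (induction I rule: infinite_finite_induct) auto
      show ?thesis unfolding Tr_def app kk ..
    qed
    also have "\<dots> = kid d m x x0" unfolding sum_negf sum_power by simp
    finally show ?thesis .
  qed
  moreover have "ksupp d m \<theta>" using w by (auto simp: ksupp_def \<theta>_def)
  moreover from ksupp_Tr[OF this] have "(kid d m - Tr m \<theta>) x y = 0" if "y \<notin> words d m" for x y
    using that by (auto simp: ksupp_def kid_def)
  ultimately show ?thesis unfolding reducible_def m_def[symmetric] x0_def[symmetric]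
    by (intro conjI exI[of _ \<theta>] allI impI) auto
qed

lemma card_append_image:
  assumes "S \<subseteq> words d n" "S' \<subseteq> words d m"
  shows "card ((\<lambda>(x, y). x @ y) ` (S \<times> S')) = card S * card S'"
proof -
  have "inj_on (\<lambda>(x, y). x @ y) (S \<times> S')"
  proof (rule inj_onI, clarify)
    fix x y x' y' assume *: "x \<in> S" "y \<in> S'" "x' \<in> S" "y' \<in> S'" "x @ y = x' @ y'"
    then have "length x = length x'" using words_length[OF subsetD[OF assms(1)]] by simp
    then show "x = x' \<and> y = y'" using *(5) by simp
  qed
  then show ?thesis by (simp add: card_image card_cartesian_product)
qed

lemma reducible_blocks: "\<exists>S. reducible ((p - 1) * q) S \<and> card S = (d ^ (p - 1) - 1) ^ q"
proof (induction q)
  case 0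
  show ?case using reducible_all[of 0] by (intro exI[of _ "words d 0"]) (simp add: words_0)
next
  case (Suc q)
  let ?m = "p - 1" and ?B = "words d (p - 1) - {replicate (p - 1) 0}"
  obtain S where S: "reducible (?m * q) S" "card S = (d ^ ?m - 1) ^ q" using Suc by blast
  have "replicate ?m 0 \<in> words d ?m" using d2 by (auto simp: words_def)
  then have cB: "card ?B = d ^ ?m - 1" by (simp add: card_words)
  have "S \<subseteq> words d (?m * q)" using S(1) by (simp add: reducible_def)
  then have "card ((\<lambda>(x, y). x @ y) ` (?B \<times> S)) = (d ^ ?m - 1) * (d ^ ?m - 1) ^ q"
    using card_append_image[of ?B ?m S "?m * q"] cB S(2) by auto
  moreover have "reducible (?m + ?m * q) ((\<lambda>(x, y). x @ y) ` (?B \<times> S))"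
    by (rule reducible_append[OF reducible_block S(1)])
  ultimately show ?case by (intro exI[of _ "(\<lambda>(x, y). x @ y) ` (?B \<times> S)"]) simp
qed

text \<open>Words are cut into blocks of length \<open>p - 1\<close>, each losing one choice; the
  incomplete block at the end keeps all its words.\<close>

lemma reducible_length:
  "\<exists>S. reducible n S \<and> card S = (d ^ (p - 1) - 1) ^ (n div (p - 1)) * d ^ (n mod (p - 1))"
proof -
  let ?m = "p - 1"
  obtain S where S: "reducible (?m * (n div ?m)) S" "card S = (d ^ ?m - 1) ^ (n div ?m)"
    using reducible_blocks by blast
  have "S \<subseteq> words d (?m * (n div ?m))" using S(1) by (simp add: reducible_def)
  then have "card ((\<lambda>(x, y). x @ y) ` (S \<times> words d (n mod ?m))) = (d ^ ?m - 1) ^ (n div ?m) * d ^ (n mod ?m)"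
    using card_append_image[of S _ "words d (n mod ?m)" "n mod ?m"] S(2) by (simp add: card_words)
  moreover have "reducible (?m * (n div ?m) + n mod ?m) ((\<lambda>(x, y). x @ y) ` (S \<times> words d (n mod ?m)))"
    by (rule reducible_append[OF S(1) reducible_all])
  ultimately show ?thesis by (metis mult_div_mod_eq)
qed

end

section \<open>Unipotent maps, elements of order p and Jordan pairs\<close>

context based_space
begin

lemma linear_diff_id:
  assumes "Vector_Spaces.linear scale scale f"
  shows "Vector_Spaces.linear scale scale (\<lambda>w. f w - w)"
proof -
  interpret f: Vector_Spaces.linear scale scale f by (rule assms)
  show ?thesis by unfold_locales (simp_all add: f.add f.scale scale_right_diff_distrib)
qed

lemma pact_add: "pact f (p + q) v = pact f p v + pact f q v"
proof -
  define n where "n = max (degree p) (degree q)"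
  have "degree (p + q) \<le> n" "degree p \<le> n" "degree q \<le> n" by (auto simp: n_def degree_add_le)
  then show ?thesis by (simp add: pact_bound[of _ n] scale_left_distrib sum.distrib)
qed

lemma pact_monom: "pact f (monom c n) v = scale c ((f ^^ n) v)"
proof -
  have "pact f (monom c n) v = (\<Sum>i\<le>n. scale (coeff (monom c n) i) ((f ^^ i) v))"
    by (rule pact_bound) (rule degree_monom_le)
  also have "\<dots> = (\<Sum>i\<in>{n}. scale (coeff (monom c n) i) ((f ^^ i) v))"
    by (rule sum.mono_neutral_right) auto
  finally show ?thesis by simp
qed

text \<open>The polynomial identity \<open>(X - 1) ^ q = X ^ q - 1\<close> for a power
  \<open>q\<close> of the characteristic, evaluated at \<open>f\<close>.\<close>

lemma funpow_char_diff:
  assumes f: "Vector_Spaces.linear scale scale f" and p: "CHAR('k) > 0"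
  shows "(f ^^ (CHAR('k) ^ k)) v - v = ((\<lambda>w. f w - w) ^^ (CHAR('k) ^ k)) v"
proof -
  define q where "q = CHAR('k) ^ k"
  have pr: "prime CHAR('k)" using prime_CHAR_semidom[OF p] .
  have cp: "CHAR('k poly) = CHAR('k)" by simp
  have fd: "(a + b) ^ q = a ^ q + b ^ q" for a b :: "'k poly"
    by (rule freshmans_dream'[of q k]) (simp_all add: pr q_def)
  have "q > 0" using p by (simp add: q_def)
  have m1: "(- 1 :: 'k poly) ^ q = - 1"
    using fd[of 1 "- 1"] \<open>q > 0\<close> by (simp add: eq_neg_iff_add_eq_0 add.commute zero_power)
  have "[:- 1, 1:] ^ q = (monom 1 1 + (- 1) :: 'k poly) ^ q"
    by (simp add: monom_altdef one_pCons)
  also have "\<dots> = monom 1 q + monom (- 1) 0" unfolding fd m1 by (simp add: monom_power monom_0 one_pCons)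
  finally have "pact f ([:- 1, 1:] ^ q) v = (f ^^ q) v - v"
    by (simp add: pact_add pact_monom)
  moreover have "pact f ([:- 1, 1:] ^ n) v = ((\<lambda>w. f w - w) ^^ n) v" for n
  proof (induction n)
    case 0
    then show ?case using pact_monom[of f 1 0 v] by (simp add: monom_0 one_pCons)
  next
    case (Suc n)
    then show ?case using pact_mult_linear[OF f, of "[:- 1, 1:] ^ n" 1 v] by (simp add: mult.commute)
  qed
  ultimately show ?thesis by (simp add: q_def)
qed

text \<open>Nilpotency makes some \<open>p\<close>-power iterate of \<open>f\<close> the identity;
  the last iterate before that is nontrivial and has order \<open>p\<close>.\<close>

lemma unipotent_element_order:
  assumes f: "Vector_Spaces.linear scale scale f" and p: "CHAR('k) > 0" and uni: "unipotent f" "f \<noteq> id"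
  shows "\<exists>k. (f ^^ k) ^^ CHAR('k) = id \<and> f ^^ k \<noteq> id"
proof -
  let ?N = "\<lambda>w. f w - w"
  interpret N: Vector_Spaces.linear scale scale ?N by (rule linear_diff_id[OF f])
  obtain n where n: "\<And>v. (?N ^^ n) v = 0" using uni(1) by (auto simp: unipotent_def)
  have "CHAR('k) > 1" using prime_CHAR_semidom[OF p] prime_gt_1_nat by blast
  then have "n \<le> CHAR('k) ^ n" using power_gt_expt[of "CHAR('k)" n] by simp
  then have "(?N ^^ (CHAR('k) ^ n)) v = 0" for v
  proof -
    have "(?N ^^ (CHAR('k) ^ n)) v = (?N ^^ n) ((?N ^^ (CHAR('k) ^ n - n)) v)"
      using \<open>n \<le> CHAR('k) ^ n\<close> by (simp add: funpow_add[symmetric, THEN fun_cong, unfolded comp_def])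
    then show ?thesis using n by simp
  qed
  then have "f ^^ (CHAR('k) ^ n) = id" using funpow_char_diff[OF f p, of n] by (auto simp: fun_eq_iff)
  then obtain k where k: "f ^^ (CHAR('k) ^ k) = id" "\<And>l. l < k \<Longrightarrow> f ^^ (CHAR('k) ^ l) \<noteq> id"
    using exists_least_iff[of "\<lambda>k. f ^^ (CHAR('k) ^ k) = id"] by blast
  have "k \<noteq> 0" using k(1) uni(2) by (intro notI) simp
  then obtain l where l: "k = Suc l" by (cases k) auto
  have "(f ^^ (CHAR('k) ^ l)) ^^ CHAR('k) = id" using k(1) unfolding l by (simp add: funpow_mult mult.commute)
  then show ?thesis using k(2)[of l] l by auto
qed

text \<open>Apply \<open>f - 1\<close> repeatedly to a vector moved by \<open>f\<close>. The last
  two nonzero vectors of this chain form the pair, with the killed one placed first.\<close>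

lemma jordan_basis_exists:
  assumes f: "Vector_Spaces.linear scale scale f" and p: "CHAR('k) > 0" and fp: "f ^^ CHAR('k) = id" and "f \<noteq> id"
  shows "\<exists>bs'. basis_list scale bs' \<and> length bs' \<ge> 2 \<and> f (bs' ! 0) = bs' ! 0 \<and> f (bs' ! 1) = bs' ! 1 + bs' ! 0"
proof -
  define N where "N w = f w - w" for w
  have linN: "Vector_Spaces.linear scale scale N" unfolding N_def[abs_def] by (rule linear_diff_id[OF f])
  interpret N: Vector_Spaces.linear scale scale N by (rule linN)
  obtain v0 where v0: "N v0 \<noteq> 0" using \<open>f \<noteq> id\<close> by (auto simp: N_def fun_eq_iff)
  have "(N ^^ CHAR('k)) v0 = 0" using funpow_char_diff[OF f p, of 1 v0] fp by (simp add: N_def[abs_def])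
  then obtain j where j: "(N ^^ j) v0 = 0" "\<And>i. i < j \<Longrightarrow> (N ^^ i) v0 \<noteq> 0"
    using exists_least_iff[of "\<lambda>j. (N ^^ j) v0 = 0"] by blast
  have "j \<noteq> 0" using j(1) v0 N.zero by (intro notI) auto
  moreover have "j \<noteq> 1" using j(1) v0 by (intro notI) auto
  \<comment> \<open>The chain has length at least two because \<open>v0\<close> is moved, so there
    is a vector before the last one.\<close>
  ultimately obtain i where i: "j = Suc (Suc i)" by (metis One_nat_def not0_implies_Suc)
  define v where "v = (N ^^ i) v0"
  define w where "w = N v"
  have w: "w \<noteq> 0" using j(2)[of "Suc i"] by (simp add: i w_def v_def)
  have Nw: "N w = 0" using j(1) by (simp add: i w_def v_def)
  have fw: "f w = w" "f v = v + w" using Nw by (simp_all add: N_def w_def)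
  have "v \<notin> span {w}"
  proof
    assume "v \<in> span {w}"
    then obtain c where "v = scale c w" by (auto simp: span_singleton)
    then have "w = scale c (N w)" unfolding w_def by (metis N.scale)
    then show False using w Nw by simp
  qed
  moreover have "independent {w}" using w by (simp add: dependent_single)
  ultimately have ind: "independent {v, w}" by (simp add: independent_insert)
  have "v \<noteq> w" using \<open>v \<notin> span {w}\<close> span_base by blast
  define B where "B = extend_basis {v, w}"
  have B: "independent B" "span B = UNIV" "{v, w} \<subseteq> B"
    using independent_extend_basis[OF ind] span_extend_basis[OF ind] extend_basis_superset[OF ind] by (auto simp: B_def)
  have "finite B" using independent_span_bound[of "set bs" B] B(1) span_bs by auto
  then obtain cs where cs: "set cs = B - {v, w}" "distinct cs" using finite_distinct_list[of "B - {v, w}"] by auto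
  have "set (w # v # cs) = B" using cs(1) B(3) by auto
  moreover have "distinct (w # v # cs)" using cs \<open>v \<noteq> w\<close> by auto
  ultimately show ?thesis unfolding basis_list_def using B(1,2) fw by (intro exI[of _ "w # v # cs"]) simp
qed

lemma fixed_vec_funpow:
  assumes f: "Vector_Spaces.linear scale scale f" and z: "fixed_vec n f z"
  shows "fixed_vec n (f ^^ t) z"
proof (induction t)
  case 0
  have "(\<Sum>y\<in>W n. kron (mco id) x y * z y) = z x" if x: "x \<in> W n" for x
  proof -
    have "(\<Sum>y\<in>W n. kron (mco id) x y * z y) = (\<Sum>y\<in>W n. z y * (if x = y then 1 else 0))"
      by (intro sum.cong refl) (simp add: kron_id[OF x, of _ "mco id"] mco_id)
    then show ?thesis using x by (simp add: sum_mult_delta)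
  qed
  then show ?case by (simp add: fixed_vec_def id_def)
next
  case (Suc t)
  have "(\<Sum>y\<in>W n. kron (mco (f ^^ Suc t)) x y * z y) = z x" if x: "x \<in> W n" for x
  proof -
    have "(\<Sum>y\<in>W n. kron (mco (f ^^ Suc t)) x y * z y)
       = (\<Sum>y\<in>W n. (\<Sum>w\<in>W n. kron (mco f) x w * kron (mco (f ^^ t)) w y) * z y)"
    proof (intro sum.cong refl arg_cong2[of _ _ _ _ "(*)"])
      fix y assume y: "y \<in> W n"
      show "kron (mco (f ^^ Suc t)) x y = (\<Sum>w\<in>W n. kron (mco f) x w * kron (mco (f ^^ t)) w y)"
        by (rule kron_mult[OF x y, symmetric]) (simp only: funpow.simps mco_comp[OF f])
    qed
    also have "\<dots> = (\<Sum>w\<in>W n. kron (mco f) x w * (\<Sum>y\<in>W n. kron (mco (f ^^ t)) w y * z y))"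
      unfolding sum_distrib_left sum_distrib_right by (subst sum.swap) (simp add: mult.assoc)
    also have "\<dots> = (\<Sum>w\<in>W n. kron (mco f) x w * z w)"
      using Suc by (intro sum.cong refl) (simp add: fixed_vec_def)
    also have "\<dots> = z x" using z x by (simp add: fixed_vec_def)
    finally show ?thesis .
  qed
  then show ?case unfolding fixed_vec_def by blast
qed

lemma fixed_form_funpow:
  assumes f: "Vector_Spaces.linear scale scale f" and h: "fixed_form n f h"
  shows "fixed_form n (f ^^ t) h"
proof (induction t)
  case 0
  have "(\<Sum>x\<in>W n. h x * kron (mco id) x y) = h y" if y: "y \<in> W n" for y
  proof -
    have "(\<Sum>x\<in>W n. h x * kron (mco id) x y) = (\<Sum>x\<in>W n. h x * (if x = y then 1 else 0))"
      by (intro sum.cong refl) (simp add: kron_id[OF _ y, of _ "mco id"] mco_id)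
    then show ?thesis using y by (simp add: sum_mult_delta)
  qed
  then show ?case by (simp add: fixed_form_def id_def)
next
  case (Suc t)
  have "(\<Sum>x\<in>W n. h x * kron (mco (f ^^ Suc t)) x y) = h y" if y: "y \<in> W n" for y
  proof -
    have "(\<Sum>x\<in>W n. h x * kron (mco (f ^^ Suc t)) x y)
       = (\<Sum>x\<in>W n. h x * (\<Sum>w\<in>W n. kron (mco f) x w * kron (mco (f ^^ t)) w y))"
    proof (intro sum.cong refl arg_cong2[of _ _ _ _ "(*)"])
      fix x assume x: "x \<in> W n"
      show "kron (mco (f ^^ Suc t)) x y = (\<Sum>w\<in>W n. kron (mco f) x w * kron (mco (f ^^ t)) w y)"
        by (rule kron_mult[OF x y, symmetric]) (simp only: funpow.simps mco_comp[OF f])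
    qed
    also have "\<dots> = (\<Sum>w\<in>W n. (\<Sum>x\<in>W n. h x * kron (mco f) x w) * kron (mco (f ^^ t)) w y)"
      unfolding sum_distrib_left sum_distrib_right by (subst sum.swap) (simp add: mult.assoc)
    also have "\<dots> = (\<Sum>w\<in>W n. h w * kron (mco (f ^^ t)) w y)"
      using h by (intro sum.cong refl) (simp add: fixed_form_def)
    also have "\<dots> = h y" using Suc y by (simp add: fixed_form_def)
    finally show ?thesis .
  qed
  then show ?case unfolding fixed_form_def by blast
qed

lemma jordan_bound:
  assumes f: "Vector_Spaces.linear scale scale f" and p: "CHAR('k) > 0" and fp: "f ^^ CHAR('k) = id"
    and bs2: "length bs \<ge> 2" "f (bs ! 0) = bs ! 0" "f (bs ! 1) = bs ! 1 + bs ! 0"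
    and Z: "\<And>k. k < N \<Longrightarrow> fixed_vec n f (Z k)" and F: "\<And>k. k < N \<Longrightarrow> fixed_form n f (F k)"
    and bi: "\<And>k l. k < N \<Longrightarrow> l < N \<Longrightarrow> (\<Sum>x\<in>W n. F k x * Z l x) = (if k = l then 1 else 0)"
  shows "N \<le> (length bs ^ (CHAR('k) - 1) - 1) ^ (n div (CHAR('k) - 1)) * length bs ^ (n mod (CHAR('k) - 1))"
proof -
  define C where "C t = mco (f ^^ t)" for t
  interpret f: Vector_Spaces.linear scale scale f by (rule f)
  have f0: "(f ^^ t) (bs ! 0) = bs ! 0" for t by (induction t) (simp_all add: bs2)
  have f1: "(f ^^ t) (bs ! 1) = bs ! 1 + scale (of_nat t) (bs ! 0)" for t
    by (induction t) (simp_all add: bs2[unfolded One_nat_def] f.add f.scale scale_left_distrib add.assoc)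
  interpret J: jordan_action "length bs" "CHAR('k)" C
  proof unfold_locales
    show "prime CHAR('k)" using prime_CHAR_semidom[OF p] .
    show "C (s + t) i j = (\<Sum>k<length bs. C s i k * C t k j)" for s t i j
      unfolding C_def funpow_add by (rule mco_comp[OF linear_funpow[OF f]])
    show "C 0 i j = (if i = j then 1 else 0)" if "i < length bs" "j < length bs" for i j
      using mco_id[OF that] by (simp add: C_def id_def)
    show "C CHAR('k) i j = C 0 i j" for i j unfolding C_def fp by (simp add: id_def)
    show "2 \<le> length bs" by (rule bs2)
    have l: "0 < length bs" "1 < length bs" using bs2(1) by auto
    show "C t i 0 = (if i = 0 then 1 else 0)" if "i < length bs" for t i
      unfolding C_def mco_def f0 co_bs[OF that l(1)] ..
    show "C t i 1 = (if i = 0 then of_nat t else if i = 1 then 1 else 0)" if "i < length bs" for t i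
      unfolding C_def mco_def f1 co_add co_scale co_bs[OF that l(1)] co_bs[OF that l(2)] by auto
  qed simp
  obtain S where S: "J.reducible n S"
    "card S = (length bs ^ (CHAR('k) - 1) - 1) ^ (n div (CHAR('k) - 1)) * length bs ^ (n mod (CHAR('k) - 1))"
    using J.reducible_length by blast
  have "S \<subseteq> W n" using S(1) by (simp add: J.reducible_def)
  then have "finite S" by (rule finite_subset) simp
  have "N \<le> card S"
  proof (rule biorthogonal_bound[where X = "W n" and Z = Z and F = F, OF \<open>finite S\<close> _ bi])
    fix c k assume 0: "\<And>x. x \<in> S \<Longrightarrow> (\<Sum>l<N. c l * Z l x) = 0" and k: "k < N"
    show "(\<Sum>x\<in>W n. F k x * (\<Sum>l<N. c l * Z l x)) = 0"
    proof (rule J.reducible_pairing[OF S(1)])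
      fix t x assume x: "x \<in> W n"
      have "(\<Sum>y\<in>W n. kron (C t) x y * (\<Sum>l<N. c l * Z l y)) = (\<Sum>l<N. c l * (\<Sum>y\<in>W n. kron (C t) x y * Z l y))"
        unfolding sum_distrib_left by (subst sum.swap) (simp add: mult_ac)
      also have "\<dots> = (\<Sum>l<N. c l * Z l x)"
        using fixed_vec_funpow[OF f Z] x by (intro sum.cong refl) (simp add: fixed_vec_def C_def)
      finally show "(\<Sum>y\<in>W n. kron (C t) x y * (\<Sum>l<N. c l * Z l y)) = (\<Sum>l<N. c l * Z l x)" .
    next
      fix t y assume y: "y \<in> W n"
      show "(\<Sum>x\<in>W n. F k x * kron (C t) x y) = F k y"
        using fixed_form_funpow[OF f F[OF k], of t] y by (simp add: fixed_form_def C_def)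
    qed (rule 0)
  qed auto
  then show ?thesis unfolding S(2) .
qed

end

section \<open>Passing invariants to the Zariski closure\<close>

lemma regular_sum:
  "finite I \<Longrightarrow> (\<And>i. i \<in> I \<Longrightarrow> P i \<in> regular_functions scale) \<Longrightarrow> (\<lambda>f. \<Sum>i\<in>I. P i f) \<in> regular_functions scale"
proof (induction I rule: finite_induct)
  case empty
  then show ?case using regular_functions.const[of 0] by simp
next
  case (insert i I)
  then show ?case using regular_functions.add[of "P i" scale "\<lambda>f. \<Sum>i\<in>I. P i f"] by simp
qed

lemma regular_prod:
  "finite I \<Longrightarrow> (\<And>i. i \<in> I \<Longrightarrow> P i \<in> regular_functions scale) \<Longrightarrow> (\<lambda>f. \<Prod>i\<in>I. P i f) \<in> regular_functions scale"
proof (induction I rule: finite_induct)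
  case empty
  then show ?case using regular_functions.const[of 1] by simp
next
  case (insert i I)
  then show ?case using regular_functions.mult[of "P i" scale "\<lambda>f. \<Prod>i\<in>I. P i f"] by simp
qed

text \<open>The zero set of the single function \<open>P\<close> is closed and contains
  \<open>S\<close>.\<close>

lemma closure_vanish:
  assumes "u \<in> zariski_closure scale S" "S \<subseteq> carrier (GL scale)" "P \<in> regular_functions scale" "\<And>f. f \<in> S \<Longrightarrow> P f = 0"
  shows "P u = 0"
proof -
  let ?Z = "{f \<in> carrier (GL scale). \<forall>q\<in>{P}. q f = 0}"
  have "zariski_closed scale ?Z" unfolding zariski_closed_def using assms(3) by (intro exI[of _ "{P}"]) auto
  moreover have "S \<subseteq> ?Z" using assms by auto
  ultimately have "u \<in> ?Z" using assms(1) unfolding zariski_closure_def by blast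
  then show ?thesis by simp
qed

lemma closure_carrier:
  assumes "u \<in> zariski_closure scale S" "S \<subseteq> carrier (GL scale)"
  shows "u \<in> carrier (GL scale)"
proof -
  have "zariski_closed scale (carrier (GL scale))" unfolding zariski_closed_def by (intro exI[of _ "{}"]) auto
  then show ?thesis using assms unfolding zariski_closure_def by blast
qed

lemma closure_superset: "S \<subseteq> zariski_closure scale S"
  unfolding zariski_closure_def by blast

context based_space
begin

lemma regular_kron: "x \<in> W n \<Longrightarrow> (\<lambda>f. kron (mco f) x y) \<in> regular_functions scale"
  unfolding kron_def mco_def by (intro regular_prod regular_functions.coeff linear_co) simp

lemma regular_scaleI: "P \<in> regular_functions scale \<Longrightarrow> (\<lambda>f. c * P f) \<in> regular_functions scale"
  using regular_functions.mult[OF regular_functions.const[of c]] .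

lemma fixed_vec_closure:
  assumes u: "u \<in> zariski_closure scale S" "S \<subseteq> carrier (GL scale)" and z: "\<And>f. f \<in> S \<Longrightarrow> fixed_vec n f z"
  shows "fixed_vec n u z"
  unfolding fixed_vec_def
proof
  fix x assume x: "x \<in> W n"
  define P where "P = (\<lambda>f. (\<Sum>y\<in>W n. z y * kron (mco f) x y) + (- z x))"
  have "P \<in> regular_functions scale" unfolding P_def
    by (intro regular_functions.add regular_functions.const regular_sum regular_scaleI regular_kron[OF x]) simp
  moreover have "P f = 0" if "f \<in> S" for f using z[OF that] x by (simp add: P_def fixed_vec_def mult.commute)
  ultimately have "P u = 0" by (rule closure_vanish[OF u])
  then show "(\<Sum>y\<in>W n. kron (mco u) x y * z y) = z x" by (simp add: P_def mult.commute)
qed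

lemma fixed_form_closure:
  assumes u: "u \<in> zariski_closure scale S" "S \<subseteq> carrier (GL scale)" and h: "\<And>f. f \<in> S \<Longrightarrow> fixed_form n f h"
  shows "fixed_form n u h"
  unfolding fixed_form_def
proof
  fix y assume y: "y \<in> W n"
  define P where "P = (\<lambda>f. (\<Sum>x\<in>W n. h x * kron (mco f) x y) + (- h y))"
  have "P \<in> regular_functions scale" unfolding P_def
    by (intro regular_functions.add regular_functions.const regular_sum regular_scaleI regular_kron) simp_all
  moreover have "P f = 0" if "f \<in> S" for f using h[OF that] y by (simp add: P_def fixed_form_def)
  ultimately have "P u = 0" by (rule closure_vanish[OF u])
  then show "(\<Sum>x\<in>W n. h x * kron (mco u) x y) = h y" by (simp add: P_def)
qed

text \<open>The element \<open>u\<close> need not come from the group, but being in the closure it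
  fixes the same vectors and forms, and so does its power of order \<open>p\<close>, to which the
  Jordan bound applies.\<close>

lemma TS_bound_unipotent:
  assumes \<rho>: "\<And>g. g \<in> carrier G \<Longrightarrow> \<rho> g \<in> carrier (GL scale)" and p: "CHAR('k) > 0"
    and u: "u \<in> zariski_closure scale (\<rho> ` carrier G)" "unipotent u" "u \<noteq> id"
  shows "length bs \<ge> 2 \<and> TS G fun_scale (tensor_act \<rho>) (tensor_power scale n) \<le>
    (length bs ^ (CHAR('k) - 1) - 1) ^ (n div (CHAR('k) - 1)) * length bs ^ (n mod (CHAR('k) - 1))"
proof -
  let ?N = "TS G fun_scale (tensor_act \<rho>) (tensor_power scale n)"
  have S: "\<rho> ` carrier G \<subseteq> carrier (GL scale)" using \<rho> by auto
  have lin: "Vector_Spaces.linear scale scale u" using closure_carrier[OF u(1) S] by (simp add: GL_def)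
  obtain k where k: "(u ^^ k) ^^ CHAR('k) = id" "u ^^ k \<noteq> id" using unipotent_element_order[OF lin p u(2,3)] by blast
  have link: "Vector_Spaces.linear scale scale (u ^^ k)" by (rule linear_funpow[OF lin])
  obtain cs where cs: "basis_list scale cs" "length cs \<ge> 2" "(u ^^ k) (cs ! 0) = cs ! 0" "(u ^^ k) (cs ! 1) = cs ! 1 + cs ! 0"
    using jordan_basis_exists[OF link p k] by blast
  interpret B: based_space scale cs by unfold_locales (rule cs)
  have len: "length cs = length bs" using B.dim_UNIV dim_UNIV by simp
  obtain Z F where ZF: "\<And>k g. k < ?N \<Longrightarrow> g \<in> carrier G \<Longrightarrow> B.fixed_vec n (\<rho> g) (Z k)"
    "\<And>k g. k < ?N \<Longrightarrow> g \<in> carrier G \<Longrightarrow> B.fixed_form n (\<rho> g) (F k)"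
    "\<And>k l. k < ?N \<Longrightarrow> l < ?N \<Longrightarrow> (\<Sum>x\<in>B.W n. F k x * Z l x) = (if k = l then 1 else 0)"
  proof (rule B.TS_upper[where \<rho> = \<rho> and G = G and n = n, OF \<rho>], assumption)
    fix Z F assume "\<And>k g. k < ?N \<Longrightarrow> g \<in> carrier G \<Longrightarrow> B.fixed_vec n (\<rho> g) (Z k)"
      "\<And>k g. k < ?N \<Longrightarrow> g \<in> carrier G \<Longrightarrow> B.fixed_form n (\<rho> g) (F k)"
      "\<And>k l. k < ?N \<Longrightarrow> l < ?N \<Longrightarrow> (\<Sum>x\<in>B.W n. F k x * Z l x) = (if k = l then 1 else 0)"
    then show thesis by (rule that)
  qed
  have "B.fixed_vec n (u ^^ k) (Z i)" if "i < ?N" for i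
    by (rule B.fixed_vec_funpow[OF lin B.fixed_vec_closure[OF u(1) S]]) (use ZF(1)[OF that] in auto)
  moreover have "B.fixed_form n (u ^^ k) (F i)" if "i < ?N" for i
    by (rule B.fixed_form_funpow[OF lin B.fixed_form_closure[OF u(1) S]]) (use ZF(2)[OF that] in auto)
  ultimately have "?N \<le> (length cs ^ (CHAR('k) - 1) - 1) ^ (n div (CHAR('k) - 1)) * length cs ^ (n mod (CHAR('k) - 1))"
    by (rule B.jordan_bound[OF link p k(1) cs(2,3,4) _ _ ZF(3)])
  then show ?thesis using cs(2) unfolding len by simp
qed

lemma growth_less_unipotent:
  assumes \<rho>: "\<And>g. g \<in> carrier G \<Longrightarrow> \<rho> g \<in> carrier (GL scale)" and p: "CHAR('k) > 0"
    and u: "u \<in> zariski_closure scale (\<rho> ` carrier G)" "unipotent u" "u \<noteq> id"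
  shows "trivial_growth G scale \<rho> < ereal (real (length bs))"
proof -
  define d where "d = length bs"
  define m where "m = CHAR('k) - 1"
  have "CHAR('k) > 1" using prime_CHAR_semidom[OF p] prime_gt_1_nat by blast
  then have m: "m > 0" by (simp add: m_def)
  have TS: "TS G fun_scale (tensor_act \<rho>) (tensor_power scale n) \<le> (d ^ m - 1) ^ (n div m) * d ^ (n mod m)" and d: "d \<ge> 2" for n
    using TS_bound_unipotent[where \<rho> = \<rho> and G = G, OF \<rho> p u] unfolding d_def m_def by auto
  \<comment> \<open>The rate per factor: \<open>m\<close> factors together contribute
    \<open>d ^ m - 1\<close> instead of \<open>d ^ m\<close>.\<close>
  define c where "c = root m (real (d ^ m - 1))"
  have "2 ^ m \<le> d ^ m" using d by (rule power_mono) simp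
  moreover have "(2 :: nat) ^ m \<ge> 2" using m self_le_power[of 2 m] by simp
  ultimately have dm: "d ^ m - 1 \<ge> 1" by linarith
  have "1 \<le> real (d ^ m - 1)" using dm by linarith
  then have c1: "c \<ge> 1" unfolding c_def using m by (simp only: real_root_ge_1_iff)
  have cm: "c ^ m = real (d ^ m - 1)" unfolding c_def using m by (intro real_root_pow_pos2) auto
  have "d ^ m - 1 < d ^ m" using dm by linarith
  then have "c ^ m < real d ^ m" unfolding cm of_nat_power[symmetric] by (rule of_nat_less_iff[THEN iffD2])
  then have cd: "c < real d" by (rule power_less_imp_less_base) simp
  \<comment> \<open>The factor \<open>d ^ m\<close> pays for the incomplete last block.\<close>
  have "real (TS G fun_scale (tensor_act \<rho>) (tensor_power scale n)) \<le> real (d ^ m) * c ^ n" for n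
  proof -
    have "real (TS G fun_scale (tensor_act \<rho>) (tensor_power scale n)) \<le> real ((d ^ m - 1) ^ (n div m) * d ^ (n mod m))"
      using TS by (rule of_nat_mono)
    also have "\<dots> = c ^ (m * (n div m)) * real d ^ (n mod m)" by (simp add: cm power_mult)
    also have "\<dots> \<le> c ^ n * real d ^ m"
    proof (rule mult_mono)
      show "c ^ (m * (n div m)) \<le> c ^ n" using c1 by (intro power_increasing) auto
      show "real d ^ (n mod m) \<le> real d ^ m" using d m by (intro power_increasing) auto
    qed (use c1 in auto)
    finally show ?thesis by (simp add: mult.commute)
  qed
  then show ?thesis using c1 cd d unfolding d_def[symmetric] by (intro trivial_growth_less[of _ _ _ "real (d ^ m)" c]) auto
qed

end

section \<open>Invariant vectors that no invariant form detects\<close>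

lemma kron_cong:
  assumes "x \<in> words d n" "y \<in> words d n" "\<And>i j. i < d \<Longrightarrow> j < d \<Longrightarrow> A i j = B i j"
  shows "kron A x y = kron B x y"
  unfolding kron_def using assms words_nth[OF assms(1)] words_nth[OF assms(2)] words_length[OF assms(1)]
  by (intro prod.cong refl) auto

text \<open>The averaging argument: a nonzero invariant vector that dies in the coinvariants of a finite group
  forces the order of the group to vanish in the field, so that Sylow's theorem applies.\<close>

lemma finite_matrix_group_p_element:
  fixes G :: "('g, 'm) monoid_scheme" and M :: "'g \<Rightarrow> nat \<Rightarrow> nat \<Rightarrow> 'k::field"
  assumes G: "group G" and p: "CHAR('k) > 0" and I: "finite I" "I \<subseteq> G0" and G0: "subgroup G0 G"
    and M_mult: "\<And>g h i j. g \<in> G0 \<Longrightarrow> h \<in> G0 \<Longrightarrow> i < d \<Longrightarrow> j < d \<Longrightarrow> M (g \<otimes>\<^bsub>G\<^esub> h) i j = (\<Sum>k<d. M g i k * M h k j)"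
    and M_one: "\<And>i j. i < d \<Longrightarrow> j < d \<Longrightarrow> M \<one>\<^bsub>G\<^esub> i j = (if i = j then 1 else 0)"
    and fin: "finite R" "\<And>g i j. g \<in> G0 \<Longrightarrow> i < d \<Longrightarrow> j < d \<Longrightarrow> M g i j \<in> R"
    and fixed: "\<And>g x. g \<in> G0 \<Longrightarrow> x \<in> words d n \<Longrightarrow> (\<Sum>w\<in>words d n. kron (M g) x w * z w) = z x"
    and coinv: "\<And>x. x \<in> words d n \<Longrightarrow> z x = (\<Sum>g\<in>I. (\<Sum>w\<in>words d n. kron (M g) x w * t g w) - t g x)"
    and x0: "x0 \<in> words d n" "z x0 \<noteq> 0"
  shows "\<exists>g\<in>G0. (\<exists>i<d. \<exists>j<d. M g i j \<noteq> (if i = j then 1 else 0)) \<and>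
     (\<forall>i<d. \<forall>j<d. M (g [^]\<^bsub>G\<^esub> CHAR('k)) i j = (if i = j then 1 else 0))"
proof -
  interpret G: group G by (rule G)
  interpret G0: subgroup G0 G by (rule G0)
  define N where "N g = mat d d (\<lambda>(i, j). M g i j)" for g
  \<comment> \<open>Matrices are counted rather than elements of \<open>G0\<close>, which may be
    infinite; the finitely many possible entries bound their number.\<close>
  define \<G> where "\<G> = N ` G0"
  define H :: "'k mat monoid" where "H = \<lparr>carrier = \<G>, monoid.mult = (*), one = 1\<^sub>m d\<rparr>"
  have N_car: "N g \<in> carrier_mat d d" for g by (simp add: N_def)
  have N_mult: "N (g \<otimes>\<^bsub>G\<^esub> h) = N g * N h" if "g \<in> G0" "h \<in> G0" for g h
    unfolding N_def by (rule eq_matI) (auto simp: M_mult that scalar_prod_def atLeast0LessThan)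
  have N_one: "N \<one>\<^bsub>G\<^esub> = 1\<^sub>m d"
    unfolding N_def by (rule eq_matI) (auto simp: M_one)
  have fin\<G>: "finite \<G>"
  proof -
    have "\<G> \<subseteq> (\<lambda>h. mat d d (\<lambda>(i, j). h (i, j))) ` (PiE ({..<d} \<times> {..<d}) (\<lambda>_. R))"
    proof
      fix P assume "P \<in> \<G>"
      then obtain g where g: "g \<in> G0" "P = N g" by (auto simp: \<G>_def)
      define h where "h = restrict (\<lambda>(i, j). M g i j) ({..<d} \<times> {..<d})"
      have "P = mat d d (\<lambda>(i, j). h (i, j))" unfolding g(2) N_def by (rule eq_matI) (auto simp: h_def)
      moreover have "h \<in> PiE ({..<d} \<times> {..<d}) (\<lambda>_. R)" using fin(2)[OF g(1)] by (auto simp: h_def)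
      ultimately show "P \<in> (\<lambda>h. mat d d (\<lambda>(i, j). h (i, j))) ` (PiE ({..<d} \<times> {..<d}) (\<lambda>_. R))" by blast
    qed
    then show ?thesis by (rule finite_subset) (intro finite_imageI finite_PiE fin finite_cartesian_product finite_lessThan)
  qed
  have grp: "group H"
  proof (rule groupI)
    fix P Q assume "P \<in> carrier H" "Q \<in> carrier H"
    then obtain g h where "g \<in> G0" "h \<in> G0" "P = N g" "Q = N h" by (auto simp: H_def \<G>_def)
    moreover from this have "N (g \<otimes>\<^bsub>G\<^esub> h) \<in> \<G>" unfolding \<G>_def by (intro imageI G0.m_closed)
    ultimately show "P \<otimes>\<^bsub>H\<^esub> Q \<in> carrier H" using N_mult[of g h] by (simp add: H_def)
  next
    have "N \<one>\<^bsub>G\<^esub> \<in> \<G>" unfolding \<G>_def by (rule imageI[OF G0.one_closed])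
    then show "\<one>\<^bsub>H\<^esub> \<in> carrier H" using N_one by (simp add: H_def)
  next
    fix P Q P' assume "P \<in> carrier H" "Q \<in> carrier H" "P' \<in> carrier H"
    then have "P \<in> carrier_mat d d" "Q \<in> carrier_mat d d" "P' \<in> carrier_mat d d" using N_car by (auto simp: H_def \<G>_def)
    then show "P \<otimes>\<^bsub>H\<^esub> Q \<otimes>\<^bsub>H\<^esub> P' = P \<otimes>\<^bsub>H\<^esub> (Q \<otimes>\<^bsub>H\<^esub> P')" by (simp add: H_def)
  next
    fix P assume "P \<in> carrier H"
    then have "P \<in> carrier_mat d d" using N_car by (auto simp: H_def \<G>_def)
    then show "\<one>\<^bsub>H\<^esub> \<otimes>\<^bsub>H\<^esub> P = P" by (simp add: H_def)
  next
    fix P assume "P \<in> carrier H"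
    then obtain g where g: "g \<in> G0" "P = N g" by (auto simp: H_def \<G>_def)
    have "N (inv\<^bsub>G\<^esub> g) * N g = 1\<^sub>m d"
      using N_mult[of "inv\<^bsub>G\<^esub> g" g] N_one G0.m_inv_closed[OF g(1)] G.l_inv[OF G0.mem_carrier[OF g(1)]] g(1) by simp
    then show "\<exists>Q\<in>carrier H. Q \<otimes>\<^bsub>H\<^esub> P = \<one>\<^bsub>H\<^esub>" using g G0.m_inv_closed[OF g(1)] by (auto simp: H_def \<G>_def)
  qed
  interpret H: group H by (rule grp)
  define kr where "kr P = kron (\<lambda>i j. P $$ (i, j))" for P :: "'k mat"
  have kr_N: "kr (N g) x w = kron (M g) x w" if "x \<in> words d n" "w \<in> words d n" for g x w
    unfolding kr_def by (rule kron_cong[OF that]) (simp add: N_def)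
  \<comment> \<open>Every matrix of the group fixes \<open>z\<close>, so summing the action over the
    group multiplies by its order.\<close>
  have "of_nat (card \<G>) * z x0 = (\<Sum>P\<in>\<G>. \<Sum>w\<in>words d n. kr P x0 w * z w)"
  proof -
    have "(\<Sum>w\<in>words d n. kr P x0 w * z w) = z x0" if P: "P \<in> \<G>" for P
    proof -
      obtain g where g: "g \<in> G0" "P = N g" using P by (auto simp: \<G>_def)
      have "(\<Sum>w\<in>words d n. kr P x0 w * z w) = (\<Sum>w\<in>words d n. kron (M g) x0 w * z w)"
        unfolding g(2) by (intro sum.cong refl) (simp add: kr_N[OF x0(1)])
      then show ?thesis using fixed[OF g(1) x0(1)] by simp
    qed
    then show ?thesis by simp
  qed
  also have "\<dots> = (\<Sum>P\<in>\<G>. \<Sum>g\<in>I. (\<Sum>v\<in>words d n. kr (P * N g) x0 v * t g v) - (\<Sum>w\<in>words d n. kr P x0 w * t g w))"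
  proof (rule sum.cong[OF refl])
    fix P assume "P \<in> \<G>"
    then have Pc: "P \<in> carrier_mat d d" using N_car by (auto simp: \<G>_def)
    have "(\<Sum>w\<in>words d n. kr P x0 w * z w) =
      (\<Sum>w\<in>words d n. \<Sum>g\<in>I. kr P x0 w * (\<Sum>v\<in>words d n. kron (M g) w v * t g v) - kr P x0 w * t g w)"
      by (intro sum.cong refl) (simp add: coinv sum_distrib_left right_diff_distrib)
    also have "\<dots> = (\<Sum>g\<in>I. (\<Sum>w\<in>words d n. kr P x0 w * (\<Sum>v\<in>words d n. kron (M g) w v * t g v)) - (\<Sum>w\<in>words d n. kr P x0 w * t g w))"
      by (subst sum.swap) (simp add: sum_subtractf)
    also have "\<dots> = (\<Sum>g\<in>I. (\<Sum>v\<in>words d n. kr (P * N g) x0 v * t g v) - (\<Sum>w\<in>words d n. kr P x0 w * t g w))"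
    proof (rule sum.cong[OF refl], rule arg_cong2[of _ _ _ _ "(-)", OF _ refl])
      fix g assume "g \<in> I"
      have "(\<Sum>w\<in>words d n. kr P x0 w * (\<Sum>v\<in>words d n. kron (M g) w v * t g v))
        = (\<Sum>v\<in>words d n. (\<Sum>w\<in>words d n. kr P x0 w * kron (M g) w v) * t g v)"
        unfolding sum_distrib_left sum_distrib_right by (subst sum.swap) (simp add: mult.assoc)
      also have "\<dots> = (\<Sum>v\<in>words d n. kr (P * N g) x0 v * t g v)"
      proof (intro sum.cong refl arg_cong2[of _ _ _ _ "(*)"])
        fix v assume v: "v \<in> words d n"
        show "(\<Sum>w\<in>words d n. kr P x0 w * kron (M g) w v) = kr (P * N g) x0 v"
          unfolding kr_def by (rule kron_mult[OF x0(1) v])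
            (use Pc in \<open>auto simp: N_def scalar_prod_def atLeast0LessThan\<close>)
      qed
      finally show "(\<Sum>w\<in>words d n. kr P x0 w * (\<Sum>v\<in>words d n. kron (M g) w v * t g v)) = (\<Sum>v\<in>words d n. kr (P * N g) x0 v * t g v)" .
    qed
    finally show "(\<Sum>w\<in>words d n. kr P x0 w * z w) =
      (\<Sum>g\<in>I. (\<Sum>v\<in>words d n. kr (P * N g) x0 v * t g v) - (\<Sum>w\<in>words d n. kr P x0 w * t g w))" .
  qed
  also have "\<dots> = (\<Sum>g\<in>I. (\<Sum>P\<in>\<G>. \<Sum>v\<in>words d n. kr (P * N g) x0 v * t g v) - (\<Sum>P\<in>\<G>. \<Sum>w\<in>words d n. kr P x0 w * t g w))"
    by (subst sum.swap) (simp add: sum_subtractf)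
  also have "\<dots> = 0"
  proof (rule sum.neutral, rule ballI)
    fix g assume "g \<in> I"
    then have g: "N g \<in> carrier H" using I by (auto simp: H_def \<G>_def)
    \<comment> \<open>Right multiplication permutes the finite group, so the two sums coming from a
      difference \<open>g t - t\<close> cancel.\<close>
    have inj: "inj_on (\<lambda>P. P * N g) \<G>"
      using H.inj_on_multc[OF g] by (simp add: H_def)
    moreover have "(\<lambda>P. P * N g) ` \<G> \<subseteq> \<G>"
      using H.m_closed[OF _ g] by (auto simp: H_def)
    then have "(\<lambda>P. P * N g) ` \<G> = \<G>" by (rule endo_inj_surj[OF fin\<G> _ inj])
    ultimately have "(\<Sum>P\<in>\<G>. h (P * N g)) = (\<Sum>P\<in>\<G>. h P)" for h :: "'k mat \<Rightarrow> 'k"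
      using sum.reindex[of "\<lambda>P. P * N g" \<G> h] by simp
    from this[of "\<lambda>P. \<Sum>v\<in>words d n. kr P x0 v * t g v"]
    show "(\<Sum>P\<in>\<G>. \<Sum>v\<in>words d n. kr (P * N g) x0 v * t g v) - (\<Sum>P\<in>\<G>. \<Sum>w\<in>words d n. kr P x0 w * t g w) = 0"
      by simp
  qed
  finally have "of_nat (card \<G>) = (0 :: 'k)" using x0(2) by simp
  then have "CHAR('k) dvd card \<G>" by (simp add: of_nat_eq_0_iff_char_dvd)
  \<comment> \<open>Only one factor \<open>p\<close> is extracted, so that the subgroup from Sylow's
    theorem has order exactly \<open>p\<close>.\<close>
  then obtain m where m: "order H = CHAR('k) ^ 1 * m" by (auto simp: order_def H_def)
  have pr: "prime CHAR('k)" by (rule prime_CHAR_semidom[OF p])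
  obtain Q where Q: "subgroup Q H" "card Q = CHAR('k) ^ 1"
    using sylow_thm[OF pr grp m] fin\<G> by (auto simp: H_def)
  interpret Q: subgroup Q H by (rule Q(1))
  have "card Q > 1" using Q(2) prime_gt_1_nat[OF pr] by simp
  then have "Q \<noteq> {\<one>\<^bsub>H\<^esub>}" by auto
  then obtain P where P: "P \<in> Q" "P \<noteq> \<one>\<^bsub>H\<^esub>" using Q.one_closed by blast
  have "group (H\<lparr>carrier := Q\<rparr>)" by (rule Q.subgroup_is_group[OF grp])
  from group.pow_order_eq_1[OF this, of P] have "P [^]\<^bsub>H\<^esub> CHAR('k) = \<one>\<^bsub>H\<^esub>"
    using P(1) Q(2) by (simp add: order_def H.nat_pow_consistent[of P _ Q])
  moreover obtain g where g: "g \<in> G0" "P = N g" using Q.subset P(1) by (auto simp: H_def \<G>_def)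
  have pow: "N (g [^]\<^bsub>G\<^esub> k) = N g [^]\<^bsub>H\<^esub> k \<and> g [^]\<^bsub>G\<^esub> k \<in> G0" for k :: nat
  proof (induction k)
    case 0
    then show ?case using N_one by (simp add: H_def)
  next
    case (Suc k)
    then show ?case using N_mult[of "g [^]\<^bsub>G\<^esub> k" g] g by (simp add: H_def)
  qed
  ultimately have "N (g [^]\<^bsub>G\<^esub> CHAR('k)) = 1\<^sub>m d" using g by (simp add: H_def)
  have one: "M (g [^]\<^bsub>G\<^esub> CHAR('k)) i j = (if i = j then 1 else 0)" if "i < d" "j < d" for i j
    using arg_cong[OF \<open>N (g [^]\<^bsub>G\<^esub> CHAR('k)) = 1\<^sub>m d\<close>, of "\<lambda>A. A $$ (i, j)"] that by (simp add: N_def)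
  have "\<exists>i<d. \<exists>j<d. M g i j \<noteq> (if i = j then 1 else 0)"
  proof (rule ccontr)
    assume "\<not> ?thesis"
    then have "N g = 1\<^sub>m d" unfolding N_def by (intro eq_matI) auto
    then show False using P(2) g(2) by (simp add: H_def)
  qed
  then show ?thesis using g(1) one by blast
qed

context based_space
begin

text \<open>The forms that vanish on all differences \<open>g t - t\<close> are exactly the
  invariant ones. If \<open>z\<close> were not a sum of such differences, a separating functional
  would be an invariant form detecting it.\<close>

lemma coinvariant_certificate:
  assumes not_detected: "\<And>h. (\<And>g. g \<in> carrier G \<Longrightarrow> fixed_form n (\<rho> g) h) \<Longrightarrow> (\<Sum>x\<in>W n. h x * z x) = 0"
  shows "\<exists>I t. finite I \<and> I \<subseteq> carrier G \<and>
    (\<forall>x\<in>W n. z x = (\<Sum>g\<in>I. (\<Sum>w\<in>W n. kron (mco (\<rho> g)) x w * t g w) - t g x))"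
proof -
  interpret E: vector_space "fun_scale :: 'k \<Rightarrow> (nat list \<Rightarrow> 'k) \<Rightarrow> _" by (rule fun_scale_vector_space)
  define \<delta> where "\<delta> g t = (\<lambda>x. if x \<in> W n then (\<Sum>w\<in>W n. kron (mco (\<rho> g)) x w * t w) - t x else 0)" for g t
  have \<delta>_add: "\<delta> g (\<lambda>x. s x + t x) = \<delta> g s + \<delta> g t" for g s t
    by (rule ext) (simp add: \<delta>_def algebra_simps sum.distrib)
  have \<delta>_scale: "\<delta> g (\<lambda>x. c * t x) = fun_scale c (\<delta> g t)" for g c t
    by (rule ext) (simp add: \<delta>_def algebra_simps sum_distrib_left fun_scale_def)
  have \<delta>_0: "\<delta> g (\<lambda>_. 0) = 0" for g by (rule ext) (simp add: \<delta>_def)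
  \<comment> \<open>One vector per group element is enough since \<open>\<delta> g\<close> is
    linear; the zero convention off \<open>I\<close> lets two such sums be extended to the union of
    their index sets.\<close>
  define S where "S = {v. \<exists>I t. finite I \<and> I \<subseteq> carrier G \<and> (\<forall>g. g \<notin> I \<longrightarrow> t g = (\<lambda>_. 0)) \<and> v = (\<Sum>g\<in>I. \<delta> g (t g))}"
  have sub: "E.subspace S"
  proof (rule E.subspaceI)
    show "0 \<in> S" unfolding S_def by (intro CollectI exI[of _ "{}"] exI[of _ "\<lambda>_ _. 0"]) simp
    fix v w assume "v \<in> S" "w \<in> S"
    then obtain I s J t where *: "finite I" "I \<subseteq> carrier G" "\<forall>g. g \<notin> I \<longrightarrow> s g = (\<lambda>_. 0)" "v = (\<Sum>g\<in>I. \<delta> g (s g))"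
       "finite J" "J \<subseteq> carrier G" "\<forall>g. g \<notin> J \<longrightarrow> t g = (\<lambda>_. 0)" "w = (\<Sum>g\<in>J. \<delta> g (t g))"
      unfolding S_def by blast
    have "v = (\<Sum>g\<in>I \<union> J. \<delta> g (s g))" unfolding *(4)
      by (rule sum.mono_neutral_left) (use * \<delta>_0 in auto)
    moreover have "w = (\<Sum>g\<in>I \<union> J. \<delta> g (t g))" unfolding *(8)
      by (rule sum.mono_neutral_left) (use * \<delta>_0 in auto)
    ultimately have "v + w = (\<Sum>g\<in>I \<union> J. \<delta> g (\<lambda>x. s g x + t g x))" by (simp add: \<delta>_add sum.distrib)
    moreover have "\<forall>g. g \<notin> I \<union> J \<longrightarrow> (\<lambda>x. s g x + t g x) = (\<lambda>_. 0)" using *(3,7) by auto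
    moreover have "finite (I \<union> J)" "I \<union> J \<subseteq> carrier G" using * by auto
    ultimately show "v + w \<in> S" unfolding S_def
      by (intro CollectI exI[of _ "I \<union> J"] exI[of _ "\<lambda>g x. s g x + t g x"] conjI)
  next
    fix c v assume "v \<in> S"
    then obtain I s where *: "finite I" "I \<subseteq> carrier G" "\<forall>g. g \<notin> I \<longrightarrow> s g = (\<lambda>_. 0)" "v = (\<Sum>g\<in>I. \<delta> g (s g))"
      unfolding S_def by blast
    have "fun_scale c v = (\<Sum>g\<in>I. \<delta> g (\<lambda>x. c * s g x))" unfolding *(4) \<delta>_scale by (rule E.scale_sum_right)
    moreover have "\<forall>g. g \<notin> I \<longrightarrow> (\<lambda>x. c * s g x) = (\<lambda>_. 0)" using *(3) by auto
    ultimately show "fun_scale c v \<in> S" unfolding S_def using *(1,2)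
      by (intro CollectI exI[of _ I] exI[of _ "\<lambda>g x. c * s g x"] conjI)
  qed
  have \<delta>S: "\<delta> g t \<in> S" if "g \<in> carrier G" for g t
    unfolding S_def using that by (intro CollectI exI[of _ "{g}"] exI[of _ "\<lambda>h. if h = g then t else (\<lambda>_. 0)"]) auto
  \<comment> \<open>Cutting off outside the words makes a functional computable from finitely many
    values.\<close>
  define z' where "z' x = (if x \<in> W n then z x else 0)" for x
  have "z' \<in> S"
  proof (rule ccontr)
    assume "z' \<notin> S"
    from E.separating_functional[OF sub this] obtain f where
      f: "Vector_Spaces.linear fun_scale (*) f" "\<And>s. s \<in> S \<Longrightarrow> f s = 0" "f z' = 1" by blast
    interpret f: Vector_Spaces.linear fun_scale "(*)" f by (rule f(1))
    define e where "e x = (\<lambda>y. if y = x then 1 else 0 :: 'k)" for x :: "nat list"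
    define h where "h x = f (e x)" for x
    have fh: "f v = (\<Sum>x\<in>W n. h x * v x)" if "\<And>x. x \<notin> W n \<Longrightarrow> v x = 0" for v
    proof -
      have "v = (\<Sum>x\<in>W n. fun_scale (v x) (e x))"
        by (rule ext) (simp add: sum_fun_scale_apply e_def sum_mult_delta that)
      then have "f v = f (\<Sum>x\<in>W n. fun_scale (v x) (e x))" by (rule arg_cong)
      then show ?thesis by (simp add: f.sum f.scale h_def mult.commute)
    qed
    have "fixed_form n (\<rho> g) h" if g: "g \<in> carrier G" for g
      unfolding fixed_form_def
    proof
      fix y assume y: "y \<in> W n"
      have \<delta>e: "\<delta> g (e y) x = kron (mco (\<rho> g)) x y - e y x" if "x \<in> W n" for x
        using that y by (simp add: \<delta>_def e_def sum_mult_delta)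
      have "0 = f (\<delta> g (e y))" using f(2)[OF \<delta>S[OF g]] by simp
      also have "\<dots> = (\<Sum>x\<in>W n. h x * \<delta> g (e y) x)" by (rule fh) (simp add: \<delta>_def)
      also have "\<dots> = (\<Sum>x\<in>W n. h x * kron (mco (\<rho> g)) x y - h x * e y x)"
        by (intro sum.cong refl) (simp add: \<delta>e right_diff_distrib)
      also have "\<dots> = (\<Sum>x\<in>W n. h x * kron (mco (\<rho> g)) x y) - h y"
        unfolding sum_subtractf using y by (simp add: e_def sum_mult_delta)
      finally show "(\<Sum>x\<in>W n. h x * kron (mco (\<rho> g)) x y) = h y" by simp
    qed
    then have "(\<Sum>x\<in>W n. h x * z x) = 0" by (rule not_detected)
    moreover have "f z' = (\<Sum>x\<in>W n. h x * z' x)" by (rule fh) (simp add: z'_def)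
    moreover have "(\<Sum>x\<in>W n. h x * z' x) = (\<Sum>x\<in>W n. h x * z x)" by (intro sum.cong refl) (simp add: z'_def)
    ultimately show False using f(3) by simp
  qed
  then obtain I t where It: "finite I" "I \<subseteq> carrier G" "z' = (\<Sum>g\<in>I. \<delta> g (t g))" unfolding S_def by blast
  have "z x = (\<Sum>g\<in>I. (\<Sum>w\<in>W n. kron (mco (\<rho> g)) x w * t g w) - t g x)" if x: "x \<in> W n" for x
  proof -
    have app: "(\<Sum>g\<in>J. A g) x = (\<Sum>g\<in>J. A g x)" for A :: "'d \<Rightarrow> nat list \<Rightarrow> 'k" and J
      by (induction J rule: infinite_finite_induct) auto
    have "z x = z' x" using x by (simp add: z'_def)
    also have "\<dots> = (\<Sum>g\<in>I. \<delta> g (t g) x)" unfolding It(3) app ..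
    finally show ?thesis using x by (simp add: \<delta>_def)
  qed
  then show ?thesis using It(1,2) by blast
qed

end

section \<open>Specialising determinants and matrix groups\<close>

lemma permutes_lt: "p permutes {0..<d} \<Longrightarrow> i < d \<Longrightarrow> p i < (d :: nat)"
  using permutes_in_image[of p "{0..<d}" i] by simp

lemma det_in_subring:
  assumes R: "is_subring R" and M: "\<And>i j. i < d \<Longrightarrow> j < d \<Longrightarrow> M i j \<in> R"
  shows "det (mat d d (\<lambda>(i, j). M i j)) \<in> R"
proof -
  have sg: "signof p \<in> R" for p :: "nat \<Rightarrow> nat"
    using is_subringD(2)[OF R] is_subring_uminus[OF R] by (auto simp: sign_def)
  have "det (mat d d (\<lambda>(i, j). M i j)) = (\<Sum>p | p permutes {0..<d}. signof p * (\<Prod>i = 0..<d. M i (p i)))"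
    unfolding det_def by (auto intro!: sum.cong prod.cong arg_cong2[of _ _ _ _ "(*)"] simp: permutes_lt)
  also have "\<dots> \<in> R"
    by (intro is_subring_sum[OF R] is_subringD(5)[OF R] sg is_subring_prod[OF R] M) (auto simp: permutes_lt)
  finally show ?thesis .
qed

text \<open>The Leibniz formula is a polynomial with integer coefficients in the entries.\<close>

lemma det_hom_on:
  fixes \<phi> :: "'b::comm_ring_1 \<Rightarrow> 'c::comm_ring_1"
  assumes R: "is_subring R" and \<phi>: "hom_on R \<phi>" and M: "\<And>i j. i < d \<Longrightarrow> j < d \<Longrightarrow> M i j \<in> R"
  shows "\<phi> (det (mat d d (\<lambda>(i, j). M i j))) = det (mat d d (\<lambda>(i, j). \<phi> (M i j)))"
proof -
  have sg: "signof p \<in> R" for p :: "nat \<Rightarrow> nat"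
    using is_subringD(2)[OF R] is_subring_uminus[OF R] by (auto simp: sign_def)
  have \<phi>sg: "\<phi> (signof p) = signof p" for p :: "nat \<Rightarrow> nat"
    using hom_onD(1)[OF \<phi>] hom_on_uminus[OF R \<phi> is_subringD(2)[OF R]] by (auto simp: sign_def)
  have e: "det (mat d d (\<lambda>(i, j). M i j)) = (\<Sum>p | p permutes {0..<d}. signof p * (\<Prod>i = 0..<d. M i (p i)))" for M :: "nat \<Rightarrow> nat \<Rightarrow> 'e::comm_ring_1"
    unfolding det_def by (auto intro!: sum.cong prod.cong arg_cong2[of _ _ _ _ "(*)"] simp: permutes_lt)
  have pr: "(\<Prod>i = 0..<d. M i (p i)) \<in> R" if "p permutes {0..<d}" for p
    using that by (intro is_subring_prod[OF R] M) (auto simp: permutes_lt)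
  have "\<phi> (\<Sum>p | p permutes {0..<d}. signof p * (\<Prod>i = 0..<d. M i (p i)))
    = (\<Sum>p | p permutes {0..<d}. \<phi> (signof p * (\<Prod>i = 0..<d. M i (p i))))"
    by (intro hom_on_sum[OF R \<phi>] is_subringD(5)[OF R] sg pr) auto
  also have "\<dots> = (\<Sum>p | p permutes {0..<d}. signof p * (\<Prod>i = 0..<d. \<phi> (M i (p i))))"
  proof (intro sum.cong refl)
    fix p assume "p \<in> {p. p permutes {0..<d}}"
    then have p: "p permutes {0..<d}" by simp
    have "\<phi> (signof p * (\<Prod>i = 0..<d. M i (p i))) = \<phi> (signof p) * \<phi> (\<Prod>i = 0..<d. M i (p i))"
      by (rule hom_onD(3)[OF \<phi> sg pr[OF p]])
    also have "\<phi> (\<Prod>i = 0..<d. M i (p i)) = (\<Prod>i = 0..<d. \<phi> (M i (p i)))"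
      by (rule hom_on_prod[OF R \<phi>]) (use M p in \<open>auto simp: permutes_lt\<close>)
    finally show "\<phi> (signof p * (\<Prod>i = 0..<d. M i (p i))) = signof p * (\<Prod>i = 0..<d. \<phi> (M i (p i)))"
      by (simp add: \<phi>sg)
  qed
  finally show ?thesis unfolding e .
qed

lemma hom_GL_linear:
  "\<rho> \<in> hom G (GL scale) \<Longrightarrow> g \<in> carrier G \<Longrightarrow> Vector_Spaces.linear scale scale (\<rho> g)"
  using hom_in_carrier[of \<rho> G "GL scale" g] by (simp add: GL_def)

lemma hom_GL_mult:
  "\<rho> \<in> hom G (GL scale) \<Longrightarrow> g \<in> carrier G \<Longrightarrow> h \<in> carrier G \<Longrightarrow> \<rho> (g \<otimes>\<^bsub>G\<^esub> h) = \<rho> g \<circ> \<rho> h"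
  using hom_mult[of \<rho> G "GL scale" g h] by (simp add: GL_def)

lemma hom_GL_one:
  assumes "group G" and \<rho>: "\<rho> \<in> hom G (GL scale)"
  shows "\<rho> \<one>\<^bsub>G\<^esub> = id"
proof -
  interpret G: group G by fact
  have "\<rho> \<one>\<^bsub>G\<^esub> \<circ> \<rho> \<one>\<^bsub>G\<^esub> = \<rho> \<one>\<^bsub>G\<^esub>" using hom_GL_mult[OF \<rho> G.one_closed G.one_closed] by simp
  moreover have "bij (\<rho> \<one>\<^bsub>G\<^esub>)" using hom_in_carrier[OF \<rho> G.one_closed] by (simp add: GL_def)
  ultimately show ?thesis by (metis bij_is_inj comp_assoc fun.map_id inj_iff)
qed

locale alg_closed_space = based_space scale bs
  for scale :: "'k::alg_closed_field \<Rightarrow> 'v::ab_group_add \<Rightarrow> 'v" and bs +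
  assumes char_pos: "CHAR('k) > 0"
begin

text \<open>The certificate, the invariant vector and the matrices of \<open>I\<close> need only
  finitely many coefficients, so a specialisation with finite image that keeps \<open>z x0\<close>
  nonzero carries the whole situation to a finite matrix group. The set \<open>F\<close> is free so
  that the rings can later be made to exhaust the field.\<close>

lemma specialised_p_element:
  assumes G: "group G" and \<rho>: "\<rho> \<in> hom G (GL scale)" and I: "finite I" "I \<subseteq> carrier G"
    and z: "\<And>g. g \<in> carrier G \<Longrightarrow> fixed_vec n (\<rho> g) z"
    and cert: "\<And>x. x \<in> W n \<Longrightarrow> z x = (\<Sum>g\<in>I. (\<Sum>w\<in>W n. kron (mco (\<rho> g)) x w * t g w) - t g x)"
    and x0: "x0 \<in> W n" "z x0 \<noteq> 0" and F: "finite F"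
  shows "\<exists>(R :: 'k set) (\<phi> :: 'k \<Rightarrow> 'k) g. is_subring R \<and> F \<subseteq> R \<and> hom_on R \<phi> \<and> g \<in> carrier G \<and>
    (\<forall>h. (\<exists>k. h = g [^]\<^bsub>G\<^esub> (k::nat) \<or> h = inv\<^bsub>G\<^esub> g) \<longrightarrow> h \<in> carrier G \<and> (\<forall>i<length bs. \<forall>j<length bs. mco (\<rho> h) i j \<in> R)) \<and>
    (\<exists>i<length bs. \<exists>j<length bs. \<phi> (mco (\<rho> g) i j) \<noteq> (if i = j then 1 else 0)) \<and>
    (\<forall>i<length bs. \<forall>j<length bs. \<phi> (mco (\<rho> (g [^]\<^bsub>G\<^esub> CHAR('k))) i j) = (if i = j then 1 else 0))"
proof -
  interpret G: group G by (rule G)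
  let ?d = "length bs"
  note lin = hom_GL_linear[OF \<rho>] and mult = hom_GL_mult[OF \<rho>] and one = hom_GL_one[OF G \<rho>]
  \<comment> \<open>Entries of inverses are included so that all matrices of the generated subgroup
    have entries in the ring.\<close>
  define S where "S = F \<union> ((\<lambda>(g, i, j). mco (\<rho> g) i j) ` ((I \<union> (\<lambda>g. inv\<^bsub>G\<^esub> g) ` I) \<times> {..<?d} \<times> {..<?d}))
     \<union> z ` W n \<union> (\<lambda>(g, x). t g x) ` (I \<times> W n)"
  have finS: "finite S" unfolding S_def using I F by auto
  define R where "R = gen_ring S"
  have R: "is_subring R" unfolding R_def by (rule is_subring_gen_ring)
  have SR: "S \<subseteq> R" unfolding R_def by (rule gen_ring_superset)
  have zR: "z x \<in> R" if "x \<in> W n" for x using SR that by (auto simp: S_def)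
  have tR: "t g x \<in> R" if "g \<in> I" "x \<in> W n" for g x using SR that by (force simp: S_def)
  define G0 where "G0 = generate G I"
  have sub: "subgroup G0 G" unfolding G0_def by (rule G.generate_is_subgroup[OF I(2)])
  interpret G0: subgroup G0 G by (rule sub)
  have mR: "mco (\<rho> g) i j \<in> R" if "g \<in> G0" "i < ?d" "j < ?d" for g i j
    using that unfolding G0_def
  proof (induction g arbitrary: i j rule: generate.induct)
    case one
    then show ?case unfolding \<open>\<rho> \<one>\<^bsub>G\<^esub> = id\<close> mco_id[OF one] using is_subringD(1,2)[OF R] by simp
  next
    case (incl h)
    then have "mco (\<rho> h) i j \<in> (\<lambda>(g, i, j). mco (\<rho> g) i j) ` ((I \<union> (\<lambda>g. inv\<^bsub>G\<^esub> g) ` I) \<times> {..<?d} \<times> {..<?d})"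
      by (intro image_eqI[of _ _ "(h, i, j)"]) simp_all
    then have "mco (\<rho> h) i j \<in> S" unfolding S_def by (rule UnI1[OF UnI1[OF UnI2]])
    then show ?case using SR by auto
  next
    case (inv h)
    then have "mco (\<rho> (inv\<^bsub>G\<^esub> h)) i j \<in> (\<lambda>(g, i, j). mco (\<rho> g) i j) ` ((I \<union> (\<lambda>g. inv\<^bsub>G\<^esub> g) ` I) \<times> {..<?d} \<times> {..<?d})"
      by (intro image_eqI[of _ _ "(inv\<^bsub>G\<^esub> h, i, j)"]) simp_all
    then have "mco (\<rho> (inv\<^bsub>G\<^esub> h)) i j \<in> S" unfolding S_def by (rule UnI1[OF UnI1[OF UnI2]])
    then show ?case using SR by auto
  next
    case (eng h1 h2)
    have c: "h1 \<in> carrier G" "h2 \<in> carrier G"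
      using eng.hyps G.generate_in_carrier[OF I(2)] by blast+
    show ?case unfolding mult[OF c] mco_comp[OF lin[OF c(1)]]
      by (intro is_subring_sum[OF R] is_subringD(5)[OF R] eng.IH eng.prems) auto
  qed
  have kR: "kron (mco (\<rho> g)) x w \<in> R" if "g \<in> G0" "x \<in> W n" "w \<in> W n" for g x w
    unfolding kron_def using mR[OF that(1)] words_nth[OF that(2)] words_nth[OF that(3)] words_length[OF that(2)]
    by (intro is_subring_prod[OF R]) auto
  obtain \<phi> :: "'k \<Rightarrow> 'k" where \<phi>: "hom_on R \<phi>" "finite (\<phi> ` R)" "\<phi> (z x0) \<noteq> 0"
    using finite_specialisation[OF char_pos finS, of "z x0"] zR[OF x0(1)] x0(2) unfolding R_def by blast
  define M where "M g i j = \<phi> (mco (\<rho> g) i j)" for g i j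
  have kM: "kron (M g) x w = \<phi> (kron (mco (\<rho> g)) x w)" if "g \<in> G0" "x \<in> W n" "w \<in> W n" for g x w
    unfolding kron_def M_def using mR[OF that(1)] words_nth[OF that(2)] words_nth[OF that(3)] words_length[OF that(2)]
    by (intro hom_on_prod[OF R \<phi>(1), symmetric]) auto
  have IG0: "I \<subseteq> G0" unfolding G0_def using generate.incl by auto
  have M_mult: "M (g \<otimes>\<^bsub>G\<^esub> h) i j = (\<Sum>k<?d. M g i k * M h k j)" if gh: "g \<in> G0" "h \<in> G0" and ij: "i < ?d" "j < ?d" for g h i j
  proof -
    have c: "g \<in> carrier G" "h \<in> carrier G" using gh by auto
    have "M (g \<otimes>\<^bsub>G\<^esub> h) i j = \<phi> (\<Sum>k<?d. mco (\<rho> g) i k * mco (\<rho> h) k j)"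
      unfolding M_def mult[OF c] mco_comp[OF lin[OF c(1)]] ..
    also have "\<dots> = (\<Sum>k<?d. \<phi> (mco (\<rho> g) i k * mco (\<rho> h) k j))"
      by (rule hom_on_sum[OF R \<phi>(1)]) (use mR gh ij in \<open>auto intro!: is_subringD(5)[OF R]\<close>)
    also have "\<dots> = (\<Sum>k<?d. M g i k * M h k j)" unfolding M_def
      by (intro sum.cong refl hom_onD(3)[OF \<phi>(1)]) (use mR gh ij in auto)
    finally show ?thesis .
  qed
  have M_one: "M \<one>\<^bsub>G\<^esub> i j = (if i = j then 1 else 0)" if "i < ?d" "j < ?d" for i j
    unfolding M_def one mco_id[OF that] using hom_onD(1)[OF \<phi>(1)] hom_on_0[OF R \<phi>(1)] by simp
  have M_img: "M g i j \<in> \<phi> ` R" if "g \<in> G0" "i < ?d" "j < ?d" for g i j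
    unfolding M_def using mR[OF that] by simp
  have M_fixed: "(\<Sum>w\<in>W n. kron (M g) x w * \<phi> (z w)) = \<phi> (z x)" if g: "g \<in> G0" and x: "x \<in> W n" for g x
  proof -
    have "(\<Sum>w\<in>W n. kron (M g) x w * \<phi> (z w)) = (\<Sum>w\<in>W n. \<phi> (kron (mco (\<rho> g)) x w * z w))"
      by (intro sum.cong refl) (simp add: kM[OF g x] hom_onD(3)[OF \<phi>(1) kR[OF g x] zR])
    also have "\<dots> = \<phi> (\<Sum>w\<in>W n. kron (mco (\<rho> g)) x w * z w)"
      by (rule hom_on_sum[OF R \<phi>(1), symmetric]) (intro is_subringD(5)[OF R] kR[OF g x] zR)
    also have "(\<Sum>w\<in>W n. kron (mco (\<rho> g)) x w * z w) = z x" using z[of g] g x by (auto simp: fixed_vec_def)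
    finally show ?thesis .
  qed
  have M_coinv: "\<phi> (z x) = (\<Sum>g\<in>I. (\<Sum>w\<in>W n. kron (M g) x w * \<phi> (t g w)) - \<phi> (t g x))" if x: "x \<in> W n" for x
  proof -
    have inner: "\<phi> ((\<Sum>w\<in>W n. kron (mco (\<rho> g)) x w * t g w) - t g x) = (\<Sum>w\<in>W n. kron (M g) x w * \<phi> (t g w)) - \<phi> (t g x)"
      and innerR: "(\<Sum>w\<in>W n. kron (mco (\<rho> g)) x w * t g w) - t g x \<in> R" if g: "g \<in> I" for g
    proof -
      have gG: "g \<in> G0" using g IG0 by auto
      have kt: "kron (mco (\<rho> g)) x w * t g w \<in> R" if "w \<in> W n" for w
        by (intro is_subringD(5)[OF R] kR[OF gG x that] tR[OF g that])
      have sR: "(\<Sum>w\<in>W n. kron (mco (\<rho> g)) x w * t g w) \<in> R" by (intro is_subring_sum[OF R] kt)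
      then show "(\<Sum>w\<in>W n. kron (mco (\<rho> g)) x w * t g w) - t g x \<in> R" by (intro is_subringD(4)[OF R] tR[OF g x])
      have "\<phi> ((\<Sum>w\<in>W n. kron (mco (\<rho> g)) x w * t g w) - t g x) = \<phi> (\<Sum>w\<in>W n. kron (mco (\<rho> g)) x w * t g w) - \<phi> (t g x)"
        by (rule hom_on_diff[OF R \<phi>(1) sR tR[OF g x]])
      also have "\<phi> (\<Sum>w\<in>W n. kron (mco (\<rho> g)) x w * t g w) = (\<Sum>w\<in>W n. \<phi> (kron (mco (\<rho> g)) x w * t g w))"
        by (rule hom_on_sum[OF R \<phi>(1) kt])
      also have "\<dots> = (\<Sum>w\<in>W n. kron (M g) x w * \<phi> (t g w))"
        by (intro sum.cong refl) (simp add: kM[OF gG x] hom_onD(3)[OF \<phi>(1) kR[OF gG x] tR[OF g]])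
      finally show "\<phi> ((\<Sum>w\<in>W n. kron (mco (\<rho> g)) x w * t g w) - t g x) = (\<Sum>w\<in>W n. kron (M g) x w * \<phi> (t g w)) - \<phi> (t g x)" .
    qed
    show "\<phi> (z x) = (\<Sum>g\<in>I. (\<Sum>w\<in>W n. kron (M g) x w * \<phi> (t g w)) - \<phi> (t g x))"
      unfolding cert[OF x] by (rule trans[OF hom_on_sum[OF R \<phi>(1) innerR] sum.cong[OF refl inner]])
  qed
  have "\<exists>g\<in>G0. (\<exists>i<?d. \<exists>j<?d. M g i j \<noteq> (if i = j then 1 else 0)) \<and>
     (\<forall>i<?d. \<forall>j<?d. M (g [^]\<^bsub>G\<^esub> CHAR('k)) i j = (if i = j then 1 else 0))"
    by (rule finite_matrix_group_p_element[where G = G and I = I and ?G0.0 = G0 and M = M and d = ?d and n = n and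
      R = "\<phi> ` R" and z = "\<lambda>x. \<phi> (z x)" and t = "\<lambda>g x. \<phi> (t g x)" and ?x0.0 = x0])
      (fact G char_pos I(1) IG0 sub M_mult M_one \<phi>(2,3) M_img M_fixed M_coinv x0(1))+
  then obtain g where g: "g \<in> G0" "\<exists>i<?d. \<exists>j<?d. M g i j \<noteq> (if i = j then 1 else 0)"
     "\<forall>i<?d. \<forall>j<?d. M (g [^]\<^bsub>G\<^esub> CHAR('k)) i j = (if i = j then 1 else 0)" by (elim bexE conjE) (rule that)
  have powG0: "g [^]\<^bsub>G\<^esub> (k::nat) \<in> G0" for k by (induction k) (auto simp: g(1))
  have elts: "\<forall>h. (\<exists>k. h = g [^]\<^bsub>G\<^esub> (k::nat) \<or> h = inv\<^bsub>G\<^esub> g) \<longrightarrow> h \<in> carrier G \<and> (\<forall>i<?d. \<forall>j<?d. mco (\<rho> h) i j \<in> R)"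
  proof (intro allI impI, elim exE)
    fix h and k :: nat assume "h = g [^]\<^bsub>G\<^esub> k \<or> h = inv\<^bsub>G\<^esub> g"
    then have hG0: "h \<in> G0" by (elim disjE) (simp_all only: powG0 G0.m_inv_closed[OF g(1)])
    then have "h \<in> carrier G" by (rule G0.mem_carrier)
    then show "h \<in> carrier G \<and> (\<forall>i<?d. \<forall>j<?d. mco (\<rho> h) i j \<in> R)" by (intro conjI allI impI mR[OF hG0])
  qed
  have FR: "F \<subseteq> R" using SR by (auto simp: S_def)
  show ?thesis
    by (intro exI[of _ R] exI[of _ \<phi>] exI[of _ g] conjI)
      (fact R FR \<phi>(1) elts G0.mem_carrier[OF g(1)] g(2)[unfolded M_def] g(3)[unfolded M_def])+
qed

end

context alg_closed_space
begin

lemma eq_1_of_power_char: "(x :: 'k) ^ CHAR('k) = 1 \<Longrightarrow> x = 1"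
  using frob_inj[OF char_pos, of x 1 1] by simp

text \<open>An undetected invariant yields, for every finite \<open>F\<close>, a specialised element
  of order \<open>p\<close>. Their ultraproduct is a matrix over a large domain, and a homomorphism
  from the algebra generated by its entries to the field produces a point \<open>u\<close> of the
  closure with \<open>u ^^ p = id\<close> and \<open>u\<close> different from the identity.\<close>

lemma invariant_detected:
  assumes G: "group G" and \<rho>: "\<rho> \<in> hom G (GL scale)"
    and no_unipotent: "\<And>u. u \<in> zariski_closure scale (\<rho> ` carrier G) \<Longrightarrow> unipotent u \<Longrightarrow> u = id"
    and z: "\<And>g. g \<in> carrier G \<Longrightarrow> fixed_vec n (\<rho> g) z" and x0: "x0 \<in> W n" "z x0 \<noteq> 0"
  shows "\<exists>h. (\<forall>g\<in>carrier G. fixed_form n (\<rho> g) h) \<and> (\<Sum>x\<in>W n. h x * z x) \<noteq> 0"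
proof (rule ccontr)
  assume not_detected: "\<not> ?thesis"
  interpret G: group G by (rule G)
  let ?d = "length bs" and ?p = "CHAR('k)"
  note lin = hom_GL_linear[OF \<rho>] and mult = hom_GL_mult[OF \<rho>] and one = hom_GL_one[OF G \<rho>]
  have pow: "\<rho> (g [^]\<^bsub>G\<^esub> (k::nat)) = \<rho> g ^^ k" if g: "g \<in> carrier G" for g k
  proof (induction k)
    case 0
    show ?case using one by (simp add: id_def)
  next
    case (Suc k)
    have "\<rho> (g [^]\<^bsub>G\<^esub> Suc k) = (\<rho> g ^^ k) \<circ> \<rho> g" using g mult[of "g [^]\<^bsub>G\<^esub> k" g] Suc by simp
    then show ?case by (simp only: funpow_Suc_right)
  qed
  have "\<exists>I t. finite I \<and> I \<subseteq> carrier G \<and>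
    (\<forall>x\<in>W n. z x = (\<Sum>g\<in>I. (\<Sum>w\<in>W n. kron (mco (\<rho> g)) x w * t g w) - t g x))"
    by (rule coinvariant_certificate) (use not_detected in blast)
  then obtain I t where I: "finite I" "I \<subseteq> carrier G" and
    cert: "\<And>x. x \<in> W n \<Longrightarrow> z x = (\<Sum>g\<in>I. (\<Sum>w\<in>W n. kron (mco (\<rho> g)) x w * t g w) - t g x)" by blast
  define good where "good F R \<phi> g \<longleftrightarrow> is_subring R \<and> F \<subseteq> R \<and> hom_on R \<phi> \<and> g \<in> carrier G \<and>
    (\<forall>h. (\<exists>k. h = g [^]\<^bsub>G\<^esub> (k::nat) \<or> h = inv\<^bsub>G\<^esub> g) \<longrightarrow> h \<in> carrier G \<and> (\<forall>i<?d. \<forall>j<?d. mco (\<rho> h) i j \<in> R)) \<and>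
    (\<exists>i<?d. \<exists>j<?d. \<phi> (mco (\<rho> g) i j) \<noteq> (if i = j then 1 else 0)) \<and>
    (\<forall>i<?d. \<forall>j<?d. \<phi> (mco (\<rho> (g [^]\<^bsub>G\<^esub> ?p)) i j) = (if i = j then 1 else 0))"
    for F R :: "'k set" and \<phi> :: "'k \<Rightarrow> 'k" and g
  have "\<forall>F. \<exists>T. finite F \<longrightarrow> good F (fst T) (fst (snd T)) (snd (snd T))"
  proof
    fix F :: "'k set"
    show "\<exists>T. finite F \<longrightarrow> good F (fst T) (fst (snd T)) (snd (snd T))"
    proof (cases "finite F")
      case True
      have "\<exists>R \<phi> g. good F R \<phi> g"
        unfolding good_def by (rule specialised_p_element[OF G \<rho> I z cert x0 True])
      then obtain R \<phi> g where "good F R \<phi> g" by (elim exE) (rule that)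
      then show ?thesis by (intro exI[of _ "(R, \<phi>, g)"]) simp
    qed simp
  qed
  from choice[OF this] obtain T where T0: "\<forall>F. finite F \<longrightarrow> good F (fst (T F)) (fst (snd (T F))) (snd (snd (T F)))"
    by (elim exE) (rule that)
  have T: "good F (fst (T F)) (fst (snd (T F))) (snd (snd (T F)))" if "finite F" for F
    using T0 that by (elim allE[of _ F]) (rule mp)
  define R where "R F = fst (T F)" for F
  define \<phi> where "\<phi> F = fst (snd (T F))" for F
  define g where "g F = snd (snd (T F))" for F
  have good: "good F (R F) (\<phi> F) (g F)" if "finite F" for F using T[OF that] by (simp add: R_def \<phi>_def g_def)
  have Rsub: "is_subring (R F)" and FR: "F \<subseteq> R F" and \<phi>hom: "hom_on (R F) (\<phi> F)" and gG: "g F \<in> carrier G"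
    if "finite F" for F using good[OF that] unfolding good_def by blast+
  have mcoR: "mco (\<rho> (g F [^]\<^bsub>G\<^esub> (k::nat))) i j \<in> R F" "mco (\<rho> (inv\<^bsub>G\<^esub> (g F))) i j \<in> R F"
    if "finite F" "i < ?d" "j < ?d" for F k i j using good[OF that(1)] that(2,3) unfolding good_def by blast+
  have mcoR1: "mco (\<rho> (g F)) i j \<in> R F" if "finite F" "i < ?d" "j < ?d" for F i j
    using mcoR(1)[OF that, of 1] gG[OF that(1)] by simp
  have mcop: "\<phi> F (mco (\<rho> (g F [^]\<^bsub>G\<^esub> ?p)) i j) = (if i = j then 1 else 0)"
    if "finite F" "i < ?d" "j < ?d" for F i j using good[OF that(1)] that(2,3) unfolding good_def by blast
  have nontriv: "\<exists>i<?d. \<exists>j<?d. \<phi> F (mco (\<rho> (g F)) i j) \<noteq> (if i = j then 1 else 0)" if "finite F" for F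
    using good[OF that] unfolding good_def by blast
  \<comment> \<open>The ultrafilter refines inclusion of finite sets, so each element of the field
    lies in \<open>R F\<close> for almost all \<open>F\<close>.\<close>
  obtain U :: "'k set filter" where U: "U \<le> finite_subsets_at_top UNIV" "U \<noteq> bot"
    and ultra: "\<And>Q. eventually Q U \<or> eventually (\<lambda>x. \<not> Q x) U"
    using ultrafilter_exists[of "finite_subsets_at_top (UNIV :: 'k set)"] by auto
  have ev_mem: "eventually (\<lambda>F. finite F \<and> c \<in> R F) U" for c
  proof -
    have "eventually (\<lambda>F. finite F \<and> c \<in> F) (finite_subsets_at_top UNIV)"
      unfolding eventually_finite_subsets_at_top by (intro exI[of _ "{c}"]) auto
    then have "eventually (\<lambda>F. finite F \<and> c \<in> F) U" using U(1) by (simp add: le_filter_def)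
    then show ?thesis by (rule eventually_mono) (use FR in auto)
  qed
  have ev_fin: "eventually finite U" using eventually_mono[OF ev_mem[of 0]] by blast
  \<comment> \<open>Families that vanish almost everywhere. Primality uses the ultrafilter property;
    the quotient is an ultrapower of the field.\<close>
  define P where "P = {h :: 'k set \<Rightarrow> 'k. eventually (\<lambda>F. h F = 0) U}"
  interpret PS: prime_set P
  proof
    show "0 \<in> P" by (simp add: P_def)
    show "x + y \<in> P" if "x \<in> P" "y \<in> P" for x y
      using that unfolding P_def by (auto elim: eventually_elim2)
    show "x * y \<in> P" if "y \<in> P" for x y
      using that unfolding P_def by (auto elim: eventually_mono)
    show "1 \<notin> P" using U(2) by (simp add: P_def trivial_limit_def)
    show "x \<in> P \<or> y \<in> P" if xy: "x * y \<in> P" for x y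
    proof (cases "eventually (\<lambda>F. x F = 0) U")
      case False
      then have "eventually (\<lambda>F. x F \<noteq> 0) U" using ultra by blast
      moreover have "eventually (\<lambda>F. x F * y F = 0) U" using xy by (simp add: P_def)
      ultimately have "eventually (\<lambda>F. y F = 0) U" by eventually_elim simp
      then show ?thesis by (simp add: P_def)
    qed (simp add: P_def)
  qed
  \<comment> \<open>The family \<open>h\<close> represents \<open>c\<close> when it agrees almost
    everywhere with the specialised values of \<open>c\<close>. These families form the copy of the
    field over which the homomorphism must be linear.\<close>
  define rel where "rel h c \<longleftrightarrow> eventually (\<lambda>F. h F = \<phi> F c) U" for h c
  have rel_0: "rel h 0 \<longleftrightarrow> h \<in> P" for h
  proof -
    have "eventually (\<lambda>F. \<phi> F 0 = 0) U" using ev_fin by eventually_elim (use Rsub \<phi>hom hom_on_0 in blast)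
    then show ?thesis unfolding rel_def P_def by (auto elim: eventually_elim2)
  qed
  have rel_1: "rel (\<lambda>_. 1) 1"
    unfolding rel_def using ev_fin by eventually_elim (use \<phi>hom hom_onD(1) in metis)
  have rel_ops: "rel (h + h') (c + c')" "rel (h - h') (c - c')" "rel (h * h') (c * c')" if "rel h c" "rel h' c'" for h h' c c'
  proof -
    have ev: "eventually (\<lambda>F. h F = \<phi> F c \<and> h' F = \<phi> F c' \<and> finite F \<and> c \<in> R F \<and> c' \<in> R F) U"
      using that ev_mem[of c] ev_mem[of c'] unfolding rel_def by eventually_elim auto
    show "rel (h + h') (c + c')" unfolding rel_def
      using ev by eventually_elim (simp add: hom_onD(2)[OF \<phi>hom])
    show "rel (h - h') (c - c')" unfolding rel_def
      using ev by eventually_elim (simp add: hom_on_diff[OF Rsub \<phi>hom])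
    show "rel (h * h') (c * c')" unfolding rel_def
      using ev by eventually_elim (simp add: hom_onD(3)[OF \<phi>hom])
  qed
  \<comment> \<open>A nonzero difference is invertible in the field, and its inverse also lies in
    almost every \<open>R F\<close>, so it cannot represent zero.\<close>
  have rel_unique: "c = c'" if "rel h c" "rel h c'" for h c c'
  proof (rule ccontr)
    assume "c \<noteq> c'"
    define e where "e = inverse (c - c')"
    have "(c - c') * e = 1" using \<open>c \<noteq> c'\<close> by (simp add: e_def)
    have "rel (h - h) (c - c')" using rel_ops(2)[OF that] .
    moreover have "rel (\<lambda>F. \<phi> F e) e" by (simp add: rel_def)
    ultimately have "rel ((h - h) * (\<lambda>F. \<phi> F e)) 1" using rel_ops(3)[of "h - h" "c - c'" "\<lambda>F. \<phi> F e" e] \<open>(c - c') * e = 1\<close> by simp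
    then have "eventually (\<lambda>F. 0 = \<phi> F 1 \<and> finite F) U" unfolding rel_def using ev_fin by eventually_elim auto
    then have "eventually (\<lambda>F. False) U" by eventually_elim (use \<phi>hom hom_onD(1) in fastforce)
    then show False using U(2) by (simp add: trivial_limit_def)
  qed
  define A0 where "A0 = {h. \<exists>c. rel h c}"
  define \<phi>0 where "\<phi>0 h = (SOME c. rel h c)" for h
  have \<phi>0: "\<phi>0 h = c" if "rel h c" for h c
    unfolding \<phi>0_def
  proof (rule some_equality)
    show "rel h c" by (rule that)
    show "c' = c" if "rel h c'" for c' using that \<open>rel h c\<close> by (rule rel_unique)
  qed
  have A0: "is_subring A0" unfolding is_subring_def
  proof (intro conjI ballI)
    show "0 \<in> A0" using rel_0[of 0] PS.zero_mem unfolding A0_def by blast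
    show "1 \<in> A0" using rel_1 unfolding A0_def one_fun_def by blast
  next
    fix x y assume "x \<in> A0" "y \<in> A0"
    then obtain c c' where cc: "rel x c" "rel y c'" unfolding A0_def mem_Collect_eq by (elim exE)
    show "x + y \<in> A0" "x - y \<in> A0" "x * y \<in> A0"
      unfolding A0_def mem_Collect_eq using rel_ops[OF cc] by - (rule exI, assumption)+
  qed
  have h0: "hom_on A0 \<phi>0" unfolding hom_on_def
  proof (intro conjI ballI)
    show "\<phi>0 1 = 1" using \<phi>0[OF rel_1] by (simp add: one_fun_def)
    fix x y assume "x \<in> A0" "y \<in> A0"
    then obtain c c' where cc: "rel x c" "rel y c'" by (auto simp: A0_def)
    show "\<phi>0 (x + y) = \<phi>0 x + \<phi>0 y" "\<phi>0 (x * y) = \<phi>0 x * \<phi>0 y"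
      using \<phi>0[OF rel_ops(1)[OF cc]] \<phi>0[OF rel_ops(3)[OF cc]] \<phi>0[OF cc(1)] \<phi>0[OF cc(2)] by auto
  qed
  have closed: "\<exists>\<xi>\<in>UNIV. poly q \<xi> = 0" if "Polynomial.degree q > 0" for q :: "'k poly"
    using alg_closed_imp_poly_has_root[OF that] by blast
  have subU: "is_subring (UNIV :: 'k set)" by (simp add: is_subring_def)
  have infU: "infinite (UNIV :: 'k set)" by (rule infinite_if_closed[OF subU]) (rule closed)
  have base: "PS.extends_to \<phi>0 A0 UNIV A0"
  proof (rule PS.extends_to_base[OF A0 h0])
    fix a assume "a \<in> A0"
    then obtain c where c: "rel a c" by (auto simp: A0_def)
    have "c = 0 \<longleftrightarrow> rel a 0" using c rel_unique[of a c 0] by blast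
    then show "\<phi>0 a = 0 \<longleftrightarrow> a \<in> P" unfolding \<phi>0[OF c] rel_0 .
  qed simp
  define x where "x i j = (\<lambda>F. \<phi> F (mco (\<rho> (g F)) i j))" for i j
  define \<delta> where "\<delta> i j = (\<lambda>F :: 'k set. if i = j then 1 else 0 :: 'k)" for i j :: nat
  have rel_\<delta>: "rel (\<delta> i j) (if i = j then 1 else 0)" for i j
    using rel_1 rel_0[of 0] PS.zero_mem unfolding \<delta>_def zero_fun_def by auto
  \<comment> \<open>Each specialised matrix differs from the identity at some entry. There are
    finitely many entries, so one of them differs for almost all \<open>F\<close>; it is the element
    to be kept nonzero.\<close>
  have "\<exists>i<?d. \<exists>j<?d. x i j - \<delta> i j \<notin> P"
  proof (rule ccontr)
    assume "\<not> ?thesis"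
    then have "eventually (\<lambda>F. x i j F = \<delta> i j F) U" if "i < ?d" "j < ?d" for i j
      using that by (auto simp: P_def)
    then have "eventually (\<lambda>F. \<forall>i\<in>{..<?d}. \<forall>j\<in>{..<?d}. x i j F = \<delta> i j F) U"
      by (intro eventually_ball_finite ballI) auto
    then have "eventually (\<lambda>F. False) U" using ev_fin
    proof eventually_elim
      fix F assume "\<forall>i\<in>{..<?d}. \<forall>j\<in>{..<?d}. x i j F = \<delta> i j F" "finite F"
      then show False using nontriv[of F] by (auto simp: x_def \<delta>_def)
    qed
    then show False using U(2) by (simp add: trivial_limit_def)
  qed
  then obtain i0 j0 where ij0: "i0 < ?d" "j0 < ?d" "x i0 j0 - \<delta> i0 j0 \<notin> P" by blast
  have "finite ((\<lambda>(i, j). x i j) ` ({..<?d} \<times> {..<?d}))" by simp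
  from PS.extends_to_finite[OF base this subU infU] closed
  obtain A where A: "PS.extends_to \<phi>0 A0 UNIV A" "(\<lambda>(i, j). x i j) ` ({..<?d} \<times> {..<?d}) \<subseteq> A" by blast
  have Asub: "is_subring A" and A0A: "A0 \<subseteq> A" using A(1)[unfolded PS.extends_to_def] by (simp_all only:)
  have xA: "x i j \<in> A" if "i < ?d" "j < ?d" for i j using A(2) that by auto
  have \<delta>A: "\<delta> i j \<in> A" for i j using rel_\<delta> A0A by (auto simp: A0_def)
  have "x i0 j0 - \<delta> i0 j0 \<in> A - P" using is_subringD(4)[OF Asub xA \<delta>A] ij0 by auto
  then obtain \<Phi> :: "('k set \<Rightarrow> 'k) \<Rightarrow> 'k" where \<Phi>: "hom_on A \<Phi>" "\<And>a. a \<in> A0 \<Longrightarrow> \<Phi> a = \<phi>0 a"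
     "\<And>a. a \<in> A \<Longrightarrow> a \<in> P \<Longrightarrow> \<Phi> a = 0" "\<Phi> (x i0 j0 - \<delta> i0 j0) \<noteq> 0"
    using A(1)[unfolded PS.extends_to_def, THEN conjunct2, THEN conjunct2, THEN bspec] by blast
  have \<Phi>rel: "\<Phi> h = c" "h \<in> A" if "rel h c" for h c
    using \<Phi>(2)[of h] \<phi>0[OF that] that A0A by (auto simp: A0_def)
  have PA: "h \<in> A" if "h \<in> P" for h using that rel_0[of h] \<Phi>rel(2) by auto
  \<comment> \<open>Changing a family on a negligible set of indices affects neither membership in
    \<open>A\<close> nor the value of \<open>\<Phi>\<close>.\<close>
  have \<Phi>cong: "h' \<in> A \<and> \<Phi> h' = \<Phi> h" if "h \<in> A" "h' - h \<in> P" for h h'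
  proof -
    have eq: "h + (h' - h) = h'" by simp
    have "h' \<in> A" using is_subringD(3)[OF Asub that(1) PA[OF that(2)]] unfolding eq .
    moreover have "\<Phi> (h + (h' - h)) = \<Phi> h + 0" using hom_onD(2)[OF \<Phi>(1) that(1) PA[OF that(2)]] \<Phi>(3)[OF PA[OF that(2)] that(2)] by simp
    ultimately show ?thesis unfolding eq by simp
  qed
  define a where "a i j = \<Phi> (x i j)" for i j
  \<comment> \<open>The endomorphism whose matrix entries are the images of the generic entries
    \<open>x i j\<close>.\<close>
  define u where "u v = (\<Sum>i<?d. scale (\<Sum>j<?d. a i j * co j v) (bs ! i))" for v
  have linu: "Vector_Spaces.linear scale scale u"
    by unfold_locales
      (simp_all add: u_def co_add co_scale algebra_simps sum.distrib scale_left_distrib scale_sum_right sum_distrib_left)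
  have mcou: "mco u i j = a i j" if "i < ?d" "j < ?d" for i j
  proof -
    interpret c: Vector_Spaces.linear scale "(*)" "co i" by (rule linear_co)
    have "u (bs ! j) = (\<Sum>k<?d. scale (a k j) (bs ! k))"
      unfolding u_def by (intro sum.cong refl) (simp add: co_bs that sum_mult_delta)
    then have "mco u i j = (\<Sum>k<?d. a k j * co i (bs ! k))" unfolding mco_def by (simp add: c.sum c.scale)
    also have "\<dots> = (\<Sum>k<?d. a k j * (if i = k then 1 else 0))" by (intro sum.cong refl) (simp add: co_bs that)
    also have "\<dots> = a i j" using that by (simp add: sum_mult_delta)
    finally show ?thesis .
  qed
  define tq where "tq q = (\<lambda>F. \<phi> F (q (\<rho> (g F))))" for q :: "('v \<Rightarrow> 'v) \<Rightarrow> 'k"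
  \<comment> \<open>The function \<open>q\<close> commutes with the passage to the point:
    \<open>\<Phi>\<close> of its specialised values along the chosen elements is its value at
    \<open>u\<close>. This is proved for all regular functions by induction on their
    generation.\<close>
  define spec where "spec q \<longleftrightarrow> eventually (\<lambda>F. finite F \<and> q (\<rho> (g F)) \<in> R F) U \<and> tq q \<in> A \<and> \<Phi> (tq q) = q u" for q
  have spec_const: "spec (\<lambda>_. c)" for c
    unfolding spec_def using ev_mem[of c] \<Phi>rel[of "tq (\<lambda>_. c)" c] by (simp add: tq_def rel_def)
  have spec_mco: "spec (\<lambda>f. mco f i j)" if "i < ?d" "j < ?d" for i j
  proof -
    have "eventually (\<lambda>F. finite F \<and> mco (\<rho> (g F)) i j \<in> R F) U"
      using ev_fin by eventually_elim (use mcoR1 that in auto)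
    moreover have "tq (\<lambda>f. mco f i j) = x i j" by (simp add: tq_def x_def)
    ultimately show ?thesis unfolding spec_def using xA[OF that] mcou[OF that] by (simp add: a_def)
  qed
  have spec_add: "spec (\<lambda>f. q f + r f)" if q: "spec q" and r: "spec r" for q r
  proof -
    have ev: "eventually (\<lambda>F. finite F \<and> q (\<rho> (g F)) \<in> R F \<and> r (\<rho> (g F)) \<in> R F) U"
      using q r unfolding spec_def by (auto elim: eventually_elim2)
    have "tq (\<lambda>f. q f + r f) - (tq q + tq r) \<in> P"
      unfolding P_def using ev by (auto elim!: eventually_mono simp: tq_def hom_onD(2)[OF \<phi>hom])
    then have "tq (\<lambda>f. q f + r f) \<in> A \<and> \<Phi> (tq (\<lambda>f. q f + r f)) = \<Phi> (tq q + tq r)"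
      using q r unfolding spec_def by (intro \<Phi>cong is_subringD(3)[OF Asub]) auto
    moreover have "\<Phi> (tq q + tq r) = q u + r u" using q r unfolding spec_def by (simp add: hom_onD(2)[OF \<Phi>(1)])
    moreover have "eventually (\<lambda>F. finite F \<and> q (\<rho> (g F)) + r (\<rho> (g F)) \<in> R F) U"
      using ev by eventually_elim (simp add: is_subringD(3)[OF Rsub])
    ultimately show ?thesis unfolding spec_def by simp
  qed
  have spec_mult: "spec (\<lambda>f. q f * r f)" if q: "spec q" and r: "spec r" for q r
  proof -
    have ev: "eventually (\<lambda>F. finite F \<and> q (\<rho> (g F)) \<in> R F \<and> r (\<rho> (g F)) \<in> R F) U"
      using q r unfolding spec_def by (auto elim: eventually_elim2)
    have "tq (\<lambda>f. q f * r f) - (tq q * tq r) \<in> P"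
      unfolding P_def using ev by (auto elim!: eventually_mono simp: tq_def hom_onD(3)[OF \<phi>hom])
    then have "tq (\<lambda>f. q f * r f) \<in> A \<and> \<Phi> (tq (\<lambda>f. q f * r f)) = \<Phi> (tq q * tq r)"
      using q r unfolding spec_def by (intro \<Phi>cong is_subringD(5)[OF Asub]) auto
    moreover have "\<Phi> (tq q * tq r) = q u * r u" using q r unfolding spec_def by (simp add: hom_onD(3)[OF \<Phi>(1)])
    moreover have "eventually (\<lambda>F. finite F \<and> q (\<rho> (g F)) * r (\<rho> (g F)) \<in> R F) U"
      using ev by eventually_elim (simp add: is_subringD(5)[OF Rsub])
    ultimately show ?thesis unfolding spec_def by simp
  qed
  have spec_sum: "spec (\<lambda>f. \<Sum>i\<in>J. q i f)" if "finite J" "\<And>i. i \<in> J \<Longrightarrow> spec (q i)" for J :: "nat set" and q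
    using that by (induction J rule: finite_induct) (simp_all add: spec_const spec_add)
  have spec_cong: "spec r" if q: "spec q" and eq: "\<And>f. Vector_Spaces.linear scale scale f \<Longrightarrow> r f = q f" for q r
  proof -
    have e: "eventually (\<lambda>F. r (\<rho> (g F)) = q (\<rho> (g F))) U"
      using ev_fin by eventually_elim (use eq lin gG in auto)
    have "tq r - tq q \<in> P" unfolding P_def using e by (auto elim!: eventually_mono simp: tq_def)
    then have "tq r \<in> A \<and> \<Phi> (tq r) = \<Phi> (tq q)" using q unfolding spec_def by (intro \<Phi>cong) auto
    moreover have "eventually (\<lambda>F. finite F \<and> r (\<rho> (g F)) \<in> R F) U"
      using q e unfolding spec_def by (auto elim: eventually_elim2)
    ultimately show ?thesis using q eq[OF linu] unfolding spec_def by simp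
  qed
  have spec_pow: "spec (\<lambda>f. mco (f ^^ k) i j)" if "i < ?d" "j < ?d" for k i j
    using that
  proof (induction k arbitrary: i j)
    case 0
    show ?case using spec_const[of "mco id i j"] by (simp add: id_def)
  next
    case (Suc k)
    have "spec (\<lambda>f. \<Sum>l<?d. mco f i l * mco (f ^^ k) l j)"
      using Suc by (intro spec_sum spec_mult spec_mco) auto
    then show ?case by (rule spec_cong) (simp only: funpow.simps mco_comp)
  qed
  have up: "u ^^ ?p = id"
  proof (rule linear_eqI_bs[OF linear_funpow[OF linu] linear_id'])
    fix i j assume ij: "i < ?d" "j < ?d"
    have r: "rel (tq (\<lambda>f. mco (f ^^ ?p) i j)) (if i = j then 1 else 0)"
      unfolding rel_def using ev_fin
    proof eventually_elim
      fix F :: "'k set" assume F: "finite F"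
      have "tq (\<lambda>f. mco (f ^^ ?p) i j) F = (if i = j then 1 else 0)"
        unfolding tq_def using mcop[OF F ij] pow[OF gG[OF F]] by simp
      then show "tq (\<lambda>f. mco (f ^^ ?p) i j) F = \<phi> F (if i = j then 1 else 0)"
        using hom_onD(1)[OF \<phi>hom[OF F]] hom_on_0[OF Rsub[OF F] \<phi>hom[OF F]] by simp
    qed
    have "mco (u ^^ ?p) i j = (if i = j then 1 else 0)"
      using spec_pow[OF ij, of ?p] \<Phi>rel(1)[OF r] unfolding spec_def by (elim conjE) (rule trans[OF sym])
    then show "co i ((u ^^ ?p) (bs ! j)) = co i (id (bs ! j))" unfolding mco_def by (simp add: co_bs ij)
  qed
  have spec_inv_det: "spec (\<lambda>f. inverse (lin_det scale f))"
  proof -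
    \<comment> \<open>The inverse determinant is the determinant of the inverse element, hence lies
      in \<open>R F\<close>. The \<open>p\<close>-th power of the specialised determinant is one,
      and Frobenius is injective, so the specialised determinant is one as well.\<close>
    have F_det: "inverse (lin_det scale (\<rho> (g F))) \<in> R F \<and> \<phi> F (inverse (lin_det scale (\<rho> (g F)))) = 1" if F: "finite F" for F
    proof -
      have gF: "g F \<in> carrier G" by (rule gG[OF F])
      have det: "lin_det scale (\<rho> h) = det (mat ?d ?d (\<lambda>(i, j). mco (\<rho> h) i j))" if "h \<in> carrier G" for h
        using lin_det_eq[OF lin[OF that]] by (simp add: endo_matrix_mco)
      define D where "D = lin_det scale (\<rho> (g F))"
      define D' where "D' = lin_det scale (\<rho> (inv\<^bsub>G\<^esub> (g F)))"
      have "D * D' = 1"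
        unfolding D_def D'_def lin_det_comp[OF lin[OF gF] lin[OF G.inv_closed[OF gF]], symmetric]
          mult[OF gF G.inv_closed[OF gF], symmetric] G.r_inv[OF gF] one by (rule lin_det_id)
      then have inv: "inverse D = D'" by (simp add: inverse_unique)
      have DR: "D \<in> R F" unfolding D_def det[OF gF] by (intro det_in_subring[OF Rsub[OF F]] mcoR1[OF F])
      have D'R: "D' \<in> R F" unfolding D'_def det[OF G.inv_closed[OF gF]] by (intro det_in_subring[OF Rsub[OF F]] mcoR(2)[OF F])
      have "\<phi> F D ^ ?p = \<phi> F (D ^ ?p)" using hom_on_power[OF Rsub[OF F] \<phi>hom[OF F] DR] by simp
      also have "D ^ ?p = lin_det scale (\<rho> (g F [^]\<^bsub>G\<^esub> ?p))"
        unfolding D_def pow[OF gF] lin_det_funpow[OF lin[OF gF]] ..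
      also have "\<phi> F \<dots> = det (mat ?d ?d (\<lambda>(i, j). \<phi> F (mco (\<rho> (g F [^]\<^bsub>G\<^esub> ?p)) i j)))"
        unfolding det[OF G.nat_pow_closed[OF gF]]
        by (intro det_hom_on[OF Rsub[OF F] \<phi>hom[OF F]] mcoR(1)[OF F])
      also have "mat ?d ?d (\<lambda>(i, j). \<phi> F (mco (\<rho> (g F [^]\<^bsub>G\<^esub> ?p)) i j)) = 1\<^sub>m ?d"
        by (rule eq_matI) (auto simp: mcop[OF F])
      finally have "\<phi> F D ^ ?p = 1" unfolding det_one .
      then have "\<phi> F D = 1" by (rule eq_1_of_power_char)
      moreover have "\<phi> F (D * D') = \<phi> F D * \<phi> F D'" by (rule hom_onD(3)[OF \<phi>hom[OF F] DR D'R])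
      ultimately have "\<phi> F D' = 1" using \<open>D * D' = 1\<close> hom_onD(1)[OF \<phi>hom[OF F]] by simp
      then show ?thesis using D'R inv unfolding D_def by simp
    qed
    have "rel (tq (\<lambda>f. inverse (lin_det scale f))) 1"
      unfolding rel_def using ev_fin by eventually_elim (simp add: tq_def F_det hom_onD(1)[OF \<phi>hom])
    moreover have "eventually (\<lambda>F. finite F \<and> inverse (lin_det scale (\<rho> (g F))) \<in> R F) U"
      using ev_fin by eventually_elim (use F_det in blast)
    moreover have "lin_det scale u = 1"
      by (rule eq_1_of_power_char) (simp add: lin_det_funpow[OF linu, symmetric] up lin_det_id)
    ultimately show ?thesis unfolding spec_def using \<Phi>rel by simp
  qed
  have spec_regular: "spec q" if "q \<in> regular_functions scale" for q
    using that
  proof (induction rule: regular_functions.induct)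
    case (coeff \<psi> v)
    have "spec (\<lambda>f. \<Sum>i<?d. \<Sum>j<?d. (\<psi> (bs ! i) * co j v) * mco f i j)"
      by (intro spec_sum spec_mult spec_const spec_mco) auto
    then show ?case
    proof (rule spec_cong)
      fix f assume f: "Vector_Spaces.linear scale scale f"
      have "\<psi> (f v) = (\<Sum>i<?d. co i (f v) * \<psi> (bs ! i))" by (rule functional_expand[OF coeff])
      also have "\<dots> = (\<Sum>i<?d. \<Sum>j<?d. (\<psi> (bs ! i) * co j v) * mco f i j)"
      proof (intro sum.cong refl)
        fix i
        have *: "co i (f v) = (\<Sum>j<?d. co j v * mco f i j)"
          using functional_expand[OF Vector_Spaces.linear_compose[OF f linear_co[of i]], of v] by (simp add: mco_def)
        show "co i (f v) * \<psi> (bs ! i) = (\<Sum>j<?d. (\<psi> (bs ! i) * co j v) * mco f i j)"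
          unfolding * sum_distrib_right by (intro sum.cong refl) (simp only: mult_ac)
      qed
      finally show "\<psi> (f v) = (\<Sum>i<?d. \<Sum>j<?d. (\<psi> (bs ! i) * co j v) * mco f i j)" .
    qed
  qed (auto intro: spec_const spec_inv_det spec_add spec_mult)
  have bij: "bij u"
  proof -
    obtain k where k: "?p = Suc k" using char_pos gr0_conv_Suc by blast
    have "u \<circ> (u ^^ k) = id" using up unfolding k by (simp only: funpow.simps)
    moreover have "(u ^^ k) \<circ> u = id" using up unfolding k by (simp only: funpow_Suc_right)
    ultimately show ?thesis by (rule o_bij[rotated])
  qed
  have uGL: "u \<in> carrier (GL scale)" using linu bij by (simp add: GL_def)
  \<comment> \<open>A regular function that vanishes on the image of the group specialises to zero
    along all chosen elements, hence vanishes at \<open>u\<close>.\<close>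
  have "u \<in> Z" if Z: "zariski_closed scale Z" "\<rho> ` carrier G \<subseteq> Z" for Z
  proof -
    obtain Q where Q: "Q \<subseteq> regular_functions scale" "Z = {f \<in> carrier (GL scale). \<forall>q\<in>Q. q f = 0}"
      using Z(1) by (auto simp: zariski_closed_def)
    have "q u = 0" if q: "q \<in> Q" for q
    proof -
      have q0: "q (\<rho> (g F)) = 0" if "finite F" for F using Z(2) gG[OF that] q unfolding Q(2) by blast
      have "tq q \<in> P" unfolding P_def
        using ev_fin by (auto elim!: eventually_mono simp: tq_def q0 hom_on_0[OF Rsub \<phi>hom])
      then have "\<Phi> (tq q) = 0" using \<Phi>(3) PA by blast
      then show ?thesis using spec_regular[of q] Q(1) q unfolding spec_def by auto
    qed
    then show ?thesis using uGL unfolding Q(2) by blast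
  qed
  then have "u \<in> zariski_closure scale (\<rho> ` carrier G)" unfolding zariski_closure_def by blast
  moreover have "unipotent u"
    unfolding unipotent_def using funpow_char_diff[OF linu char_pos, of 1] up by (intro exI[of _ ?p]) simp
  ultimately have "u = id" by (rule no_unipotent)
  then have "a i0 j0 = (if i0 = j0 then 1 else 0)" using mcou[OF ij0(1,2)] mco_id[OF ij0(1,2)] by simp
  moreover have "\<Phi> (x i0 j0 - \<delta> i0 j0) = a i0 j0 - (if i0 = j0 then 1 else 0)"
    using hom_on_diff[OF Asub \<Phi>(1) xA[OF ij0(1,2)] \<delta>A] \<Phi>rel(1)[OF rel_\<delta>] by (simp add: a_def)
  ultimately show False using \<Phi>(4) by simp
qed

end

section \<open>Tensors of ballot words\<close>

text \<open>A word is read as filling a tableau: letter \<open>i\<close> at position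
  \<open>t\<close> puts \<open>t\<close> at the end of row \<open>i\<close>, and this number is the
  column of its cell.\<close>

definition column_index :: "nat list \<Rightarrow> nat \<Rightarrow> nat" where
  "column_index x t = count_list (take t x) (x ! t)"

text \<open>The lattice words of standard Young tableaux with \<open>d\<close> rows and
  \<open>m\<close> columns.\<close>

definition ballot :: "nat \<Rightarrow> nat \<Rightarrow> nat list \<Rightarrow> bool" where
  "ballot d m x \<longleftrightarrow> x \<in> words d (d * m) \<and> (\<forall>i<d. count_list x i = m) \<and>
     (\<forall>t. \<forall>i<d. \<forall>j<i. count_list (take t x) i \<le> count_list (take t x) j)"

lemma count_list_take_mono:
  assumes "s \<le> t"
  shows "count_list (take s x) a \<le> count_list (take t x) a"
proof -
  have "take t x = take s x @ take (t - s) (drop s x)" using assms take_add[of s "t - s" x] by simp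
  then show ?thesis by (simp only: count_list_append)
qed

lemma count_list_take_Suc:
  "t < length x \<Longrightarrow> count_list (take (Suc t) x) a = count_list (take t x) a + (if x ! t = a then 1 else 0)"
  by (simp add: take_Suc_conv_app_nth)

lemma column_index_strict:
  assumes "s < t" "t < length x" "x ! s = x ! t"
  shows "column_index x s < column_index x t"
proof -
  have "count_list (take (Suc s) x) (x ! t) \<le> count_list (take t x) (x ! t)"
    using assms by (intro count_list_take_mono) simp
  then show ?thesis unfolding column_index_def using assms count_list_take_Suc[of s x "x ! t"] by simp
qed

lemma column_index_less:
  assumes "t < length x"
  shows "column_index x t < count_list x (x ! t)"
  using count_list_take_mono[of "Suc t" "length x" x "x ! t"] count_list_take_Suc[OF assms, of "x ! t"] assms
  unfolding column_index_def by simp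

text \<open>Positions correspond to cells. Distinct positions in the same row get distinct columns,
  and the number of positions equals the number of cells.\<close>

lemma ballot_bij:
  assumes x: "ballot d m x"
  shows "bij_betw (\<lambda>t. (column_index x t, x ! t)) {..<d * m} ({..<m} \<times> {..<d})"
proof -
  let ?f = "\<lambda>t. (column_index x t, x ! t)"
  have w: "x \<in> words d (d * m)" using x by (simp add: ballot_def)
  have len: "length x = d * m" by (rule words_length[OF w])
  have inj: "inj_on ?f {..<d * m}"
  proof (rule inj_onI)
    fix s t assume st: "s \<in> {..<d * m}" "t \<in> {..<d * m}" "?f s = ?f t"
    show "s = t"
    proof (rule linorder_cases[of s t])
      assume "s < t" then show ?thesis using column_index_strict[of s t x] st len by simp
    next
      assume "t < s" then show ?thesis using column_index_strict[of t s x] st len by simp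
    qed
  qed
  have sub: "?f ` {..<d * m} \<subseteq> {..<m} \<times> {..<d}"
  proof
    fix p assume "p \<in> ?f ` {..<d * m}"
    then obtain t where t: "t < d * m" "p = ?f t" by blast
    have "x ! t < d" by (rule words_nth[OF w t(1)])
    moreover have "column_index x t < m" using column_index_less[of t x] t(1) len calculation x by (simp add: ballot_def)
    ultimately show "p \<in> {..<m} \<times> {..<d}" using t(2) by simp
  qed
  have "card (?f ` {..<d * m}) = card ({..<m} \<times> {..<d})" by (simp add: card_image[OF inj])
  then have "?f ` {..<d * m} = {..<m} \<times> {..<d}" using sub by (intro card_subset_eq) simp_all
  then show ?thesis using inj by (simp add: bij_betw_def)
qed

text \<open>Columns of the tableau increase downwards: when a larger letter reaches a column, the
  ballot condition says that the smaller letters have already reached it.\<close>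

lemma ballot_column_order:
  assumes x: "ballot d m x" and s: "s < d * m" and t: "t < d * m"
    and c: "column_index x s = column_index x t" and lt: "x ! s < x ! t"
  shows "s < t"
proof (rule ccontr)
  assume "\<not> s < t"
  then have ts: "t < s" using lt by (cases "s = t") auto
  have w: "x \<in> words d (d * m)" using x by (simp add: ballot_def)
  have "Suc (column_index x t) = count_list (take (Suc t) x) (x ! t)"
    using count_list_take_Suc[of t x "x ! t"] t words_length[OF w] by (simp add: column_index_def)
  also have "\<dots> \<le> count_list (take (Suc t) x) (x ! s)"
    using x words_nth[OF w t] lt unfolding ballot_def by blast
  also have "\<dots> \<le> column_index x s"
    unfolding column_index_def using ts by (intro count_list_take_mono) simp
  finally show False using c by simp
qed

text \<open>A product of one determinant per column, written out over tuples of column permutations.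
  For the identity matrix it is the tensor obtained from \<open>x\<close> by antisymmetrising the
  letters in each column.\<close>

definition det_tensor :: "(nat \<Rightarrow> nat \<Rightarrow> 'k::comm_ring_1) \<Rightarrow> nat \<Rightarrow> nat \<Rightarrow> nat list \<Rightarrow> nat list \<Rightarrow> 'k" where
  "det_tensor A d m x y = (\<Sum>P\<in>Pi\<^sub>E {..<m} (\<lambda>_. {p. p permutes {..<d}}).
     (\<Prod>k<m. signof (P k)) * (\<Prod>t<d * m. A (y ! t) (P (column_index x t) (x ! t))))"

abbreviation kronecker_delta :: "nat \<Rightarrow> nat \<Rightarrow> 'k::comm_ring_1" where
  "kronecker_delta i j \<equiv> if i = j then 1 else 0"

lemma det_tensor_eq_prod_det:
  assumes x: "ballot d m x"
  shows "det_tensor A d m x y =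
    (\<Prod>k<m. det (mat d d (\<lambda>(i, j). A (y ! (inv_into {..<d * m} (\<lambda>t. (column_index x t, x ! t)) (k, i))) j)))"
proof -
  let ?f = "\<lambda>t. (column_index x t, x ! t)"
  define e where "e = inv_into {..<d * m} ?f"
  note bij = ballot_bij[OF x]
  have "(\<Prod>t<d * m. A (y ! t) (P (column_index x t) (x ! t))) = (\<Prod>k<m. \<Prod>i<d. A (y ! e (k, i)) (P k i))" for P
  proof -
    have "(\<Prod>t<d * m. A (y ! t) (P (column_index x t) (x ! t))) = (\<Prod>t<d * m. (\<lambda>(k, i). A (y ! e (k, i)) (P k i)) (?f t))"
      using bij by (intro prod.cong refl) (simp add: e_def bij_betw_inv_into_left[OF bij])
    also have "\<dots> = (\<Prod>(k, i)\<in>{..<m} \<times> {..<d}. A (y ! e (k, i)) (P k i))"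
      by (rule prod.reindex_bij_betw[OF bij])
    also have "\<dots> = (\<Prod>k<m. \<Prod>i<d. A (y ! e (k, i)) (P k i))" by (rule prod.cartesian_product[symmetric])
    finally show ?thesis .
  qed
  then have "det_tensor A d m x y = (\<Sum>P\<in>Pi\<^sub>E {..<m} (\<lambda>_. {p. p permutes {..<d}}).
     \<Prod>k<m. signof (P k) * (\<Prod>i<d. A (y ! e (k, i)) (P k i)))"
    unfolding det_tensor_def by (simp add: prod.distrib)
  also have "\<dots> = (\<Prod>k<m. \<Sum>p\<in>{p. p permutes {..<d}}. signof p * (\<Prod>i<d. A (y ! e (k, i)) (p i)))"
    by (rule prod_sum_PiE[symmetric]) (simp_all add: finite_permutations)
  also have "\<dots> = (\<Prod>k<m. det (mat d d (\<lambda>(i, j). A (y ! e (k, i)) j)))"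
  proof (intro prod.cong refl)
    fix k
    have "det (mat d d (\<lambda>(i, j). A (y ! e (k, i)) j)) = (\<Sum>p\<in>{p. p permutes {..<d}}. signof p *
       (\<Prod>i<d. mat d d (\<lambda>(i, j). A (y ! e (k, i)) j) $$ (i, p i)))"
      by (subst det_def'[of _ d]) (simp_all add: atLeast0LessThan)
    also have "\<dots> = (\<Sum>p\<in>{p. p permutes {..<d}}. signof p * (\<Prod>i<d. A (y ! e (k, i)) (p i)))"
    proof (intro sum.cong refl arg_cong2[where f = "(*)"] prod.cong)
      fix p i assume "p \<in> {p. p permutes {..<d}}" "i \<in> {..<d}"
      then have "p i < d" "i < d" using permutes_in_image[of p "{..<d}" i] by simp_all
      then show "mat d d (\<lambda>(i, j). A (y ! e (k, i)) j) $$ (i, p i) = A (y ! e (k, i)) (p i)" by simp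
    qed
    finally show "(\<Sum>p\<in>{p. p permutes {..<d}}. signof p * (\<Prod>i<d. A (y ! e (k, i)) (p i))) =
      det (mat d d (\<lambda>(i, j). A (y ! e (k, i)) j))" by (rule sym)
  qed
  finally show ?thesis unfolding e_def .
qed

text \<open>Each column factor is the determinant of the rows of \<open>A\<close> selected by
  \<open>y\<close>, and that matrix is a selection matrix times \<open>A\<close>.\<close>

lemma det_tensor_mult_det:
  assumes x: "ballot d m x" and y: "y \<in> words d (d * m)"
  shows "det_tensor A d m x y = det_tensor kronecker_delta d m x y * det (mat d d (\<lambda>(i, j). A i j)) ^ m"
proof -
  define e where "e = inv_into {..<d * m} (\<lambda>t. (column_index x t, x ! t))"
  have e: "y ! e (k, i) < d" if "k < m" "i < d" for k i
    using bij_betwE[OF bij_betw_inv_into[OF ballot_bij[OF x]], of ] that words_nth[OF y] unfolding e_def by fastforce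
  have "det (mat d d (\<lambda>(i, j). A (y ! e (k, i)) j)) =
      det (mat d d (\<lambda>(i, j). kronecker_delta (y ! e (k, i)) j)) * det (mat d d (\<lambda>(i, j). A i j))" if k: "k < m" for k
  proof -
    have "mat d d (\<lambda>(i, j). A (y ! e (k, i)) j) = mat d d (\<lambda>(i, j). kronecker_delta (y ! e (k, i)) j) * mat d d (\<lambda>(i, j). A i j)"
    proof (rule eq_matI)
      fix i j assume ij: "i < dim_row (mat d d (\<lambda>(i, j). kronecker_delta (y ! e (k, i)) j) * mat d d (\<lambda>(i, j). A i j))"
        "j < dim_col (mat d d (\<lambda>(i, j). kronecker_delta (y ! e (k, i)) j) * mat d d (\<lambda>(i, j). A i j))"
      then have ij: "i < d" "j < d" by simp_all
      have "(\<Sum>l = 0..<d. kronecker_delta (y ! e (k, i)) l * A l j) = (\<Sum>l = 0..<d. A l j * kronecker_delta (y ! e (k, i)) l)"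
        by (intro sum.cong refl) (rule mult.commute)
      also have "\<dots> = A (y ! e (k, i)) j" using e[OF k ij(1)] by (subst sum_mult_delta) simp_all
      finally show "mat d d (\<lambda>(i, j). A (y ! e (k, i)) j) $$ (i, j) =
         (mat d d (\<lambda>(i, j). kronecker_delta (y ! e (k, i)) j) * mat d d (\<lambda>(i, j). A i j)) $$ (i, j)"
        using ij by (simp add: scalar_prod_def)
    qed simp_all
    then show ?thesis by (simp only:) (rule det_mult[of _ d], simp_all)
  qed
  then show ?thesis unfolding det_tensor_eq_prod_det[OF x] e_def[symmetric] by (simp add: prod.distrib)
qed

text \<open>Applying the tensor power of \<open>A\<close> replaces each Kronecker delta by an entry
  of \<open>A\<close>. Together with \<open>det_tensor_mult_det\<close>, the tensor is multiplied by
  the \<open>m\<close>-th power of the determinant.\<close>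

lemma kron_det_tensor:
  assumes x: "ballot d m x" and y: "y \<in> words d (d * m)"
  shows "(\<Sum>w\<in>words d (d * m). kron A y w * det_tensor kronecker_delta d m x w) = det_tensor A d m x y"
proof -
  let ?P = "Pi\<^sub>E {..<m} (\<lambda>_. {p. p permutes {..<d}})"
  let ?\<tau> = "\<lambda>P t. P (column_index x t) (x ! t)"
  have len: "length y = d * m" by (rule words_length[OF y])
  have \<tau>: "?\<tau> P t < d" if "P \<in> ?P" "t < d * m" for P t
  proof -
    have "(column_index x t, x ! t) \<in> {..<m} \<times> {..<d}" using bij_betwE[OF ballot_bij[OF x]] that(2) by blast
    then have "column_index x t < m" "x ! t < d" by simp_all
    then show ?thesis using that(1) permutes_in_image[of "P (column_index x t)" "{..<d}" "x ! t"] by (auto simp: PiE_iff)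
  qed
  have "(\<Sum>w\<in>words d (d * m). kron A y w * det_tensor kronecker_delta d m x w) =
     (\<Sum>w\<in>words d (d * m). \<Sum>P\<in>?P. (\<Prod>k<m. signof (P k)) * (\<Prod>t<d * m. A (y ! t) (w ! t) * kronecker_delta (w ! t) (?\<tau> P t)))"
    unfolding det_tensor_def kron_def len sum_distrib_left prod.distrib
    by (intro sum.cong refl) (simp only: mult_ac)
  also have "\<dots> = (\<Sum>P\<in>?P. (\<Prod>k<m. signof (P k)) * (\<Sum>w\<in>words d (d * m). \<Prod>t<d * m. A (y ! t) (w ! t) * kronecker_delta (w ! t) (?\<tau> P t)))"
    unfolding sum_distrib_left by (rule sum.swap)
  also have "\<dots> = (\<Sum>P\<in>?P. (\<Prod>k<m. signof (P k)) * (\<Prod>t<d * m. A (y ! t) (?\<tau> P t)))"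
  proof (intro sum.cong refl arg_cong2[where f = "(*)"])
    fix P assume P: "P \<in> ?P"
    have "(\<Sum>w\<in>words d (d * m). \<Prod>t<d * m. A (y ! t) (w ! t) * kronecker_delta (w ! t) (?\<tau> P t)) =
       (\<Prod>t<d * m. \<Sum>i<d. A (y ! t) i * kronecker_delta i (?\<tau> P t))"
      by (rule sum_words_prod)
    also have "\<dots> = (\<Prod>t<d * m. A (y ! t) (?\<tau> P t))"
    proof (rule prod.cong[OF refl])
      fix t assume "t \<in> {..<d * m}"
      then have "?\<tau> P t \<in> {..<d}" using \<tau>[OF P] by simp
      then show "(\<Sum>i<d. A (y ! t) i * kronecker_delta i (?\<tau> P t)) = A (y ! t) (?\<tau> P t)"
        unfolding sum_mult_delta(2)[OF finite_lessThan] by (rule if_P)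
    qed
    finally show "(\<Sum>w\<in>words d (d * m). \<Prod>t<d * m. A (y ! t) (w ! t) * kronecker_delta (w ! t) (?\<tau> P t)) =
       (\<Prod>t<d * m. A (y ! t) (?\<tau> P t))" .
  qed
  finally show ?thesis unfolding det_tensor_def .
qed

text \<open>If a ballot word \<open>x\<close> and a word \<open>y\<close> in the support of its tensor first differ at position
  \<open>t\<close>, then the smaller letters of the column of \<open>t\<close> are already placed, so \<open>y ! t > x ! t\<close>.\<close>

lemma det_tensor_support:
  assumes x: "ballot d m x" and y: "y \<in> words d (d * m)" and nz: "det_tensor kronecker_delta d m x y \<noteq> 0"
  shows "x \<le> y"
proof (cases "x = y")
  case False
  let ?P = "Pi\<^sub>E {..<m} (\<lambda>_. {p. p permutes {..<d}})"
  have w: "x \<in> words d (d * m)" using x by (simp add: ballot_def)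
  obtain P where P: "P \<in> ?P" and "(\<Prod>k<m. signof (P k)) * (\<Prod>t<d * m. kronecker_delta (y ! t) (P (column_index x t) (x ! t))) \<noteq> (0 :: 'a)"
    using nz unfolding det_tensor_def by (rule sum.not_neutral_contains_not_neutral)
  note prod_nz = this(2)
  have nz': "(\<Prod>t<d * m. kronecker_delta (y ! t) (P (column_index x t) (x ! t))) \<noteq> (0 :: 'a)"
  proof
    assume "(\<Prod>t<d * m. kronecker_delta (y ! t) (P (column_index x t) (x ! t))) = (0 :: 'a)"
    then show False using prod_nz by (simp only: mult_zero_right not_True_eq_False simp_thms)
  qed
  have yt: "y ! t = P (column_index x t) (x ! t)" if t: "t < d * m" for t
  proof (rule ccontr)
    assume "y ! t \<noteq> P (column_index x t) (x ! t)"
    then have "(\<Prod>t<d * m. kronecker_delta (y ! t) (P (column_index x t) (x ! t))) = (0 :: 'a)"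
      using t by (intro prod_zero finite_lessThan bexI[of _ t]) simp_all
    then show False using nz' by (rule notE[rotated])
  qed
  define t where "t = (LEAST t. t < d * m \<and> x ! t \<noteq> y ! t)"
  have "\<exists>t. t < d * m \<and> x ! t \<noteq> y ! t"
    using False nth_equalityI[of x y] words_length[OF w] words_length[OF y] by auto
  then have "t < d * m \<and> x ! t \<noteq> y ! t" unfolding t_def by (rule LeastI_ex)
  then have t: "t < d * m" "x ! t \<noteq> y ! t" by (rule conjunct1, elim conjunct2)
  have before: "x ! s = y ! s" if "s < t" for s
  proof (rule ccontr)
    assume ne: "x ! s \<noteq> y ! s"
    have "s < d * m" using that t(1) by simp
    then have "t \<le> s" unfolding t_def using ne by (intro Least_le conjI)
    then show False using that by simp
  qed
  have bij: "bij_betw (\<lambda>t. (column_index x t, x ! t)) {..<d * m} ({..<m} \<times> {..<d})" by (rule ballot_bij[OF x])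
  have ct: "column_index x t < m" using bij_betwE[OF bij] t(1) by auto
  have inj: "inj (P (column_index x t))" using P ct by (auto simp: PiE_iff intro: permutes_inj)
  have "x ! t < y ! t"
  proof (rule ccontr)
    assume "\<not> x ! t < y ! t"
    then have lt: "y ! t < x ! t" using t(2) by simp
    have "(column_index x t, y ! t) \<in> (\<lambda>t. (column_index x t, x ! t)) ` {..<d * m}"
      using ct words_nth[OF y t(1)] unfolding bij_betw_imp_surj_on[OF bij] by simp
    then obtain s where s: "s < d * m" "column_index x s = column_index x t" "x ! s = y ! t" by auto
    have "s < t" using ballot_column_order[OF x s(1) t(1) s(2)] s(3) lt by simp
    have "P (column_index x t) (x ! s) = y ! s" using yt[OF s(1)] unfolding s(2) by (rule sym)
    from trans[OF trans[OF this before[OF \<open>s < t\<close>, symmetric]] trans[OF s(3) yt[OF t(1)]]]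
    have "x ! s = x ! t" by (rule injD[OF inj])
    then show False using s(3) lt by simp
  qed
  moreover have "take t x = take t y"
    by (rule nth_equalityI) (use before words_length[OF w] words_length[OF y] in auto)
  ultimately have "t < min (length x) (length y) \<and> take t x = take t y \<and> (x ! t, y ! t) \<in> {(u, v). u < v}"
    using t(1) words_length[OF w] words_length[OF y] by simp
  then have "(x, y) \<in> lexord {(u, v). u < v}"
    unfolding lexord_take_index_conv by (intro disjI2 exI[of _ t])
  then show ?thesis by (simp add: list_le_def list_less_def)
qed simp

text \<open>Only the tuple of identity permutations reproduces the word \<open>x\<close>.\<close>

lemma det_tensor_self:
  assumes x: "ballot d m x"
  shows "det_tensor kronecker_delta d m x x = (1 :: 'k::comm_ring_1)"
proof -
  let ?P = "Pi\<^sub>E {..<m} (\<lambda>_. {p. p permutes {..<d}})"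
  define I :: "nat \<Rightarrow> nat \<Rightarrow> nat" where "I = restrict (\<lambda>_. id) {..<m}"
  have I: "I \<in> ?P" by (simp add: I_def permutes_id)
  note bij = ballot_bij[OF x]
  have "(\<Prod>t<d * m. kronecker_delta (x ! t) (P (column_index x t) (x ! t))) = (0 :: 'k)" if P: "P \<in> ?P" "P \<noteq> I" for P
  proof -
    obtain k where k: "k < m" "P k \<noteq> id"
      using P PiE_ext[OF P(1) I] by (auto simp: I_def)
    then obtain i where i: "P k i \<noteq> i" by (auto simp: fun_eq_iff)
    have "i < d" using i P(1) k(1) permutes_not_in[of "P k" "{..<d}" i] by (auto simp: PiE_iff)
    then have "(k, i) \<in> (\<lambda>t. (column_index x t, x ! t)) ` {..<d * m}" unfolding bij_betw_imp_surj_on[OF bij] using k by simp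
    then obtain t where t: "t < d * m" "column_index x t = k" "x ! t = i" by auto
    show ?thesis by (rule prod_zero[OF finite_lessThan]) (intro bexI[of _ t], use t i in auto)
  qed
  then have "det_tensor kronecker_delta d m x x = (\<Sum>P\<in>?P. if P = I then 1 else 0 :: 'k)"
    unfolding det_tensor_def
  proof (intro sum.cong refl)
    fix P assume P: "P \<in> ?P" and z: "\<And>P. P \<in> ?P \<Longrightarrow> P \<noteq> I \<Longrightarrow> (\<Prod>t<d * m. kronecker_delta (x ! t) (P (column_index x t) (x ! t))) = (0 :: 'k)"
    have "(\<Prod>k<m. signof (I k)) = (1 :: 'k)" by (rule prod.neutral) (simp add: I_def)
    moreover have "(\<Prod>t<d * m. kronecker_delta (x ! t) (I (column_index x t) (x ! t))) = (1 :: 'k)"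
      by (rule prod.neutral) (use bij_betwE[OF bij] in \<open>auto simp: I_def\<close>)
    ultimately show "(\<Prod>k<m. signof (P k)) * (\<Prod>t<d * m. kronecker_delta (x ! t) (P (column_index x t) (x ! t))) = (if P = I then 1 else 0 :: 'k)"
      using z[OF P] by (cases "P = I") simp_all
  qed
  also have "\<dots> = 1" using I by (subst sum.delta) (simp_all add: finite_PiE finite_permutations)
  finally show ?thesis .
qed

text \<open>At the least word \<open>x0\<close> with nonzero coefficient all other tensors of the
  relation vanish, since their supports lie above larger words.\<close>

lemma det_tensor_independent:
  fixes c :: "nat list \<Rightarrow> 'k::comm_ring_1"
  assumes S: "finite S" "\<And>x. x \<in> S \<Longrightarrow> ballot d m x"
    and zero: "\<And>y. y \<in> words d (d * m) \<Longrightarrow> (\<Sum>x\<in>S. c x * det_tensor kronecker_delta d m x y) = 0" and s: "s \<in> S"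
  shows "c s = 0"
proof (rule ccontr)
  assume "c s \<noteq> 0"
  define x0 where "x0 = Min {x \<in> S. c x \<noteq> 0}"
  have fin: "finite {x \<in> S. c x \<noteq> 0}" using S(1) by simp
  have "{x \<in> S. c x \<noteq> 0} \<noteq> {}" using s \<open>c s \<noteq> 0\<close> by blast
  then have "x0 \<in> {x \<in> S. c x \<noteq> 0}" unfolding x0_def by (rule Min_in[OF fin])
  then have x0: "x0 \<in> S" "c x0 \<noteq> 0" by simp_all
  have w: "x0 \<in> words d (d * m)" using S(2)[OF x0(1)] by (simp add: ballot_def)
  have "c x * det_tensor kronecker_delta d m x x0 = (if x = x0 then c x0 else 0)" if x: "x \<in> S" for x
  proof (cases "x = x0")
    case True
    have "det_tensor kronecker_delta d m x0 x0 = (1 :: 'k)" by (rule det_tensor_self[OF S(2)[OF x0(1)]])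
    then show ?thesis using True by simp
  next
    case False
    show ?thesis
    proof (rule ccontr)
      assume nz: "\<not> ?thesis"
      then have "c x \<noteq> 0" "det_tensor kronecker_delta d m x x0 \<noteq> (0 :: 'k)" using False by auto
      then have "x0 \<le> x" "x \<le> x0"
        using Min_le[OF fin, of x] x det_tensor_support[OF S(2)[OF x] w] by (auto simp: x0_def)
      then show False using False by simp
    qed
  qed
  then have "(\<Sum>x\<in>S. c x * det_tensor kronecker_delta d m x x0) = (\<Sum>x\<in>S. if x = x0 then c x0 else 0)"
    by (intro sum.cong refl)
  also have "\<dots> = c x0" using S(1) x0(1) by simp
  finally show False using zero[OF w] x0(2) by simp
qed

section \<open>Counting words by letter content\<close>

definition words_of_type :: "nat \<Rightarrow> nat \<Rightarrow> (nat \<Rightarrow> nat) \<Rightarrow> nat list set" where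
  "words_of_type d n f = {u \<in> words d n. \<forall>i<d. count_list u i = f i}"

lemma finite_words_of_type [simp]: "finite (words_of_type d n f)"
  unfolding words_of_type_def by simp

lemma append_in_words: "u \<in> words d n \<Longrightarrow> v \<in> words d k \<Longrightarrow> u @ v \<in> words d (n + k)"
  by (simp add: words_def)

lemma inj_on_append:
  assumes "\<And>u v. (u, v) \<in> S \<Longrightarrow> length u = n"
  shows "inj_on (\<lambda>(u, v). u @ v) S"
proof (rule inj_onI)
  fix p q assume pq: "p \<in> S" "q \<in> S" "(case p of (u, v) \<Rightarrow> u @ v) = (case q of (u, v) \<Rightarrow> u @ v)"
  obtain u v u' v' where uv: "p = (u, v)" "q = (u', v')" by (cases p, cases q)
  have "length u = length u'" using pq(1,2) assms unfolding uv by simp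
  then show "p = q" using pq(3) unfolding uv by simp
qed

lemma card_words_of_type_add:
  "card (words_of_type d n f) * card (words_of_type d k g) \<le> card (words_of_type d (n + k) (\<lambda>i. f i + g i))"
proof -
  have "card (words_of_type d n f) * card (words_of_type d k g) =
      card ((\<lambda>(u, v). u @ v) ` (words_of_type d n f \<times> words_of_type d k g))"
    by (subst card_image) (auto intro!: inj_on_append[of _ n] simp: words_of_type_def words_def card_cartesian_product)
  also have "\<dots> \<le> card (words_of_type d (n + k) (\<lambda>i. f i + g i))"
    by (rule card_mono) (auto simp: words_of_type_def append_in_words)
  finally show ?thesis .
qed

lemma card_words_of_type_rotate:
  assumes d: "d > 0"
  shows "card (words_of_type d n f) \<le> card (words_of_type d n (\<lambda>i. f ((i + r) mod d)))"
proof (rule card_inj_on_le)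
  \<comment> \<open>Subtraction of \<open>r\<close> modulo \<open>d\<close>, written as addition of
    \<open>r * (d - 1)\<close> to stay within the natural numbers.\<close>
  define b where "b i = (i + r * (d - 1)) mod d" for i
  have b1: "(b i + r) mod d = i" if "i < d" for i
  proof -
    have "(b i + r) mod d = (i + r * (d - 1) + r) mod d" unfolding b_def by (rule mod_add_left_eq)
    also have "i + r * (d - 1) + r = i + r * d" using d by (cases d) simp_all
    finally show ?thesis using that by simp
  qed
  have inj: "inj_on b {..<d}" by (rule inj_on_inverseI[of _ "\<lambda>i. (i + r) mod d"]) (simp add: b1)
  have bd: "b i < d" for i using d by (simp add: b_def)
  show "inj_on (map b) (words_of_type d n f)"
    by (rule inj_on_subset[OF inj_on_mapI[of b "lists {..<d}"]])
      (auto simp: words_of_type_def words_def lists_eq_set intro: inj_on_subset[OF inj])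
  show "map b ` words_of_type d n f \<subseteq> words_of_type d n (\<lambda>i. f ((i + r) mod d))"
  proof
    fix v assume "v \<in> map b ` words_of_type d n f"
    then obtain u where u: "u \<in> words_of_type d n f" "v = map b u" by blast
    have ud: "set u \<subseteq> {..<d}" "length u = n" using u(1) by (auto simp: words_of_type_def words_def)
    have "count_list v i = f ((i + r) mod d)" if i: "i < d" for i
    proof -
      define j where "j = (i + r) mod d"
      have j: "j < d" using d by (simp add: j_def)
      have "b ` {..<d} = {..<d}" by (rule endo_inj_surj) (use inj bd in auto)
      then obtain j' where j': "j' < d" "b j' = i" using i by (metis imageE lessThan_iff)
      have "j' = j" using b1[OF j'(1)] j'(2) by (simp add: j_def)
      have "count_list (map b u) (b j) = count_list u j" using ud(1)
      proof (induction u)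
        case (Cons a u)
        have "b a = b j \<longleftrightarrow> a = j" using Cons.prems j by (intro inj_on_eq_iff[OF inj]) simp_all
        then show ?case using Cons by simp
      qed simp
      then show ?thesis using u j j' \<open>j' = j\<close> by (simp add: words_of_type_def j_def)
    qed
    moreover have "v \<in> words d n" using ud bd u(2) by (auto simp: words_def)
    ultimately show "v \<in> words_of_type d n (\<lambda>i. f ((i + r) mod d))" by (simp add: words_of_type_def)
  qed
qed simp

text \<open>Words whose contents are successive rotations of \<open>f\<close> are concatenated;
  after \<open>d\<close> rotations every letter has been counted with each value of \<open>f\<close>
  once.\<close>

lemma card_words_of_type_rotations:
  assumes d: "d > 0"
  shows "card (words_of_type d n f) ^ r \<le> card (words_of_type d (r * n) (\<lambda>i. \<Sum>k<r. f ((i + k) mod d)))"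
proof (induction r)
  case 0
  have "[] \<in> words_of_type d (0 * n) (\<lambda>i. \<Sum>k<0. f ((i + k) mod d))" by (simp add: words_of_type_def words_def)
  then have "card (words_of_type d (0 * n) (\<lambda>i. \<Sum>k<0. f ((i + k) mod d))) > 0" by (subst card_gt_0_iff) auto
  then show ?case by simp
next
  case (Suc r)
  have "card (words_of_type d n f) ^ Suc r \<le>
     card (words_of_type d (r * n) (\<lambda>i. \<Sum>k<r. f ((i + k) mod d))) * card (words_of_type d n (\<lambda>i. f ((i + r) mod d)))"
    unfolding power_Suc2 by (intro mult_mono Suc card_words_of_type_rotate d) simp_all
  also have "\<dots> \<le> card (words_of_type d (r * n + n) (\<lambda>i. (\<Sum>k<r. f ((i + k) mod d)) + f ((i + r) mod d)))"
    by (rule card_words_of_type_add)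
  finally show ?case by (simp add: add.commute)
qed

lemma sum_rotate:
  fixes f :: "nat \<Rightarrow> nat"
  assumes d: "d > 0"
  shows "(\<Sum>k<d. f ((i + k) mod d)) = (\<Sum>k<d. f k)"
proof -
  have inj: "inj_on (\<lambda>k. (i + k) mod d) {..<d}"
  proof (rule inj_onI)
    fix k l assume "k \<in> {..<d}" "l \<in> {..<d}" "(i + k) mod d = (i + l) mod d"
    moreover have "k = l" if "k \<le> l" "l < d" "(i + k) mod d = (i + l) mod d" for k l
    proof -
      have "d dvd (i + l) - (i + k)" using that mod_eq_dvd_iff_nat[of "i + k" "i + l" d] by simp
      then have "d dvd l - k" by simp
      then have "l - k = 0" using that(2) dvd_imp_le[of d "l - k"] by (cases "l - k = 0") simp_all
      then show ?thesis using that(1) by simp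
    qed
    ultimately show "k = l" by (metis lessThan_iff linear)
  qed
  have "(\<lambda>k. (i + k) mod d) ` {..<d} = {..<d}" by (rule endo_inj_surj) (use inj d in auto)
  then have "bij_betw (\<lambda>k. (i + k) mod d) {..<d} {..<d}" using inj by (simp add: bij_betw_def)
  then show ?thesis by (rule sum.reindex_bij_betw)
qed

text \<open>Pigeonhole: the \<open>d ^ l\<close> words have at most \<open>(l + 1) ^ d\<close>
  contents, so some content has \<open>c\<close> words with the stated bound. Concatenating its
  \<open>d\<close> rotations balances it.\<close>

lemma balanced_words_bound:
  assumes d: "d > 0"
  shows "\<exists>c. d ^ l \<le> c * (l + 1) ^ d \<and> c ^ d \<le> card (words_of_type d (d * l) (\<lambda>_. l))"
proof -
  let ?T = "{..<d} \<rightarrow>\<^sub>E {..l}"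
  define c where "c = Max ((\<lambda>f. card (words_of_type d l f)) ` ?T)"
  have finT: "finite ?T" by (rule finite_PiE) simp_all
  have neT: "?T \<noteq> {}" by (simp add: PiE_eq_empty_iff)
  have "words d l \<subseteq> (\<Union>f\<in>?T. words_of_type d l f)"
  proof
    fix u assume u: "u \<in> words d l"
    have "restrict (count_list u) {..<d} \<in> ?T" using count_le_length[of u] u by (simp add: words_def)
    moreover have "u \<in> words_of_type d l (restrict (count_list u) {..<d})" using u by (simp add: words_of_type_def)
    ultimately show "u \<in> (\<Union>f\<in>?T. words_of_type d l f)" by blast
  qed
  then have "card (words d l) \<le> card (\<Union>f\<in>?T. words_of_type d l f)"
    using finT by (intro card_mono) simp_all
  also have "\<dots> \<le> (\<Sum>f\<in>?T. card (words_of_type d l f))" by (rule card_UN_le[OF finT])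
  also have "\<dots> \<le> (\<Sum>f\<in>?T. c)" unfolding c_def using finT by (intro sum_mono Max_ge) auto
  also have "\<dots> = c * (l + 1) ^ d" by (simp add: card_PiE mult.commute)
  finally have 1: "d ^ l \<le> c * (l + 1) ^ d" by (simp add: card_words)
  have "c \<in> (\<lambda>f. card (words_of_type d l f)) ` ?T" unfolding c_def using finT neT by (intro Max_in) simp_all
  then obtain f where c: "c = card (words_of_type d l f)" by blast
  have "c ^ d \<le> card (words_of_type d (d * l) (\<lambda>_. l))"
  proof (cases "words_of_type d l f = {}")
    case False
    then obtain u where u: "u \<in> words d l" "\<And>i. i < d \<Longrightarrow> count_list u i = f i" by (auto simp: words_of_type_def)
    have "(\<Sum>i<d. f i) = l" using sum_count_set[of u "{..<d}"] u by (simp add: words_def)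
    then show ?thesis using card_words_of_type_rotations[OF d, of l f d] unfolding sum_rotate[OF d] c by simp
  next
    case True
    then have "c = 0" using c by simp
    then show ?thesis using d by (simp add: power_0_left)
  qed
  then show ?thesis using 1 by blast
qed

text \<open>Made to contain all concatenations of \<open>b\<close> balanced words of length
  \<open>d * l\<close>: counts agree after each such block and drift apart by at most
  \<open>l\<close> inside one.\<close>

definition near_balanced :: "nat \<Rightarrow> nat \<Rightarrow> nat \<Rightarrow> nat list set" where
  "near_balanced d l b = {q \<in> words_of_type d (b * (d * l)) (\<lambda>_. b * l).
     \<forall>t. \<forall>i<d. \<forall>j<d. count_list (take t q) i \<le> count_list (take t q) j + l}"

lemma card_near_balanced: "card (words_of_type d (d * l) (\<lambda>_. l)) ^ b \<le> card (near_balanced d l b)"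
proof (induction b)
  case 0
  have "[] \<in> near_balanced d l 0" by (simp add: near_balanced_def words_of_type_def words_def)
  moreover have "finite (near_balanced d l 0)" by (simp add: near_balanced_def)
  ultimately have "card (near_balanced d l 0) > 0" by (subst card_gt_0_iff) auto
  then show ?case by simp
next
  case (Suc b)
  let ?B = "words_of_type d (d * l) (\<lambda>_. l)"
  have "card ?B ^ Suc b \<le> card ?B * card (near_balanced d l b)" using Suc by simp
  also have "\<dots> = card ((\<lambda>(u, v). u @ v) ` (?B \<times> near_balanced d l b))"
    by (subst card_image) (auto intro!: inj_on_append[of _ "d * l"] simp: words_of_type_def words_def card_cartesian_product)
  also have "\<dots> \<le> card (near_balanced d l (Suc b))"
  proof (rule card_mono)
    show "finite (near_balanced d l (Suc b))" by (simp add: near_balanced_def)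
    show "(\<lambda>(u, v). u @ v) ` (?B \<times> near_balanced d l b) \<subseteq> near_balanced d l (Suc b)"
    proof (intro image_subsetI)
      fix p assume p: "p \<in> ?B \<times> near_balanced d l b"
      obtain u v where uv: "p = (u, v)" "u \<in> ?B" "v \<in> near_balanced d l b" using p by blast
      have cu: "count_list u i = l" if "i < d" for i using uv(2) that by (simp add: words_of_type_def)
      have lu: "length u = d * l" using uv(2) by (simp add: words_of_type_def words_def)
      have v: "v \<in> words_of_type d (b * (d * l)) (\<lambda>_. b * l)"
        "\<And>t i j. i < d \<Longrightarrow> j < d \<Longrightarrow> count_list (take t v) i \<le> count_list (take t v) j + l"
        using uv(3) by (simp_all add: near_balanced_def)
      have "u @ v \<in> words_of_type d (Suc b * (d * l)) (\<lambda>_. Suc b * l)"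
        using uv(2) v(1) append_in_words[of u d "d * l" v "b * (d * l)"] by (simp add: words_of_type_def)
      moreover have "count_list (take t (u @ v)) i \<le> count_list (take t (u @ v)) j + l" if ij: "i < d" "j < d" for t i j
      proof (cases "t \<le> length u")
        case True
        then have "count_list (take t u) i \<le> l"
          using count_list_take_mono[of t "length u" u i] cu[OF ij(1)] by simp
        then show ?thesis using True by simp
      next
        case False
        then show ?thesis using v(2)[OF ij, of "t - length u"] cu[OF ij(1)] cu[OF ij(2)] by simp
      qed
      ultimately show "(case p of (u, v) \<Rightarrow> u @ v) \<in> near_balanced d l (Suc b)"
        unfolding uv(1) near_balanced_def by simp
    qed
  qed
  finally show ?case .
qed

section \<open>From near-balanced words to ballot words\<close>

definition sorted_word :: "nat \<Rightarrow> (nat \<Rightarrow> nat) \<Rightarrow> nat list" where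
  "sorted_word d f = concat (map (\<lambda>i. replicate (f i) i) [0..<d])"

lemma count_list_replicate: "count_list (replicate k a) b = (if a = b then k else 0)"
  by (induction k) auto

lemma sorted_word_Suc: "sorted_word (Suc d) f = sorted_word d f @ replicate (f d) d"
  by (simp add: sorted_word_def)

lemma count_list_sorted_word: "count_list (sorted_word d f) i = (if i < d then f i else 0)"
proof (induction d)
  case 0
  show ?case by (simp add: sorted_word_def)
next
  case (Suc d)
  then show ?case by (simp add: sorted_word_Suc count_list_replicate)
qed

lemma sorted_word_words: "sorted_word d f \<in> words d (\<Sum>i<d. f i)"
proof (induction d)
  case 0
  show ?case by (simp add: sorted_word_def words_def)
next
  case (Suc d)
  then show ?case by (auto simp: sorted_word_Suc words_def)
qed

text \<open>Letters come in increasing order, so once \<open>i\<close> has appeared every smaller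
  letter is complete.\<close>

lemma sorted_word_prefix:
  assumes "j < i"
  shows "count_list (take t (sorted_word d f)) i = 0 \<or> count_list (take t (sorted_word d f)) j = (if j < d then f j else 0)"
proof (induction d)
  case 0
  show ?case by (simp add: sorted_word_def)
next
  case (Suc d)
  show ?case
  proof (cases "t \<le> length (sorted_word d f)")
    case True
    have "count_list (take t (sorted_word d f)) i \<le> count_list (sorted_word d f) i"
      using count_list_take_mono[OF True, of "sorted_word d f" i] by simp
    then have "count_list (take t (sorted_word d f)) i = 0" if "\<not> i < d"
      using that by (simp add: count_list_sorted_word)
    then show ?thesis using True Suc assms by (cases "i < d") (auto simp: sorted_word_Suc)
  next
    case False
    then show ?thesis using assms
      by (auto simp: sorted_word_Suc count_list_sorted_word count_list_replicate)
  qed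
qed

text \<open>The prefix gives each letter a lead of \<open>l\<close> over the next one, which absorbs
  the drift of \<open>q\<close>; the suffix gives letter \<open>i\<close> the missing
  \<open>i * l\<close> copies, so all counts become equal.\<close>

lemma ballot_near_balanced:
  assumes q: "q \<in> near_balanced d l b"
  shows "ballot d ((d - 1 + b) * l) (sorted_word d (\<lambda>i. (d - 1 - i) * l) @ q @ sorted_word d (\<lambda>i. i * l))"
proof -
  let ?m = "(d - 1 + b) * l"
  let ?p = "sorted_word d (\<lambda>i. (d - 1 - i) * l)" and ?s = "sorted_word d (\<lambda>i. i * l)"
  let ?x = "?p @ q @ ?s"
  have q': "q \<in> words d (b * (d * l))" "\<And>i. i < d \<Longrightarrow> count_list q i = b * l"
    "\<And>t i j. i < d \<Longrightarrow> j < d \<Longrightarrow> count_list (take t q) i \<le> count_list (take t q) j + l"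
    using q by (simp_all add: near_balanced_def words_of_type_def)
  have cnt: "count_list ?x i = ?m" if "i < d" for i
  proof -
    have "count_list ?x i = (d - 1 - i) * l + (b * l + i * l)"
      using that q'(2)[OF that] by (simp add: count_list_sorted_word)
    also have "\<dots> = (d - 1 - i + b + i) * l" by (simp add: algebra_simps)
    also have "d - 1 - i + b + i = d - 1 + b" using that by simp
    finally show ?thesis .
  qed
  have "set ?x \<subseteq> {..<d}" using q'(1) sorted_word_words[of d "\<lambda>i. (d - 1 - i) * l"] sorted_word_words[of d "\<lambda>i. i * l"]
    by (auto simp: words_def)
  moreover have "length ?x = d * ?m"
  proof -
    have "length ?x = (\<Sum>i<d. count_list ?x i)" by (rule sum_count_set[OF calculation finite_lessThan, symmetric])
    also have "\<dots> = (\<Sum>i<d. ?m)" by (intro sum.cong refl cnt) simp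
    finally show ?thesis by (simp only: sum_constant card_lessThan of_nat_id)
  qed
  ultimately have "?x \<in> words d (d * ?m)" by (simp add: words_def)
  moreover have "count_list (take t ?x) i \<le> count_list (take t ?x) j" if ij: "i < d" "j < i" for t i j
  proof -
    have jd: "j < d" using ij by simp
    have le: "(d - 1 - i) * l + l \<le> (d - 1 - j) * l"
    proof -
      have "(d - 1 - i + 1) * l \<le> (d - 1 - j) * l" by (rule mult_le_mono1) (use ij in simp)
      then show ?thesis by simp
    qed
    have cp: "count_list ?p i = (d - 1 - i) * l" "count_list ?p j = (d - 1 - j) * l"
      using ij jd by (simp_all add: count_list_sorted_word)
    consider (p) "t \<le> length ?p" | (q) "length ?p < t" "t - length ?p \<le> length q" | (s) "length ?p < t" "length q < t - length ?p"
      by linarith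
    then show ?thesis
    proof cases
      case p
      have "count_list (take t ?p) i \<le> (d - 1 - i) * l"
        using count_list_take_mono[OF p, of ?p i] cp by simp
      then have "count_list (take t ?p) i \<le> count_list (take t ?p) j"
        using sorted_word_prefix[OF ij(2), of t d "\<lambda>i. (d - 1 - i) * l"] le jd by auto
      then show ?thesis using p by simp
    next
      case q
      then have "take t ?x = ?p @ take (t - length ?p) q" by simp
      then show ?thesis using q'(3)[OF ij(1) jd, of "t - length ?p"] cp le by simp
    next
      case s
      define r where "r = t - length ?p - length q"
      have tx: "take t ?x = ?p @ q @ take r ?s" using s by (simp add: r_def)
      have "count_list (take r ?s) i = 0 \<or> count_list (take r ?s) j = j * l"
        using sorted_word_prefix[OF ij(2), of r d "\<lambda>i. i * l"] jd by simp
      then show ?thesis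
      proof
        assume "count_list (take r ?s) i = 0"
        then show ?thesis unfolding tx using cp q'(2)[OF ij(1)] q'(2)[OF jd] le by simp
      next
        \<comment> \<open>In the suffix, once \<open>i\<close> has appeared, \<open>j\<close>
          already has its final count, which equals the final count of \<open>i\<close>.\<close>
        assume full: "count_list (take r ?s) j = j * l"
        have "count_list (take t ?x) i \<le> count_list ?x i"
          using count_list_take_mono[of t "max t (length ?x)" ?x i] by simp
        also have "\<dots> = ?m" by (rule cnt[OF ij(1)])
        also have "\<dots> = count_list ?x j" by (rule cnt[OF jd, symmetric])
        also have "\<dots> = count_list (take t ?x) j"
          unfolding tx using full jd by (simp add: count_list_sorted_word)
        finally show ?thesis .
      qed
    qed
  qed
  ultimately show ?thesis unfolding ballot_def using cnt by blast
qed

lemma many_ballot_words: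
  "\<exists>S. finite S \<and> (\<forall>x\<in>S. ballot d ((d - 1 + b) * l) x) \<and> card (words_of_type d (d * l) (\<lambda>_. l)) ^ b \<le> card S"
proof (intro exI conjI)
  let ?p = "sorted_word d (\<lambda>i. (d - 1 - i) * l)" and ?s = "sorted_word d (\<lambda>i. i * l)"
  let ?S = "(\<lambda>q. ?p @ q @ ?s) ` near_balanced d l b"
  show "finite ?S" by (simp add: near_balanced_def)
  show "\<forall>x\<in>?S. ballot d ((d - 1 + b) * l) x" using ballot_near_balanced by blast
  have "card ?S = card (near_balanced d l b)" by (rule card_image) (simp add: inj_on_def)
  then show "card (words_of_type d (d * l) (\<lambda>_. l)) ^ b \<le> card ?S" using card_near_balanced by simp
qed

section \<open>The growth rate\<close>

context based_space
begin

lemma det_tensor_fixed_vec: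
  assumes f: "Vector_Spaces.linear scale scale f" and det: "lin_det scale f ^ m = 1" and x: "ballot (length bs) m x"
  shows "fixed_vec (length bs * m) f (det_tensor kronecker_delta (length bs) m x)"
  unfolding fixed_vec_def
proof
  fix y assume y: "y \<in> W (length bs * m)"
  have "det (mat (length bs) (length bs) (\<lambda>(i, j). mco f i j)) = lin_det scale f"
    unfolding lin_det_eq[OF f] endo_matrix_mco ..
  then have "det_tensor (mco f) (length bs) m x y = det_tensor kronecker_delta (length bs) m x y"
    using det_tensor_mult_det[OF x y, of "mco f"] det by simp
  then show "(\<Sum>w\<in>W (length bs * m). kron (mco f) y w * det_tensor kronecker_delta (length bs) m x w) =
      det_tensor kronecker_delta (length bs) m x y"
    unfolding kron_det_tensor[OF x y] .
qed

lemma TS_le_dim_power: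
  assumes \<rho>: "\<And>g. g \<in> carrier G \<Longrightarrow> \<rho> g \<in> carrier (GL scale)"
  shows "TS G fun_scale (tensor_act \<rho>) (tensor_power scale n) \<le> length bs ^ n"
proof (rule TS_upper[of G \<rho> n, OF \<rho>])
  let ?TS = "TS G fun_scale (tensor_act \<rho>) (tensor_power scale n)"
  fix Z F :: "nat \<Rightarrow> nat list \<Rightarrow> 'k"
  assume bi: "\<And>k l. k < ?TS \<Longrightarrow> l < ?TS \<Longrightarrow> (\<Sum>x\<in>W n. F k x * Z l x) = (if k = l then 1 else 0)"
  have "?TS \<le> card (W n)"
  proof (rule biorthogonal_bound[where F = F and Z = Z and X = "W n"])
    show "(\<Sum>x\<in>W n. F k x * Z l x) = (if k = l then 1 else 0)" if "k < ?TS" "l < ?TS" for k l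
      using that by (rule bi)
  qed simp_all
  then show "?TS \<le> length bs ^ n" by (simp add: card_words)
qed

lemma trivial_growth_le_dim:
  assumes \<rho>: "\<And>g. g \<in> carrier G \<Longrightarrow> \<rho> g \<in> carrier (GL scale)"
  shows "trivial_growth G scale \<rho> \<le> ereal (real (length bs))"
  unfolding trivial_growth_def
proof (rule Limsup_bounded, rule eventually_mono[OF eventually_gt_at_top[of 0]])
  fix n :: nat assume n: "0 < n"
  have "real (TS G fun_scale (tensor_act \<rho>) (tensor_power scale n)) \<le> real (length bs) ^ n"
    using TS_le_dim_power[of G \<rho> n, OF \<rho>] by (simp flip: of_nat_power)
  then have "root n (real (TS G fun_scale (tensor_act \<rho>) (tensor_power scale n))) \<le> root n (real (length bs) ^ n)"
    using n by simp
  also have "\<dots> = real (length bs)" using n by (simp add: real_root_power_cancel)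
  finally show "ereal (root n (real (TS G fun_scale (tensor_act \<rho>) (tensor_power scale n)))) \<le> ereal (real (length bs))" by simp
qed

lemma TS_growth_of_unit_det:
  assumes \<rho>: "\<And>g. g \<in> carrier G \<Longrightarrow> \<rho> g \<in> carrier (GL scale)"
    and N: "N > 0" "\<And>g. g \<in> carrier G \<Longrightarrow> lin_det scale (\<rho> g) ^ N = 1"
    and detected: "\<And>n z x. x \<in> W n \<Longrightarrow> z x \<noteq> 0 \<Longrightarrow> (\<And>g. g \<in> carrier G \<Longrightarrow> fixed_vec n (\<rho> g) z) \<Longrightarrow>
       \<exists>h. (\<forall>g\<in>carrier G. fixed_form n (\<rho> g) h) \<and> (\<Sum>x\<in>W n. h x * z x) \<noteq> 0"
    and l: "N dvd l"
  shows "card (words_of_type (length bs) (length bs * l) (\<lambda>_. l)) ^ b \<le>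
    TS G fun_scale (tensor_act \<rho>) (tensor_power scale (length bs * ((length bs - 1 + b) * l)))"
proof -
  let ?d = "length bs"
  let ?m = "(?d - 1 + b) * l"
  obtain S where S: "finite S" "\<forall>x\<in>S. ballot ?d ?m x" "card (words_of_type ?d (?d * l) (\<lambda>_. l)) ^ b \<le> card S"
    using many_ballot_words[of ?d b l] by (elim exE conjE) (rule that)
  have lin: "Vector_Spaces.linear scale scale (\<rho> g)" if "g \<in> carrier G" for g
    using \<rho>[OF that] by (simp add: GL_def)
  have det: "lin_det scale (\<rho> g) ^ ?m = 1" if "g \<in> carrier G" for g
  proof -
    obtain k where k: "?m = N * k" using dvd_mult[OF l, of "?d - 1 + b"] by (elim dvdE)
    show ?thesis unfolding k power_mult N(2)[OF that] by (rule power_one)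
  qed
  have "card S \<le> TS G fun_scale (tensor_act \<rho>) (tensor_power scale (?d * ?m))"
  proof (rule TS_lower[where w = "det_tensor kronecker_delta ?d ?m", OF \<rho> detected S(1)])
    show "fixed_vec (?d * ?m) (\<rho> g) (det_tensor kronecker_delta ?d ?m s)" if "s \<in> S" "g \<in> carrier G" for s g
      by (rule det_tensor_fixed_vec[OF lin[OF that(2)] det[OF that(2)] bspec[OF S(2) that(1)]])
    show "c s = 0" if "\<And>x. x \<in> W (?d * ?m) \<Longrightarrow> (\<Sum>s\<in>S. c s * det_tensor kronecker_delta ?d ?m s x) = 0" "s \<in> S" for c :: "nat list \<Rightarrow> 'k" and s
      by (rule det_tensor_independent[OF S(1) bspec[OF S(2)] that])
  qed
  then show ?thesis using S(3) by (rule le_trans[rotated])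
qed

text \<open>If the growth were below \<open>d\<close>, the counts would be at most
  \<open>c ^ n\<close> for large \<open>n\<close> with some \<open>c < d\<close>. Letting the number
  \<open>b\<close> of blocks grow bounds the balanced words of length \<open>d * l\<close> by
  \<open>c ^ (d * l)\<close>, and the pigeonhole count then bounds the exponential
  \<open>(d / c) ^ l\<close> by a polynomial in \<open>l\<close>.\<close>

lemma trivial_growth_ge_dim:
  assumes \<rho>: "\<And>g. g \<in> carrier G \<Longrightarrow> \<rho> g \<in> carrier (GL scale)" and d: "length bs > 0"
    and N: "N > 0" "\<And>g. g \<in> carrier G \<Longrightarrow> lin_det scale (\<rho> g) ^ N = 1"
    and detected: "\<And>n z x. x \<in> W n \<Longrightarrow> z x \<noteq> 0 \<Longrightarrow> (\<And>g. g \<in> carrier G \<Longrightarrow> fixed_vec n (\<rho> g) z) \<Longrightarrow>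
       \<exists>h. (\<forall>g\<in>carrier G. fixed_form n (\<rho> g) h) \<and> (\<Sum>x\<in>W n. h x * z x) \<noteq> 0"
  shows "trivial_growth G scale \<rho> \<ge> ereal (real (length bs))"
proof (rule ccontr)
  let ?d = "length bs"
  let ?TS = "\<lambda>n. real (TS G fun_scale (tensor_act \<rho>) (tensor_power scale n))"
  assume "\<not> ?thesis"
  then have less: "trivial_growth G scale \<rho> < ereal (real ?d)" by simp
  then obtain e where e: "trivial_growth G scale \<rho> < ereal e" "ereal e < ereal (real ?d)"
    using ereal_dense2[OF less] by (elim exE conjE) (rule that)
  \<comment> \<open>The number \<open>e\<close> may be negative or zero; the maximum makes the base
    positive and still below \<open>d\<close>.\<close>
  define c where "c = max e (1 / 2)"
  have "real ?d \<ge> 1" using d by linarith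
  then have c: "c > 0" "c < real ?d" using e(2) unfolding c_def less_ereal.simps by linarith+
  have "trivial_growth G scale \<rho> < ereal c" using e(1) by (rule less_le_trans) (simp add: c_def)
  then have "eventually (\<lambda>n. ereal (root n (?TS n)) < ereal c) sequentially"
    unfolding trivial_growth_def by (rule Limsup_lessD)
  then obtain n0 where n0: "\<And>n. n \<ge> n0 \<Longrightarrow> root n (?TS n) < c" unfolding eventually_sequentially by auto
  have TS: "?TS n \<le> c ^ n" if "n \<ge> n0" "n > 0" for n
  proof -
    have "?TS n = root n (?TS n) ^ n" using that(2) by simp
    also have "\<dots> \<le> c ^ n" using n0[OF that(1)] that(2) by (intro power_mono) simp_all
    finally show ?thesis .
  qed
  have K: "real (card (words_of_type ?d (?d * l) (\<lambda>_. l))) \<le> c ^ (?d * l)" if l: "N dvd l" "l > 0" for l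
  proof (rule ccontr)
    let ?K = "real (card (words_of_type ?d (?d * l) (\<lambda>_. l)))"
    assume "\<not> ?thesis"
    then have q: "?K / c ^ (?d * l) > 1" using c(1) by (simp add: divide_simps)
    \<comment> \<open>The power must outweigh the contribution of the sorted prefix and suffix,
      whose length does not depend on \<open>b\<close>.\<close>
    obtain b0 where b0: "c ^ ((?d - 1) * (?d * l)) < (?K / c ^ (?d * l)) ^ b0" using real_arch_pow[OF q] by blast
    \<comment> \<open>The summands \<open>n0\<close> and 1 make the length \<open>?n\<close> reach
      the range where \<open>TS\<close> applies and stay positive.\<close>
    define b where "b = b0 + n0 + 1"
    let ?n = "?d * ((?d - 1 + b) * l)"
    have "c ^ ((?d - 1) * (?d * l)) < (?K / c ^ (?d * l)) ^ b"
      using b0 power_increasing[of b0 b "?K / c ^ (?d * l)"] q by (simp add: b_def)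
    then have "c ^ ((?d - 1) * (?d * l)) * (c ^ (?d * l)) ^ b < ?K ^ b"
      using c(1) by (simp add: power_divide divide_simps)
    moreover have "c ^ ((?d - 1) * (?d * l)) * (c ^ (?d * l)) ^ b = c ^ ?n"
      unfolding power_mult[symmetric] power_add[symmetric] by (simp add: algebra_simps)
    moreover have "?K ^ b \<le> ?TS ?n"
      unfolding of_nat_power[symmetric] of_nat_le_iff
      by (rule TS_growth_of_unit_det[where N = N]) (fact \<rho> N detected l(1))+
    moreover have "?n \<ge> n0"
    proof -
      have "n0 \<le> ?d - 1 + b" by (simp add: b_def)
      also have "\<dots> \<le> ?d * ((?d - 1 + b) * l)" using d l(2) by (cases ?d; cases l) simp_all
      finally show ?thesis .
    qed
    moreover have "?n > 0" using d l(2) by (simp add: b_def)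
    ultimately show False using TS[of ?n] by linarith
  qed
  have main: "(real ?d / c) ^ l \<le> (real l + 1) ^ ?d" if l: "N dvd l" "l > 0" for l
  proof -
    obtain k where k: "?d ^ l \<le> k * (l + 1) ^ ?d" "k ^ ?d \<le> card (words_of_type ?d (?d * l) (\<lambda>_. l))"
      using balanced_words_bound[OF d, of l] by (elim exE conjE) (rule that)
    have "real k ^ ?d \<le> (c ^ l) ^ ?d"
      using K[OF l] k(2) unfolding power_mult[symmetric] mult.commute[of l] by (simp flip: of_nat_power)
    then have "real k \<le> c ^ l" using d c(1) by (subst (asm) power_mono_iff) simp_all
    have "real ?d ^ l = real (?d ^ l)" by simp
    also have "\<dots> \<le> real (k * (l + 1) ^ ?d)" using k(1) by (rule of_nat_mono)
    also have "\<dots> = real k * (real l + 1) ^ ?d" by (simp add: add.commute)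
    also have "\<dots> \<le> c ^ l * (real l + 1) ^ ?d" using \<open>real k \<le> c ^ l\<close> by (rule mult_right_mono) simp
    finally show ?thesis using c(1) by (simp add: power_divide divide_simps mult.commute)
  qed
  define a where "a = real ?d / c"
  have a: "a > 1" using c by (simp add: a_def)
  \<comment> \<open>With \<open>y = (l + 1) * ln a\<close> for \<open>l = N * Suc j\<close>, the
    comparison of \<open>(l + 1) ^ d\<close> with \<open>a ^ l\<close> becomes one of
    \<open>y ^ d\<close> with \<open>exp y\<close>; the threshold \<open>ln a ^ d / a\<close>
    accounts for the rescaling and for the extra factor \<open>a\<close>.\<close>
  define y where "y j = (real (N * Suc j) + 1) * ln a" for j
  have "filterlim (\<lambda>j. real j * ln a) at_top sequentially"
    by (rule filterlim_at_top_mult_tendsto_pos[OF tendsto_const _ filterlim_real_sequentially]) (use a in simp)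
  then have "filterlim y at_top sequentially"
  proof (rule filterlim_at_top_mono)
    have "real j * ln a \<le> y j" for j
    proof -
      have "1 * j \<le> N * Suc j" using N(1) by (intro mult_le_mono) simp_all
      then have "real j \<le> real (N * Suc j) + 1" by linarith
      then show ?thesis unfolding y_def using a by (intro mult_right_mono) simp_all
    qed
    then show "\<forall>\<^sub>F j in sequentially. real j * ln a \<le> y j" by (intro always_eventually allI)
  qed
  from filterlim_compose[OF tendsto_power_div_exp_0[of ?d] this]
  have "((\<lambda>j. y j ^ ?d / exp (y j)) \<longlongrightarrow> 0) sequentially" .
  then have "eventually (\<lambda>j. y j ^ ?d / exp (y j) < ln a ^ ?d / a) sequentially"
    by (rule order_tendstoD) (use a in simp)
  then obtain j where j: "y j ^ ?d / exp (y j) < ln a ^ ?d / a" by (auto simp: eventually_sequentially)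
  define l where "l = N * Suc j"
  have "exp (y j) = a ^ (l + 1)"
  proof -
    have "y j = real (l + 1) * ln a" by (simp only: y_def l_def of_nat_add of_nat_1)
    then show ?thesis using a by (simp only: exp_of_nat_mult) simp
  qed
  moreover have "y j ^ ?d = (real l + 1) ^ ?d * ln a ^ ?d" by (simp only: y_def l_def power_mult_distrib)
  ultimately have "(real l + 1) ^ ?d * ln a ^ ?d / a ^ (l + 1) < ln a ^ ?d / a" using j by simp
  then have "(real l + 1) ^ ?d * (ln a ^ ?d / a) / a ^ l < 1 * (ln a ^ ?d / a)" by (simp add: mult_ac)
  then have "(real l + 1) ^ ?d / a ^ l * (ln a ^ ?d / a) < 1 * (ln a ^ ?d / a)" by (simp only: times_divide_eq_left)
  then have "(real l + 1) ^ ?d / a ^ l < 1" using a by (subst (asm) mult_less_cancel_right_pos) simp_all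
  then have "(real l + 1) ^ ?d < a ^ l" using a by (subst (asm) divide_less_eq_1_pos) simp_all
  then show False using main[of l] N(1) unfolding a_def[symmetric] by (simp add: l_def)
qed

end

text \<open>The powers of each \<open>x\<close> repeat inside the finite set, and cancellation gives
  \<open>x\<close> finite order; the product of these exponents serves all elements.\<close>

lemma finite_image_common_exponent:
  fixes D :: "'k::field set"
  assumes fin: "finite D" and pow: "\<And>x n. x \<in> D \<Longrightarrow> x ^ n \<in> D" and nz: "0 \<notin> D"
  shows "\<exists>N>0. \<forall>x\<in>D. x ^ N = (1 :: 'k)"
proof -
  have ex: "\<exists>n>0. x ^ n = 1" if x: "x \<in> D" for x
  proof -
    have "\<not> inj (\<lambda>n::nat. x ^ n)"
    proof
      assume "inj (\<lambda>n::nat. x ^ n)"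
      then have "infinite (range (\<lambda>n::nat. x ^ n))" by (rule range_inj_infinite)
      moreover have "range (\<lambda>n::nat. x ^ n) \<subseteq> D" using pow[OF x] by blast
      ultimately show False using fin finite_subset by blast
    qed
    then obtain i j :: nat where ij: "x ^ i = x ^ j" "i < j" unfolding inj_on_def by (metis linorder_neqE_nat)
    have "x ^ i * x ^ (j - i) = x ^ j" unfolding power_add[symmetric] using ij(2) by simp
    then have "x ^ i * x ^ (j - i) = x ^ i * 1" unfolding ij(1) mult_1_right .
    moreover have "x ^ i \<noteq> 0" using x nz by auto
    ultimately have "x ^ (j - i) = 1" by (simp only: mult_cancel_left) simp
    then show ?thesis using ij(2) by (intro exI[of _ "j - i"]) simp
  qed
  then have "\<forall>x\<in>D. \<exists>n. n > 0 \<and> x ^ n = 1" by (intro ballI)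
  from bchoice[OF this] obtain n where n: "\<forall>x\<in>D. n x > 0 \<and> x ^ n x = 1" by (elim exE) (rule that)
  show ?thesis
  proof (intro exI[of _ "\<Prod>x\<in>D. n x"] conjI ballI)
    show "(\<Prod>x\<in>D. n x) > 0" using n by (intro prod_pos) simp
    fix x assume x: "x \<in> D"
    then obtain k where k: "(\<Prod>x\<in>D. n x) = n x * k" using dvd_prodI[OF fin x, of n] by (elim dvdE)
    show "x ^ (\<Prod>x\<in>D. n x) = 1" unfolding k power_mult conjunct2[OF bspec[OF n x]] by (rule power_one)
  qed
qed

theorem theorem1p2:
  fixes scale :: "'k::alg_closed_field \<Rightarrow> 'v::ab_group_add \<Rightarrow> 'v"
    and Basis :: "'v set"
    and G :: "('g, 'm) monoid_scheme"
    and \<rho> :: "'g \<Rightarrow> 'v \<Rightarrow> 'v"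
  assumes "CHAR('k) > 0"
    and "finite_dimensional_vector_space scale Basis"
    and "group G"
    and "\<rho> \<in> hom G (GL scale)"
  shows "trivial_growth G scale \<rho> = ereal (real (vector_space.dim scale (UNIV :: 'v set))) \<longleftrightarrow>
    finite (lin_det scale ` \<rho> ` carrier G) \<and>
    {h \<in> zariski_closure scale (\<rho> ` carrier G). unipotent h} = {\<one>\<^bsub>GL scale\<^esub>}"
proof -
  note char_pos = assms(1) and G = assms(3) and \<rho> = assms(4)
  interpret fd: finite_dimensional_vector_space scale Basis by (rule assms(2))
  interpret G: group G by (rule G)
  obtain bs where bs: "set bs = Basis" "distinct bs" using finite_distinct_list[OF fd.finite_Basis] by blast
  interpret alg_closed_space scale bs
    by unfold_locales (simp_all add: basis_list_def bs fd.independent_Basis fd.span_Basis char_pos)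
  let ?d = "length bs"
  have car: "\<rho> g \<in> carrier (GL scale)" if "g \<in> carrier G" for g using hom_in_carrier[OF \<rho> that] .
  note lin = hom_GL_linear[OF \<rho>] and mult = hom_GL_mult[OF \<rho>] and one = hom_GL_one[OF G \<rho>]
  let ?H = "{h \<in> zariski_closure scale (\<rho> ` carrier G). unipotent h}"
  \<comment> \<open>The identity is always a unipotent element of the closure, so the equality with
    the singleton reduces to one inclusion.\<close>
  have "id \<in> \<rho> ` carrier G" using one G.one_closed by (intro image_eqI[of _ _ "\<one>\<^bsub>G\<^esub>"]) simp_all
  moreover have "unipotent (id :: 'v \<Rightarrow> 'v)" unfolding unipotent_def by (intro exI[of _ "Suc 0"]) simp
  ultimately have id_H: "id \<in> ?H" using closure_superset by blast
  have one_GL: "\<one>\<^bsub>GL scale\<^esub> = id" by (simp add: GL_def)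
  have H: "?H = {\<one>\<^bsub>GL scale\<^esub>} \<longleftrightarrow> (\<forall>u. u \<in> zariski_closure scale (\<rho> ` carrier G) \<longrightarrow> unipotent u \<longrightarrow> u = id)"
    unfolding one_GL using id_H by blast
  show ?thesis unfolding dim_UNIV H
  proof
    assume growth: "trivial_growth G scale \<rho> = ereal (real ?d)"
    show "finite (lin_det scale ` \<rho> ` carrier G) \<and> (\<forall>u. u \<in> zariski_closure scale (\<rho> ` carrier G) \<longrightarrow> unipotent u \<longrightarrow> u = id)"
    proof (intro conjI allI impI)
      show "finite (lin_det scale ` \<rho> ` carrier G)"
      proof (rule ccontr)
        assume inf: "infinite (lin_det scale ` \<rho> ` carrier G)"
        have "\<exists>c<real ?d. c \<ge> 0 \<and> (\<forall>n. real (TS G fun_scale (tensor_act \<rho>) (tensor_power scale n)) \<le> c ^ n)"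
          by (rule TS_bound_infinite_det[OF _ car inf]) (rule alg_closed_imp_poly_has_root)
        then obtain c where c: "c < real ?d" "c \<ge> 0" "\<And>n. real (TS G fun_scale (tensor_act \<rho>) (tensor_power scale n)) \<le> c ^ n"
          by blast
        have "trivial_growth G scale \<rho> < ereal (real ?d)"
          by (rule trivial_growth_less[where C = 1 and c = c]) (use c in simp_all)
        then show False using growth by simp
      qed
    next
      fix u assume u: "u \<in> zariski_closure scale (\<rho> ` carrier G)" "unipotent u"
      show "u = id"
      proof (rule ccontr)
        assume "u \<noteq> id"
        have "trivial_growth G scale \<rho> < ereal (real ?d)"
          by (rule growth_less_unipotent[OF car char_pos u \<open>u \<noteq> id\<close>])
        then show False using growth by simp
      qed
    qed
  next
    assume *: "finite (lin_det scale ` \<rho> ` carrier G) \<and> (\<forall>u. u \<in> zariski_closure scale (\<rho> ` carrier G) \<longrightarrow> unipotent u \<longrightarrow> u = id)"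
    show "trivial_growth G scale \<rho> = ereal (real ?d)"
    proof (rule antisym)
      show "trivial_growth G scale \<rho> \<le> ereal (real ?d)" by (rule trivial_growth_le_dim[OF car])
      show "ereal (real ?d) \<le> trivial_growth G scale \<rho>"
      \<comment> \<open>For the zero space nonnegativity of the growth is the whole claim; the
        ballot construction assumes positive dimension.\<close>
      proof (cases "?d = 0")
        case True
        have "0 \<le> trivial_growth G scale \<rho>" unfolding trivial_growth_def
          by (rule le_Limsup[OF trivial_limit_sequentially always_eventually]) (simp add: real_root_ge_zero)
        then show ?thesis using True by (simp add: zero_ereal_def)
      next
        case False
        let ?D = "lin_det scale ` \<rho> ` carrier G"
        \<comment> \<open>The determinants form a finite set of nonzero scalars closed under powers,
          so a common exponent exists, and it is what makes products of determinants
          invariant.\<close>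
        have "\<exists>N>0. \<forall>x\<in>?D. x ^ N = 1"
        proof (rule finite_image_common_exponent)
          show "finite ?D" using * by blast
          show "x ^ n \<in> ?D" if "x \<in> ?D" for x n
          proof -
            obtain g where g: "g \<in> carrier G" "x = lin_det scale (\<rho> g)" using \<open>x \<in> ?D\<close> by blast
            have "lin_det scale (\<rho> (g [^]\<^bsub>G\<^esub> n)) = x ^ n"
            proof (induction n)
              case 0
              show ?case by (simp only: G.nat_pow_0 one lin_det_id power_0)
            next
              case (Suc n)
              have "\<rho> (g [^]\<^bsub>G\<^esub> Suc n) = \<rho> (g [^]\<^bsub>G\<^esub> n) \<circ> \<rho> g" using mult[of "g [^]\<^bsub>G\<^esub> n" g] g(1) by simp
              then show ?case
                unfolding lin_det_comp[OF lin[OF G.nat_pow_closed[OF g(1)]] lin[OF g(1)]] Suc g(2)[symmetric] power_Suc2 by (simp only:) (simp only: lin_det_comp[OF lin[OF G.nat_pow_closed[OF g(1)]] lin[OF g(1)]] Suc g(2)[symmetric])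
            qed
            moreover have "lin_det scale (\<rho> (g [^]\<^bsub>G\<^esub> n)) \<in> ?D"
              by (intro imageI G.nat_pow_closed g(1))
            ultimately show ?thesis by (simp only:)
          qed
          show "0 \<notin> ?D"
          proof
            assume "0 \<in> ?D"
            then obtain g where g: "g \<in> carrier G" "lin_det scale (\<rho> g) = 0" by auto
            have "lin_det scale (\<rho> g \<circ> \<rho> (inv\<^bsub>G\<^esub> g)) = 1"
              unfolding mult[OF g(1) G.inv_closed[OF g(1)], symmetric] G.r_inv[OF g(1)] one by (rule lin_det_id)
            then show False unfolding lin_det_comp[OF lin[OF g(1)] lin[OF G.inv_closed[OF g(1)]]] g(2) by simp
          qed
        qed
        then obtain N where N: "N > 0" "\<And>g. g \<in> carrier G \<Longrightarrow> lin_det scale (\<rho> g) ^ N = 1" by auto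
        show ?thesis
        proof (rule trivial_growth_ge_dim[OF car _ N])
          show "length bs > 0" using False by simp
          show "\<exists>h. (\<forall>g\<in>carrier G. fixed_form n (\<rho> g) h) \<and> (\<Sum>x\<in>W n. h x * z x) \<noteq> 0"
            if "x \<in> W n" "z x \<noteq> 0" "\<And>g. g \<in> carrier G \<Longrightarrow> fixed_vec n (\<rho> g) z" for n z x
          proof (rule invariant_detected[OF G \<rho>])
            show "u = id" if "u \<in> zariski_closure scale (\<rho> ` carrier G)" "unipotent u" for u
              using * that by blast
          qed (fact that)+
        qed
      qed
    qed
  qed
qed

end
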